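(* Let $\mathcal P=\mathcal P_{Q^F}$ be a poset of type $\mathbb A$, where $Q$ is a Dynkin quiver of type $\mathbb A_n$ and $F$ is an alien set for $Q$, and let $T=\{\tau_1,\dots,\tau_n\}$ be a triangulation of the regular $(n+3)$-gon with $Q_T=Q$. Then the functor $$\Omega:\mathcal C_{(T,F)}\to\operatorname{mod}_{sp}(k\mathcal P)$$ from the category of sp-diagonals to the category of finitely generated socle-projective $k\mathcal P$-modules is an equivalence of categories.
   Context: $k$ is a field. Quivers and posets. A Dynkin quiver of type $\mathbb A_n$ is any orientation of the path graph with $n$ vertices; its extremal vertices are the ends of the path. For a sink $z$ of $Q$, $\operatorname{Supp} I(z)$ is the set of vertices having a (possibly trivial) path to $z$ in $Q$. For an acyclic quiver, $\mathcal P_Q$ is the vertex set $Q_0$ ordered by $x\preceq y$ iff there is a path from $x$ to $y$. For a finite set $F$ of new arrows between vertices of $Q$, $Q^F$ has vertices $Q_0$ and arrows $Q_1\cup F$; $s(\alpha)$ and $t(\alpha)$ denote the starting and target vertices of an arrow $\alpha$. $F$ is an alien set for $Q$ if: (a) for each $\alpha\in F$ there is a sink $z$ of $Q$ with $s(\alpha),t(\alpha)\in\operatorname{Supp}I(z)$; (b) for each $\alpha\in F$, $t(\alpha)$ is not a source of $Q$ unless it is an extremal vertex; (c) each $\alpha\in F$ is the unique path from $s(\alpha)$ to $t(\alpha)$ in $Q^F$; (d) $Q^F$ is acyclic. The posets of the form $\mathcal P_{Q^F}$ are exactly the posets of type $\mathbb A$. Modules. $k\mathcal P$ is the incidence algebra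 of $\mathcal P$. A finitely generated $k\mathcal P$-module is identified with a system $M=(M_x,{}_yh_x)$ of finite-dimensional $k$-vector spaces $M_x$ ($x\in\mathcal P$) and linear maps ${}_yh_x:M_x\to M_y$ for $x\preceq y$, with ${}_xh_x=\mathrm{id}$ and ${}_wh_y\,{}_yh_x={}_wh_x$ for $x\preceq y\preceq w$; morphisms are families of linear maps commuting with the ${}_yh_x$. $M$ is socle-projective if its socle is a projective module; equivalently, $\bigcap_{z\in\max\mathcal P,\,x\prec z}\ker{}_zh_x=0$ for every non-maximal $x$. $\operatorname{mod}_{sp}(k\mathcal P)$ is the full subcategory of socle-projective modules. Diagonals. A diagonal of the regular $(n+3)$-gon joins two vertices through the interior; a triangulation is a maximal set of non-crossing diagonals. The quiver $Q_T$ of $T=\{\tau_1,\dots,\tau_n\}$ has vertices $1,\dots,n$ and an arrow $x\to y$ iff $\tau_x,\tau_y$ are two sides of a triangle of $T$ in which $\tau_y$ lies counter-clockwise from $\tau_x$ (following the boundary of the triangle counter-clockwise, $\tau_y$ comes right after $\tau_x$; equivalently, inside the triangle $\tau_y$ is obtained from $\tau_x$ by clockwise rotation about their common vertex). For a diagonal $\gamma\notin T$, $\operatorname{supp}\gamma=\{x:\tau_x\text{ crosses }\gamma\}$. Category $\mathcal C_T$. A pivoting elementary move $P_v:\gamma\to\gamma'$ between diagonals not in $T$ fixes an endpoint $v$ (the pivot) of $\gamma$ and moves the other endpoint to the next polygon vertex counter-clockwise. $\mathcal C_T$ is the $k$-linear additive category whose objects are formal finite direct sums of diagonals not in $T$;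 morphisms between diagonals are linear combinations of compositions of pivoting elementary moves modulo the mesh relations: if $\gamma$ has endpoints $v_1,v_2$ and $\gamma'$ has endpoints $v_1',v_2'$, where $v_i'$ is the vertex following $v_i$ counter-clockwise, then the two paths $\gamma\to\beta\to\gamma'$ and $\gamma\to\beta'\to\gamma'$, with $\beta=\{v_1,v_2'\}$, $\beta'=\{v_1',v_2\}$, are equal, where a path is replaced by $0$ if its intermediate edge is in $T$ or is a boundary edge. sp-diagonals. A fan in $T$ is a maximal subset $\Sigma_v\subseteq T$ of at least two diagonals such that all the diagonals in $\Sigma_v$ share the polygon vertex $v$. The peak-diagonal of a fan is its maximal element for the order $\tau_x<\tau_y$ iff there is a path from $x$ to $y$ in $Q$. A diagonal $\gamma\notin T$ is an sp-diagonal if (a) whenever $\gamma$ crosses $\tau\in T$, $\gamma$ crosses the peak-diagonal of a fan in $T$ containing $\tau$; and (b) for every $\alpha\in F$ with $s(\alpha),t(\alpha)\in\operatorname{Supp}I(z)$ ($z$ a sink of $Q$), if $\gamma$ crosses $\tau_{s(\alpha)}$ and $\tau_z$ then $\gamma$ also crosses $\tau_{t(\alpha)}$. $\mathcal C_{(T,F)}$ is the full subcategory of $\mathcal C_T$ generated by all sp-diagonals, i.e. whose objects are finite direct sums of sp-diagonals. A pivoting sp-move $\gamma\to\gamma'$ between sp-diagonals is a composition $\gamma=\gamma_0\to\gamma_1\to\dots\to\gamma_s=\gamma'$ of pivoting elementary moves all with the same pivot such that $\gamma_1,\dots,\gamma_{s-1}$ are not sp-diagonals; the pivoting sp-moves generate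 the morphisms of $\mathcal C_{(T,F)}$. The functor $\Omega$. $\Omega$ is $k$-linear and additive. On an sp-diagonal, $\Omega(\gamma)=M^\gamma=(M^\gamma_x,{}_yh^\gamma_x)$ with $M^\gamma_x=k$ if $x\in\operatorname{supp}\gamma$ and $0$ otherwise, and, for $x\preceq y$ in $\mathcal P$, ${}_yh^\gamma_x=\mathrm{id}_k$ if $x,y\in\operatorname{supp}\gamma$ and $0$ otherwise. On a pivoting sp-move $P:\gamma\to\gamma'$, $\Omega(P)_x=\mathrm{id}_k$ if $M^\gamma_x=M^{\gamma'}_x=k$ and $\Omega(P)_x=0$ otherwise; compositions are sent to compositions.
   Formalization: Stated for n ≥ 2: for n = 1 there is no fan with two diagonals, so there are no sp-diagonals and the category of sp-diagonals is zero, while the module category is not. Finite-dimensional vector spaces are realized as subspaces of the functions from the naturals to k. *)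

theory Defs
  imports Complex_Main "HOL-Library.Function_Algebras"
begin

section \<open>Vector spaces of functions\<close>

definition fscale :: "'k::field \<Rightarrow> ('b \<Rightarrow> 'k) \<Rightarrow> 'b \<Rightarrow> 'k" where
  "fscale c f = (\<lambda>i. c * f i)"

interpretation fvs: vector_space "fscale :: 'k::field \<Rightarrow> ('b \<Rightarrow> 'k) \<Rightarrow> 'b \<Rightarrow> 'k"
  by unfold_locales (auto simp: fscale_def fun_eq_iff algebra_simps)

definition basis_vec :: "'b \<Rightarrow> 'b \<Rightarrow> 'k::field" where
  "basis_vec p = (\<lambda>q. if q = p then 1 else 0)"

definition lin_map_on :: "('b \<Rightarrow> 'k::field) set \<Rightarrow> ('c \<Rightarrow> 'k) set \<Rightarrow> (('b \<Rightarrow> 'k) \<Rightarrow> 'c \<Rightarrow> 'k) \<Rightarrow> bool" where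
  "lin_map_on A B f \<longleftrightarrow> (\<forall>v\<in>A. f v \<in> B) \<and> (\<forall>u\<in>A. \<forall>v\<in>A. f (u + v) = f u + f v)
     \<and> (\<forall>c. \<forall>v\<in>A. f (fscale c v) = fscale c (f v))"

definition fin_dim_subspace :: "('b \<Rightarrow> 'k::field) set \<Rightarrow> bool" where
  "fin_dim_subspace A \<longleftrightarrow> fvs.subspace A \<and> (\<exists>B. finite B \<and> A = fvs.span B)"


section \<open>Categories, functors and equivalences\<close>

text \<open>Hom-sets carry a \<open>k\<close>-linear structure. Since hom-sets of different pairs of objects need not be
  disjoint, all operations take the objects as arguments; \<open>Comp C a b c g f\<close> is the composite of
  \<open>f : a \<rightarrow> b\<close> followed by \<open>g : b \<rightarrow> c\<close>.\<close>

record ('o, 'm, 'k) lcat =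
  Ob :: "'o set"
  Hom :: "'o \<Rightarrow> 'o \<Rightarrow> 'm set"
  Ident :: "'o \<Rightarrow> 'm"
  Comp :: "'o \<Rightarrow> 'o \<Rightarrow> 'o \<Rightarrow> 'm \<Rightarrow> 'm \<Rightarrow> 'm"
  Add :: "'o \<Rightarrow> 'o \<Rightarrow> 'm \<Rightarrow> 'm \<Rightarrow> 'm"
  Scale :: "'o \<Rightarrow> 'o \<Rightarrow> 'k \<Rightarrow> 'm \<Rightarrow> 'm"

definition category :: "('o, 'm, 'k) lcat \<Rightarrow> bool" where
  "category C \<longleftrightarrow>
     (\<forall>a\<in>Ob C. Ident C a \<in> Hom C a a) \<and>
     (\<forall>a\<in>Ob C. \<forall>b\<in>Ob C. \<forall>c\<in>Ob C. \<forall>f\<in>Hom C a b. \<forall>g\<in>Hom C b c. Comp C a b c g f \<in> Hom C a c) \<and>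
     (\<forall>a\<in>Ob C. \<forall>b\<in>Ob C. \<forall>f\<in>Hom C a b.
        Comp C a a b f (Ident C a) = f \<and> Comp C a b b (Ident C b) f = f) \<and>
     (\<forall>a\<in>Ob C. \<forall>b\<in>Ob C. \<forall>c\<in>Ob C. \<forall>d\<in>Ob C. \<forall>f\<in>Hom C a b. \<forall>g\<in>Hom C b c. \<forall>h\<in>Hom C c d.
        Comp C a b d (Comp C b c d h g) f = Comp C a c d h (Comp C a b c g f))"

definition full_subcat :: "('o, 'm, 'k) lcat \<Rightarrow> ('o \<Rightarrow> bool) \<Rightarrow> ('o, 'm, 'k) lcat" where
  "full_subcat C S = C\<lparr>Ob := {a \<in> Ob C. S a}\<rparr>"

definition is_functor ::
  "('o, 'm, 'k) lcat \<Rightarrow> ('p, 'l, 'k) lcat \<Rightarrow> ('o \<Rightarrow> 'p) \<Rightarrow> ('o \<Rightarrow> 'o \<Rightarrow> 'm \<Rightarrow> 'l) \<Rightarrow> bool" where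
  "is_functor C D Fo Fm \<longleftrightarrow> category C \<and> category D \<and>
     (\<forall>a\<in>Ob C. Fo a \<in> Ob D) \<and>
     (\<forall>a\<in>Ob C. \<forall>b\<in>Ob C. \<forall>f\<in>Hom C a b. Fm a b f \<in> Hom D (Fo a) (Fo b)) \<and>
     (\<forall>a\<in>Ob C. Fm a a (Ident C a) = Ident D (Fo a)) \<and>
     (\<forall>a\<in>Ob C. \<forall>b\<in>Ob C. \<forall>c\<in>Ob C. \<forall>f\<in>Hom C a b. \<forall>g\<in>Hom C b c.
        Fm a c (Comp C a b c g f) = Comp D (Fo a) (Fo b) (Fo c) (Fm b c g) (Fm a b f))"

definition is_linear_functor ::
  "('o, 'm, 'k) lcat \<Rightarrow> ('p, 'l, 'k) lcat \<Rightarrow> ('o \<Rightarrow> 'p) \<Rightarrow> ('o \<Rightarrow> 'o \<Rightarrow> 'm \<Rightarrow> 'l) \<Rightarrow> bool" where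
  "is_linear_functor C D Fo Fm \<longleftrightarrow> is_functor C D Fo Fm \<and>
     (\<forall>a\<in>Ob C. \<forall>b\<in>Ob C. \<forall>f\<in>Hom C a b. \<forall>g\<in>Hom C a b.
        Fm a b (Add C a b f g) = Add D (Fo a) (Fo b) (Fm a b f) (Fm a b g)) \<and>
     (\<forall>a\<in>Ob C. \<forall>b\<in>Ob C. \<forall>f\<in>Hom C a b. \<forall>c.
        Fm a b (Scale C a b c f) = Scale D (Fo a) (Fo b) c (Fm a b f))"

definition is_iso :: "('o, 'm, 'k) lcat \<Rightarrow> 'o \<Rightarrow> 'o \<Rightarrow> 'm \<Rightarrow> bool" where
  "is_iso C a b f \<longleftrightarrow> f \<in> Hom C a b \<and>
     (\<exists>g\<in>Hom C b a. Comp C a b a g f = Ident C a \<and> Comp C b a b f g = Ident C b)"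

definition naturally_isomorphic ::
  "('o, 'm, 'k) lcat \<Rightarrow> ('p, 'l, 'k) lcat \<Rightarrow> ('o \<Rightarrow> 'p) \<Rightarrow> ('o \<Rightarrow> 'o \<Rightarrow> 'm \<Rightarrow> 'l)
     \<Rightarrow> ('o \<Rightarrow> 'p) \<Rightarrow> ('o \<Rightarrow> 'o \<Rightarrow> 'm \<Rightarrow> 'l) \<Rightarrow> bool" where
  "naturally_isomorphic C D Fo Fm Go Gm \<longleftrightarrow>
     (\<exists>\<eta>. (\<forall>a\<in>Ob C. is_iso D (Fo a) (Go a) (\<eta> a)) \<and>
          (\<forall>a\<in>Ob C. \<forall>b\<in>Ob C. \<forall>f\<in>Hom C a b.
             Comp D (Fo a) (Go a) (Go b) (Gm a b f) (\<eta> a)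
             = Comp D (Fo a) (Fo b) (Go b) (\<eta> b) (Fm a b f)))"

definition is_equivalence ::
  "('o, 'm, 'k) lcat \<Rightarrow> ('p, 'l, 'k) lcat \<Rightarrow> ('o \<Rightarrow> 'p) \<Rightarrow> ('o \<Rightarrow> 'o \<Rightarrow> 'm \<Rightarrow> 'l) \<Rightarrow> bool" where
  "is_equivalence C D Fo Fm \<longleftrightarrow> is_functor C D Fo Fm \<and>
     (\<exists>Go Gm. is_functor D C Go Gm \<and>
        naturally_isomorphic C C
          (\<lambda>a. Go (Fo a)) (\<lambda>a b f. Gm (Fo a) (Fo b) (Fm a b f)) (\<lambda>a. a) (\<lambda>a b f. f) \<and>
        naturally_isomorphic D D
          (\<lambda>a. Fo (Go a)) (\<lambda>a b f. Fm (Go a) (Go b) (Gm a b f)) (\<lambda>a. a) (\<lambda>a b f. f))"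


section \<open>Quivers, alien sets and posets of type A\<close>

text \<open>Quivers without parallel arrows, with vertices \<open>{1..n}\<close>, are given by their set of arrows. A path
  is the nonempty list of vertices that it visits; \<open>[x]\<close> is the trivial path at \<open>x\<close>.\<close>

definition is_path :: "('a \<times> 'a) set \<Rightarrow> 'a \<Rightarrow> 'a \<Rightarrow> 'a list \<Rightarrow> bool" where
  "is_path E x y p \<longleftrightarrow> p \<noteq> [] \<and> hd p = x \<and> last p = y \<and> successively (\<lambda>u v. (u, v) \<in> E) p"

definition dynkin_A :: "nat \<Rightarrow> (nat \<times> nat) set \<Rightarrow> bool" where
  "dynkin_A n Q \<longleftrightarrow>
     (\<exists>vs. distinct vs \<and> set vs = {1..n} \<and>
        (\<forall>x y. (x, y) \<in> Q \<or> (y, x) \<in> Q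
           \<longleftrightarrow> (\<exists>i. Suc i < length vs \<and> {x, y} = {vs ! i, vs ! Suc i}))) \<and>
     (\<forall>x y. (x, y) \<in> Q \<longrightarrow> (y, x) \<notin> Q)"

text \<open>The ends of a path graph are its vertices with at most one neighbour.\<close>

definition extremal :: "nat \<Rightarrow> (nat \<times> nat) set \<Rightarrow> nat \<Rightarrow> bool" where
  "extremal n Q x \<longleftrightarrow> x \<in> {1..n} \<and> card {y. (x, y) \<in> Q \<or> (y, x) \<in> Q} \<le> 1"

definition is_sink :: "nat \<Rightarrow> (nat \<times> nat) set \<Rightarrow> nat \<Rightarrow> bool" where
  "is_sink n Q z \<longleftrightarrow> z \<in> {1..n} \<and> (\<forall>y. (z, y) \<notin> Q)"

definition is_source :: "nat \<Rightarrow> (nat \<times> nat) set \<Rightarrow> nat \<Rightarrow> bool" where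
  "is_source n Q z \<longleftrightarrow> z \<in> {1..n} \<and> (\<forall>y. (y, z) \<notin> Q)"

definition supp_I :: "nat \<Rightarrow> (nat \<times> nat) set \<Rightarrow> nat \<Rightarrow> nat set" where
  "supp_I n Q z = {x \<in> {1..n}. (x, z) \<in> Q\<^sup>*}"

text \<open>The new arrows of \<open>Q\<^sup>F\<close> may a priori be parallel to each other or to arrows of \<open>Q\<close>, but uniqueness of
  paths rules this out. Hence \<open>F\<close> is a set of pairs, disjoint from \<open>Q\<close>.\<close>

definition alien_set :: "nat \<Rightarrow> (nat \<times> nat) set \<Rightarrow> (nat \<times> nat) set \<Rightarrow> bool" where
  "alien_set n Q F \<longleftrightarrow> F \<subseteq> {1..n} \<times> {1..n} \<and> F \<inter> Q = {} \<and>
     (\<forall>(s, t)\<in>F. \<exists>z. is_sink n Q z \<and> s \<in> supp_I n Q z \<and> t \<in> supp_I n Q z) \<and>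
     (\<forall>(s, t)\<in>F. is_source n Q t \<longrightarrow> extremal n Q t) \<and>
     (\<forall>(s, t)\<in>F. \<forall>p. is_path (Q \<union> F) s t p \<longrightarrow> p = [s, t]) \<and>
     acyclic (Q \<union> F)"

definition poset_of :: "nat \<Rightarrow> (nat \<times> nat) set \<Rightarrow> (nat \<times> nat) set \<Rightarrow> nat rel" where
  "poset_of n Q F = Restr ((Q \<union> F)\<^sup>*) {1..n}"


section \<open>Modules over the incidence algebra of a poset\<close>

text \<open>A poset is given by its reflexive order relation \<open>r\<close>, with underlying set \<open>Field r\<close>. To have a
  single type of objects, the finite-dimensional spaces \<open>M\<^sub>x\<close> are taken inside \<open>nat \<Rightarrow> 'k\<close>, which contains a
  copy of every finite-dimensional \<open>'k\<close>-vector space. \<open>str M y x\<close> is the map from \<open>M\<^sub>x\<close> to \<open>M\<^sub>y\<close>. Morphisms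
  are extended by zero, so that equality of morphisms is equality of functions.\<close>

type_synonym 'k vec = "nat \<Rightarrow> 'k"

record 'k psys =
  spc :: "nat \<Rightarrow> 'k vec set"
  str :: "nat \<Rightarrow> nat \<Rightarrow> 'k vec \<Rightarrow> 'k vec"

definition fg_module :: "nat rel \<Rightarrow> 'k::field psys \<Rightarrow> bool" where
  "fg_module r M \<longleftrightarrow>
     (\<forall>x\<in>Field r. fin_dim_subspace (spc M x)) \<and>
     (\<forall>(x, y)\<in>r. lin_map_on (spc M x) (spc M y) (str M y x)) \<and>
     (\<forall>x\<in>Field r. \<forall>v\<in>spc M x. str M x x v = v) \<and>
     (\<forall>x y w. (x, y) \<in> r \<longrightarrow> (y, w) \<in> r \<longrightarrow> (\<forall>v\<in>spc M x. str M w y (str M y x v) = str M w x v))"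

definition mod_hom ::
  "nat rel \<Rightarrow> 'k::field psys \<Rightarrow> 'k psys \<Rightarrow> (nat \<Rightarrow> 'k vec \<Rightarrow> 'k vec) set" where
  "mod_hom r M N = {f.
     (\<forall>x\<in>Field r. lin_map_on (spc M x) (spc N x) (f x)) \<and>
     (\<forall>(x, y)\<in>r. \<forall>v\<in>spc M x. f y (str M y x v) = str N y x (f x v)) \<and>
     (\<forall>x v. x \<notin> Field r \<or> v \<notin> spc M x \<longrightarrow> f x v = 0)}"

definition mod_cat :: "nat rel \<Rightarrow> ('k::field psys, nat \<Rightarrow> 'k vec \<Rightarrow> 'k vec, 'k) lcat" where
  "mod_cat r = \<lparr>Ob = {M. fg_module r M},
     Hom = mod_hom r,
     Ident = (\<lambda>M x v. if x \<in> Field r \<and> v \<in> spc M x then v else 0),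
     Comp = (\<lambda>L M N g f x v. g x (f x v)),
     Add = (\<lambda>M N f g x v. f x v + g x v),
     Scale = (\<lambda>M N c f x v. fscale c (f x v))\<rparr>"

definition submodule :: "nat rel \<Rightarrow> (nat \<Rightarrow> 'k::field vec set) \<Rightarrow> 'k psys \<Rightarrow> bool" where
  "submodule r N M \<longleftrightarrow>
     (\<forall>x\<in>Field r. fvs.subspace (N x) \<and> N x \<subseteq> spc M x) \<and> (\<forall>(x, y)\<in>r. str M y x ` N x \<subseteq> N y)"

definition simple_submodule :: "nat rel \<Rightarrow> (nat \<Rightarrow> 'k::field vec set) \<Rightarrow> 'k psys \<Rightarrow> bool" where
  "simple_submodule r S M \<longleftrightarrow> submodule r S M \<and> (\<exists>x\<in>Field r. S x \<noteq> {0}) \<and>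
     (\<forall>N. submodule r N M \<and> (\<forall>x\<in>Field r. N x \<subseteq> S x)
        \<longrightarrow> (\<forall>x\<in>Field r. N x = {0}) \<or> (\<forall>x\<in>Field r. N x = S x))"

definition socle :: "nat rel \<Rightarrow> 'k::field psys \<Rightarrow> 'k psys" where
  "socle r M = M\<lparr>spc := \<lambda>x. fvs.span (\<Union>S\<in>{S. simple_submodule r S M}. S x)\<rparr>"

definition projective :: "nat rel \<Rightarrow> 'k::field psys \<Rightarrow> bool" where
  "projective r P \<longleftrightarrow> fg_module r P \<and>
     (\<forall>A B g f. fg_module r A \<and> fg_module r B \<and> g \<in> mod_hom r A B \<and>
        (\<forall>x\<in>Field r. g x ` spc A x = spc B x) \<and> f \<in> mod_hom r P B
        \<longrightarrow> (\<exists>h\<in>mod_hom r P A. \<forall>x\<in>Field r. \<forall>v\<in>spc P x. g x (h x v) = f x v))"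

definition socle_projective :: "nat rel \<Rightarrow> 'k::field psys \<Rightarrow> bool" where
  "socle_projective r M \<longleftrightarrow> projective r (socle r M)"

definition mod_sp :: "nat rel \<Rightarrow> ('k::field psys, nat \<Rightarrow> 'k vec \<Rightarrow> 'k vec, 'k) lcat" where
  "mod_sp r = full_subcat (mod_cat r) (socle_projective r)"


section \<open>Diagonals and triangulations of the regular (n+3)-gon\<close>

text \<open>The polygon vertices are \<open>0, \<dots>, n + 2\<close> in counter-clockwise order; a diagonal is the set of its two
  endpoints.\<close>

type_synonym diag = "nat set"

definition nxt :: "nat \<Rightarrow> nat \<Rightarrow> nat" where
  "nxt n v = Suc v mod (n + 3)"

definition boundary_edge :: "nat \<Rightarrow> diag \<Rightarrow> bool" where
  "boundary_edge n e \<longleftrightarrow> (\<exists>v<n + 3. e = {v, nxt n v})"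

definition diagonal :: "nat \<Rightarrow> diag \<Rightarrow> bool" where
  "diagonal n d \<longleftrightarrow>
     (\<exists>a b. a < n + 3 \<and> b < n + 3 \<and> a \<noteq> b \<and> d = {a, b}) \<and> \<not> boundary_edge n d"

definition crosses :: "diag \<Rightarrow> diag \<Rightarrow> bool" where
  "crosses d e \<longleftrightarrow> (\<exists>a b c f. a < c \<and> c < b \<and> b < f \<and>
     (d = {a, b} \<and> e = {c, f} \<or> d = {c, f} \<and> e = {a, b}))"

definition triangulation :: "nat \<Rightarrow> diag set \<Rightarrow> bool" where
  "triangulation n T \<longleftrightarrow> (\<forall>d\<in>T. diagonal n d) \<and> (\<forall>d\<in>T. \<forall>e\<in>T. \<not> crosses d e) \<and>
     (\<forall>d. diagonal n d \<and> (\<forall>e\<in>T. \<not> crosses d e) \<longrightarrow> d \<in> T)"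

text \<open>The triangle with vertices \<open>a, b, c\<close> in counter-clockwise order.\<close>

definition triangle :: "nat \<Rightarrow> diag set \<Rightarrow> nat \<Rightarrow> nat \<Rightarrow> nat \<Rightarrow> bool" where
  "triangle n T a b c \<longleftrightarrow> a < n + 3 \<and> b < n + 3 \<and> c < n + 3 \<and>
     (a < b \<and> b < c \<or> b < c \<and> c < a \<or> c < a \<and> a < b) \<and>
     (\<forall>e\<in>{{a, b}, {b, c}, {c, a}}. e \<in> T \<or> boundary_edge n e)"

text \<open>The triangulation \<open>T = {\<tau> 1, \<dots>, \<tau> n}\<close> is given by its labelling \<open>\<tau>\<close>.\<close>

definition labelled_triangulation :: "nat \<Rightarrow> (nat \<Rightarrow> diag) \<Rightarrow> bool" where
  "labelled_triangulation n \<tau> \<longleftrightarrow> inj_on \<tau> {1..n} \<and> triangulation n (\<tau> ` {1..n})"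

definition quiver_of :: "nat \<Rightarrow> (nat \<Rightarrow> diag) \<Rightarrow> (nat \<times> nat) set" where
  "quiver_of n \<tau> = {(x, y). x \<in> {1..n} \<and> y \<in> {1..n} \<and>
     (\<exists>a b c. triangle n (\<tau> ` {1..n}) a b c \<and> \<tau> x = {a, b} \<and> \<tau> y = {b, c})}"

text \<open>The diagonals not in \<open>T\<close>.\<close>

definition free_diagonal :: "nat \<Rightarrow> (nat \<Rightarrow> diag) \<Rightarrow> diag \<Rightarrow> bool" where
  "free_diagonal n \<tau> \<gamma> \<longleftrightarrow> diagonal n \<gamma> \<and> \<gamma> \<notin> \<tau> ` {1..n}"

definition supp :: "nat \<Rightarrow> (nat \<Rightarrow> diag) \<Rightarrow> diag \<Rightarrow> nat set" where
  "supp n \<tau> \<gamma> = {x \<in> {1..n}. crosses (\<tau> x) \<gamma>}"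


section \<open>The category \<open>C\<^sub>T\<close>\<close>

definition pivot_move :: "nat \<Rightarrow> (nat \<Rightarrow> diag) \<Rightarrow> nat \<Rightarrow> diag \<Rightarrow> diag \<Rightarrow> bool" where
  "pivot_move n \<tau> v \<gamma> \<gamma>' \<longleftrightarrow> free_diagonal n \<tau> \<gamma> \<and> free_diagonal n \<tau> \<gamma>' \<and>
     (\<exists>w. \<gamma> = {v, w} \<and> \<gamma>' = {v, nxt n w})"

text \<open>A pivoting elementary move is determined by its source and target. Hence compositions of such moves
  are paths in the following quiver, given as the lists of diagonals that they visit.\<close>

definition moves :: "nat \<Rightarrow> (nat \<Rightarrow> diag) \<Rightarrow> (diag \<times> diag) set" where
  "moves n \<tau> = {(\<gamma>, \<gamma>'). \<exists>v. pivot_move n \<tau> v \<gamma> \<gamma>'}"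

type_synonym 'k comb = "diag list \<Rightarrow> 'k"

definition path_comb :: "nat \<Rightarrow> (nat \<Rightarrow> diag) \<Rightarrow> diag \<Rightarrow> diag \<Rightarrow> 'k::field comb set" where
  "path_comb n \<tau> \<gamma> \<delta> = {f. finite {p. f p \<noteq> 0} \<and> (\<forall>p. f p \<noteq> 0 \<longrightarrow> is_path (moves n \<tau>) \<gamma> \<delta> p)}"

text \<open>Bilinear extension of the concatenation of paths, in diagrammatic order.\<close>

definition comb_concat :: "'k::field comb \<Rightarrow> 'k comb \<Rightarrow> 'k comb" where
  "comb_concat f g = (\<lambda>s. \<Sum>p\<in>{p. f p \<noteq> 0}. \<Sum>q\<in>{q. g q \<noteq> 0}. if p @ tl q = s then f p * g q else 0)"

definition path_via :: "nat \<Rightarrow> (nat \<Rightarrow> diag) \<Rightarrow> diag list \<Rightarrow> diag \<Rightarrow> diag list \<Rightarrow> 'k::field comb" where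
  "path_via n \<tau> p \<beta> q = (if free_diagonal n \<tau> \<beta> then basis_vec (p @ \<beta> # q) else 0)"

text \<open>The mesh relations between \<open>{v1, v2}\<close> and \<open>{nxt v1, nxt v2}\<close>, multiplied on both sides by the paths
  \<open>p\<close> and \<open>q\<close>; they span the component from \<open>\<gamma>\<close> to \<open>\<delta>\<close> of the mesh ideal.\<close>

definition mesh_relators :: "nat \<Rightarrow> (nat \<Rightarrow> diag) \<Rightarrow> diag \<Rightarrow> diag \<Rightarrow> 'k::field comb set" where
  "mesh_relators n \<tau> \<gamma> \<delta> =
     {path_via n \<tau> p {v1, nxt n v2} q - path_via n \<tau> p {nxt n v1, v2} q | p q v1 v2.
        free_diagonal n \<tau> {v1, v2} \<and> free_diagonal n \<tau> {nxt n v1, nxt n v2} \<and>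
        is_path (moves n \<tau>) \<gamma> {v1, v2} p \<and> is_path (moves n \<tau>) {nxt n v1, nxt n v2} \<delta> q}"

text \<open>A formal direct sum of diagonals is a list. A morphism between two of them is a matrix whose
  \<open>(i, j)\<close> entry is a morphism from the \<open>i\<close>-th summand to the \<open>j\<close>-th one; it is given as a class of
  matrices of linear combinations of paths, modulo the mesh relations in each entry.\<close>

type_synonym 'k cmat = "nat \<Rightarrow> nat \<Rightarrow> 'k comb"

definition comb_mat :: "nat \<Rightarrow> (nat \<Rightarrow> diag) \<Rightarrow> diag list \<Rightarrow> diag list \<Rightarrow> 'k::field cmat set" where
  "comb_mat n \<tau> as bs = {f.
     (\<forall>i<length as. \<forall>j<length bs. f i j \<in> path_comb n \<tau> (as ! i) (bs ! j)) \<and>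
     (\<forall>i j. \<not> (i < length as \<and> j < length bs) \<longrightarrow> f i j = 0)}"

definition mesh_eq :: "nat \<Rightarrow> (nat \<Rightarrow> diag) \<Rightarrow> diag list \<Rightarrow> diag list \<Rightarrow> 'k::field cmat rel" where
  "mesh_eq n \<tau> as bs = {(f, g). f \<in> comb_mat n \<tau> as bs \<and> g \<in> comb_mat n \<tau> as bs \<and>
     (\<forall>i<length as. \<forall>j<length bs. f i j - g i j \<in> fvs.span (mesh_relators n \<tau> (as ! i) (bs ! j)))}"

definition unit_mat :: "nat \<Rightarrow> nat \<Rightarrow> diag list \<Rightarrow> 'k::field cmat" where
  "unit_mat i j p = (\<lambda>i' j'. if i' = i \<and> j' = j then basis_vec p else 0)"

definition cat_T :: "nat \<Rightarrow> (nat \<Rightarrow> diag) \<Rightarrow> (diag list, 'k::field cmat set, 'k) lcat" where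
  "cat_T n \<tau> = \<lparr>Ob = {as. \<forall>\<gamma>\<in>set as. free_diagonal n \<tau> \<gamma>},
     Hom = (\<lambda>as bs. comb_mat n \<tau> as bs // mesh_eq n \<tau> as bs),
     Ident = (\<lambda>as. mesh_eq n \<tau> as as `` {\<Sum>i<length as. unit_mat i i [as ! i]}),
     Comp = (\<lambda>as bs cs Y X. mesh_eq n \<tau> as cs ``
       {(\<lambda>i l. \<Sum>j<length bs. comb_concat (f i j) (g j l)) | f g. f \<in> X \<and> g \<in> Y}),
     Add = (\<lambda>as bs X Y. mesh_eq n \<tau> as bs `` {f + g | f g. f \<in> X \<and> g \<in> Y}),
     Scale = (\<lambda>as bs c X. mesh_eq n \<tau> as bs `` {(\<lambda>i j. fscale c (f i j)) | f. f \<in> X})\<rparr>"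


section \<open>sp-diagonals\<close>

definition fan :: "nat \<Rightarrow> (nat \<Rightarrow> diag) \<Rightarrow> diag set \<Rightarrow> bool" where
  "fan n \<tau> S \<longleftrightarrow> (\<exists>v<n + 3. S = {d \<in> \<tau> ` {1..n}. v \<in> d}) \<and> 2 \<le> card S"

text \<open>\<open>\<tau> x\<close> is the peak-diagonal of the fan \<open>S\<close>.\<close>

definition is_peak :: "nat \<Rightarrow> (nat \<Rightarrow> diag) \<Rightarrow> (nat \<times> nat) set \<Rightarrow> diag set \<Rightarrow> nat \<Rightarrow> bool" where
  "is_peak n \<tau> Q S x \<longleftrightarrow> x \<in> {1..n} \<and> \<tau> x \<in> S \<and>
     (\<forall>y\<in>{1..n}. \<tau> y \<in> S \<longrightarrow> (x, y) \<notin> Q\<^sup>+)"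

definition sp_diagonal ::
  "nat \<Rightarrow> (nat \<Rightarrow> diag) \<Rightarrow> (nat \<times> nat) set \<Rightarrow> (nat \<times> nat) set \<Rightarrow> diag \<Rightarrow> bool" where
  "sp_diagonal n \<tau> Q F \<gamma> \<longleftrightarrow> free_diagonal n \<tau> \<gamma> \<and>
     (\<forall>x\<in>supp n \<tau> \<gamma>. \<exists>S y. fan n \<tau> S \<and> \<tau> x \<in> S \<and> is_peak n \<tau> Q S y \<and> y \<in> supp n \<tau> \<gamma>) \<and>
     (\<forall>(s, t)\<in>F. \<forall>z. is_sink n Q z \<and> s \<in> supp_I n Q z \<and> t \<in> supp_I n Q z \<and>
        s \<in> supp n \<tau> \<gamma> \<and> z \<in> supp n \<tau> \<gamma> \<longrightarrow> t \<in> supp n \<tau> \<gamma>)"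

definition cat_TF ::
  "nat \<Rightarrow> (nat \<Rightarrow> diag) \<Rightarrow> (nat \<times> nat) set \<Rightarrow> (nat \<times> nat) set \<Rightarrow> (diag list, 'k::field cmat set, 'k) lcat" where
  "cat_TF n \<tau> Q F = full_subcat (cat_T n \<tau>) (\<lambda>as. \<forall>\<gamma>\<in>set as. sp_diagonal n \<tau> Q F \<gamma>)"

definition sp_move ::
  "nat \<Rightarrow> (nat \<Rightarrow> diag) \<Rightarrow> (nat \<times> nat) set \<Rightarrow> (nat \<times> nat) set \<Rightarrow> diag \<Rightarrow> diag \<Rightarrow> diag list \<Rightarrow> bool" where
  "sp_move n \<tau> Q F \<gamma> \<gamma>' p \<longleftrightarrow> 2 \<le> length p \<and> hd p = \<gamma> \<and> last p = \<gamma>' \<and>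
     sp_diagonal n \<tau> Q F \<gamma> \<and> sp_diagonal n \<tau> Q F \<gamma>' \<and>
     (\<exists>v. successively (pivot_move n \<tau> v) p) \<and>
     (\<forall>i. 0 < i \<and> Suc i < length p \<longrightarrow> \<not> sp_diagonal n \<tau> Q F (p ! i))"


section \<open>The functor \<open>\<Omega>\<close>\<close>

text \<open>\<open>Omega_ob n \<tau> as\<close> is the direct sum of the modules \<open>M\<^sup>\<gamma>\<close> over the entries \<open>\<gamma>\<close> of the list \<open>as\<close>: the
  \<open>i\<close>-th coordinate of a vector lies in \<open>M\<^sup>\<gamma>\<^sub>x\<close>, \<open>\<gamma> = as ! i\<close>, which is \<open>k\<close> or \<open>0\<close>.\<close>

definition Omega_ob :: "nat \<Rightarrow> (nat \<Rightarrow> diag) \<Rightarrow> diag list \<Rightarrow> 'k::field psys" where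
  "Omega_ob n \<tau> as =
     \<lparr>spc = (\<lambda>x. {v. \<forall>i. v i \<noteq> 0 \<longrightarrow> i < length as \<and> x \<in> supp n \<tau> (as ! i)}),
      str = (\<lambda>y x v i. if i < length as \<and> x \<in> supp n \<tau> (as ! i) \<and> y \<in> supp n \<tau> (as ! i)
                       then v i else 0)\<rparr>"

text \<open>\<open>Om\<close> is the morphism part of \<open>\<Omega>\<close>: a \<open>k\<close>-linear functor that maps the canonical inclusions and projections
  of direct sums to the canonical inclusions and projections, and that has the prescribed values on
  pivoting sp-moves.\<close>

definition is_Omega ::
  "nat \<Rightarrow> (nat \<Rightarrow> diag) \<Rightarrow> (nat \<times> nat) set \<Rightarrow> (nat \<times> nat) set \<Rightarrow>
   (diag list \<Rightarrow> diag list \<Rightarrow> 'k::field cmat set \<Rightarrow> nat \<Rightarrow> 'k vec \<Rightarrow> 'k vec) \<Rightarrow> bool" where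
  "is_Omega n \<tau> Q F Om \<longleftrightarrow>
     is_linear_functor (cat_TF n \<tau> Q F) (mod_sp (poset_of n Q F)) (Omega_ob n \<tau>) Om \<and>
     (\<forall>as\<in>Ob (cat_TF n \<tau> Q F :: (diag list, 'k cmat set, 'k) lcat). \<forall>i<length as.
        Om [as ! i] as (mesh_eq n \<tau> [as ! i] as `` {unit_mat 0 i [as ! i]}) =
          (\<lambda>x v. if v \<in> spc (Omega_ob n \<tau> [as ! i]) x then (\<lambda>l. if l = i then v 0 else 0) else 0) \<and>
        Om as [as ! i] (mesh_eq n \<tau> as [as ! i] `` {unit_mat i 0 [as ! i]}) =
          (\<lambda>x v. if v \<in> spc (Omega_ob n \<tau> as) x then (\<lambda>l. if l = 0 then v i else 0) else 0)) \<and>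
     (\<forall>\<gamma> \<gamma>' p. sp_move n \<tau> Q F \<gamma> \<gamma>' p \<longrightarrow>
        Om [\<gamma>] [\<gamma>'] (mesh_eq n \<tau> [\<gamma>] [\<gamma>'] `` {unit_mat 0 0 p}) =
          (\<lambda>x v. if v \<in> spc (Omega_ob n \<tau> [\<gamma>]) x \<and> x \<in> supp n \<tau> \<gamma> \<inter> supp n \<tau> \<gamma>' then v else 0))"

end

theory Submission
  imports Defs
begin

text \<open>Sending a diagonal outside \<open>T\<close> to the set of diagonals of \<open>T\<close> that it crosses is a bijection onto the
  intervals of the path underlying \<open>Q\<close>, by injectivity and because both sets have \<open>n (n + 1) / 2\<close> elements.
  Under it the sp-diagonals become the intervals \<open>I\<close> in which every vertex lies below a sink of \<open>I\<close> and that
  are closed under the alien arrows below a sink of \<open>I\<close>. Modulo the mesh relations a path of pivoting moves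
  is determined by the diagonals of \<open>T\<close> crossed by all diagonals on the path: it is zero if there are none,
  and otherwise that set is the intersection of the supports of the two ends. A nonzero path exists exactly
  when there is a nonzero homomorphism between the two interval representations of \<open>Q\<close>. Hence \<open>\<Omega>\<close> is full
  and faithful, where the prescribed values determine \<open>\<Omega>\<close> because nonzero paths between sp-diagonals factor,
  modulo the mesh relations, into sp-moves.

  For density, the restriction of a module to \<open>Q\<close> has bases matched along all arrows, hence is a direct sum of
  interval representations. Vectors of a socle-projective module are detected at the sinks. This makes the
  intervals those of sp-diagonals. It also determines the action of an alien arrow \<open>s \<rightarrow> t\<close>: there is
  only one sink \<open>z\<close> above \<open>t\<close>, so \<open>M\<^sub>t \<rightarrow> M\<^sub>z\<close> is injective.\<close>

section \<open>Geometry of the polygon and its triangulation\<close>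

section \<open>Lifting polygon vertices to the integers\<close>

text \<open>Crossings, triangles and pivoting are cyclic notions. Lifting polygon vertices to
  integers turns them into linear inequalities inside a window of length \<open>n + 3\<close>, and a
  path of moves becomes a word in two letters, one for each end. The words with given ends fill a
  rectangle of diagonals. If it contains no boundary edge and no member of \<open>T\<close>, a hex
  argument gives one member of \<open>T\<close> that crosses all of it; this governs both the
  vanishing and the uniqueness of paths modulo the mesh relations.

  The delicate point is the factorization into sp-moves: a rectangle between two sp-diagonals need
  not have an sp-diagonal at either remaining corner. Translated to intervals, failure at both
  corners forces the first interval inside the second, and acyclicity of \<open>Q \<union> F\<close>
  yields an sp-interval strictly between them.

  For density, bases cannot be fixed greedily from left to right, since a later map may call for a
  different basis. Instead flags are pushed to the right, and the bases are chosen backwards from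
  the right end.\<close>

definition pvert :: "nat \<Rightarrow> int \<Rightarrow> nat" where
  "pvert n t = nat (t mod (int n + 3))"

text \<open>One diagonal has the lifts \<open>(a, b)\<close> and \<open>(b, a + (n + 3))\<close> and
  all their translates by multiples of the period. Choosing among them puts a configuration into a
  single window that starts at a prescribed vertex.\<close>

definition chord :: "nat \<Rightarrow> int \<Rightarrow> int \<Rightarrow> diag" where
  "chord n a b = {pvert n a, pvert n b}"

lemma pvert_less: "pvert n t < n + 3"
  by (simp add: pvert_def nat_less_iff)

lemma pvert_eq_iff: "pvert n s = pvert n t \<longleftrightarrow> s mod (int n + 3) = t mod (int n + 3)"
  by (auto simp: pvert_def nat_eq_iff2)

lemma pvert_inj:
  assumes "pvert n s = pvert n t" "\<bar>s - t\<bar> < int n + 3"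
  shows "s = t"
proof -
  have "(int n + 3) dvd (s - t)"
    using assms(1) by (simp add: pvert_eq_iff mod_eq_dvd_iff)
  then show ?thesis
    using assms(2) zdvd_not_zless[of "\<bar>s - t\<bar>" "int n + 3"] by fastforce
qed

lemma pvert_shift [simp]: "pvert n (t + (int n + 3)) = pvert n t" "pvert n (t + int n + 3) = pvert n t"
    "pvert n (t - (int n + 3)) = pvert n t"
proof -
  have *: "pvert n (t + (int n + 3)) = pvert n t" for t
    unfolding pvert_def by (metis mod_add_self2)
  then show "pvert n (t + (int n + 3)) = pvert n t" .
  show "pvert n (t + int n + 3) = pvert n t"
    using *[of t] by (simp add: add.assoc)
  show "pvert n (t - (int n + 3)) = pvert n t"
    using *[of "t - (int n + 3)"] by simp
qed

lemma pvert_int: "v < n + 3 \<Longrightarrow> pvert n (int v) = v"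
  by (simp add: pvert_def)

lemma nxt_pvert: "nxt n (pvert n t) = pvert n (t + 1)"
proof -
  have "int (nxt n (pvert n t)) = (t mod (int n + 3) + 1) mod (int n + 3)"
    by (simp add: nxt_def pvert_def zmod_int add.commute)
  also have "\<dots> = int (pvert n (t + 1))"
    by (simp add: pvert_def mod_add_left_eq)
  finally show ?thesis by simp
qed

lemma pvert_window:
  assumes "v < n + 3"
  obtains t where "a \<le> t" "t < a + (int n + 3)" "pvert n t = v"
proof
  let ?N = "int n + 3"
  let ?t = "a + (int v - a) mod ?N"
  show "a \<le> ?t" "?t < a + ?N" by auto
  show "pvert n ?t = v"
    using assms by (simp add: pvert_def mod_add_right_eq)
qed

text \<open>A window meets at most two blocks of residues, separated by the first multiple of the
  period above \<open>a\<close>. Once that multiple is named, residues are affine on both parts and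
  comparing them is linear arithmetic.\<close>

lemma pvert_explicit:
  assumes "a \<le> t" "t < a + (int n + 3)"
  shows "int (pvert n t) = (if t < (a div (int n + 3) + 1) * (int n + 3)
      then t - (a div (int n + 3)) * (int n + 3) else t - (a div (int n + 3) + 1) * (int n + 3))"
proof -
  let ?N = "int n + 3"
  define k where "k = a div ?N"
  have a: "k * ?N \<le> a" "a < k * ?N + ?N"
    using div_mult_mod_eq[of a ?N] pos_mod_bound[of ?N a] pos_mod_sign[of ?N a]
    unfolding k_def by linarith+
  have "t mod ?N = (if t < (k + 1) * ?N then t - k * ?N else t - (k + 1) * ?N)"
  proof (cases "t < (k + 1) * ?N")
    case True
    then have "0 \<le> t - k * ?N" "t - k * ?N < ?N"
      using a assms by (auto simp: distrib_right)
    then have "(t - k * ?N) mod ?N = t - k * ?N" by simp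
    moreover have "(t - k * ?N) mod ?N = t mod ?N"
      by (metis add.commute diff_add_cancel mod_mult_self1)
    ultimately show ?thesis using True by simp
  next
    case False
    then have "0 \<le> t - (k + 1) * ?N" "t - (k + 1) * ?N < ?N"
      using a assms by (auto simp: distrib_right)
    then have "(t - (k + 1) * ?N) mod ?N = t - (k + 1) * ?N" by simp
    moreover have "(t - (k + 1) * ?N) mod ?N = t mod ?N"
      by (metis add.commute diff_add_cancel mod_mult_self1)
    ultimately show ?thesis using False by simp
  qed
  moreover have "int (pvert n t) = t mod ?N"
    by (simp add: pvert_def)
  ultimately show ?thesis
    unfolding k_def by simp
qed

text \<open>Removes the existential choice of how the endpoints are ordered, so that crossing
  becomes a condition decidable by cases.\<close>

lemma crosses_doubleton:
  "crosses {p, r} {q, s} \<longleftrightarrow>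
     (min p r < min q s \<and> min q s < max p r \<and> max p r < max q s) \<or>
     (min q s < min p r \<and> min p r < max q s \<and> max q s < max p r)"
  (is "?L \<longleftrightarrow> ?R")
proof
  assume ?L
  then obtain a b c f where o: "a < c" "c < b" "b < f"
    and e: "{p, r} = {a, b} \<and> {q, s} = {c, f} \<or> {p, r} = {c, f} \<and> {q, s} = {a, b}"
    unfolding crosses_def by blast
  from e show ?R
  proof
    assume e: "{p, r} = {a, b} \<and> {q, s} = {c, f}"
    then have "min p r = a \<and> max p r = b" "min q s = c \<and> max q s = f"
      using o by (auto simp: doubleton_eq_iff)
    then show ?R using o by simp
  next
    assume e: "{p, r} = {c, f} \<and> {q, s} = {a, b}"
    then have "min q s = a \<and> max q s = b" "min p r = c \<and> max p r = f"
      using o by (auto simp: doubleton_eq_iff)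
    then show ?R using o by simp
  qed
next
  assume R: ?R
  have *: "{u, v} = {min u v, max u v}" for u v :: nat
    by (auto simp: min_def max_def)
  from R show ?L
    unfolding crosses_def using *[of p r] *[of q s] by blast
qed

lemma crosses_sym: "crosses d e \<longleftrightarrow> crosses e d"
  unfolding crosses_def by blast

lemma chord_sym: "chord n a b = chord n b a"
  by (auto simp: chord_def)

lemma chord_shift [simp]: "chord n (a + (int n + 3)) b = chord n a b" "chord n a (b + (int n + 3)) = chord n a b"
  "chord n (a - (int n + 3)) b = chord n a b" "chord n a (b - (int n + 3)) = chord n a b"
  by (simp_all add: chord_def)

lemma chord_rot: "chord n b (a + (int n + 3)) = chord n a b"
  by (simp add: chord_sym)

lemma chord_eqD:
  assumes "chord n a b = chord n c d" "a \<le> b" "b < a + (int n + 3)"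
    "a \<le> c" "c < a + (int n + 3)" "a \<le> d" "d < a + (int n + 3)"
  shows "c = a \<and> d = b \<or> c = b \<and> d = a"
proof -
  have *: "s = t" if "pvert n s = pvert n t" "a \<le> s" "s < a + (int n + 3)" "a \<le> t" "t < a + (int n + 3)" for s t
    using that by (intro pvert_inj[of n]) auto
  have "pvert n a = pvert n c \<and> pvert n b = pvert n d \<or> pvert n a = pvert n d \<and> pvert n b = pvert n c"
    using assms(1) unfolding chord_def by (auto simp: doubleton_eq_iff)
  then show ?thesis
    using *[of a c] *[of b d] *[of a d] *[of b c] assms by auto
qed

text \<open>Crossing is defined by comparing the labels \<open>0, ..., n + 2\<close>, which is not
  visibly invariant under rotation. Writing all labels relative to the multiple \<open>w\<close> of
  the period at which they restart reduces the cyclic comparison to the linear one.\<close>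

lemma crosses_chord_window:
  assumes "a < b" "b < a + (int n + 3)" "a \<le> c" "c < a + (int n + 3)" "a \<le> d" "d < a + (int n + 3)"
  shows "crosses (chord n a b) (chord n c d) \<longleftrightarrow> a < c \<and> c < b \<and> b < d \<or> a < d \<and> d < b \<and> b < c"
proof -
  define w where "w = (a div (int n + 3) + 1) * (int n + 3)"
  have "0 \<le> a mod (int n + 3)" "a mod (int n + 3) < int n + 3"
    by auto
  moreover have "w = a - a mod (int n + 3) + (int n + 3)"
    using div_mult_mod_eq[of a "int n + 3"] unfolding w_def by (simp add: algebra_simps)
  ultimately have w: "a < w" "w \<le> a + (int n + 3)"
    by simp_all
  have v: "int (pvert n t) = (if t < w then t - w + (int n + 3) else t - w)"
    if "a \<le> t" "t < a + (int n + 3)" for t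
    using pvert_explicit[OF that] unfolding w_def by (auto simp: distrib_right)
  show ?thesis
    unfolding chord_def crosses_doubleton
    using v[of a] v[of b] v[of c] v[of d] w assms
    by (auto simp: min_def max_def split: if_splits)
qed

lemma crosses_chord:
  assumes "a < b" "b < a + (int n + 3)"
  shows "crosses (chord n a b) (chord n x y) \<longleftrightarrow>
    (\<exists>c d. a < c \<and> c < b \<and> b < d \<and> d < a + (int n + 3) \<and> chord n x y = chord n c d)"
    (is "?L \<longleftrightarrow> ?R")
proof -
  obtain c where c: "a \<le> c" "c < a + (int n + 3)" "pvert n c = pvert n x"
    by (rule pvert_window[OF pvert_less])
  obtain d where d: "a \<le> d" "d < a + (int n + 3)" "pvert n d = pvert n y"
    by (rule pvert_window[OF pvert_less])
  have e: "chord n x y = chord n c d"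
    using c d by (simp add: chord_def)
  show ?thesis
  proof
    assume ?L
    then consider "a < c \<and> c < b \<and> b < d" | "a < d \<and> d < b \<and> b < c"
      using crosses_chord_window[OF assms c(1,2) d(1,2)] e by auto
    then show ?R
    proof cases
      case 1
      then show ?thesis using e d by blast
    next
      case 2
      then show ?thesis using e c by (metis chord_sym)
    qed
  next
    assume ?R
    then obtain c d where "a < c" "c < b" "b < d" "d < a + (int n + 3)" "chord n x y = chord n c d"
      by blast
    then show ?L
      using crosses_chord_window[of a b n c d] assms by auto
  qed
qed

lemma chord_window:
  assumes "u < n + 3" "v < n + 3" "u \<noteq> v"
  obtains a b where "{u, v} = chord n a b" "a < b" "b < a + (int n + 3)" "pvert n a = u" "pvert n b = v"
proof -
  have a: "pvert n (int u) = u" using assms by (simp add: pvert_int)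
  obtain b where b: "int u \<le> b" "b < int u + (int n + 3)" "pvert n b = v"
    by (rule pvert_window[OF assms(2)])
  have "b \<noteq> int u" using a b assms by auto
  then show ?thesis
    using that[of "int u" b] a b unfolding chord_def by auto
qed

text \<open>The second alternative is the edge that closes the window: \<open>a + n + 2\<close> is
  the predecessor of the next lift of \<open>a\<close>.\<close>

lemma boundary_chord:
  assumes "a < b" "b < a + (int n + 3)"
  shows "boundary_edge n (chord n a b) \<longleftrightarrow> b = a + 1 \<or> b = a + int n + 2"
proof
  assume "boundary_edge n (chord n a b)"
  then obtain v where v: "v < n + 3" "chord n a b = {v, nxt n v}"
    unfolding boundary_edge_def by blast
  obtain c where c: "a \<le> c" "c < a + (int n + 3)" "pvert n c = v"
    by (rule pvert_window[OF v(1)])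
  have e: "chord n a b = chord n c (c + 1)"
    using v c unfolding chord_def by (simp flip: nxt_pvert)
  show "b = a + 1 \<or> b = a + int n + 2"
  proof (cases "c + 1 < a + (int n + 3)")
    case True
    then show ?thesis using chord_eqD[OF e] assms c by auto
  next
    case False
    then have "c + 1 = a + (int n + 3)" using c by simp
    then have "chord n a b = chord n c a" using e by (metis chord_shift(2))
    then show ?thesis using chord_eqD[of n a b c a] assms c \<open>c + 1 = a + (int n + 3)\<close> by auto
  qed
next
  assume "b = a + 1 \<or> b = a + int n + 2"
  then show "boundary_edge n (chord n a b)"
  proof
    assume "b = a + 1"
    then show ?thesis
      unfolding boundary_edge_def chord_def using pvert_less[of n a] nxt_pvert[of n a] by auto
  next
    assume "b = a + int n + 2"
    then have "pvert n a = nxt n (pvert n b)"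
      using nxt_pvert[of n b] pvert_shift(1)[of n a] by (simp add: algebra_simps)
    then show ?thesis
      unfolding boundary_edge_def chord_def using pvert_less[of n b] by (metis insert_commute)
  qed
qed

lemma diagonal_chord:
  assumes "a < b" "b < a + (int n + 3)"
  shows "diagonal n (chord n a b) \<longleftrightarrow> a + 2 \<le> b \<and> b \<le> a + int n + 1"
proof -
  have "pvert n a \<noteq> pvert n b" using assms pvert_inj[of n a b] by auto
  then have "diagonal n (chord n a b) \<longleftrightarrow> \<not> boundary_edge n (chord n a b)"
    unfolding diagonal_def chord_def using pvert_less by blast
  then show ?thesis using boundary_chord[OF assms] assms by auto
qed

lemma diagonalE:
  assumes "diagonal n d"
  obtains a b where "d = chord n a b" "a + 2 \<le> b" "b \<le> a + int n + 1"
proof -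
  obtain u v where "u < n + 3" "v < n + 3" "u \<noteq> v" "d = {u, v}"
    using assms unfolding diagonal_def by blast
  then obtain a b where "d = chord n a b" "a < b" "b < a + (int n + 3)"
    using chord_window by metis
  then show ?thesis using that assms diagonal_chord by metis
qed

lemma finite_maximizer:
  fixes f :: "'a \<Rightarrow> 'b::linorder"
  assumes "finite S" "S \<noteq> {}"
  obtains m where "m \<in> S" "\<And>s. s \<in> S \<Longrightarrow> f s \<le> f m"
proof -
  have "Max (f ` S) \<in> f ` S" using assms by simp
  then obtain m where "m \<in> S" "f m = Max (f ` S)" by auto
  then show ?thesis using that assms by simp
qed

section \<open>Triangles of a labelled triangulation\<close>

locale labelled_tri =
  fixes n :: nat and \<tau> :: "nat \<Rightarrow> diag"
  assumes labelled: "labelled_triangulation n \<tau>"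
begin

abbreviation N :: int where "N \<equiv> int n + 3"
abbreviation ch :: "int \<Rightarrow> int \<Rightarrow> diag" where "ch \<equiv> chord n"
abbreviation T :: "diag set" where "T \<equiv> \<tau> ` {1..n}"
abbreviation spp :: "diag \<Rightarrow> nat set" where "spp \<equiv> supp n \<tau>"
abbreviation free :: "diag \<Rightarrow> bool" where "free \<equiv> free_diagonal n \<tau>"
abbreviation Qv :: "(nat \<times> nat) set" where "Qv \<equiv> quiver_of n \<tau>"

text \<open>Sides of triangles may be boundary edges. Treating them like members of \<open>T\<close>
  removes most case distinctions from arguments about triangles.\<close>

definition edge :: "diag \<Rightarrow> bool" where
  "edge e \<longleftrightarrow> e \<in> T \<or> boundary_edge n e"

lemma inj_label: "inj_on \<tau> {1..n}"
  using labelled by (simp add: labelled_triangulation_def)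

lemma T_diagonal: "d \<in> T \<Longrightarrow> diagonal n d"
  and T_nocross: "d \<in> T \<Longrightarrow> e \<in> T \<Longrightarrow> \<not> crosses d e"
  and T_maximal: "diagonal n d \<Longrightarrow> d \<notin> T \<Longrightarrow> \<exists>x\<in>{1..n}. crosses d (\<tau> x)"
proof -
  have t: "triangulation n T" using labelled by (simp add: labelled_triangulation_def)
  show "d \<in> T \<Longrightarrow> diagonal n d" "d \<in> T \<Longrightarrow> e \<in> T \<Longrightarrow> \<not> crosses d e"
    using t unfolding triangulation_def by blast+
  have "\<forall>d. diagonal n d \<and> (\<forall>e\<in>T. \<not> crosses d e) \<longrightarrow> d \<in> T"
    using t unfolding triangulation_def by (elim conjE)
  then show "diagonal n d \<Longrightarrow> d \<notin> T \<Longrightarrow> \<exists>x\<in>{1..n}. crosses d (\<tau> x)"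
    by auto
qed

lemma T_chord:
  assumes "x \<in> {1..n}"
  obtains a b where "\<tau> x = ch a b" "a + 2 \<le> b" "b \<le> a + int n + 1"
  using T_diagonal[of "\<tau> x"] assms diagonalE by blast

lemma edge_sym: "edge (ch a b) = edge (ch b a)"
  by (simp add: chord_sym)

lemma edge_T: "edge (ch a b) \<Longrightarrow> a + 2 \<le> b \<Longrightarrow> b \<le> a + int n + 1 \<Longrightarrow> ch a b \<in> T"
  unfolding edge_def using boundary_chord[of a b n] by auto

lemma T_edge: "x \<in> {1..n} \<Longrightarrow> edge (\<tau> x)"
  by (simp add: edge_def)

lemma edge_label:
  assumes "edge (ch a b)" "a + 2 \<le> b" "b \<le> a + int n + 1"
  obtains x where "x \<in> {1..n}" "\<tau> x = ch a b"
  using edge_T[OF assms] by (metis imageE)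

lemma label_inj: "x \<in> {1..n} \<Longrightarrow> y \<in> {1..n} \<Longrightarrow> \<tau> x = \<tau> y \<Longrightarrow> x = y"
  using inj_label by (auto dest: inj_onD)

lemma edge_nocross:
  assumes "edge (ch a b)" "edge (ch c d)" "a < c" "c < b" "b < d" "d < a + N"
  shows False
proof -
  have x: "crosses (ch a b) (ch c d)"
    using assms crosses_chord_window[of a b n c d] by auto
  have "\<not> boundary_edge n (ch a b)" "\<not> boundary_edge n (ch c d)"
    using assms boundary_chord[of a b n] boundary_chord[of c d n] by auto
  then have "ch a b \<in> T" "ch c d \<in> T"
    using assms(1,2) by (auto simp: edge_def)
  then show False using T_nocross x by blast
qed

text \<open>Take \<open>c\<close> farthest from \<open>a\<close> among the edges from
  \<open>a\<close> into the arc. If \<open>ch c b\<close> were not an edge, maximality of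
  \<open>T\<close> would give a diagonal crossing it. Its far end lies outside the arc, at
  \<open>a\<close>, or between \<open>a\<close> and \<open>c\<close>; so it crosses
  \<open>ch a b\<close>, contradicts the choice of \<open>c\<close>, or crosses
  \<open>ch a c\<close>.\<close>

lemma third_vertex:
  assumes e: "edge (ch a b)" and "a + 2 \<le> b" "b < a + N"
  obtains c where "a < c" "c < b" "edge (ch a c)" "edge (ch c b)"
proof -
  define S where "S = {c \<in> {a<..<b}. edge (ch a c)}"
  have fin: "finite S" unfolding S_def by (rule finite_subset[of _ "{a<..<b}"]) auto
  have "a + 1 \<in> S"
    using assms boundary_chord[of a "a + 1" n] by (auto simp: S_def edge_def)
  then have ne: "S \<noteq> {}" by auto
  define c where "c = Max S"
  have cS: "c \<in> S" and cm: "\<And>x. x \<in> S \<Longrightarrow> x \<le> c"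
    using fin ne by (auto simp: c_def)
  have c: "a < c" "c < b" "edge (ch a c)" using cS by (auto simp: S_def)
  have "edge (ch c b)"
  proof (rule ccontr)
    assume ne: "\<not> edge (ch c b)"
    then have cb: "c + 2 \<le> b" "b \<le> c + int n + 1"
      using c assms boundary_chord[of c b n] by (auto simp: edge_def)
    then have "diagonal n (ch c b)" using diagonal_chord[of c b n] by auto
    then obtain x where x: "x \<in> {1..n}" "crosses (ch c b) (\<tau> x)"
      using T_maximal[of "ch c b"] ne unfolding edge_def by auto
    obtain u v where uv: "\<tau> x = ch u v" using T_chord[OF x(1)] by blast
    then have "crosses (ch c b) (ch u v)" using x by simp
    then obtain y z where "c < y" "y < b" "b < z" "z < c + N" "\<tau> x = ch y z"
      using crosses_chord[of c b n u v] cb uv by auto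
    note yz = this
    have ed: "edge (ch y z)" using T_edge[OF x(1)] yz by simp
    consider "z < a + N" | "z = a + N" | "a + N < z" by linarith
    then show False
    proof cases
      case 1
      then show False using edge_nocross[OF e ed] yz c by auto
    next
      case 2
      then have "edge (ch a y)" using ed by (simp add: edge_sym)
      then have "y \<in> S" using yz c by (auto simp: S_def)
      then show False using cm[of y] yz by linarith
    next
      case 3
      have "edge (ch (z - N) y)" using ed by (simp add: edge_sym)
      then show False using edge_nocross[OF c(3), of "z - N" y]
        edge_nocross[of a c "z - N" y] c yz 3 assms by auto
    qed
  qed
  then show ?thesis using that c by blast
qed

text \<open>A triangle listed counter-clockwise lifts to a chain \<open>a < b < c < a + N\<close>;
  the three alternatives in \<open>triangle\<close> are the places where the labels may
  restart.\<close>

lemma quiver_iff: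
  "(x, y) \<in> Qv \<longleftrightarrow> x \<in> {1..n} \<and> y \<in> {1..n} \<and> (\<exists>a b c. a < b \<and> b < c \<and> c < a + N \<and>
     edge (ch a c) \<and> \<tau> x = ch a b \<and> \<tau> y = ch b c)"
    (is "?L \<longleftrightarrow> ?R")
proof
  assume ?L
  then obtain p q r where xy: "x \<in> {1..n}" "y \<in> {1..n}" and t: "triangle n T p q r"
    and e: "\<tau> x = {p, q}" "\<tau> y = {q, r}"
    unfolding quiver_of_def by blast
  define b where "b = (if p < q then int q else int q + N)"
  define c where "c = (if p < r then int r else int r + N)"
  have l: "p < n + 3" "q < n + 3" "r < n + 3" using t by (auto simp: triangle_def)
  have v: "pvert n (int p) = p" "pvert n b = q" "pvert n c = r"
    using l pvert_shift(1)[of n "int q"] pvert_shift(1)[of n "int r"]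
    by (auto simp: b_def c_def pvert_int)
  have "int p < b" "b < c" "c < int p + N"
    using t by (auto simp: triangle_def b_def c_def)
  moreover have "edge (ch (int p) c)"
    using t v unfolding triangle_def edge_def chord_def by (auto simp: insert_commute)
  moreover have "\<tau> x = ch (int p) b" "\<tau> y = ch b c"
    using e v by (simp_all add: chord_def)
  ultimately show ?R
    using xy by blast
next
  assume ?R
  then obtain a b c where xy: "x \<in> {1..n}" "y \<in> {1..n}" and o: "a < b" "b < c" "c < a + N"
    and e: "edge (ch a c)" "\<tau> x = ch a b" "\<tau> y = ch b c" by blast
  define w where "w = (a div N + 1) * N"
  have v: "int (pvert n t) = (if t < w then t - w + N else t - w)"
    if "a \<le> t" "t < a + N" for t
    using pvert_explicit[OF that] unfolding w_def by (auto simp: distrib_right)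
  have "triangle n T (pvert n a) (pvert n b) (pvert n c)"
    unfolding triangle_def
  proof (intro conjI ballI)
    show "pvert n a < pvert n b \<and> pvert n b < pvert n c \<or>
      pvert n b < pvert n c \<and> pvert n c < pvert n a \<or> pvert n c < pvert n a \<and> pvert n a < pvert n b"
      using v[of a] v[of b] v[of c] o pvert_less[of n a] pvert_less[of n b] pvert_less[of n c]
      by (auto split: if_splits)
  next
    fix d assume "d \<in> {{pvert n a, pvert n b}, {pvert n b, pvert n c}, {pvert n c, pvert n a}}"
    then show "d \<in> T \<or> boundary_edge n d"
      using e xy T_edge[OF xy(1)] T_edge[OF xy(2)] unfolding edge_def chord_def by (auto simp: insert_commute)
  qed (auto simp: pvert_less)
  then show ?L using xy e unfolding quiver_of_def chord_def by blast
qed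

lemma quiver_ranges: "(x, y) \<in> Qv \<Longrightarrow> x \<in> {1..n} \<and> y \<in> {1..n}"
  by (simp add: quiver_iff)

text \<open>The three possible arrows of one triangle. The last two follow from the first by
  starting the window at \<open>b\<close> or at \<open>c\<close>.\<close>

lemma quiver_triangle:
  assumes "a < b" "b < c" "c < a + N" "x \<in> {1..n}" "y \<in> {1..n}"
  shows "edge (ch a c) \<Longrightarrow> \<tau> x = ch a b \<Longrightarrow> \<tau> y = ch b c \<Longrightarrow> (x, y) \<in> Qv"
    "edge (ch a b) \<Longrightarrow> \<tau> x = ch b c \<Longrightarrow> \<tau> y = ch a c \<Longrightarrow> (x, y) \<in> Qv"
    "edge (ch b c) \<Longrightarrow> \<tau> x = ch a c \<Longrightarrow> \<tau> y = ch a b \<Longrightarrow> (x, y) \<in> Qv"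
proof -
  show "edge (ch a c) \<Longrightarrow> \<tau> x = ch a b \<Longrightarrow> \<tau> y = ch b c \<Longrightarrow> (x, y) \<in> Qv"
    using assms quiver_iff by blast
next
  assume "edge (ch a b)" "\<tau> x = ch b c" "\<tau> y = ch a c"
  then have "b < c \<and> c < a + N \<and> a + N < b + N \<and> edge (ch b (a + N)) \<and> \<tau> x = ch b c \<and> \<tau> y = ch c (a + N)"
    using assms by (simp add: chord_sym)
  then show "(x, y) \<in> Qv" using assms quiver_iff by blast
next
  assume "edge (ch b c)" "\<tau> x = ch a c" "\<tau> y = ch a b"
  then have "c < a + N \<and> a + N < b + N \<and> b + N < c + N \<and> edge (ch c (b + N)) \<and> \<tau> x = ch c (a + N) \<and> \<tau> y = ch (a + N) (b + N)"
    using assms by (simp add: chord_sym)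
  then show "(x, y) \<in> Qv" using assms quiver_iff by blast
qed

text \<open>The cases are the two orders of the endpoints: lifts differ by a translation, possibly
  after passing from \<open>(e, f)\<close> to \<open>(f, e + N)\<close>.\<close>

lemma chord_eq_shift:
  assumes "ch a b = ch e f" "a < b" "b < a + N" "e < f" "f < e + N"
  obtains k where "a = e + k * N" "b = f + k * N" | k where "a = f + k * N" "b = e + (k + 1) * N"
proof -
  define k where "k = (a - e) div N"
  have "0 \<le> (a - e) mod N" "(a - e) mod N < N" by auto
  then have k: "e + k * N \<le> a" "a < e + k * N + N"
    using div_mult_mod_eq[of "a - e" N] unfolding k_def by linarith+
  have sh: "pvert n (t + k * N) = pvert n t" for t
    by (simp add: pvert_eq_iff)
  have eq: "ch (e + k * N) (f + k * N) = ch a b"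
    using assms(1) by (simp add: chord_def sh)
  define b' where "b' = (if b < e + k * N + N then b else b - N)"
  have "ch (e + k * N) (f + k * N) = ch a b'"
    using eq by (simp add: b'_def)
  then consider "a = e + k * N" "b' = f + k * N" | "a = f + k * N" "b' = e + k * N"
    using chord_eqD[of n "e + k * N" "f + k * N" a b'] assms k by (fastforce simp: b'_def split: if_splits)
  then show ?thesis
  proof cases
    case 1
    then show ?thesis using that(1)[of k] assms k by (auto simp: b'_def split: if_splits)
  next
    case 2
    then show ?thesis using that(2)[of k] assms k by (auto simp: b'_def distrib_right split: if_splits)
  qed
qed

lemma pvert_mult: "pvert n (t + k * N) = pvert n t" "pvert n (t - k * N) = pvert n t"
proof -
  show *: "pvert n (t + k * N) = pvert n t" for t k
    by (simp add: pvert_eq_iff)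
  show "pvert n (t - k * N) = pvert n t"
    using *[of t "- k"] by simp
qed

text \<open>A diagonal borders two triangles, and an arrow turns it within one of them about a
  common end: about \<open>f\<close> in the triangle beyond \<open>f\<close>, about \<open>e\<close>
  in the triangle between \<open>e\<close> and \<open>f\<close>.\<close>

lemma quiver_out:
  assumes "(u, v) \<in> Qv" "\<tau> u = ch e f" "e < f" "f < e + N"
  obtains r where "f < r" "r < e + N" "edge (ch e r)" "\<tau> v = ch f r"
    | r where "e < r" "r < f" "edge (ch r f)" "\<tau> v = ch e r"
proof -
  obtain a b c where abc: "a < b" "b < c" "c < a + N" "edge (ch a c)" "\<tau> u = ch a b" "\<tau> v = ch b c"
    using assms(1) quiver_iff by blast
  have "ch a b = ch e f" using abc assms by simp
  then show ?thesis
  proof (rule chord_eq_shift)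
    fix k assume k: "a = e + k * N" "b = f + k * N"
    have "ch e (c - k * N) = ch a c" "ch f (c - k * N) = ch b c"
      using k by (auto simp: chord_def pvert_mult)
    then show ?thesis using that(1)[of "c - k * N"] abc k by auto
  next
    fix k assume k: "a = f + k * N" "b = e + (k + 1) * N"
    have "ch (c - (k + 1) * N) f = ch a c" "ch e (c - (k + 1) * N) = ch b c"
      unfolding k chord_def pvert_mult by auto
    then show ?thesis using that(2)[of "c - (k + 1) * N"] abc k by (auto simp: algebra_simps)
  qed (use abc assms in auto)
qed

lemma quiver_in:
  assumes "(u, v) \<in> Qv" "\<tau> v = ch e f" "e < f" "f < e + N"
  obtains p where "f < p" "p < e + N" "edge (ch f p)" "\<tau> u = ch e p"
    | p where "e < p" "p < f" "edge (ch e p)" "\<tau> u = ch p f"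
proof -
  obtain a b c where abc: "a < b" "b < c" "c < a + N" "edge (ch a c)" "\<tau> u = ch a b" "\<tau> v = ch b c"
    using assms(1) quiver_iff by blast
  have "ch b c = ch e f" using abc assms by simp
  then show ?thesis
  proof (rule chord_eq_shift)
    fix k assume k: "b = e + k * N" "c = f + k * N"
    have "ch f (a - (k - 1) * N) = ch a c" "ch e (a - (k - 1) * N) = ch a b"
      unfolding k chord_def pvert_mult by auto
    then show ?thesis using that(1)[of "a - (k - 1) * N"] abc k by (auto simp: algebra_simps)
  next
    fix k assume k: "b = f + k * N" "c = e + (k + 1) * N"
    have "ch e (a - k * N) = ch a c" "ch (a - k * N) f = ch a b"
      unfolding k chord_def pvert_mult by auto
    then show ?thesis using that(2)[of "a - k * N"] abc k by (auto simp: algebra_simps)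
  qed (use abc assms in auto)
qed

lemma supp_chord:
  assumes "a < b" "b < a + N"
  shows "x \<in> spp (ch a b) \<longleftrightarrow> x \<in> {1..n} \<and>
    (\<exists>c d. a < c \<and> c < b \<and> b < d \<and> d < a + N \<and> \<tau> x = ch c d)"
proof -
  have "crosses (ch a b) (\<tau> x) \<longleftrightarrow> (\<exists>c d. a < c \<and> c < b \<and> b < d \<and> d < a + N \<and> \<tau> x = ch c d)"
    if "x \<in> {1..n}"
  proof -
    obtain u v where "\<tau> x = ch u v" using T_chord[OF \<open>x \<in> {1..n}\<close>] by blast
    then show ?thesis using crosses_chord[OF assms, of u v] by simp
  qed
  then show ?thesis
    by (auto simp: supp_def crosses_sym[of "\<tau> x"])
qed

lemma supp_window:
  assumes "a < b" "b < a + N" "\<tau> x = ch c d" "a \<le> c" "c < a + N" "a \<le> d" "d < a + N" "x \<in> {1..n}"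
  shows "x \<in> spp (ch a b) \<longleftrightarrow> a < c \<and> c < b \<and> b < d \<or> a < d \<and> d < b \<and> b < c"
  using crosses_chord_window[OF assms(1,2,4-7)] assms(3,8) by (simp add: supp_def crosses_sym[of "ch c d"])

lemma supp_subset: "spp \<gamma> \<subseteq> {1..n}"
  by (auto simp: supp_def)

lemma free_chordE:
  assumes "free \<gamma>"
  obtains a b where "\<gamma> = ch a b" "a + 2 \<le> b" "b \<le> a + int n + 1"
  using assms diagonalE unfolding free_diagonal_def by blast

lemma free_chord_bounds:
  assumes "free (ch a b)" "a < b" "b < a + N"
  shows "a + 2 \<le> b" "b \<le> a + int n + 1"
  using assms diagonal_chord[of a b n] unfolding free_diagonal_def by auto

text \<open>Maximality of \<open>T\<close> makes a diagonal outside \<open>T\<close> cross some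
  member, while members cross none. Freeness is thus certified by one crossed label.\<close>

lemma free_iff: "free \<gamma> \<longleftrightarrow> diagonal n \<gamma> \<and> spp \<gamma> \<noteq> {}"
proof
  assume f: "free \<gamma>"
  then have "\<exists>x\<in>{1..n}. crosses \<gamma> (\<tau> x)"
    using T_maximal[of \<gamma>] unfolding free_diagonal_def by simp
  then show "diagonal n \<gamma> \<and> spp \<gamma> \<noteq> {}"
    using f unfolding free_diagonal_def supp_def by (auto simp: crosses_sym[of \<gamma>])
next
  assume "diagonal n \<gamma> \<and> spp \<gamma> \<noteq> {}"
  then show "free \<gamma>"
    using T_nocross unfolding free_diagonal_def supp_def by blast
qed

lemma crossed_free:
  assumes "x \<in> {1..n}" "\<tau> x = ch c d" "a < c" "c < b" "b < d" "d < a + N"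
  shows "free (ch a b)"
proof -
  have "x \<in> spp (ch a b)" using assms supp_chord[of a b x] by auto
  moreover have "diagonal n (ch a b)" using assms diagonal_chord[of a b n] by auto
  ultimately show ?thesis using free_iff by blast
qed

text \<open>This is the hex game on the polygon: the sides of the board are the four arcs into which
  \<open>a\<close>, \<open>a'\<close>, \<open>b\<close> and \<open>b'\<close> cut the boundary.\<close>

lemma hex_edge:
  assumes "a \<le> a'" "a' + 2 \<le> b" "b \<le> b'" "b' + 2 \<le> a + N"
    and no: "\<And>i j. a \<le> i \<Longrightarrow> i \<le> a' \<Longrightarrow> b \<le> j \<Longrightarrow> j \<le> b' \<Longrightarrow> \<not> edge (ch i j)"
  obtains c d where "a' < c" "c < b" "b' < d" "d < a + N" "ch c d \<in> T"
proof -
  \<comment> \<open>Edges from the first side of the board to the second; the boundary edge at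
    \<open>a'\<close> is one. Beyond the longest of them, the third vertex of the triangle cannot
    lie on these two sides, which would give a longer edge, nor on the third side, where edges are
    excluded. So it lies on the fourth.\<close>
  define S where "S = {(x, y) \<in> {a..a'} \<times> {a'<..<b}. edge (ch x y)}"
  have fin: "finite S" unfolding S_def by (rule finite_subset[of _ "{a..a'} \<times> {a'<..<b}"]) auto
  have "(a', a' + 1) \<in> S"
    using assms boundary_chord[of a' "a' + 1" n] by (auto simp: S_def edge_def)
  then have ne: "S \<noteq> {}" by auto
  obtain m where m: "m \<in> S" "\<And>s. s \<in> S \<Longrightarrow> snd s - fst s \<le> snd m - fst m"
    using finite_maximizer[OF fin ne, of "\<lambda>s. snd s - fst s"] by blast
  obtain x y where xy: "m = (x, y)" by fastforce
  have x: "a \<le> x" "x \<le> a'" "a' < y" "y < b" "edge (ch x y)"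
    using m(1) by (auto simp: S_def xy)
  have "edge (ch y (x + N))" using x by (simp add: chord_sym)
  then obtain z where z: "y < z" "z < x + N" "edge (ch y z)" "edge (ch z (x + N))"
    using third_vertex[of y "x + N"] x assms by auto
  have zx: "edge (ch x z)" using z by (simp add: chord_sym)
  consider "z < b" | "b \<le> z" "z \<le> b'" | "b' < z" "z < a + N" | "a + N \<le> z" by linarith
  then show ?thesis
  proof cases
    case 1
    then have "(x, z) \<in> S" using x z zx by (auto simp: S_def)
    then show ?thesis using m(2) z by (fastforce simp: xy)
  next
    case 2
    then show ?thesis using no[of x z] x zx by auto
  next
    case 3
    then have "ch y z \<in> T" using edge_T[OF z(3)] x assms by auto
    then show ?thesis using that[of y z] x 3 by auto
  next
    case 4
    have "edge (ch (z - N) y)" using z by (simp add: chord_sym)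
    then have "(z - N, y) \<in> S" using x z 4 by (auto simp: S_def)
    then show ?thesis using m(2) z by (fastforce simp: xy)
  qed
qed

end

section \<open>Supports and homomorphisms of thin representations\<close>

text \<open>The family that is the identity on \<open>I \<inter> J\<close> and zero elsewhere is a
  nonzero morphism between the thin representations on \<open>I\<close> and \<open>J\<close>. The
  two implications are the two ways in which the square of an arrow could fail to commute.\<close>

definition thin_hom :: "('a \<times> 'a) set \<Rightarrow> 'a set \<Rightarrow> 'a set \<Rightarrow> bool" where
  "thin_hom Q I J \<longleftrightarrow> I \<inter> J \<noteq> {} \<and> (\<forall>(u, v)\<in>Q. (u \<in> I \<inter> J \<and> v \<in> J \<longrightarrow> v \<in> I) \<and> (u \<in> I \<and> v \<in> I \<inter> J \<longrightarrow> u \<in> J))"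

definition connected_in :: "('a \<times> 'a) set \<Rightarrow> 'a set \<Rightarrow> bool" where
  "connected_in Q S \<longleftrightarrow> (\<forall>x\<in>S. \<forall>y\<in>S. (x, y) \<in> (Restr (Q \<union> Q\<inverse>) S)\<^sup>*)"

context labelled_tri
begin

lemma T_separated:
  assumes "z \<in> {1..n}" "x \<in> {1..n}" "\<tau> z = ch c d" "\<tau> x = ch e f"
    "c < e" "e < d" "d < f" "f < c + N"
  shows False
  using edge_nocross[OF T_edge[OF assms(1), unfolded assms(3)] T_edge[OF assms(2), unfolded assms(4)]] assms by auto

text \<open>A priori \<open>x\<close> crosses the two diagonals with different lifts. If one lift
  did not serve for both, \<open>x\<close> would interleave with \<open>z\<close>. A common lift
  means that \<open>x\<close> crosses every diagonal of the rectangle between the two.\<close>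

lemma both_crossed:
  assumes "a \<le> a'" "b \<le> b'" "a' < c" "c < b" "b' < d" "d < a + N"
    and z: "z \<in> {1..n}" "\<tau> z = ch c d"
    and x: "x \<in> spp (ch a b)" "x \<in> spp (ch a' b')"
  obtains e f where "a' < e" "e < b" "b' < f" "f < a + N" "\<tau> x = ch e f"
proof -
  obtain e f where ef: "a < e" "e < b" "b < f" "f < a + N" "\<tau> x = ch e f" and x1: "x \<in> {1..n}"
    using x(1) supp_chord[of a b x] assms by auto
  have "a' < e \<and> b' < f"
  proof (rule ccontr)
    assume neg: "\<not> (a' < e \<and> b' < f)"
    show False
    proof (cases "a' \<le> e")
      case True
      have w: "a' < e \<and> e < b' \<and> b' < f \<or> a' < f \<and> f < b' \<and> b' < e"
        using supp_window[of a' b' x e f] x(2) ef x1 assms True by auto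
      then show False using neg ef assms by auto
    next
      case False
      have w: "a' < e + N \<and> e + N < b' \<and> b' < f \<or> a' < f \<and> f < b' \<and> b' < e + N"
        using supp_window[of a' b' x "e + N" f] x(2) ef x1 assms False by auto
      then have "f < b'" using ef assms by auto
      then show False
        using T_separated[OF x1 z(1) ef(5) z(2)] ef assms False by auto
    qed
  qed
  then show ?thesis using that ef by blast
qed

lemma supp_crossed:
  assumes "a < c" "c < b" "b < d" "d < a + N" "x \<in> {1..n}" "\<tau> x = ch c d"
  shows "x \<in> spp (ch a b)"
  using supp_chord[of a b x] assms by auto

text \<open>This is the morphism carried by a nonzero path. For a label in both supports with common
  lift \<open>(e, f)\<close>, an arrow keeps one of \<open>e\<close>, \<open>f\<close> and turns the
  other end in a fixed direction, which decides the membership that is still open.\<close>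

lemma thin_hom_forward:
  assumes o: "a \<le> a'" "b \<le> b'" "a' < c" "c < b" "b' < d" "d < a + N"
    and z: "z \<in> {1..n}" "\<tau> z = ch c d"
  shows "thin_hom Qv (spp (ch a b)) (spp (ch a' b'))"
proof -
  let ?I = "spp (ch a b)" and ?J = "spp (ch a' b')"
  have "z \<in> ?I \<inter> ?J" using supp_crossed[of _ c _ d z] assms by auto
  moreover have "v \<in> ?I" if uv: "(u, v) \<in> Qv" "u \<in> ?I \<inter> ?J" "v \<in> ?J" for u v
  proof -
    have v1: "v \<in> {1..n}" using quiver_ranges uv by blast
    obtain e f where ef: "a' < e" "e < b" "b' < f" "f < a + N" "\<tau> u = ch e f"
      using both_crossed[OF o z, of u] uv(2) by blast
    from uv(1) ef(5) show ?thesis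
    proof (rule quiver_out)
      fix r assume r: "f < r" "r < e + N" "\<tau> v = ch f r"
      show ?thesis
      proof (cases "r < a' + N")
        case True
        then show ?thesis using supp_window[of a' b' v f r] uv(3) v1 r ef o by auto
      next
        case False
        have "\<tau> v = ch f (r - N)" using r by simp
        moreover have "a' < r - N"
          using supp_window[of a' b' v f "r - N"] uv(3) v1 r ef o False by auto
        ultimately show ?thesis
          using supp_crossed[of a "r - N" b f v] v1 r ef o by (auto simp: chord_sym)
      qed
    next
      fix r assume r: "e < r" "r < f" "\<tau> v = ch e r"
      have "b' < r" using supp_window[of a' b' v e r] uv(3) v1 r ef o by auto
      then show ?thesis using supp_crossed[of a e b r v] v1 r ef o by auto
    qed (use ef o in auto)
  qed
  moreover have "u \<in> ?J" if uv: "(u, v) \<in> Qv" "u \<in> ?I" "v \<in> ?I \<inter> ?J" for u v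
  proof -
    have u1: "u \<in> {1..n}" using quiver_ranges uv by blast
    obtain e f where ef: "a' < e" "e < b" "b' < f" "f < a + N" "\<tau> v = ch e f"
      using both_crossed[OF o z, of v] uv(3) by blast
    from uv(1) ef(5) show ?thesis
    proof (rule quiver_in)
      fix p assume p: "f < p" "p < e + N" "\<tau> u = ch e p"
      have "p < a + N"
      proof (rule ccontr)
        assume "\<not> p < a + N"
        moreover have "\<tau> u = ch e (p - N)" using p by simp
        ultimately show False
          using supp_window[of a b u e "p - N"] uv(2) u1 p ef o by auto
      qed
      then show ?thesis using supp_crossed[of a' e b' p u] u1 p ef o by auto
    next
      fix p assume p: "e < p" "p < f" "\<tau> u = ch p f"
      have "p < b"
        using supp_window[of a b u p f] uv(2) u1 p ef o by auto
      then show ?thesis using supp_crossed[of a' p b' f u] u1 p ef o by auto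
    qed (use ef o in auto)
  qed
  ultimately show ?thesis unfolding thin_hom_def by blast
qed

text \<open>If \<open>a'\<close> lay before \<open>a\<close>, the triangle beyond the longest edge
  crossing both chords would have its third vertex between \<open>a'\<close> and \<open>a\<close>.
  One of its sides then crosses exactly one of the chords, and the arrow between this side and the
  longest edge violates one of the implications in \<open>thin_hom\<close>.\<close>

lemma thin_hom_left:
  assumes h: "thin_hom Qv (spp (ch a b)) (spp (ch a' b'))"
    and o: "a < c" "c < b" "b < d" "d < a + N" "a' < c" "c < b'" "b' < d" "d < a' + N"
    and z: "z \<in> {1..n}" "\<tau> z = ch c d"
  shows "a \<le> a'"
proof (rule ccontr)
  assume "\<not> a \<le> a'"
  then have aa: "a' < a" by simp
  let ?I = "spp (ch a b)" and ?J = "spp (ch a' b')"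
  define S where "S = {(c, d) \<in> {a<..<min b b'} \<times> {max b b'<..<a' + N}. edge (ch c d)}"
  have fin: "finite S"
    unfolding S_def by (rule finite_subset[of _ "{a<..<min b b'} \<times> {max b b'<..<a' + N}"]) auto
  have "(c, d) \<in> S" using o z T_edge[OF z(1)] by (auto simp: S_def)
  then have ne: "S \<noteq> {}" by auto
  obtain m where m: "m \<in> S" "\<And>s. s \<in> S \<Longrightarrow> snd s - fst s \<le> snd m - fst m"
    using finite_maximizer[OF fin ne, of "\<lambda>s. snd s - fst s"] by blast
  obtain p q where pq: "m = (p, q)" by fastforce
  have p: "a < p" "p < b" "p < b'" "b < q" "b' < q" "q < a' + N" "edge (ch p q)"
    using m(1) by (auto simp: S_def pq)
  obtain x where x: "x \<in> {1..n}" "\<tau> x = ch p q"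
    using edge_label[of p q] p aa by auto
  have xIJ: "x \<in> ?I" "x \<in> ?J" using supp_crossed[of _ p _ q x] x p aa by auto
  have "edge (ch (q - N) p)" using p by (simp add: edge_sym)
  then obtain y where y: "q - N < y" "y < p" "edge (ch (q - N) y)" "edge (ch y p)"
    using third_vertex[of "q - N" p] p aa by auto
  have y': "edge (ch p (y + N))" "edge (ch y q)" using y by (simp_all add: chord_sym)
  consider "y < a'" | "a < y" | "a' \<le> y" "y < a" | "y = a" using aa by linarith
  then show False
  proof cases
    case 1
    then have "(p, y + N) \<in> S" using y y' p aa by (auto simp: S_def)
    then show False using m(2) y by (fastforce simp: pq)
  next
    case 2
    then have "(y, q) \<in> S" using y y' p aa by (auto simp: S_def)
    then show False using m(2) y by (fastforce simp: pq)
  next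
    case 3
    then obtain s where s: "s \<in> {1..n}" "\<tau> s = ch y p"
      using edge_label[of y p] y p aa by auto
    have "(s, x) \<in> Qv" using quiver_triangle(1)[of y p q s x] y' s x y p aa by auto
    moreover have "s \<in> ?I"
      using supp_crossed[of a p b "y + N" s] s y p aa 3 o by (auto simp: chord_sym)
    ultimately have "s \<in> ?J" using h xIJ unfolding thin_hom_def by blast
    then show False using supp_window[of a' b' s y p] s y p aa 3 o by auto
  next
    case 4
    then obtain s where s: "s \<in> {1..n}" "\<tau> s = ch q (y + N)"
      using edge_label[of q "y + N"] y p aa o by (auto simp: chord_sym)
    have "(x, s) \<in> Qv" using quiver_triangle(1)[of p q "y + N" x s] y' s x y p aa by auto
    moreover have "s \<in> ?J"
      using supp_crossed[of a' y b' q s] s y p aa 4 o by (auto simp: chord_sym)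
    ultimately have "s \<in> ?I" using h xIJ unfolding thin_hom_def by blast
    moreover have "\<tau> s = ch q a" using s 4 by simp
    ultimately show False using supp_window[of a b s q a] s y p aa 4 o by auto
  qed
qed

lemma thin_hom_order:
  assumes h: "thin_hom Qv (spp (ch a b)) (spp (ch a' b'))"
    and o: "a < c" "c < b" "b < d" "d < a + N" "a' < c" "c < b'" "b' < d" "d < a' + N"
    and z: "z \<in> {1..n}" "\<tau> z = ch c d"
  shows "a \<le> a'" "b \<le> b'"
proof -
  show "a \<le> a'" using thin_hom_left[OF h o z] .
  \<comment> \<open>Passing to the lifts \<open>(b, a + N)\<close> exchanges the roles of the ends,
    so the bound for \<open>b\<close> is an instance of the bound for \<open>a\<close>.\<close>
  have "thin_hom Qv (spp (ch b (a + N))) (spp (ch b' (a' + N)))"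
    using h by (simp add: chord_sym)
  moreover have "\<tau> z = ch d (c + N)" using z by (simp add: chord_sym)
  ultimately show "b \<le> b'"
    using thin_hom_left[of b "a + N" b' "a' + N" d "c + N"] o z by auto
qed

lemma common_lift:
  assumes "diagonal n \<gamma>" "z \<in> spp \<gamma>" "\<tau> z = ch c d" "c < d" "d < c + N"
  obtains a b where "\<gamma> = ch a b" "a < c" "c < b" "b < d" "d < a + N"
proof -
  obtain u v where g: "\<gamma> = ch u v" using diagonalE[OF assms(1)] by blast
  have "crosses (ch c d) (ch u v)" using assms g by (simp add: supp_def)
  then obtain b a where "c < b" "b < d" "d < a" "a < c + N" "ch u v = ch b a"
    using crosses_chord[of c d n u v] assms by auto
  then show ?thesis using that[of "a - N" b] g by (auto simp: chord_sym)
qed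

lemma free_diagonalD: "free \<gamma> \<Longrightarrow> diagonal n \<gamma>"
  by (simp add: free_diagonal_def)

text \<open>Normal position for a thin morphism: both ends move forward and one label crosses the
  whole rectangle. Together with \<open>thin_hom_forward\<close> this makes thin morphisms a matter
  of inequalities.\<close>

lemma thin_homE:
  assumes "free \<gamma>" "free \<delta>" "thin_hom Qv (spp \<gamma>) (spp \<delta>)"
  obtains a b a' b' c d z where "\<gamma> = ch a b" "\<delta> = ch a' b'" "a \<le> a'" "b \<le> b'" "a' < c" "c < b" "b' < d" "d < a + N"
    "z \<in> {1..n}" "\<tau> z = ch c d"
proof -
  obtain z where z: "z \<in> spp \<gamma>" "z \<in> spp \<delta>" using assms(3) unfolding thin_hom_def by blast
  then have z1: "z \<in> {1..n}" using supp_subset by blast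
  obtain c d where cd0: "\<tau> z = ch c d" "c + 2 \<le> d" "d \<le> c + int n + 1" by (rule T_chord[OF z1])
  then have cd: "\<tau> z = ch c d" "c < d" "d < c + N" by auto
  obtain a b where ab: "\<gamma> = ch a b" "a < c" "c < b" "b < d" "d < a + N"
    using common_lift[OF free_diagonalD[OF assms(1)] z(1) cd] by blast
  obtain a' b' where ab': "\<delta> = ch a' b'" "a' < c" "c < b'" "b' < d" "d < a' + N"
    using common_lift[OF free_diagonalD[OF assms(2)] z(2) cd] by blast
  have "a \<le> a'" "b \<le> b'"
    using thin_hom_order[OF assms(3)[unfolded ab(1) ab'(1)] ab(2-5) ab'(2-5) z1 cd(1)] by auto
  then show ?thesis using that ab ab' z1 cd by blast
qed

text \<open>Equal nonempty supports give thin morphisms in both directions, so the inequalities of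
  \<open>thin_hom_order\<close> hold both ways.\<close>

lemma supp_inj:
  assumes "free \<gamma>" "free \<delta>" "spp \<gamma> = spp \<delta>"
  shows "\<gamma> = \<delta>"
proof -
  have h: "thin_hom Qv (spp \<gamma>) (spp \<delta>)" "thin_hom Qv (spp \<delta>) (spp \<gamma>)"
    using assms free_iff unfolding thin_hom_def by auto
  from thin_homE[OF assms(1,2) h(1)] obtain a b a' b' c d z where
    o: "\<gamma> = ch a b" "\<delta> = ch a' b'" "a \<le> a'" "b \<le> b'" "a' < c" "c < b" "b' < d" "d < a + N"
    "z \<in> {1..n}" "\<tau> z = ch c d" by blast
  have "a' \<le> a" "b' \<le> b"
    using thin_hom_order[OF h(2)[unfolded o(1,2)], of c d z] o by auto
  then show ?thesis using o by auto
qed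

text \<open>Every member is nested in the longest one. As long as it differs from it, the triangle
  outside it has its third vertex between the two, and a further side of this triangle is a longer
  member adjacent in the quiver. Induction on the missing length connects everything to the longest
  member.\<close>

lemma crossing_connected:
  assumes o: "\<alpha> < \<beta>" "\<beta> \<le> \<beta>'" "\<omega> \<le> \<alpha> + N"
  shows "connected_in Qv {x \<in> {1..n}. \<exists>c d. \<alpha> < c \<and> c < \<beta> \<and> \<beta>' < d \<and> d < \<omega> \<and> \<tau> x = ch c d}"
    (is "connected_in Qv ?S")
proof (cases "?S = {}")
  case True
  show ?thesis unfolding True connected_in_def by simp
next
  case False
  define P where "P = {(c, d) \<in> {\<alpha><..<\<beta>} \<times> {\<beta>'<..<\<omega>}. edge (ch c d)}"
  have fin: "finite P" unfolding P_def by (rule finite_subset[of _ "{\<alpha><..<\<beta>} \<times> {\<beta>'<..<\<omega>}"]) auto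
  have PI: "(c, d) \<in> P" if "\<alpha> < c" "c < \<beta>" "\<beta>' < d" "d < \<omega>" "edge (ch c d)" for c d
    using that by (auto simp: P_def)
  have PD: "\<alpha> < c" "c < \<beta>" "\<beta>' < d" "d < \<omega>" "edge (ch c d)" if "(c, d) \<in> P" for c d
    using that by (auto simp: P_def)
  have lab: "\<exists>x. x \<in> ?S \<and> \<tau> x = ch c d" if "(c, d) \<in> P" for c d
  proof -
    note p = PD[OF that]
    obtain x where "x \<in> {1..n}" "\<tau> x = ch c d" using edge_label[of c d] p o by auto
    then show ?thesis using p by blast
  qed
  have inS: "\<exists>c d. (c, d) \<in> P \<and> \<tau> x = ch c d" if "x \<in> ?S" for x
    using that T_edge[of x] unfolding P_def by fastforce
  have "P \<noteq> {}" using False inS by blast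
  then obtain m where m: "m \<in> P" "\<And>s. s \<in> P \<Longrightarrow> snd s - fst s \<le> snd m - fst m"
    using finite_maximizer[OF fin, of "\<lambda>s. snd s - fst s"] by blast
  obtain c0 d0 where cd0: "m = (c0, d0)" by fastforce
  note p0 = PD[OF m(1)[unfolded cd0]]
  obtain x0 where x0: "x0 \<in> ?S" "\<tau> x0 = ch c0 d0" using lab m(1) cd0 by blast
  define R where "R = Restr (Qv \<union> Qv\<inverse>) ?S"
  have key: "(x, x0) \<in> R\<^sup>*" if "x \<in> ?S" "(c, d) \<in> P" "\<tau> x = ch c d" for x c d
    using that
  proof (induction "nat (d0 - c0 - (d - c))" arbitrary: x c d rule: less_induct)
    case less
    note p = PD[OF less.prems(2)]
    have le: "d - c \<le> d0 - c0" using m(2)[OF less.prems(2)] cd0 by simp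
    show ?case
    proof (cases "c = c0 \<and> d = d0")
      case True
      then have "x = x0" using label_inj[of x x0] less.prems x0 by auto
      then show ?thesis by simp
    next
      case False
      have cd: "c0 \<le> c" "d \<le> d0"
        using edge_nocross[OF p(5) p0(5)] edge_nocross[OF p0(5) p(5)] p p0 o le by force+
      have "edge (ch (d - N) c)" using p by (simp add: edge_sym)
      then obtain y where y: "d - N < y" "y < c" "edge (ch (d - N) y)" "edge (ch y c)"
        using third_vertex[of "d - N" c] p o cd p0 False by auto
      have y': "edge (ch c (y + N))" "edge (ch y d)" using y by (simp_all add: chord_sym)
      have "c0 \<le> y \<or> y \<le> d0 - N"
      proof (rule ccontr)
        assume "\<not> (c0 \<le> y \<or> y \<le> d0 - N)"
        then have yy: "y < c0" "d0 < y + N" by auto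
        show False
        proof (cases "c0 < c")
          case True
          then show False using edge_nocross[OF y(4) p0(5)] yy y p p0 cd o by auto
        next
          case False
          then have "d < d0" using cd \<open>\<not> (c = c0 \<and> d = d0)\<close> by auto
          then show False using edge_nocross[OF y'(2) p0(5)] yy y p p0 cd o by auto
        qed
      qed
      then have "\<exists>c' d'. (c', d') \<in> P \<and> d - c < d' - c' \<and>
          (\<forall>x'. x' \<in> {1..n} \<and> \<tau> x' = ch c' d' \<longrightarrow> (x, x') \<in> Qv \<union> Qv\<inverse>)"
      proof
        assume yc: "c0 \<le> y"
        have "(y, d) \<in> P" using PI[of y d] y y' yc p p0 by auto
        moreover have "(x', x) \<in> Qv \<or> (x, x') \<in> Qv" if "x' \<in> {1..n}" "\<tau> x' = ch y d" for x'
          using quiver_triangle(2)[of y c d x x'] that less.prems y p o by auto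
        ultimately show ?thesis using y by (intro exI[of _ y] exI[of _ d]) auto
      next
        assume yd: "y \<le> d0 - N"
        have "(c, y + N) \<in> P" using PI[of c "y + N"] y y' yd p p0 by auto
        moreover have "(x', x) \<in> Qv \<or> (x, x') \<in> Qv" if "x' \<in> {1..n}" "\<tau> x' = ch c (y + N)" for x'
        proof -
          have "edge (ch d (y + N))" using y(3) by (simp add: chord_sym)
          then show ?thesis using quiver_triangle(3)[of c d "y + N" x' x] that less.prems y p o by auto
        qed
        ultimately show ?thesis using y by (intro exI[of _ c] exI[of _ "y + N"]) auto
      qed
      then obtain c' d' where cd': "(c', d') \<in> P" "d - c < d' - c'"
        "\<And>x'. x' \<in> {1..n} \<Longrightarrow> \<tau> x' = ch c' d' \<Longrightarrow> (x, x') \<in> Qv \<union> Qv\<inverse>" by blast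
      obtain x' where x': "x' \<in> ?S" "\<tau> x' = ch c' d'" using lab[OF cd'(1)] by blast
      have "(x, x') \<in> R" using cd'(3) x' less.prems(1) by (auto simp: R_def)
      moreover have "d' - c' \<le> d0 - c0" using m(2)[OF cd'(1)] cd0 by simp
      then have "(x', x0) \<in> R\<^sup>*"
        using less.hyps[OF _ x'(1) cd'(1) x'(2)] cd'(2) by auto
      ultimately show ?thesis by (rule converse_rtrancl_into_rtrancl)
    qed
  qed
  have sym: "sym (R\<^sup>*)" unfolding R_def by (intro sym_rtrancl) (auto simp: sym_def)
  show ?thesis
    unfolding connected_in_def R_def[symmetric]
  proof (intro ballI)
    fix x y assume xy: "x \<in> ?S" "y \<in> ?S"
    have "(x, x0) \<in> R\<^sup>*" "(y, x0) \<in> R\<^sup>*" using key inS[OF xy(1)] inS[OF xy(2)] xy by blast+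
    then show "(x, y) \<in> R\<^sup>*" using sym by (meson rtrancl_trans symD)
  qed
qed

lemma supp_connected:
  assumes "free \<gamma>"
  shows "connected_in Qv (spp \<gamma>)"
proof -
  obtain a b where g: "\<gamma> = ch a b" "a + 2 \<le> b" "b \<le> a + int n + 1" by (rule free_chordE[OF assms])
  have "spp \<gamma> = {x \<in> {1..n}. \<exists>c d. a < c \<and> c < b \<and> b < d \<and> d < a + N \<and> \<tau> x = ch c d}"
    using supp_chord[of a b] g by auto
  then show ?thesis using crossing_connected[of a b b "a + N"] g by simp
qed

end

section \<open>Fans, and the two sides of a diagonal of the triangulation\<close>

lemma (in labelled_tri) label_diagonal: "x \<in> {1..n} \<Longrightarrow> diagonal n (\<tau> x)"
  by (rule T_diagonal) simp

text \<open>Excludes triangles with all three sides in \<open>T\<close>, since these give oriented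
  3-cycles. As a consequence, a path in the quiver turns about a single polygon vertex.\<close>

locale cycle_free_tri = labelled_tri +
  assumes no_3cycle: "(x, y) \<in> Qv \<Longrightarrow> (y, z) \<in> Qv \<Longrightarrow> (z, x) \<notin> Qv"
begin

text \<open>An arrow from \<open>ch a b\<close> to \<open>ch b c\<close> turns about
  \<open>b\<close>. The next arrow either keeps \<open>b\<close> or goes on to the third side of the
  same triangle, and the latter closes a 3-cycle. So \<open>b\<close> is kept along the whole
  path.\<close>

lemma path_vertex:
  assumes "(x, z) \<in> Qv\<^sup>+"
  shows "\<exists>v. v \<in> \<tau> x \<and> v \<in> \<tau> z"
proof -
  have "\<exists>y a b c. (y, z) \<in> Qv \<and> a < b \<and> b < c \<and> c < a + N \<and> edge (ch a c) \<and>
      \<tau> y = ch a b \<and> \<tau> z = ch b c \<and> pvert n b \<in> \<tau> x"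
    using assms
  proof (induction rule: trancl_induct)
    case (base z)
    then obtain a b c where "a < b" "b < c" "c < a + N" "edge (ch a c)" "\<tau> x = ch a b" "\<tau> z = ch b c"
      using quiver_iff by blast
    then show ?case using base unfolding chord_def by blast
  next
    case (step z w)
    then obtain y a b c where y: "(y, z) \<in> Qv" and o: "a < b" "b < c" "c < a + N" and e: "edge (ch a c)"
      "\<tau> y = ch a b" "\<tau> z = ch b c" "pvert n b \<in> \<tau> x" by blast
    have r: "w \<in> {1..n}" "y \<in> {1..n}" "z \<in> {1..n}" using quiver_ranges step.hyps(2) y by blast+
    show ?case
    proof (rule quiver_out[OF step.hyps(2) e(3)])
      show "b < c" "c < b + N" using o by auto
    next
      fix s assume s: "c < s" "s < b + N" "edge (ch b s)" "\<tau> w = ch c s"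
      have ec: "edge (ch c (a + N))" using e(1) by (simp add: chord_sym)
      have eb: "edge (ch b (a + N))" using T_edge[OF r(2)] e(2) by (simp add: chord_sym)
      have ew: "edge (ch c s)" using T_edge[OF r(1)] s(4) by simp
      have "s = a + N"
      proof (rule ccontr)
        assume "s \<noteq> a + N"
        then consider "s < a + N" | "a + N < s" by linarith
        then show False
        proof cases
          case 1
          then show False using edge_nocross[OF s(3) ec] s o by auto
        next
          case 2
          then show False using edge_nocross[OF eb ew] s o by auto
        qed
      qed
      then have "\<tau> w = ch a c" using s(4) by (simp add: chord_sym)
      moreover have "edge (ch b c)" using T_edge[OF r(3)] e(3) by simp
      ultimately have "(w, y) \<in> Qv" using quiver_triangle(3)[of a b c w y] e o r by auto
      then show ?thesis using no_3cycle y step.hyps(2) by blast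
    next
      fix s assume s: "b < s" "s < c" "edge (ch s c)" "\<tau> w = ch b s"
      have "edge (ch (c - N) s)" "\<tau> z = ch (c - N) b" using s e by (simp_all add: chord_sym)
      moreover have "c - N < b" "b < s" "s < (c - N) + N" using s o by auto
      ultimately show ?thesis using step.hyps(2) s e by blast
    qed
  qed
  then show ?thesis unfolding chord_def by blast
qed

text \<open>Successive diagonals at \<open>e\<close> bound triangles with apex \<open>e\<close>, and
  each such triangle has an arrow towards the diagonal with the earlier end. Hence a fan is linearly
  ordered, with its peak at the earliest end.\<close>

lemma fan_path:
  assumes "x \<in> {1..n}" "y \<in> {1..n}" "\<tau> x = ch e f" "\<tau> y = ch e g" "e < f" "f < g" "g < e + N"
  shows "(y, x) \<in> Qv\<^sup>+"
  using assms
proof (induction "nat (g - f)" arbitrary: x f rule: less_induct)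
  case less
  have "edge (ch f (e + N))" using T_edge[OF less.prems(1)] less.prems by (simp add: chord_sym)
  moreover have gf: "e + 2 \<le> f" "g \<le> e + int n + 1"
    using diagonal_chord[of e f n] diagonal_chord[of e g n] label_diagonal[OF less.prems(1)]
      label_diagonal[OF less.prems(2)] less.prems by auto
  ultimately obtain z where z: "f < z" "z < e + N" "edge (ch f z)" "edge (ch z (e + N))"
    using third_vertex[of f "e + N"] less.prems by auto
  have "z \<le> g"
  proof (rule ccontr)
    assume "\<not> z \<le> g"
    moreover have "edge (ch g (e + N))" using T_edge[OF less.prems(2)] less.prems by (simp add: chord_sym)
    ultimately show False using edge_nocross[OF z(3), of g "e + N"] less.prems z by auto
  qed
  then have "edge (ch e z)" "e + 2 \<le> z" "z \<le> e + int n + 1"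
    using z gf less.prems by (auto simp: chord_sym)
  then obtain w where w: "w \<in> {1..n}" "\<tau> w = ch e z" using edge_label by blast
  have q: "(w, x) \<in> Qv" using quiver_triangle(3)[of e f z w x] w z less.prems by auto
  show ?case
  proof (cases "z = g")
    case True
    then have "w = y" using label_inj[of w y] w less.prems by auto
    then show ?thesis using q by auto
  next
    case False
    then have "(y, w) \<in> Qv\<^sup>+" using less.hyps[of z w] w z less.prems \<open>z \<le> g\<close> by auto
    then show ?thesis using q by auto
  qed
qed

lemma chord_at_vertex:
  assumes "x \<in> {1..n}" "pvert n e \<in> \<tau> x"
  obtains f where "\<tau> x = ch e f" "e + 2 \<le> f" "f \<le> e + int n + 1"
proof -
  obtain a b where ab: "\<tau> x = ch a b" "a + 2 \<le> b" "b \<le> a + int n + 1" by (rule T_chord[OF assms(1)])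
  have "\<exists>v. \<tau> x = {pvert n e, v} \<and> v < n + 3"
    using assms(2) ab(1) unfolding chord_def by (auto simp: insert_commute pvert_less)
  then obtain v where v: "\<tau> x = {pvert n e, v}" "v < n + 3" by blast
  obtain f where f: "e \<le> f" "f < e + N" "pvert n f = v" by (rule pvert_window[OF v(2)])
  have c: "\<tau> x = ch e f" using v f by (simp add: chord_def)
  have "e \<noteq> f"
  proof
    assume "e = f"
    then have "pvert n a = pvert n b" using c ab by (auto simp: chord_def doubleton_eq_iff)
    then show False using pvert_inj[of n a b] ab by auto
  qed
  then have "e + 2 \<le> f \<and> f \<le> e + int n + 1"
    using diagonal_chord[of e f n] label_diagonal[OF assms(1)] c f by auto
  then show ?thesis using that c by auto
qed

text \<open>An arrow leaving the peak either stays in the fan, against maximality, or turns about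
  the other end \<open>g\<close>. In the latter case a second member of the fan lies beyond, which
  forces the third side of the triangle into \<open>T\<close> and produces a 3-cycle. This is where
  a fan must have two members.\<close>

lemma peak_sink:
  assumes S: "fan n \<tau> S" and p: "is_peak n \<tau> Qv S y"
  shows "is_sink n Qv y" "\<And>x. x \<in> {1..n} \<Longrightarrow> \<tau> x \<in> S \<Longrightarrow> (x, y) \<in> Qv\<^sup>*"
proof -
  obtain v where v: "v < n + 3" "S = {d \<in> T. v \<in> d}" and card: "2 \<le> card S"
    using S unfolding fan_def by blast
  have y: "y \<in> {1..n}" "\<tau> y \<in> S" and pk: "\<And>x. x \<in> {1..n} \<Longrightarrow> \<tau> x \<in> S \<Longrightarrow> (y, x) \<notin> Qv\<^sup>+"
    using p unfolding is_peak_def by blast+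
  define e where "e = int v"
  have e: "pvert n e = v" using v by (simp add: e_def pvert_int)
  have at: "\<exists>f. \<tau> x = ch e f \<and> e + 2 \<le> f \<and> f \<le> e + int n + 1" if "x \<in> {1..n}" "\<tau> x \<in> S" for x
  proof -
    have "pvert n e \<in> \<tau> x" using that(2) v e by blast
    then show ?thesis using chord_at_vertex[OF that(1)] by metis
  qed
  obtain g where g: "\<tau> y = ch e g" "e + 2 \<le> g" "g \<le> e + int n + 1" using at y by blast
  have later: "x = y \<or> (x, y) \<in> Qv\<^sup>+ \<and> (\<exists>f. \<tau> x = ch e f \<and> g < f \<and> f \<le> e + int n + 1)"
    if x: "x \<in> {1..n}" "\<tau> x \<in> S" for x
  proof -
    obtain f where f: "\<tau> x = ch e f" "e + 2 \<le> f" "f \<le> e + int n + 1" using at x by blast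
    consider "f < g" | "f = g" | "g < f" by linarith
    then show ?thesis
    proof cases
      case 1
      then show ?thesis using fan_path[of x y e f g] pk x y f g by auto
    next
      case 2
      then show ?thesis using label_inj[of x y] x y f g by auto
    next
      case 3
      then show ?thesis using fan_path[of y x e g f] x y f g by auto
    qed
  qed
  show "\<And>x. x \<in> {1..n} \<Longrightarrow> \<tau> x \<in> S \<Longrightarrow> (x, y) \<in> Qv\<^sup>*"
    using later by (metis rtrancl.rtrancl_refl trancl_into_rtrancl)
  have "S \<noteq> {\<tau> y}" using card by auto
  then obtain x where x: "x \<in> {1..n}" "\<tau> x \<in> S" "x \<noteq> y" using y v by blast
  then obtain f where f: "\<tau> x = ch e f" "g < f" "f \<le> e + int n + 1" using later by blast
  have "(y, w) \<notin> Qv" for w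
  proof
    assume w: "(y, w) \<in> Qv"
    have w1: "w \<in> {1..n}" using w quiver_ranges by blast
    show False
    proof (rule quiver_out[OF w g(1)])
      fix r assume r: "g < r" "r < e + N" "edge (ch e r)" "\<tau> w = ch g r"
      have "r \<le> f"
        using edge_nocross[of e f g r] T_edge[OF x(1)] T_edge[OF w1] r f g by (cases "r \<le> f") auto
      then obtain u where u: "u \<in> {1..n}" "\<tau> u = ch e r" using edge_label[OF r(3)] r f g by auto
      have "(w, u) \<in> Qv" using quiver_triangle(2)[of e g r w u] T_edge[OF y(1)] w1 u r g by auto
      moreover have "(u, y) \<in> Qv" using quiver_triangle(3)[of e g r u y] T_edge[OF w1] y u r g by auto
      ultimately show False using no_3cycle w by blast
    next
      fix r assume r: "e < r" "r < g" "edge (ch r g)" "\<tau> w = ch e r"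
      then have "\<tau> w \<in> S" using v w1 e by (auto simp: chord_def)
      then show False using pk w1 w by blast
    qed (use g in auto)
  qed
  then show "is_sink n Qv y" using y by (simp add: is_sink_def)
qed

text \<open>The two ends of a path share a polygon vertex, and the fan consists of all members of
  \<open>T\<close> at that vertex. A sink is its peak because no arrow leaves it.\<close>

lemma sink_fan:
  assumes z: "is_sink n Qv z" and x: "(x, z) \<in> Qv\<^sup>+"
  shows "\<exists>S. fan n \<tau> S \<and> \<tau> x \<in> S \<and> \<tau> z \<in> S \<and> is_peak n \<tau> Qv S z"
proof -
  have zr: "z \<in> {1..n}" and zs: "\<And>y. (z, y) \<notin> Qv" using z by (auto simp: is_sink_def)
  have xr: "x \<in> {1..n}" using tranclD[OF x] quiver_ranges by blast
  have "x \<noteq> z" using x zs by (meson converse_tranclE)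
  then have ne: "\<tau> x \<noteq> \<tau> z" using label_inj xr zr by blast
  obtain v where v: "v \<in> \<tau> x" "v \<in> \<tau> z" using path_vertex[OF x] by blast
  define S where "S = {d \<in> T. v \<in> d}"
  have "v < n + 3"
    using T_chord[OF xr] v by (metis chord_def insertE pvert_less singletonD)
  moreover have "{\<tau> x, \<tau> z} \<subseteq> S" using v xr zr by (auto simp: S_def)
  moreover have "finite S" by (auto simp: S_def)
  ultimately have "fan n \<tau> S"
    using ne card_mono[of S "{\<tau> x, \<tau> z}"] unfolding fan_def S_def by auto
  moreover have "is_peak n \<tau> Qv S z"
    unfolding is_peak_def using zr zs v by (auto simp: S_def dest: tranclD)
  ultimately show ?thesis using \<open>{\<tau> x, \<tau> z} \<subseteq> S\<close> by blast
qed

end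

context labelled_tri
begin

text \<open>The labels of the diagonals on the side of \<open>ch c d\<close> containing the arc from \<open>d - N\<close> to \<open>c\<close>.\<close>

definition side :: "int \<Rightarrow> int \<Rightarrow> nat set" where
  "side c d = {x \<in> {1..n}. \<exists>e f. d - N \<le> e \<and> e < f \<and> f \<le> c \<and> \<tau> x = ch e f} - {x. \<tau> x = ch c d}"

lemma sideE:
  assumes "x \<in> side c d"
  obtains e f where "d - N \<le> e" "e < f" "f \<le> c" "\<tau> x = ch e f" "x \<in> {1..n}" "\<tau> x \<noteq> ch c d"
  using assms unfolding side_def by blast

lemma side_otherE:
  assumes "x \<in> side d (c + N)"
  obtains e f where "c \<le> e" "e < f" "f \<le> d" "\<tau> x = ch e f" "x \<in> {1..n}" "\<tau> x \<noteq> ch c d"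
proof -
  obtain e f where "c + N - N \<le> e" "e < f" "f \<le> d" "\<tau> x = ch e f" "x \<in> {1..n}" "\<tau> x \<noteq> ch d (c + N)"
    using assms by (rule sideE)
  then show ?thesis using that[of e f] chord_rot[of n d c] by (metis add_diff_cancel_right')
qed

lemma side_cases:
  assumes "t \<in> {1..n}" "\<tau> t = ch c d" "c < d" "d < c + N" "x \<in> {1..n}" "x \<noteq> t"
  shows "x \<in> side c d \<or> x \<in> side d (c + N)"
proof -
  obtain u v where uv: "\<tau> x = ch u v" "u + 2 \<le> v" "v \<le> u + int n + 1" by (rule T_chord[OF assms(5)])
  obtain a b where ab: "\<tau> x = ch a b" "c \<le> a" "a < b" "b < c + N"
  proof -
    obtain p where p: "c \<le> p" "p < c + N" "pvert n p = pvert n u" by (rule pvert_window[OF pvert_less])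
    obtain q where q: "c \<le> q" "q < c + N" "pvert n q = pvert n v" by (rule pvert_window[OF pvert_less])
    have "p \<noteq> q" using p q pvert_inj[of n u v] uv by auto
    moreover have "\<tau> x = ch p q" using uv p q by (simp add: chord_def)
    moreover have "\<tau> x = ch q p" using calculation(2) chord_sym[of n p q] by simp
    ultimately show ?thesis using that[of p q] that[of q p] p q by (cases "p < q") auto
  qed
  have ne: "\<tau> x \<noteq> ch c d" "\<tau> x \<noteq> ch d c" using assms label_inj[of x t] by (auto simp: chord_sym)
  have "\<not> (c < a \<and> a < d \<and> d < b)"
    using T_separated[OF assms(1,5,2) ab(1)] ab by auto
  then consider "b \<le> d" | "d \<le> a" | "a = c" "d < b" using ab by linarith
  then show ?thesis
  proof cases
    case 1
    have "c \<le> a \<and> a < b \<and> b \<le> d \<and> \<tau> x = ch a b" using ab 1 by auto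
    then have "c + N - N \<le> a \<and> a < b \<and> b \<le> d \<and> \<tau> x = ch a b" "\<tau> x \<noteq> ch d (c + N)"
      using ne by simp_all
    then show ?thesis using assms(5) unfolding side_def by blast
  next
    case 2
    have "d - N \<le> a - N \<and> a - N < b - N \<and> b - N \<le> c \<and> \<tau> x = ch (a - N) (b - N)" using ab 2 by auto
    then show ?thesis using assms(5) ne unfolding side_def by blast
  next
    case 3
    have "d - N \<le> b - N \<and> b - N < a \<and> a \<le> c \<and> \<tau> x = ch (b - N) a" using ab 3 chord_sym[of n b a] by auto
    then show ?thesis using assms(5) ne unfolding side_def by blast
  qed
qed

text \<open>Both ends of \<open>\<tau> x\<close> lie on the closed arc from \<open>d - N\<close> to
  \<open>c\<close>, and \<open>b\<close>, \<open>b'\<close> lie off that arc. So whether it is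
  crossed depends on \<open>a\<close> alone.\<close>

lemma supp_side:
  assumes "x \<in> side c d" "d - N < a" "a < c" "c < b" "b < d" "c < b'" "b' < d"
  shows "x \<in> spp (ch a b) \<longleftrightarrow> x \<in> spp (ch a b')"
proof -
  obtain e f where ef: "d - N \<le> e" "e < f" "f \<le> c" "\<tau> x = ch e f" and x: "x \<in> {1..n}"
    using assms(1) by (auto simp: side_def)
  have "x \<in> spp (ch a \<beta>) \<longleftrightarrow> e < a \<and> a < f" if "c < \<beta>" "\<beta> < d" for \<beta>
  proof (cases "a \<le> e")
    case True
    then show ?thesis using supp_window[of a \<beta> x e f] ef x that assms by auto
  next
    case e: False
    show ?thesis
    proof (cases "a \<le> f")
      case True
      have "\<tau> x = ch (e + N) f" using ef by simp
      then show ?thesis using supp_window[of a \<beta> x "e + N" f] e True ef x that assms by auto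
    next
      case False
      have "\<tau> x = ch (e + N) (f + N)" using ef by simp
      then show ?thesis using supp_window[of a \<beta> x "e + N" "f + N"] e False ef x that assms by auto
    qed
  qed
  then show ?thesis using assms by auto
qed

text \<open>Adjacent labels share a vertex, and the third side of their triangle is an edge. If they
  lay on different sides, the shared vertex would be an end of \<open>ch c d\<close>, and the third
  side would cross \<open>ch c d\<close>.\<close>

lemma side_adjacent_aux:
  assumes "t \<in> {1..n}" "\<tau> t = ch c d" "c < d" "d < c + N"
    "x \<in> side c d" "y \<in> side d (c + N)" and xy: "(x, y) \<in> Qv \<or> (y, x) \<in> Qv"
  shows False
proof -
  obtain e f where ef: "d - N \<le> e" "e < f" "f \<le> c" "\<tau> x = ch e f" and x: "x \<in> {1..n}" "\<tau> x \<noteq> ch c d"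
    using assms(5) by (rule sideE)
  have efc: "\<not> (e = d - N \<and> f = c)" using ef(4) x chord_sym[of n d c] by auto
  obtain e' f' where ef': "c \<le> e'" "e' < f'" "f' \<le> d" "\<tau> y = ch e' f'" and y: "y \<in> {1..n}" "\<tau> y \<noteq> ch c d"
    using assms(6) by (rule side_otherE)
  have et: "edge (ch c d)" using T_edge assms by metis
  have eN: "f < e + N" using ef assms by auto
  have no: "\<not> edge (ch p q)" if "d - N < p" "p < c" "c < q" "q < d" for p q
    using edge_nocross[of p q c d] et that by auto
  have off: "pvert n s \<notin> \<tau> y" if "d - N < s" "s < c" for s
  proof
    assume "pvert n s \<in> \<tau> y"
    then have "pvert n s = pvert n e' \<or> pvert n s = pvert n f'" using ef' by (auto simp: chord_def)
    then show False using pvert_inj[of n s e'] pvert_inj[of n s f'] ef' that by auto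
  qed
  have key: False if tw: "\<tau> y = ch q r" "q = e \<and> q' = f \<or> q = f \<and> q' = e" "e < r" "r < e + N" "r \<noteq> f" "edge (ch q' r)" for q q' r
  proof -
    have q: "q = d - N \<or> q = c"
    proof (rule ccontr)
      assume "\<not> ?thesis"
      then have "d - N < q" "q < c" using tw(2) ef(1-3) by auto
      then show False using off[of q] tw(1) by (simp add: chord_def)
    qed
    have r1: "c \<le> r \<and> r \<le> d"
    proof -
      have "\<not> r < c" using off[of r] tw ef by (auto simp: chord_def)
      moreover have "\<not> d < r" using off[of "r - N"] tw ef by (auto simp: chord_def)
      ultimately show ?thesis by simp
    qed
    have "r \<noteq> c"
    proof
      assume "r = c"
      then have "q = d - N" using q tw ef by auto
      then show False using tw(1) y(2) \<open>r = c\<close> chord_sym[of n d c] by simp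
    qed
    moreover have "r \<noteq> d"
    proof
      assume "r = d"
      then have "q = c" using q tw ef by auto
      then show False using tw(1) y \<open>r = d\<close> by simp
    qed
    ultimately have "c < r" "r < d" using r1 by auto
    then show False using no[of q' r] tw q efc ef by auto
  qed
  from xy show False
  proof
    assume "(x, y) \<in> Qv"
    then show False
    proof (rule quiver_out[OF _ ef(4,2) eN])
      fix r assume "f < r" "r < e + N" "edge (ch e r)" "\<tau> y = ch f r"
      then show False using key[of f r e] ef by auto
    next
      fix r assume "e < r" "r < f" "edge (ch r f)" "\<tau> y = ch e r"
      then show False using key[of e r f] eN edge_sym[of r f] by auto
    qed
  next
    assume "(y, x) \<in> Qv"
    then show False
    proof (rule quiver_in[OF _ ef(4,2) eN])
      fix r assume "f < r" "r < e + N" "edge (ch f r)" "\<tau> y = ch e r"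
      then show False using key[of e r f] ef by auto
    next
      fix r assume "e < r" "r < f" "edge (ch e r)" "\<tau> y = ch r f"
      then show False using key[of f r e] eN chord_sym[of n r f] by auto
    qed
  qed
qed

lemma side_adjacent:
  assumes "t \<in> {1..n}" "\<tau> t = ch c d" "c < d" "d < c + N" "x \<noteq> t" "y \<noteq> t"
    "(x, y) \<in> Qv \<or> (y, x) \<in> Qv" "x \<in> side c d"
  shows "y \<in> side c d"
proof (rule ccontr)
  assume "y \<notin> side c d"
  moreover have "y \<in> {1..n}" using assms quiver_ranges by blast
  ultimately have "y \<in> side d (c + N)" using side_cases assms by blast
  then show False using side_adjacent_aux assms by blast
qed

end

section \<open>Combinatorics of sp-intervals on the line\<close>

section \<open>Intervals of a linearly ordered quiver with alien arrows\<close>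

text \<open>Here \<open>rt h\<close> means that the arrow between the positions \<open>h\<close> and
  \<open>h + 1\<close> points to the right. A directed path on a line is monotone, so all arrows
  between its ends must agree.\<close>

definition reach_pos :: "(nat \<Rightarrow> bool) \<Rightarrow> nat \<Rightarrow> nat \<Rightarrow> bool" where
  "reach_pos rt i j \<longleftrightarrow> i \<le> j \<and> (\<forall>h. i \<le> h \<and> h < j \<longrightarrow> rt h) \<or> j \<le> i \<and> (\<forall>h. j \<le> h \<and> h < i \<longrightarrow> \<not> rt h)"

definition sink_pos :: "nat \<Rightarrow> (nat \<Rightarrow> bool) \<Rightarrow> nat \<Rightarrow> bool" where
  "sink_pos n rt z \<longleftrightarrow> (0 < z \<longrightarrow> rt (z - 1)) \<and> (Suc z < n \<longrightarrow> \<not> rt z)"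

text \<open>The excluded cycles run through one alien arrow or alternate between two of them, with
  paths of the line in between. For the actual alien arrows this comes from acyclicity of
  \<open>Q \<union> F\<close>.\<close>

locale alien_positions =
  fixes n :: nat and rt :: "nat \<Rightarrow> bool" and A :: "nat \<Rightarrow> nat \<Rightarrow> bool"
  assumes no_2cycle: "A s t \<Longrightarrow> \<not> reach_pos rt t s"
    and no_4cycle: "A s t \<Longrightarrow> A s' t' \<Longrightarrow> reach_pos rt t' s \<Longrightarrow> \<not> reach_pos rt t s'"
begin

abbreviation "R \<equiv> reach_pos rt"
abbreviation "snk \<equiv> sink_pos n rt"

definition spI :: "nat \<Rightarrow> nat \<Rightarrow> bool" where
  "spI l r \<longleftrightarrow> l \<le> r \<and> r < n \<and> (\<forall>i\<in>{l..r}. \<exists>z\<in>{l..r}. snk z \<and> R i z) \<and>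
     (\<forall>s t z. A s t \<and> snk z \<and> R s z \<and> R t z \<and> s \<in> {l..r} \<and> z \<in> {l..r} \<longrightarrow> t \<in> {l..r})"

text \<open>This is \<open>thin_hom\<close> for two intervals: the arrow across an end points into
  the first interval where only the second one continues, and out of the second interval where only
  the first one continues.\<close>

definition homI :: "nat \<Rightarrow> nat \<Rightarrow> nat \<Rightarrow> nat \<Rightarrow> bool" where
  "homI l r l' r' \<longleftrightarrow> l \<le> r' \<and> l' \<le> r \<and> (l < l' \<longrightarrow> \<not> rt (l' - 1)) \<and> (l' < l \<longrightarrow> rt (l - 1)) \<and>
     (r < r' \<longrightarrow> \<not> rt r) \<and> (r' < r \<longrightarrow> rt r')"

lemma R_right: "R i j \<Longrightarrow> i \<le> h \<Longrightarrow> h < j \<Longrightarrow> rt h"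
  and R_left: "R i j \<Longrightarrow> j \<le> h \<Longrightarrow> h < i \<Longrightarrow> \<not> rt h"
  unfolding reach_pos_def by auto

lemma snk_right: "snk z \<Longrightarrow> Suc z < n \<Longrightarrow> \<not> rt z"
  and snk_left: "snk z \<Longrightarrow> h < z \<Longrightarrow> Suc h = z \<Longrightarrow> rt h"
  unfolding sink_pos_def by auto

lemma spI_sink:
  assumes "spI l r" "l \<le> i" "i \<le> r"
  obtains z where "l \<le> z" "z \<le> r" "snk z" "R i z"
  using assms unfolding spI_def by (metis atLeastAtMost_iff)

lemma spI_closed:
  assumes "spI l r" "A s t" "snk z" "R s z" "R t z" "l \<le> s" "s \<le> r" "l \<le> z" "z \<le> r"
  shows "l \<le> t \<and> t \<le> r"
proof -
  have "\<forall>s t z. A s t \<and> snk z \<and> R s z \<and> R t z \<and> s \<in> {l..r} \<and> z \<in> {l..r} \<longrightarrow> t \<in> {l..r}"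
    using assms(1) unfolding spI_def by (elim conjE)
  then have "A s t \<and> snk z \<and> R s z \<and> R t z \<and> s \<in> {l..r} \<and> z \<in> {l..r} \<longrightarrow> t \<in> {l..r}" by blast
  then show ?thesis using assms by auto
qed

lemma spI_I:
  assumes "l \<le> r" "r < n" "\<And>i. l \<le> i \<Longrightarrow> i \<le> r \<Longrightarrow> \<exists>z\<ge>l. z \<le> r \<and> snk z \<and> R i z"
    "\<And>s t z. A s t \<Longrightarrow> snk z \<Longrightarrow> R s z \<Longrightarrow> R t z \<Longrightarrow> l \<le> s \<Longrightarrow> s \<le> r \<Longrightarrow> l \<le> z \<Longrightarrow> z \<le> r \<Longrightarrow> l \<le> t \<and> t \<le> r"
  shows "spI l r"
  unfolding spI_def
proof (intro conjI ballI allI impI)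
  fix i assume "i \<in> {l..r}"
  then show "\<exists>z\<in>{l..r}. snk z \<and> R i z" using assms(3)[of i] by auto
next
  fix s t z assume "A s t \<and> snk z \<and> R s z \<and> R t z \<and> s \<in> {l..r} \<and> z \<in> {l..r}"
  then show "t \<in> {l..r}" using assms(4)[of s t z] by auto
qed (use assms in auto)

lemma not_spI:
  assumes "\<not> spI l r" "l \<le> r" "r < n" "\<And>i. l \<le> i \<Longrightarrow> i \<le> r \<Longrightarrow> \<exists>z\<ge>l. z \<le> r \<and> snk z \<and> R i z"
  obtains s t z where "A s t" "snk z" "R s z" "R t z" "l \<le> s" "s \<le> r" "l \<le> z" "z \<le> r" "t < l \<or> r < t"
proof -
  have "\<exists>s t z. A s t \<and> snk z \<and> R s z \<and> R t z \<and> l \<le> s \<and> s \<le> r \<and> l \<le> z \<and> z \<le> r \<and> (t < l \<or> r < t)" (is ?E)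
  proof (rule ccontr)
    assume neg: "\<not> ?E"
    have "spI l r"
    proof (rule spI_I)
      fix s t z
      assume a: "A s t" "snk z" "R s z" "R t z" "l \<le> s" "s \<le> r" "l \<le> z" "z \<le> r"
      show "l \<le> t \<and> t \<le> r"
      proof (rule ccontr)
        assume "\<not> ?thesis"
        then have "t < l \<or> r < t" by linarith
        then show False using neg a by blast
      qed
    next
      fix i assume "l \<le> i" "i \<le> r"
      then show "\<exists>z\<ge>l. z \<le> r \<and> snk z \<and> R i z" by (rule assms(4))
    qed (use assms in auto)
    then show False using assms by simp
  qed
  then show ?thesis using that by blast
qed

text \<open>If neither mixed interval is socle-projective, then the first interval is contained in the second
  one, and shrinking the second one up to the violation nearest to the first interval, on one of the
  two sides, gives an intermediate interval.\<close>

lemma mixed_intermediate: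
  assumes I: "spI l r" and J: "spI l' r'" and h: "homI l r l' r'"
    and n1: "\<not> spI l' r" and n2: "\<not> spI l r'"
  obtains p q where "spI p q" "homI l r p q" "homI p q l' r'" "p \<noteq> l \<or> q \<noteq> r" "p \<noteq> l' \<or> q \<noteq> r'"
    "p \<le> l" "r \<le> q"
proof -
  have o: "l \<le> r'" "l' \<le> r" and h1: "l < l' \<Longrightarrow> \<not> rt (l' - 1)" and h2: "l' < l \<Longrightarrow> rt (l - 1)"
    and h3: "r < r' \<Longrightarrow> \<not> rt r" and h4: "r' < r \<Longrightarrow> rt r'"
    using h unfolding homI_def by auto
  have bd: "l \<le> r" "r < n" "l' \<le> r'" "r' < n" using I J unfolding spI_def by auto
  \<comment> \<open>In both mixed intervals every vertex reaches a sink inside: the sink provided by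
    one of the given intervals cannot lie beyond the cut, because the arrow prescribed by
    \<open>homI\<close> blocks the path. So only closure under alien arrows can fail.\<close>
  have i1: "\<exists>z\<ge>l'. z \<le> r \<and> snk z \<and> R x z" if x: "l' \<le> x" "x \<le> r" for x
  proof (cases "x \<le> r'")
    case True
    obtain z where z: "l' \<le> z" "z \<le> r'" "snk z" "R x z" using spI_sink[OF J x(1) True] by blast
    have "z \<le> r"
    proof (rule ccontr)
      assume "\<not> z \<le> r"
      then show False using R_right[OF z(4), of r] h3 x z by auto
    qed
    then show ?thesis using z by auto
  next
    case False
    then obtain z where z: "l \<le> z" "z \<le> r" "snk z" "R x z" using spI_sink[OF I _ x(2)] o by force
    have "l' \<le> z"
    proof (rule ccontr)
      assume "\<not> l' \<le> z"
      then show False using R_left[OF z(4), of r'] h4 x z False bd by auto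
    qed
    then show ?thesis using z by auto
  qed
  have i2: "\<exists>z\<ge>l. z \<le> r' \<and> snk z \<and> R x z" if x: "l \<le> x" "x \<le> r'" for x
  proof (cases "l' \<le> x")
    case True
    obtain z where z: "l' \<le> z" "z \<le> r'" "snk z" "R x z" using spI_sink[OF J True x(2)] by blast
    have "l \<le> z"
    proof (rule ccontr)
      assume "\<not> l \<le> z"
      then show False using R_left[OF z(4), of "l - 1"] h2 x z by auto
    qed
    then show ?thesis using z by auto
  next
    case False
    then obtain z where z: "l \<le> z" "z \<le> r" "snk z" "R x z" using spI_sink[OF I x(1)] o by force
    have "z \<le> r'"
    proof (rule ccontr)
      assume "\<not> z \<le> r'"
      then show False using R_right[OF z(4), of "l' - 1"] h1 x z False bd by auto
    qed
    then show ?thesis using z by auto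
  qed
  obtain s t z where v1: "A s t" "snk z" "R s z" "R t z" "l' \<le> s" "s \<le> r" "l' \<le> z" "z \<le> r" "t < l' \<or> r < t"
    using not_spI[OF n1 o(2) bd(2) i1] by blast
  obtain s' t' z' where v2: "A s' t'" "snk z'" "R s' z'" "R t' z'" "l \<le> s'" "s' \<le> r'" "l \<le> z'" "z' \<le> r'"
      "t' < l \<or> r' < t'"
    using not_spI[OF n2 o(1) bd(4) i2] by blast
  \<comment> \<open>Each given interval is closed under alien arrows, so the target of a violation
    lies in the part of one of them that was cut off.\<close>
  have c1: "r < t \<and> t \<le> r' \<or> l \<le> t \<and> t < l'"
  proof -
    consider "s \<le> r'" "z \<le> r'" | "l \<le> s" "l \<le> z" | "r' < s" "z < l" | "r' < z" "s < l" by linarith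
    then show ?thesis
    proof cases
      case 1
      then show ?thesis using spI_closed[OF J v1(1-4)] v1 by auto
    next
      case 2
      then show ?thesis using spI_closed[OF I v1(1-4)] v1 by auto
    next
      case 3
      then show ?thesis using R_left[OF v1(3), of r'] h4 v1 o by auto
    next
      case 4
      obtain y where y: "l \<le> y" "y \<le> r'" "snk y" using i2[of l] o by auto
      then show ?thesis using R_right[OF v1(3), of y] snk_right[of y] 4 v1 bd by auto
    qed
  qed
  have c2: "l' \<le> t' \<and> t' < l \<or> r' < t' \<and> t' \<le> r"
  proof -
    consider "l' \<le> s'" "l' \<le> z'" | "s' \<le> r" "z' \<le> r" | "s' < l'" "r < z'" | "z' < l'" "r < s'" by linarith
    then show ?thesis
    proof cases
      case 1
      then show ?thesis using spI_closed[OF J v2(1-4)] v2 by auto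
    next
      case 2
      then show ?thesis using spI_closed[OF I v2(1-4)] v2 by auto
    next
      case 3
      then show ?thesis using R_right[OF v2(3), of "l' - 1"] h1 v2 o by auto
    next
      case 4
      obtain y where y: "l' \<le> y" "y \<le> r" "snk y" using i1[of r] o by auto
      then show ?thesis using R_left[OF v2(3), of "y - 1"] snk_left[of y "y - 1"] 4 v2 bd by auto
    qed
  qed
  \<comment> \<open>The path from \<open>t\<close> to its sink would run right across
    \<open>l' - 1\<close>, where the arrow points left. What remains is the first interval strictly
    inside the second, with the two violations escaping at opposite ends.\<close>
  have "\<not> (l \<le> t \<and> t < l')"
  proof
    assume t: "l \<le> t \<and> t < l'"
    then have "t \<le> l' - 1" "l' - 1 < z" using v1 by linarith+
    then show False using R_right[OF v1(4)] h1 t by auto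
  qed
  then have t: "r < t" "t \<le> r'" using c1 by auto
  then have t': "l' \<le> t'" "t' < l" using c2 by auto
  have rtl: "rt (l - 1)" and rtr: "\<not> rt r" using h2 h3 t t' by auto
  \<comment> \<open>\<open>S\<close> contains the sources left of \<open>l\<close> whose alien arrow
    jumps over the first interval, and \<open>S'\<close> contains the mirror images. Their elements
    \<open>m\<close> and \<open>m'\<close> nearest to that interval bound the candidates
    \<open>[m + 1, r]\<close> and \<open>[l, m' - 1]\<close>.\<close>
  define S where "S = {s \<in> {l'..<l}. \<exists>t z. A s t \<and> snk z \<and> R s z \<and> R t z \<and> l \<le> z \<and> z \<le> r \<and> r < t}"
  define S' where "S' = {s \<in> {r<..r'}. \<exists>t z. A s t \<and> snk z \<and> R s z \<and> R t z \<and> l \<le> z \<and> z \<le> r \<and> t < l}"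
  have zl: "l \<le> z"
    using R_left[OF v1(4), of "l - 1"] rtl t t' bd v1 by (cases "l \<le> z") auto
  have sl: "s < l"
    using spI_closed[OF I v1(1-4)] zl v1 t by (cases "s < l") auto
  have "s \<in> S" using v1 zl sl t by (auto simp: S_def)
  have zr: "z' \<le> r"
    using R_right[OF v2(4), of r] rtr t t' bd v2 by (cases "z' \<le> r") auto
  have sr: "r < s'"
    using spI_closed[OF I v2(1-4)] zr v2 t' by (cases "r < s'") auto
  have "s' \<in> S'" using v2 zr sr t' by (auto simp: S'_def)
  define m where "m = Max S"
  define m' where "m' = Min S'"
  have fin: "finite S" "finite S'" by (auto simp: S_def S'_def)
  have mS: "m \<in> S" and mm: "\<And>x. x \<in> S \<Longrightarrow> x \<le> m"
    using Max_in[OF fin(1)] Max_ge[OF fin(1)] \<open>s \<in> S\<close> unfolding m_def by blast+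
  have mS': "m' \<in> S'" and mm': "\<And>x. x \<in> S' \<Longrightarrow> m' \<le> x"
    using Min_in[OF fin(2)] Min_le[OF fin(2)] \<open>s' \<in> S'\<close> unfolding m'_def by blast+
  obtain u y where m: "l' \<le> m" "m < l" "A m u" "snk y" "R m y" "R u y" "l \<le> y" "y \<le> r" "r < u"
    using mS by (auto simp: S_def)
  obtain u' y' where m': "r < m'" "m' \<le> r'" "A m' u'" "snk y'" "R m' y'" "R u' y'" "l \<le> y'" "y' \<le> r" "u' < l"
    using mS' by (auto simp: S'_def)
  \<comment> \<open>A violation with target beyond \<open>r\<close> would be an element of
    \<open>S\<close> larger than \<open>m\<close>. With target at most \<open>m\<close>, the target
    would reach its own source along the line, closing a cycle.\<close>
  have sp1: "spI (m + 1) r"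
  proof (rule spI_I)
    show "m + 1 \<le> r" "r < n" using m bd by auto
  next
    fix x assume x: "m + 1 \<le> x" "x \<le> r"
    show "\<exists>z\<ge>m + 1. z \<le> r \<and> snk z \<and> R x z"
    proof (cases "l \<le> x")
      case True
      then obtain z where "l \<le> z" "z \<le> r" "snk z" "R x z" using spI_sink[OF I _ x(2)] by blast
      then show ?thesis using m by (intro exI[of _ z]) auto
    next
      case False
      then have "R x y" unfolding reach_pos_def using R_right[OF m(5)] x m by auto
      then show ?thesis using m x False by (intro exI[of _ y]) auto
    qed
  next
    fix s t z assume v: "A s t" "snk z" "R s z" "R t z" "m + 1 \<le> s" "s \<le> r" "m + 1 \<le> z" "z \<le> r"
    show "m + 1 \<le> t \<and> t \<le> r"
    proof (rule ccontr)
      assume nt: "\<not> (m + 1 \<le> t \<and> t \<le> r)"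
      have zl: "l \<le> z"
        using R_right[OF m(5), of z] snk_right[OF v(2)] v m bd by (cases "l \<le> z") auto
      have sl: "s < l"
        using spI_closed[OF I v(1-4)] zl v nt m by (cases "s < l") auto
      have "\<not> r < t"
      proof
        assume "r < t"
        then have "s \<in> S" using v zl sl m by (auto simp: S_def)
        then show False using mm v by force
      qed
      then have tm: "t \<le> m" using nt by auto
      have "R t s" unfolding reach_pos_def using R_right[OF v(4)] tm v sl zl by auto
      then show False using no_2cycle v by blast
    qed
  qed
  have sp2: "spI l (m' - 1)"
  proof (rule spI_I)
    show "l \<le> m' - 1" "m' - 1 < n" using m' bd by auto
  next
    fix x assume x: "l \<le> x" "x \<le> m' - 1"
    show "\<exists>z\<ge>l. z \<le> m' - 1 \<and> snk z \<and> R x z"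
    proof (cases "x \<le> r")
      case True
      then obtain z where "l \<le> z" "z \<le> r" "snk z" "R x z" using spI_sink[OF I x(1)] by blast
      then show ?thesis using m' by (intro exI[of _ z]) auto
    next
      case False
      then have "R x y'" unfolding reach_pos_def using R_left[OF m'(5)] x m' by auto
      then show ?thesis using m' x False by (intro exI[of _ y']) auto
    qed
  next
    fix s t z assume v: "A s t" "snk z" "R s z" "R t z" "l \<le> s" "s \<le> m' - 1" "l \<le> z" "z \<le> m' - 1"
    show "l \<le> t \<and> t \<le> m' - 1"
    proof (rule ccontr)
      assume nt: "\<not> (l \<le> t \<and> t \<le> m' - 1)"
      have zr: "z \<le> r"
        using R_left[OF m'(5), of "z - 1"] snk_left[OF v(2), of "z - 1"] v m' bd by (cases "z \<le> r") auto
      have sr: "r < s"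
        using spI_closed[OF I v(1-4)] zr v nt m' by (cases "r < s") auto
      have "\<not> t < l"
      proof
        assume "t < l"
        then have "s \<in> S'" using v zr sr m' by (auto simp: S'_def)
        then show False using mm' v m' by force
      qed
      then have tm: "m' \<le> t" using nt by auto
      have "R t s" unfolding reach_pos_def using R_left[OF v(4)] tm v sr zr m' by auto
      then show False using no_2cycle v by blast
    qed
  qed
  show ?thesis
  proof (cases "m + 1 = l")
    case False
    show ?thesis
    proof (rule that[OF sp1])
      show "homI l r (m + 1) r" unfolding homI_def using m rtl False bd by auto
      show "homI (m + 1) r l' r'" unfolding homI_def using m rtr R_right[OF m(5), of m] bd t by auto
    qed (use m False t in auto)
  next
    case True
    \<comment> \<open>If both candidates equalled the first interval, the two alien arrows jumping
      over it in opposite directions would close the cycle excluded by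
      \<open>no_4cycle\<close>.\<close>
    have "m' - 1 \<noteq> r"
    proof
      assume e: "m' - 1 = r"
      have "R u' m" unfolding reach_pos_def using R_right[OF m'(6)] m' m True by auto
      moreover have "R u m'" unfolding reach_pos_def using R_left[OF m(6)] m' m e by auto
      ultimately show False using no_4cycle[OF m(3) m'(3)] by blast
    qed
    show ?thesis
    proof (rule that[OF sp2])
      show "homI l r l (m' - 1)" unfolding homI_def using m' rtr bd by auto
      show "homI l (m' - 1) l' r'"
        unfolding homI_def using m' rtl R_left[OF m'(5), of "m' - 1"] bd t t' by auto
    qed (use m' \<open>m' - 1 \<noteq> r\<close> t' in auto)
  qed
qed

end

section \<open>Coordinates on a Dynkin quiver of type A\<close>

locale line_quiver =
  fixes n :: nat and Q :: "(nat \<times> nat) set" and pos :: "nat \<Rightarrow> nat" and rt :: "nat \<Rightarrow> bool"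
  assumes bij: "bij_betw pos {1..n} {..<n}"
    and arrow_iff: "(x, y) \<in> Q \<longleftrightarrow> x \<in> {1..n} \<and> y \<in> {1..n} \<and>
      (pos y = Suc (pos x) \<and> rt (pos x) \<or> pos x = Suc (pos y) \<and> \<not> rt (pos y))"
begin

lemma pos_less: "x \<in> {1..n} \<Longrightarrow> pos x < n"
  using bij by (auto simp: bij_betw_def)

lemma pos_inj: "x \<in> {1..n} \<Longrightarrow> y \<in> {1..n} \<Longrightarrow> pos x = pos y \<Longrightarrow> x = y"
  using bij by (auto simp: bij_betw_def dest: inj_onD)

lemma pos_surj:
  assumes "i < n"
  obtains x where "x \<in> {1..n}" "pos x = i"
proof -
  have "i \<in> pos ` {1..n}" using bij assms by (simp add: bij_betw_def)
  then show ?thesis using that by auto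
qed

abbreviation "rch \<equiv> reach_pos rt"

lemma reach_range: "(x, y) \<in> Q\<^sup>* \<Longrightarrow> x \<in> {1..n} \<longleftrightarrow> y \<in> {1..n}"
  by (induction rule: rtrancl_induct) (auto simp: arrow_iff)

lemma reach_right: "x \<in> {1..n} \<Longrightarrow> y \<in> {1..n} \<Longrightarrow> pos y = pos x + d \<Longrightarrow> (\<And>h. pos x \<le> h \<Longrightarrow> h < pos y \<Longrightarrow> rt h)
    \<Longrightarrow> (x, y) \<in> Q\<^sup>*"
proof (induction d arbitrary: y)
  case 0
  then show ?case using pos_inj[of x y] by simp
next
  case (Suc d)
  obtain w where w: "w \<in> {1..n}" "pos w = pos x + d"
    by (rule pos_surj[of "pos x + d"]) (use Suc.prems pos_less[of y] in auto)
  have "(x, w) \<in> Q\<^sup>*" using Suc w by auto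
  moreover have "(w, y) \<in> Q" using arrow_iff w Suc.prems by auto
  ultimately show ?case by auto
qed

lemma reach_left: "x \<in> {1..n} \<Longrightarrow> y \<in> {1..n} \<Longrightarrow> pos x = pos y + d \<Longrightarrow> (\<And>h. pos y \<le> h \<Longrightarrow> h < pos x \<Longrightarrow> \<not> rt h)
    \<Longrightarrow> (x, y) \<in> Q\<^sup>*"
proof (induction d arbitrary: y)
  case 0
  then show ?case using pos_inj[of x y] by simp
next
  case (Suc d)
  obtain w where w: "w \<in> {1..n}" "pos w = Suc (pos y)"
    by (rule pos_surj[of "Suc (pos y)"]) (use Suc.prems pos_less[of x] in auto)
  have "(x, w) \<in> Q\<^sup>*" using Suc w by auto
  moreover have "(w, y) \<in> Q" using arrow_iff w Suc.prems by auto
  ultimately show ?case by auto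
qed

lemma reach_iff:
  assumes "x \<in> {1..n}" "y \<in> {1..n}"
  shows "(x, y) \<in> Q\<^sup>* \<longleftrightarrow> rch (pos x) (pos y)"
proof
  assume "(x, y) \<in> Q\<^sup>*"
  then show "rch (pos x) (pos y)"
  proof (induction rule: rtrancl_induct)
    case base
    then show ?case by (auto simp: reach_pos_def)
  next
    case (step y z)
    have a: "pos z = Suc (pos y) \<and> rt (pos y) \<or> pos y = Suc (pos z) \<and> \<not> rt (pos z)"
      using step.hyps(2) arrow_iff by blast
    from step.IH consider "pos x \<le> pos y" "\<forall>h. pos x \<le> h \<and> h < pos y \<longrightarrow> rt h"
      | "pos y < pos x" "\<forall>h. pos y \<le> h \<and> h < pos x \<longrightarrow> \<not> rt h"
      unfolding reach_pos_def by force
    then show ?case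
    proof cases
      case 1
      show ?thesis
      proof (cases "pos z = Suc (pos y) \<and> rt (pos y)")
        case True
        then have "\<forall>h. pos x \<le> h \<and> h < pos z \<longrightarrow> rt h" using 1 by (auto simp: less_Suc_eq)
        then show ?thesis using True 1 by (simp add: reach_pos_def)
      next
        case False
        then have z: "pos y = Suc (pos z)" "\<not> rt (pos z)" using a by auto
        then have "pos x = pos y" using 1 by (metis le_neq_implies_less less_Suc_eq_le lessI)
        then show ?thesis using z by (auto simp: reach_pos_def less_Suc_eq)
      qed
    next
      case 2
      have z: "pos y = Suc (pos z)" "\<not> rt (pos z)" using a 2 by auto
      have "\<not> rt h" if "pos z \<le> h" "h < pos x" for h
        using 2 z that by (cases "h = pos z") auto
      then show ?thesis using z 2 by (simp add: reach_pos_def)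
    qed
  qed
next
  assume "rch (pos x) (pos y)"
  then show "(x, y) \<in> Q\<^sup>*"
    unfolding reach_pos_def
    using reach_right[OF assms, of "pos y - pos x"] reach_left[OF assms, of "pos x - pos y"] by auto
qed

lemma sink_iff:
  assumes "z \<in> {1..n}"
  shows "is_sink n Q z \<longleftrightarrow> sink_pos n rt (pos z)"
  unfolding sink_pos_def
proof
  assume s: "is_sink n Q z"
  show "(0 < pos z \<longrightarrow> rt (pos z - 1)) \<and> (Suc (pos z) < n \<longrightarrow> \<not> rt (pos z))"
  proof (intro conjI impI)
    assume "0 < pos z"
    then obtain w where w: "w \<in> {1..n}" "pos w = pos z - 1" using pos_surj pos_less[OF assms] by (metis less_imp_diff_less)
    then show "rt (pos z - 1)" using s assms arrow_iff[of z w] \<open>0 < pos z\<close> by (auto simp: is_sink_def)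
  next
    assume "Suc (pos z) < n"
    then obtain w where w: "w \<in> {1..n}" "pos w = Suc (pos z)" using pos_surj by metis
    then show "\<not> rt (pos z)" using s assms arrow_iff[of z w] by (auto simp: is_sink_def)
  qed
next
  assume a: "(0 < pos z \<longrightarrow> rt (pos z - 1)) \<and> (Suc (pos z) < n \<longrightarrow> \<not> rt (pos z))"
  have "(z, y) \<notin> Q" for y
  proof
    assume "(z, y) \<in> Q"
    then have y: "y \<in> {1..n}" and "pos y = Suc (pos z) \<and> rt (pos z) \<or> pos z = Suc (pos y) \<and> \<not> rt (pos y)"
      using arrow_iff by blast+
    then show False using a pos_less[OF y] by force
  qed
  then show "is_sink n Q z" using assms by (simp add: is_sink_def)
qed

lemma no_triangle: "(x, y) \<in> Q \<Longrightarrow> (y, z) \<in> Q \<Longrightarrow> (z, x) \<notin> Q"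
  using arrow_iff by auto

text \<open>A vertex reaching two sinks lies strictly between them and emits an arrow to each side.
  The source condition in \<open>alien_set\<close> keeps such vertices from being targets of alien
  arrows.\<close>

lemma two_sinks:
  assumes "is_sink n Q z" "is_sink n Q z'" "z \<noteq> z'" "(t, z) \<in> Q\<^sup>*" "(t, z') \<in> Q\<^sup>*"
  shows "is_source n Q t" "\<not> extremal n Q t"
proof -
  have r: "z \<in> {1..n}" "z' \<in> {1..n}" "t \<in> {1..n}"
    using assms reach_range by (auto simp: is_sink_def)
  have ne: "pos z \<noteq> pos z'" using pos_inj r assms by blast
  have R: "rch (pos t) (pos z)" "rch (pos t) (pos z')" using assms reach_iff r by auto
  note sk = sink_iff[OF r(1), unfolded sink_pos_def] sink_iff[OF r(2), unfolded sink_pos_def]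
  have aux: "pos t < b \<and> a < pos t"
    if ab: "a < b" "rch (pos t) a" "rch (pos t) b" "a < n" "b < n"
      "(0 < a \<longrightarrow> rt (a - 1)) \<and> (Suc a < n \<longrightarrow> \<not> rt a)" "(0 < b \<longrightarrow> rt (b - 1)) \<and> (Suc b < n \<longrightarrow> \<not> rt b)" for a b
  proof (rule ccontr)
    assume "\<not> ?thesis"
    then consider "pos t \<le> a" | "b \<le> pos t" by linarith
    then show False
    proof cases
      case 1
      then have "rt a" using ab unfolding reach_pos_def by auto
      then show False using ab by auto
    next
      case 2
      have "\<forall>h. a \<le> h \<and> h < pos t \<longrightarrow> \<not> rt h" using 2 ab(1,2) unfolding reach_pos_def by auto
      moreover have "a \<le> b - 1" "b - 1 < pos t" using 2 ab(1) by auto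
      ultimately have "\<not> rt (b - 1)" by blast
      then show False using ab by auto
    qed
  qed
  obtain a b where ab: "a < pos t" "pos t < b" "rch (pos t) a" "rch (pos t) b" "b < n"
  proof (cases "pos z < pos z'")
    case True
    then have "pos t < pos z' \<and> pos z < pos t"
      using aux[OF True R] sk assms(1,2) pos_less[OF r(1)] pos_less[OF r(2)] by simp
    then show ?thesis using that[of "pos z" "pos z'"] R pos_less[OF r(2)] by simp
  next
    case False
    then have lt: "pos z' < pos z" using ne by simp
    then have "pos t < pos z \<and> pos z' < pos t"
      using aux[OF lt R(2,1)] sk assms(1,2) pos_less[OF r(1)] pos_less[OF r(2)] by simp
    then show ?thesis using that[of "pos z'" "pos z"] R pos_less[OF r(1)] by simp
  qed
  have ts: "\<not> rt (pos t - 1)" "rt (pos t)" using ab unfolding reach_pos_def by auto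
  show "is_source n Q t"
    unfolding is_source_def using r ts arrow_iff ab by auto
  obtain u where u: "u \<in> {1..n}" "pos u = pos t - 1" using pos_surj ab pos_less[OF r(3)] by (metis less_imp_diff_less)
  obtain v where v: "v \<in> {1..n}" "pos v = Suc (pos t)" using pos_surj[of "Suc (pos t)"] ab by auto
  have "(t, u) \<in> Q" "(t, v) \<in> Q" "u \<noteq> v" using arrow_iff u v ts ab r by auto
  moreover have "finite {y. (t, y) \<in> Q \<or> (y, t) \<in> Q}"
    by (rule finite_subset[of _ "{1..n}"]) (auto simp: arrow_iff)
  ultimately have "card {u, v} \<le> card {y. (t, y) \<in> Q \<or> (y, t) \<in> Q}"
    by (intro card_mono) auto
  then show "\<not> extremal n Q t" using \<open>u \<noteq> v\<close> by (simp add: extremal_def)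
qed

end

lemma dynkin_line:
  assumes "dynkin_A n Q"
  shows "\<exists>pos rt. line_quiver n Q pos rt"
proof -
  obtain vs where vs: "distinct vs" "set vs = {1..n}"
    and adj: "\<And>x y. (x, y) \<in> Q \<or> (y, x) \<in> Q \<longleftrightarrow> (\<exists>i. Suc i < length vs \<and> {x, y} = {vs ! i, vs ! Suc i})"
    and asym: "\<And>x y. (x, y) \<in> Q \<Longrightarrow> (y, x) \<notin> Q"
    using assms unfolding dynkin_A_def by blast
  have len: "length vs = n" using vs distinct_card by fastforce
  have b: "bij_betw (\<lambda>i. vs ! i) {..<n} {1..n}" using bij_betw_nth[OF vs(1)] len vs(2) by auto
  define pos where "pos = the_inv_into {..<n} (\<lambda>i. vs ! i)"
  have bp: "bij_betw pos {1..n} {..<n}" unfolding pos_def by (rule bij_betw_the_inv_into[OF b])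
  have pn: "pos (vs ! i) = i" if "i < n" for i
    unfolding pos_def using b that by (intro the_inv_into_f_f) (auto simp: bij_betw_def)
  have np: "vs ! pos x = x" if "x \<in> {1..n}" for x
    unfolding pos_def using b that by (intro f_the_inv_into_f) (auto simp: bij_betw_def)
  define rt where "rt i \<longleftrightarrow> (vs ! i, vs ! Suc i) \<in> Q" for i
  have "line_quiver n Q pos rt"
  proof
    show "bij_betw pos {1..n} {..<n}" by (rule bp)
  next
    fix x y
    show "(x, y) \<in> Q \<longleftrightarrow> x \<in> {1..n} \<and> y \<in> {1..n} \<and>
      (pos y = Suc (pos x) \<and> rt (pos x) \<or> pos x = Suc (pos y) \<and> \<not> rt (pos y))" (is "?L \<longleftrightarrow> ?R")
    proof
      assume L: ?L
      then obtain i where i: "Suc i < n" "{x, y} = {vs ! i, vs ! Suc i}" using adj len by blast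
      have r: "vs ! i \<in> {1..n}" "vs ! Suc i \<in> {1..n}" using i len vs(2) nth_mem[of i vs] nth_mem[of "Suc i" vs] by auto
      from i(2) consider "x = vs ! i" "y = vs ! Suc i" | "y = vs ! i" "x = vs ! Suc i"
        by (auto simp: doubleton_eq_iff)
      then show ?R
        using i r L asym pn[of i] pn[of "Suc i"] by cases (auto simp: rt_def)
    next
      assume R: ?R
      then consider "pos y = Suc (pos x)" "rt (pos x)" | "pos x = Suc (pos y)" "\<not> rt (pos y)" by blast
      then show ?L
      proof cases
        case 1
        then show ?thesis using R np[of x] np[of y] by (simp add: rt_def)
      next
        case 2
        have "pos x < n" using bij_betwE[OF bp] R by blast
        then have "\<exists>i. Suc i < length vs \<and> {y, x} = {vs ! i, vs ! Suc i}"
          using 2 R np[of x] np[of y] len by (intro exI[of _ "pos y"]) simp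
        then have "(y, x) \<in> Q \<or> (x, y) \<in> Q" using adj by blast
        moreover have "(y, x) \<notin> Q" using 2 R np[of x] np[of y] by (simp add: rt_def)
        ultimately show ?thesis by blast
      qed
    qed
  qed
  then show ?thesis by blast
qed

section \<open>Socle-projective intervals in a poset of type A\<close>

context line_quiver
begin

definition iv :: "nat \<Rightarrow> nat \<Rightarrow> nat set" where
  "iv l r = {x \<in> {1..n}. l \<le> pos x \<and> pos x \<le> r}"

definition interval :: "nat set \<Rightarrow> bool" where
  "interval I \<longleftrightarrow> (\<exists>l r. l \<le> r \<and> r < n \<and> I = iv l r)"

lemma intervalE:
  assumes "interval I"
  obtains l r where "l \<le> r" "r < n" "I = iv l r"
  using assms unfolding interval_def by blast

lemma interval_subset: "interval I \<Longrightarrow> I \<subseteq> {1..n}"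
  unfolding interval_def iv_def by auto

lemma iv_nonempty:
  assumes "l \<le> i" "i \<le> r" "r < n"
  obtains x where "x \<in> iv l r" "pos x = i" "x \<in> {1..n}"
proof -
  obtain x where "x \<in> {1..n}" "pos x = i" by (rule pos_surj[of i]) (use assms in auto)
  then show ?thesis using that assms by (auto simp: iv_def)
qed

lemma iv_inj:
  assumes "iv l r = iv l' r'" "l \<le> r" "r < n" "l' \<le> r'" "r' < n"
  shows "l = l' \<and> r = r'"
proof -
  have *: "l' \<le> i \<and> i \<le> r'" if "iv l r \<subseteq> iv l' r'" "l \<le> i" "i \<le> r" "r < n" for i l r l' r'
  proof -
    note a = that
    obtain x where "x \<in> iv l r" "pos x = i" by (rule iv_nonempty[OF a(2-4)])
    then show ?thesis using a(1) by (auto simp: iv_def)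
  qed
  have s: "iv l r \<subseteq> iv l' r'" "iv l' r' \<subseteq> iv l r" using assms(1) by auto
  show ?thesis
    using *[OF s(1), of l] *[OF s(1), of r] *[OF s(2), of l'] *[OF s(2), of r'] assms by auto
qed

text \<open>Adjacent vertices have consecutive positions, so a walk inside the set from its smallest
  to its largest position visits all positions in between.\<close>

lemma connected_interval:
  assumes c: "connected_in Q I" and ne: "I \<noteq> {}" and sub: "I \<subseteq> {1..n}"
  shows "interval I"
proof -
  have fin: "finite (pos ` I)" using finite_subset[OF sub] by simp
  define l where "l = Min (pos ` I)"
  define r where "r = Max (pos ` I)"
  have "l \<in> pos ` I" "r \<in> pos ` I" using fin ne by (auto simp: l_def r_def)
  then obtain x y where x: "x \<in> I" "pos x = l" and y: "y \<in> I" "pos y = r" by auto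
  have bd: "l \<le> pos w \<and> pos w \<le> r" if "w \<in> I" for w
    using fin that by (auto simp: l_def r_def)
  have "\<forall>i. l \<le> i \<and> i \<le> pos w \<longrightarrow> i \<in> pos ` I" if "(x, w) \<in> (Restr (Q \<union> Q\<inverse>) I)\<^sup>*" for w
    using that
  proof (induction rule: rtrancl_induct)
    case base
    then show ?case using x by auto
  next
    case (step w w')
    then have w: "w' \<in> I" "pos w' = Suc (pos w) \<or> pos w = Suc (pos w')" using arrow_iff by auto
    have "i \<in> pos ` I" if i: "l \<le> i" "i \<le> pos w'" for i
    proof (cases "i \<le> pos w")
      case True
      then show ?thesis using step.IH i by simp
    next
      case False
      then have "i = pos w'" using w i by auto
      then show ?thesis using w by blast
    qed
    then show ?case by blast
  qed
  then have all: "\<forall>i. l \<le> i \<and> i \<le> r \<longrightarrow> i \<in> pos ` I" using c x y unfolding connected_in_def by blast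
  have "I = iv l r"
  proof
    show "I \<subseteq> iv l r" using sub bd by (auto simp: iv_def)
    show "iv l r \<subseteq> I"
    proof
      fix w assume w: "w \<in> iv l r"
      then obtain u where "u \<in> I" "pos u = pos w" using all by (auto simp: iv_def)
      then show "w \<in> I" using pos_inj[of u w] w sub by (auto simp: iv_def)
    qed
  qed
  moreover have "l \<le> r" using bd[OF y(1)] y by simp
  moreover have "r < n" using pos_less y sub by auto
  ultimately show ?thesis unfolding interval_def by blast
qed

text \<open>Directed paths are monotone in the position, so \<open>w\<close> cannot lie beyond both
  \<open>x\<close> and \<open>z\<close> on the same side.\<close>

lemma interval_convex:
  assumes I: "interval I" and x: "x \<in> I" "z \<in> I" and p: "(x, w) \<in> Q\<^sup>*" "(w, z) \<in> Q\<^sup>*"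
  shows "w \<in> I"
proof -
  obtain l r where lr: "l \<le> r" "r < n" "I = iv l r" using I by (rule intervalE)
  have rg: "x \<in> {1..n}" "z \<in> {1..n}" "w \<in> {1..n}" using x lr p reach_range by (auto simp: iv_def)
  have "rch (pos x) (pos w)" "rch (pos w) (pos z)" using p reach_iff rg by auto
  then have "pos x \<le> pos w \<and> pos w \<le> pos z \<or> pos z \<le> pos w \<and> pos w \<le> pos x \<or> pos w = pos x \<or> pos w = pos z"
  proof -
    have False if "pos w < pos x" "pos w < pos z"
      using \<open>rch (pos x) (pos w)\<close> \<open>rch (pos w) (pos z)\<close> that unfolding reach_pos_def by (metis le_refl not_le)
    moreover have False if "pos x < pos w" "pos z < pos w"
    proof -
      have "rt (pos w - 1)" using \<open>rch (pos x) (pos w)\<close> that unfolding reach_pos_def by auto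
      moreover have "\<not> rt (pos w - 1)" using \<open>rch (pos w) (pos z)\<close> that unfolding reach_pos_def by auto
      ultimately show False by simp
    qed
    ultimately show ?thesis by arith
  qed
  then show ?thesis using x lr rg by (auto simp: iv_def)
qed

text \<open>The conditions of \<open>thin_hom\<close> can fail only at an arrow that leaves one
  interval while staying in the other; there is at most one such arrow for each pair of
  ends.\<close>

lemma thin_hom_iv:
  assumes "l \<le> r" "r < n" "l' \<le> r'" "r' < n"
  shows "thin_hom Q (iv l r) (iv l' r') \<longleftrightarrow> l \<le> r' \<and> l' \<le> r \<and> (l < l' \<longrightarrow> \<not> rt (l' - 1)) \<and> (l' < l \<longrightarrow> rt (l - 1)) \<and>
     (r < r' \<longrightarrow> \<not> rt r) \<and> (r' < r \<longrightarrow> rt r')" (is "?L \<longleftrightarrow> ?R")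
proof
  assume L: ?L
  then obtain x where "x \<in> iv l r" "x \<in> iv l' r'" unfolding thin_hom_def by blast
  then have o: "l \<le> r'" "l' \<le> r" by (auto simp: iv_def)
  have al: "v \<in> iv l r" if "(u, v) \<in> Q" "u \<in> iv l r" "u \<in> iv l' r'" "v \<in> iv l' r'" for u v
    using L that unfolding thin_hom_def by blast
  have be: "u \<in> iv l' r'" if "(u, v) \<in> Q" "u \<in> iv l r" "v \<in> iv l r" "v \<in> iv l' r'" for u v
    using L that unfolding thin_hom_def by blast
  have "\<not> rt (l' - 1)" if "l < l'"
  proof
    assume t: "rt (l' - 1)"
    obtain u where u: "u \<in> {1..n}" "pos u = l' - 1" by (rule pos_surj[of "l' - 1"]) (use assms in auto)
    obtain v where v: "v \<in> {1..n}" "pos v = l'" by (rule pos_surj[of l']) (use assms in auto)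
    have "(u, v) \<in> Q" using arrow_iff u v t that by auto
    moreover have "l \<le> pos u" "\<not> l' \<le> pos u" using u that by auto
    ultimately show False using be[of u v] u v that assms o by (auto simp: iv_def)
  qed
  moreover have "rt (l - 1)" if "l' < l"
  proof (rule ccontr)
    assume t: "\<not> rt (l - 1)"
    obtain u where u: "u \<in> {1..n}" "pos u = l" by (rule pos_surj[of l]) (use assms in auto)
    obtain v where v: "v \<in> {1..n}" "pos v = l - 1" by (rule pos_surj[of "l - 1"]) (use assms in auto)
    have "(u, v) \<in> Q" using arrow_iff u v t that by auto
    moreover have "l' \<le> pos v" "\<not> l \<le> pos v" using v that by auto
    ultimately show False using al[of u v] u v that assms o by (auto simp: iv_def)
  qed
  moreover have "\<not> rt r" if "r < r'"
  proof
    assume t: "rt r"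
    have sn: "Suc r < n" using that assms by simp
    obtain u where u: "u \<in> {1..n}" "pos u = r" by (rule pos_surj[of r]) (use assms in auto)
    obtain v where v: "v \<in> {1..n}" "pos v = Suc r" by (rule pos_surj[OF sn])
    have "(u, v) \<in> Q" using arrow_iff u v t that by auto
    then show False using al[of u v] u v that assms o by (auto simp: iv_def)
  qed
  moreover have "rt r'" if "r' < r"
  proof (rule ccontr)
    assume t: "\<not> rt r'"
    have sn: "Suc r' < n" using that assms by simp
    obtain u where u: "u \<in> {1..n}" "pos u = Suc r'" by (rule pos_surj[OF sn])
    obtain v where v: "v \<in> {1..n}" "pos v = r'" by (rule pos_surj[of r']) (use assms in auto)
    have "(u, v) \<in> Q" using arrow_iff u v t that by auto
    then show False using be[of u v] u v that assms o by (auto simp: iv_def)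
  qed
  ultimately show ?R using o by blast
next
  assume R: ?R
  obtain x where x: "x \<in> {1..n}" "pos x = max l l'" by (rule pos_surj[of "max l l'"]) (use assms in auto)
  have "x \<in> iv l r \<inter> iv l' r'" using x R assms by (auto simp: iv_def)
  moreover have "v \<in> iv l r" if uv: "(u, v) \<in> Q" "u \<in> iv l r \<inter> iv l' r'" "v \<in> iv l' r'" for u v
  proof (rule ccontr)
    assume n: "v \<notin> iv l r"
    have a: "v \<in> {1..n}" "pos v = Suc (pos u) \<and> rt (pos u) \<or> pos u = Suc (pos v) \<and> \<not> rt (pos v)"
      using uv(1) arrow_iff by blast+
    from n a(1) consider "pos v < l" | "r < pos v" unfolding iv_def by fastforce
    then show False
    proof cases
      case 1
      then have "l = Suc (pos v)" "\<not> rt (pos v)" using a uv by (auto simp: iv_def)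
      moreover have "l' < l" using 1 uv by (auto simp: iv_def)
      ultimately show False using R by auto
    next
      case 2
      then have "r = pos u" "rt (pos u)" using a uv by (auto simp: iv_def)
      moreover have "r < r'" using 2 uv by (auto simp: iv_def)
      ultimately show False using R by auto
    qed
  qed
  moreover have "u \<in> iv l' r'" if uv: "(u, v) \<in> Q" "u \<in> iv l r" "v \<in> iv l r \<inter> iv l' r'" for u v
  proof (rule ccontr)
    assume n: "u \<notin> iv l' r'"
    have a: "u \<in> {1..n}" "pos v = Suc (pos u) \<and> rt (pos u) \<or> pos u = Suc (pos v) \<and> \<not> rt (pos v)"
      using uv(1) arrow_iff by blast+
    from n a(1) consider "pos u < l'" | "r' < pos u" unfolding iv_def by fastforce
    then show False
    proof cases
      case 1
      then have "l' = Suc (pos u)" "rt (pos u)" using a uv by (auto simp: iv_def)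
      moreover have "l < l'" using 1 uv by (auto simp: iv_def)
      ultimately show False using R by auto
    next
      case 2
      then have "r' = pos v" "\<not> rt (pos v)" using a uv by (auto simp: iv_def)
      moreover have "r' < r" using 2 uv by (auto simp: iv_def)
      ultimately show False using R by auto
    qed
  qed
  ultimately show ?L unfolding thin_hom_def by blast
qed

end

locale alien_line = line_quiver +
  fixes F :: "(nat \<times> nat) set"
  assumes alien: "alien_set n Q F"
begin

abbreviation P :: "nat rel" where "P \<equiv> poset_of n Q F"

lemma F_range: "(s, t) \<in> F \<Longrightarrow> s \<in> {1..n} \<and> t \<in> {1..n}"
  and F_sink: "(s, t) \<in> F \<Longrightarrow> \<exists>z. is_sink n Q z \<and> (s, z) \<in> Q\<^sup>* \<and> (t, z) \<in> Q\<^sup>*"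
  and F_target: "(s, t) \<in> F \<Longrightarrow> is_source n Q t \<Longrightarrow> extremal n Q t"
  and acyc: "acyclic (Q \<union> F)"
proof -
  have a: "F \<subseteq> {1..n} \<times> {1..n}" "\<forall>(s, t)\<in>F. \<exists>z. is_sink n Q z \<and> s \<in> supp_I n Q z \<and> t \<in> supp_I n Q z"
    "\<forall>(s, t)\<in>F. is_source n Q t \<longrightarrow> extremal n Q t" "acyclic (Q \<union> F)"
    using alien unfolding alien_set_def by blast+
  show "acyclic (Q \<union> F)" by (rule a)
  show "(s, t) \<in> F \<Longrightarrow> s \<in> {1..n} \<and> t \<in> {1..n}" using a(1) by blast
  show "(s, t) \<in> F \<Longrightarrow> \<exists>z. is_sink n Q z \<and> (s, z) \<in> Q\<^sup>* \<and> (t, z) \<in> Q\<^sup>*"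
    using a(2) unfolding supp_I_def by blast
  show "(s, t) \<in> F \<Longrightarrow> is_source n Q t \<Longrightarrow> extremal n Q t" using a(3) by blast
qed

lemma Q_range: "(x, y) \<in> Q \<Longrightarrow> x \<in> {1..n} \<and> y \<in> {1..n}"
  using arrow_iff by blast

lemma QF_range: "(x, y) \<in> (Q \<union> F)\<^sup>* \<Longrightarrow> x \<in> {1..n} \<longleftrightarrow> y \<in> {1..n}"
proof (induction rule: rtrancl_induct)
  case (step y z)
  then show ?case using Q_range F_range by blast
qed simp

lemma P_iff: "(x, y) \<in> P \<longleftrightarrow> x \<in> {1..n} \<and> (x, y) \<in> (Q \<union> F)\<^sup>*"
  using QF_range by (auto simp: poset_of_def)

lemma P_refl: "x \<in> {1..n} \<Longrightarrow> (x, x) \<in> P"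
  by (simp add: P_iff)

lemma P_trans: "(x, y) \<in> P \<Longrightarrow> (y, z) \<in> P \<Longrightarrow> (x, z) \<in> P"
  by (auto simp: P_iff)

lemma P_antisym: "(x, y) \<in> P \<Longrightarrow> (y, x) \<in> P \<Longrightarrow> x = y"
  using acyc unfolding P_iff acyclic_def by (metis rtranclD trancl_rtrancl_trancl)

lemma P_range: "(x, y) \<in> P \<Longrightarrow> x \<in> {1..n} \<and> y \<in> {1..n}"
  by (auto simp: poset_of_def)

lemma P_Field: "Field P = {1..n}"
  using P_refl P_range unfolding Field_def by blast

lemma Q_P: "(x, y) \<in> Q \<Longrightarrow> (x, y) \<in> P"
  and F_P: "(x, y) \<in> F \<Longrightarrow> (x, y) \<in> P"
  and reach_P: "x \<in> {1..n} \<Longrightarrow> (x, y) \<in> Q\<^sup>* \<Longrightarrow> (x, y) \<in> P"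
proof -
  show "(x, y) \<in> Q \<Longrightarrow> (x, y) \<in> P" using Q_range by (auto simp: P_iff)
  show "(x, y) \<in> F \<Longrightarrow> (x, y) \<in> P" using F_range by (auto simp: P_iff)
  show "x \<in> {1..n} \<Longrightarrow> (x, y) \<in> Q\<^sup>* \<Longrightarrow> (x, y) \<in> P"
    using rtrancl_mono[of Q "Q \<union> F"] by (auto simp: P_iff)
qed

text \<open>By \<open>two_sinks\<close>, a second sink would make \<open>t\<close> a source that is
  not extremal, which \<open>alien_set\<close> forbids for targets.\<close>

lemma F_one_sink:
  assumes "(s, t) \<in> F" "is_sink n Q z" "is_sink n Q z'" "(t, z) \<in> Q\<^sup>*" "(t, z') \<in> Q\<^sup>*"
  shows "z = z'"
  using two_sinks[OF assms(2,3) _ assms(4,5)] F_target[OF assms(1)] by blast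

text \<open>Alien arrows create no new relation below a sink. The sink that \<open>alien_set\<close>
  provides for the arrow is the only one above its target, so it is \<open>z\<close>, and the source
  already reaches it in \<open>Q\<close>.\<close>

lemma sink_below:
  assumes z: "is_sink n Q z" and "(x, z) \<in> (Q \<union> F)\<^sup>*"
  shows "(x, z) \<in> Q\<^sup>*"
  using assms(2)
proof (induction rule: converse_rtrancl_induct)
  case (step s t)
  then show ?case
  proof (cases "(s, t) \<in> Q")
    case False
    then have F: "(s, t) \<in> F" using step by blast
    then obtain z' where z': "is_sink n Q z'" "(s, z') \<in> Q\<^sup>*" "(t, z') \<in> Q\<^sup>*" using F_sink by blast
    have "z' = z" using F_one_sink[OF F z'(1) z z'(3) step.IH] .
    then show ?thesis using z' by simp
  qed auto
qed simp

text \<open>An alien arrow leaving \<open>z\<close> would have a sink above both of its ends. That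
  sink is \<open>z\<close> itself, so the target lies below \<open>z\<close> and the arrow closes a
  cycle.\<close>

lemma sink_maximal:
  assumes z: "is_sink n Q z" and "(z, y) \<in> P"
  shows "y = z"
proof (rule ccontr)
  assume "y \<noteq> z"
  moreover have "(z, y) \<in> (Q \<union> F)\<^sup>*" using assms(2) P_iff by blast
  ultimately obtain w where w: "(z, w) \<in> Q \<union> F" by (metis converse_rtranclE)
  then have F: "(z, w) \<in> F" using z by (auto simp: is_sink_def)
  then obtain z' where z': "is_sink n Q z'" "(z, z') \<in> Q\<^sup>*" "(w, z') \<in> Q\<^sup>*" using F_sink by blast
  have "z' = z" using z'(2) z by (metis converse_rtranclE is_sink_def)
  then have "(w, z) \<in> P" using z' reach_P F_range[OF F] by blast
  then have "w = z" using P_antisym F_P[OF F] by blast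
  then show False using F acyc unfolding acyclic_def by blast
qed

lemma maximal_sink:
  assumes "z \<in> {1..n}" "\<And>y. (z, y) \<in> P \<Longrightarrow> y = z"
  shows "is_sink n Q z"
  using assms Q_P arrow_iff[of z z] unfolding is_sink_def by (metis n_not_Suc_n)

text \<open>The conditions of \<open>sp_diagonal\<close> for an interval, with peak-diagonals of
  fans replaced by sinks of \<open>Q\<close>.\<close>

definition spset :: "nat set \<Rightarrow> bool" where
  "spset I \<longleftrightarrow> interval I \<and> (\<forall>x\<in>I. \<exists>z\<in>I. is_sink n Q z \<and> (x, z) \<in> Q\<^sup>*) \<and>
     (\<forall>(s, t)\<in>F. \<forall>z. is_sink n Q z \<and> (s, z) \<in> Q\<^sup>* \<and> (t, z) \<in> Q\<^sup>* \<and> s \<in> I \<and> z \<in> I \<longrightarrow> t \<in> I)"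

lemma spset_interval: "spset I \<Longrightarrow> interval I"
  and spset_sink: "spset I \<Longrightarrow> x \<in> I \<Longrightarrow> \<exists>z\<in>I. is_sink n Q z \<and> (x, z) \<in> Q\<^sup>*"
  and spset_F: "spset I \<Longrightarrow> (s, t) \<in> F \<Longrightarrow> is_sink n Q z \<Longrightarrow> (s, z) \<in> Q\<^sup>* \<Longrightarrow> (t, z) \<in> Q\<^sup>* \<Longrightarrow> s \<in> I \<Longrightarrow> z \<in> I \<Longrightarrow> t \<in> I"
  unfolding spset_def by blast+

text \<open>Below a sink the order is given by \<open>Q\<close>. Along a path towards a sink of
  \<open>I\<close>, arrows of \<open>Q\<close> stay in \<open>I\<close> by convexity and alien
  arrows by closure.\<close>

lemma spset_up:
  assumes I: "spset I" and z: "is_sink n Q z" "z \<in> I" and u: "u \<in> I" "(u, y) \<in> (Q \<union> F)\<^sup>*" and y: "(y, z) \<in> (Q \<union> F)\<^sup>*"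
  shows "y \<in> I"
  using u(2) y
proof (induction rule: rtrancl_induct)
  case base
  then show ?case using u by simp
next
  case (step y y')
  then have y: "y \<in> I" by (meson converse_rtrancl_into_rtrancl)
  have q: "(y', z) \<in> Q\<^sup>*" "(y, z) \<in> Q\<^sup>*"
    using sink_below[OF z(1)] step by (meson converse_rtrancl_into_rtrancl)+
  show ?case
  proof (cases "(y, y') \<in> Q")
    case True
    then show ?thesis using interval_convex[OF spset_interval[OF I] y z(2) _ q(1)] by blast
  next
    case False
    then show ?thesis using spset_F[OF I _ z(1) q(2,1) y z(2)] step by blast
  qed
qed

lemma spset_convex:
  assumes I: "spset I" and "x \<in> I" "w \<in> I" "(x, y) \<in> P" "(y, w) \<in> P"
  shows "y \<in> I"
proof -
  obtain z where z: "z \<in> I" "is_sink n Q z" "(w, z) \<in> Q\<^sup>*" using spset_sink[OF I assms(3)] by blast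
  have "(w, z) \<in> P" using reach_P z P_range assms by blast
  then have "(y, z) \<in> P" using P_trans assms by blast
  then show ?thesis using spset_up[OF I z(2,1) assms(2)] assms(4) P_iff by blast
qed

text \<open>\<open>h\<close> speaks about single arrows of \<open>Q\<close> only. Membership is
  compared at a sink of \<open>J\<close> above \<open>y\<close>; below it both \<open>x\<close> and
  \<open>y\<close> are joined to the sink by paths of \<open>Q\<close>, along which \<open>h\<close>
  can be iterated.\<close>

lemma thin_hom_P:
  assumes I: "spset I" and J: "spset J" and h: "thin_hom Q I J" and xy: "(x, y) \<in> P" "x \<in> I" "y \<in> J"
  shows "x \<in> J \<longleftrightarrow> y \<in> I"
proof -
  have al: "v \<in> I" if "(u, v) \<in> Q" "u \<in> I" "u \<in> J" "v \<in> J" for u v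
    using h that unfolding thin_hom_def by blast
  have be: "u \<in> J" if "(u, v) \<in> Q" "u \<in> I" "v \<in> I" "v \<in> J" for u v
    using h that unfolding thin_hom_def by blast
  have fwd: "z \<in> I" if "(x, z) \<in> Q\<^sup>*" "x \<in> I" "x \<in> J" "z \<in> J" for x z
    using that
  proof (induction rule: rtrancl_induct)
    case (step w w')
    have "w \<in> J" using interval_convex[OF spset_interval[OF J] step.prems(2,3) step.hyps(1)] step.hyps(2) by blast
    then show ?case using al step by blast
  qed simp
  have bwd: "x \<in> J" if "(x, z) \<in> Q\<^sup>*" "x \<in> I" "z \<in> I" "z \<in> J" for x z
    using that
  proof (induction rule: converse_rtrancl_induct)
    case (step w w')
    have "w' \<in> I" using interval_convex[OF spset_interval[OF I] step.prems(1,2) _ step.hyps(2)] step.hyps(1) by blast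
    then show ?case using be step by blast
  qed simp
  obtain z where z: "z \<in> J" "is_sink n Q z" "(y, z) \<in> Q\<^sup>*" using spset_sink[OF J xy(3)] by blast
  have yz: "(y, z) \<in> P" using reach_P z P_range xy by blast
  then have "(x, z) \<in> P" using P_trans xy by blast
  then have xz: "(x, z) \<in> Q\<^sup>*" using sink_below[OF z(2)] P_iff by blast
  show ?thesis
  proof
    assume "x \<in> J"
    then have "z \<in> I" using fwd xz xy z by blast
    then show "y \<in> I" using spset_up[OF I z(2) _ xy(2)] xy(1) yz P_iff by blast
  next
    assume "y \<in> I"
    then have "z \<in> I" using fwd z xy by blast
    then show "x \<in> J" using bwd xz xy z by blast
  qed
qed

definition Apos :: "nat \<Rightarrow> nat \<Rightarrow> bool" where
  "Apos i j \<longleftrightarrow> (\<exists>(s, t)\<in>F. i = pos s \<and> j = pos t)"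

text \<open>A cycle in positions lifts to a cycle of \<open>Q \<union> F\<close> through the alien
  arrows involved.\<close>

sublocale ap: alien_positions n rt Apos
proof
  fix s t assume "Apos s t"
  then obtain x y where xy: "(x, y) \<in> F" "s = pos x" "t = pos y" unfolding Apos_def by blast
  have r: "x \<in> {1..n}" "y \<in> {1..n}" using F_range[OF xy(1)] by auto
  have cyc: "(y, x) \<notin> (Q \<union> F)\<^sup>*"
    using acyc xy(1) unfolding acyclic_def by (meson UnI2 rtrancl_into_trancl2)
  show "\<not> reach_pos rt t s"
  proof
    assume "reach_pos rt t s"
    then have "(y, x) \<in> Q\<^sup>*" using reach_iff[OF r(2,1)] xy by simp
    then show False using cyc reach_P[OF r(2)] P_iff by blast
  qed
  fix s' t' assume "Apos s' t'" and R: "reach_pos rt t' s"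
  then obtain x' y' where xy': "(x', y') \<in> F" "s' = pos x'" "t' = pos y'" unfolding Apos_def by blast
  have r': "x' \<in> {1..n}" "y' \<in> {1..n}" using F_range[OF xy'(1)] by auto
  show "\<not> reach_pos rt t s'"
  proof
    assume "reach_pos rt t s'"
    then have "(y, x') \<in> Q\<^sup>*" using reach_iff[OF r(2) r'(1)] xy xy' by simp
    moreover have "(y', x) \<in> Q\<^sup>*" using R reach_iff[OF r'(2) r(1)] xy xy' by simp
    ultimately have "(y, x') \<in> P" "(y', x) \<in> P" using reach_P r r' by blast+
    then have "(y, x) \<in> P" using F_P[OF xy'(1)] P_trans by blast
    then show False using cyc P_iff by blast
  qed
qed

lemma spset_iv:
  assumes "l \<le> r" "r < n"
  shows "spset (iv l r) \<longleftrightarrow> ap.spI l r"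
proof
  assume sp: "spset (iv l r)"
  show "ap.spI l r"
  proof (rule ap.spI_I[OF assms])
    fix i assume i: "l \<le> i" "i \<le> r"
    then obtain x where x: "x \<in> iv l r" "pos x = i" "x \<in> {1..n}" using iv_nonempty assms by metis
    obtain z where z: "z \<in> iv l r" "is_sink n Q z" "(x, z) \<in> Q\<^sup>*" using spset_sink[OF sp x(1)] by blast
    have "z \<in> {1..n}" using z by (simp add: iv_def)
    then show "\<exists>z\<ge>l. z \<le> r \<and> sink_pos n rt z \<and> reach_pos rt i z"
      using z x sink_iff reach_iff by (intro exI[of _ "pos z"]) (auto simp: iv_def)
  next
    fix s t z assume v: "Apos s t" "sink_pos n rt z" "reach_pos rt s z" "reach_pos rt t z"
      "l \<le> s" "s \<le> r" "l \<le> z" "z \<le> r"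
    obtain x y where xy: "(x, y) \<in> F" "s = pos x" "t = pos y" using v(1) unfolding Apos_def by blast
    have r: "x \<in> {1..n}" "y \<in> {1..n}" using F_range[OF xy(1)] by auto
    obtain w where w: "w \<in> iv l r" "pos w = z" "w \<in> {1..n}" using iv_nonempty v assms by metis
    have "y \<in> iv l r"
    proof (rule spset_F[OF sp xy(1) _ _ _ _ w(1)])
      show "is_sink n Q w" using sink_iff w v by simp
      show "(x, w) \<in> Q\<^sup>*" "(y, w) \<in> Q\<^sup>*" using reach_iff r w v xy by auto
      show "x \<in> iv l r" using r v xy by (simp add: iv_def)
    qed
    then show "l \<le> t \<and> t \<le> r" using xy by (simp add: iv_def)
  qed
next
  assume sp: "ap.spI l r"
  have "\<exists>z\<in>iv l r. is_sink n Q z \<and> (x, z) \<in> Q\<^sup>*" if x: "x \<in> iv l r" for x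
  proof -
    obtain i where i: "l \<le> i" "i \<le> r" "sink_pos n rt i" "reach_pos rt (pos x) i"
      using ap.spI_sink[OF sp, of "pos x"] x by (auto simp: iv_def)
    obtain z where z: "z \<in> iv l r" "pos z = i" "z \<in> {1..n}" using iv_nonempty i assms by metis
    have "x \<in> {1..n}" using x by (simp add: iv_def)
    then show ?thesis using z i sink_iff reach_iff by blast
  qed
  moreover have "t \<in> iv l r"
    if F: "(s, t) \<in> F" and a: "is_sink n Q z" "(s, z) \<in> Q\<^sup>*" "(t, z) \<in> Q\<^sup>*" "s \<in> iv l r" "z \<in> iv l r" for s t z
  proof -
    have r: "s \<in> {1..n}" "t \<in> {1..n}" "z \<in> {1..n}" using F_range[OF F] a by (auto simp: iv_def)
    have "Apos (pos s) (pos t)" using F unfolding Apos_def by blast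
    then have "l \<le> pos t \<and> pos t \<le> r"
      using ap.spI_closed[OF sp, of "pos s" "pos t" "pos z"] a r sink_iff reach_iff by (auto simp: iv_def)
    then show "t \<in> iv l r" using r by (simp add: iv_def)
  qed
  moreover have "interval (iv l r)" using assms interval_def by blast
  ultimately show "spset (iv l r)" unfolding spset_def by blast
qed

lemma thin_hom_homI:
  assumes "l \<le> r" "r < n" "l' \<le> r'" "r' < n"
  shows "thin_hom Q (iv l r) (iv l' r') \<longleftrightarrow> ap.homI l r l' r'"
  unfolding ap.homI_def thin_hom_iv[OF assms] by simp

text \<open>The mixed intervals are written as unions cut at \<open>t\<close>, because the geometry
  only tells which of the two diagonals governs the vertices on each side of
  \<open>t\<close>.\<close>

lemma mixed_intermediate_set:
  assumes I: "spset I" and J: "spset J" and h: "thin_hom Q I J" and t: "t \<in> I" "t \<in> J"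
    and n1: "\<not> spset ({x \<in> J. pos x < pos t} \<union> {t} \<union> {x \<in> I. pos t < pos x})"
    and n2: "\<not> spset ({x \<in> I. pos x < pos t} \<union> {t} \<union> {x \<in> J. pos t < pos x})"
  obtains K where "spset K" "thin_hom Q I K" "thin_hom Q K J" "K \<noteq> I" "K \<noteq> J" "I \<subseteq> K"
proof -
  obtain l r where I': "l \<le> r" "r < n" "I = iv l r" using spset_interval[OF I] by (rule intervalE)
  obtain l' r' where J': "l' \<le> r'" "r' < n" "J = iv l' r'" using spset_interval[OF J] by (rule intervalE)
  have tp: "l \<le> pos t" "pos t \<le> r" "l' \<le> pos t" "pos t \<le> r'" "t \<in> {1..n}" using t I' J' by (auto simp: iv_def)
  have eq: "{x \<in> iv a b. pos x < pos t} \<union> {t} \<union> {x \<in> iv c d. pos t < pos x} = iv a d" (is "?L = _")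
    if "a \<le> pos t" "pos t \<le> b" "c \<le> pos t" "pos t \<le> d" for a b c d
  proof
    show "?L \<subseteq> iv a d" using that tp by (auto simp: iv_def)
    show "iv a d \<subseteq> ?L"
    proof
      fix x assume x: "x \<in> iv a d"
      then have "pos x < pos t \<or> x = t \<or> pos t < pos x" using pos_inj[of x t] tp(5) by (auto simp: iv_def)
      then show "x \<in> ?L" using x that by (auto simp: iv_def)
    qed
  qed
  have "\<not> ap.spI l' r" "\<not> ap.spI l r'"
    using n1 n2 spset_iv[of l' r] spset_iv[of l r'] I' J' tp eq by auto
  moreover have "ap.spI l r" "ap.spI l' r'" using I J spset_iv I' J' by auto
  moreover have "ap.homI l r l' r'" using h thin_hom_homI I' J' by auto
  ultimately obtain p q where pq: "ap.spI p q" "ap.homI l r p q" "ap.homI p q l' r'" "p \<noteq> l \<or> q \<noteq> r" "p \<noteq> l' \<or> q \<noteq> r'"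
    "p \<le> l" "r \<le> q" using ap.mixed_intermediate by metis
  have b: "p \<le> q" "q < n" using pq(1) unfolding ap.spI_def by auto
  show ?thesis
  proof (rule that)
    show "spset (iv p q)" using pq(1) spset_iv b by auto
    show "thin_hom Q I (iv p q)" "thin_hom Q (iv p q) J" using thin_hom_homI b I' J' pq by auto
    show "iv p q \<noteq> I" "iv p q \<noteq> J" using iv_inj[of p q] I' J' b pq by blast+
    show "I \<subseteq> iv p q" using I' pq by (auto simp: iv_def)
  qed
qed

end

section \<open>Diagonals and intervals\<close>

text \<open>With \<open>n \<ge> 2\<close> every vertex has a neighbour, so every sink is the peak of
  a fan; a single diagonal would have none.\<close>

locale type_A = labelled_tri n \<tau> + alien_line n "quiver_of n \<tau>" pos rt F
  for n \<tau> pos rt F +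
  assumes n2: "2 \<le> n"
begin

sublocale cycle_free_tri
  by unfold_locales (rule no_triangle)

lemma supp_interval: "free \<gamma> \<Longrightarrow> interval (spp \<gamma>)"
  using connected_interval[OF supp_connected] free_iff supp_subset by blast

lemma card_labels: "card T = n"
  using card_image[OF inj_label] by simp

lemma finite_free: "finite {\<gamma>. free \<gamma>}"
proof (rule finite_subset)
  show "{\<gamma>. free \<gamma>} \<subseteq> Pow {..<n + 3}"
    unfolding free_diagonal_def diagonal_def by auto
qed simp

lemma card_intervals: "card {I. interval I} \<le> (\<Sum>l<n. n - l)"
proof -
  have "{I. interval I} \<subseteq> (\<lambda>(l, r). iv l r) ` (SIGMA l:{..<n}. {l..<n})"
    unfolding interval_def by auto
  then have "card {I. interval I} \<le> card (SIGMA l:{..<n}. {l..<n})"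
    by (meson card_image_le card_mono finite_SigmaI finite_atLeastLessThan finite_imageI finite_lessThan le_trans)
  then show ?thesis by simp
qed

text \<open>Diagonals are pairs \<open>a < b\<close>: there are \<open>n\<close> at the vertex
  \<open>0\<close> and \<open>n (n + 1) / 2\<close> others. Removing the \<open>n\<close> members of
  \<open>T\<close> leaves the number of intervals.\<close>

lemma card_free: "(\<Sum>l<n. n - l) \<le> card {\<gamma>. free \<gamma>}"
proof -
  define D where "D = {0} \<times> {2..n + 1} \<union> (SIGMA a:{1..n}. {a + 2..n + 2})"
  define f where "f = (\<lambda>(a :: nat, b :: nat). {a, b})"
  have "card D = card ({0 :: nat} \<times> {2..n + 1}) + card (SIGMA a:{1..n}. {a + 2..n + 2})"
    unfolding D_def by (rule card_Un_disjoint) auto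
  also have "\<dots> = n + (\<Sum>a\<in>{1..n}. Suc n - a)"
    by (simp add: card_cartesian_product)
  also have "(\<Sum>a\<in>{1..n}. Suc n - a) = (\<Sum>l<n. n - l)"
    by (rule sum.reindex_bij_witness[of _ Suc "\<lambda>a. a - 1"]) auto
  finally have cD: "card D = n + (\<Sum>l<n. n - l)" .
  have less: "a < b" if "(a, b) \<in> D" for a b using that by (auto simp: D_def)
  have "inj_on f D"
  proof (rule inj_onI)
    fix p q assume pq: "p \<in> D" "q \<in> D" "f p = f q"
    obtain a b c d where e: "p = (a, b)" "q = (c, d)" by fastforce
    then show "p = q" using pq less[of a b] less[of c d] by (auto simp: f_def doubleton_eq_iff)
  qed
  then have cf: "card (f ` D) = n + (\<Sum>l<n. n - l)" using cD by (simp add: card_image)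
  have "diagonal n d" if d: "d \<in> f ` D" for d
  proof -
    obtain a b where ab: "(a, b) \<in> D" "d = {a, b}" using d by (auto simp: f_def)
    then have "a < n + 3" "b < n + 3" by (auto simp: D_def)
    then have "d = ch (int a) (int b)"
      using ab pvert_int[of a n] pvert_int[of b n] by (simp add: chord_def)
    moreover have "int a < int b" "int b < int a + N" "int a + 2 \<le> int b" "int b \<le> int a + int n + 1"
      using ab by (auto simp: D_def)
    ultimately show ?thesis using diagonal_chord[of "int a" "int b" n] by simp
  qed
  then have sub: "f ` D - T \<subseteq> {\<gamma>. free \<gamma>}" by (auto simp: free_diagonal_def)
  have "(\<Sum>l<n. n - l) = card (f ` D) - card T" using cf card_labels by simp
  also have "\<dots> \<le> card (f ` D - T)" by (rule diff_card_le_card_Diff) simp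
  also have "\<dots> \<le> card {\<gamma>. free \<gamma>}" by (rule card_mono[OF finite_free sub])
  finally show ?thesis .
qed

text \<open>Supports are intervals, they determine the diagonal, and there are at least as many free
  diagonals as intervals. So no diagonal has to be constructed for a given interval.\<close>

lemma interval_supp:
  assumes "interval I"
  obtains \<gamma> where "free \<gamma>" "spp \<gamma> = I"
proof -
  have "inj_on spp {\<gamma>. free \<gamma>}" using supp_inj by (auto intro!: inj_onI)
  then have "card (spp ` {\<gamma>. free \<gamma>}) = card {\<gamma>. free \<gamma>}" by (rule card_image)
  then have c: "card {I. interval I} \<le> card (spp ` {\<gamma>. free \<gamma>})"
    using card_free card_intervals by linarith
  have "finite {I. interval I}"
    by (rule finite_subset[of _ "Pow {1..n}"]) (use interval_subset in auto)
  then have "spp ` {\<gamma>. free \<gamma>} = {I. interval I}"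
    by (rule card_seteq) (use supp_interval c in auto)
  then show ?thesis using assms that by (metis (mono_tags, lifting) imageE mem_Collect_eq)
qed

lemma neighbour:
  assumes "x \<in> {1..n}"
  obtains y where "(x, y) \<in> Qv \<or> (y, x) \<in> Qv"
proof (cases "Suc (pos x) < n")
  case True
  then obtain y where "y \<in> {1..n}" "pos y = Suc (pos x)" by (rule pos_surj)
  then show ?thesis using that[of y] assms arrow_iff[of x y] arrow_iff[of y x] by auto
next
  case False
  then have p: "0 < pos x" using n2 pos_less[OF assms] by linarith
  have "pos x - 1 < n" using pos_less[OF assms] by simp
  then obtain y where y: "y \<in> {1..n}" "pos y = pos x - 1" by (rule pos_surj)
  then have "pos x = Suc (pos y)" using p by simp
  then show ?thesis using that[of y] y assms arrow_iff[of x y] arrow_iff[of y x] by auto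
qed

lemma sink_in_fan:
  assumes "is_sink n Qv z" "x \<in> {1..n}" "(x, z) \<in> Qv\<^sup>*"
  shows "\<exists>S. fan n \<tau> S \<and> \<tau> x \<in> S \<and> is_peak n \<tau> Qv S z"
proof (cases "x = z")
  case True
  \<comment> \<open>A neighbour of the sink supplies the second diagonal of its fan.\<close>
  obtain y where "(x, y) \<in> Qv \<or> (y, x) \<in> Qv" by (rule neighbour[OF assms(2)])
  then have "(y, z) \<in> Qv\<^sup>+" using True assms(1) by (auto simp: is_sink_def)
  then show ?thesis using sink_fan[OF assms(1)] True by blast
next
  case False
  then have "(x, z) \<in> Qv\<^sup>+" using assms(3) by (meson rtranclD)
  then show ?thesis using sink_fan[OF assms(1)] by blast
qed

text \<open>The peak of a fan through \<open>\<tau> x\<close> is a sink above \<open>x\<close>, and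
  conversely a sink above \<open>x\<close> is the peak of a fan through
  \<open>\<tau> x\<close>.\<close>

lemma sp_iff: "sp_diagonal n \<tau> Qv F \<gamma> \<longleftrightarrow> free \<gamma> \<and> spset (spp \<gamma>)"
proof (cases "free \<gamma>")
  case True
  have "(\<exists>S y. fan n \<tau> S \<and> \<tau> x \<in> S \<and> is_peak n \<tau> Qv S y \<and> y \<in> spp \<gamma>) \<longleftrightarrow>
      (\<exists>z\<in>spp \<gamma>. is_sink n Qv z \<and> (x, z) \<in> Qv\<^sup>*)" (is "?L \<longleftrightarrow> ?R") if x: "x \<in> spp \<gamma>" for x
  proof
    assume ?L
    then show ?R using peak_sink x supp_subset by blast
  next
    assume ?R
    then show ?L using sink_in_fan x supp_subset by blast
  qed
  moreover have "x \<in> supp_I n Qv z \<longleftrightarrow> (x, z) \<in> Qv\<^sup>*" if "is_sink n Qv z" for x z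
    using that reach_range by (auto simp: supp_I_def is_sink_def)
  ultimately show ?thesis
    using True supp_interval[OF True] unfolding sp_diagonal_def spset_def by (simp cong: conj_cong)
next
  case False
  then show ?thesis by (simp add: sp_diagonal_def)
qed

text \<open>A walk along the line can change the side of \<open>\<tau> t\<close> only by passing
  through \<open>t\<close>, since adjacent labels other than \<open>t\<close> lie on the same
  side.\<close>

lemma side_positions:
  assumes t: "t \<in> {1..n}" "\<tau> t = ch c d" "c < d" "d < c + N" and x: "x \<in> side c d"
    and y: "y \<in> {1..n}" and same: "pos x < pos t \<and> pos y < pos t \<or> pos t < pos x \<and> pos t < pos y"
  shows "y \<in> side c d"
proof -
  have xr: "x \<in> {1..n}" using x by (rule sideE)
  have step: "v \<in> side c d"
    if "u \<in> side c d" "v \<in> {1..n}" "u \<noteq> t" "v \<noteq> t" "pos v = Suc (pos u) \<or> pos u = Suc (pos v)" for u v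
  proof -
    have "u \<in> {1..n}" using that(1) by (rule sideE)
    then have "(u, v) \<in> Qv \<or> (v, u) \<in> Qv" using that arrow_iff[of u v] arrow_iff[of v u] by auto
    then show ?thesis using side_adjacent[OF t that(3,4) _ that(1)] by blast
  qed
  have up: "v \<in> side c d" if "u \<in> side c d" "v \<in> {1..n}" "pos v = pos u + k"
    "pos v < pos t \<or> pos t < pos u" for u v k
    using that
  proof (induction k arbitrary: v)
    case 0
    have "u \<in> {1..n}" using 0(1) by (rule sideE)
    then show ?case using 0 pos_inj[of u v] by simp
  next
    case (Suc k)
    have "pos u + k < n" using pos_less[OF Suc.prems(2)] Suc.prems(3) by simp
    then obtain w where w: "w \<in> {1..n}" "pos w = pos u + k" by (rule pos_surj)
    then have "w \<in> side c d" using Suc by auto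
    moreover have "w \<noteq> t" "v \<noteq> t" "pos v = Suc (pos w) \<or> pos w = Suc (pos v)" using w Suc.prems by auto
    ultimately show ?case using step[OF _ Suc.prems(2)] by blast
  qed
  have dn: "v \<in> side c d" if "u \<in> side c d" "v \<in> {1..n}" "pos u = pos v + k"
    "pos u < pos t \<or> pos t < pos v" for u v k
    using that
  proof (induction k arbitrary: v)
    case 0
    have "u \<in> {1..n}" using 0(1) by (rule sideE)
    then show ?case using 0 pos_inj[of u v] by simp
  next
    case (Suc k)
    have ur: "u \<in> {1..n}" using Suc.prems(1) by (rule sideE)
    have "Suc (pos v) < n" if "k \<noteq> 0 \<or> True" using pos_less[OF ur] Suc.prems(3) by simp
    then obtain w where w: "w \<in> {1..n}" "pos w = Suc (pos v)" using pos_surj by blast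
    then have "w \<in> side c d" using Suc by auto
    moreover have "w \<noteq> t" "v \<noteq> t" "pos v = Suc (pos w) \<or> pos w = Suc (pos v)" using w Suc.prems by auto
    ultimately show ?case using step[OF _ Suc.prems(2)] by blast
  qed
  show ?thesis
    using up[OF x y, of "pos y - pos x"] dn[OF x y, of "pos x - pos y"] same by (cases "pos x \<le> pos y") auto
qed

text \<open>On each side of \<open>\<tau> t\<close> one of the free corners looks like the first
  diagonal and the other like the second. If all positions belonged to one side, a corner would have
  the support of a given diagonal and be sp. Otherwise the corners are the two mixed
  intervals.\<close>

lemma corner_intermediate:
  assumes o: "a \<le> a'" "b \<le> b'" "a' < c" "c < b" "b' < d" "d < a + N"
    and t: "t \<in> {1..n}" "\<tau> t = ch c d"
    and I: "spset (spp (ch a b))" and J: "spset (spp (ch a' b'))"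
    and n1: "\<not> spset (spp (ch a' b))" and n2: "\<not> spset (spp (ch a b'))"
  obtains K where "spset K" "thin_hom Qv (spp (ch a b)) K" "thin_hom Qv K (spp (ch a' b'))"
    "K \<noteq> spp (ch a b)" "K \<noteq> spp (ch a' b')" "spp (ch a b) \<subseteq> K"
proof -
  let ?I = "spp (ch a b)" and ?J = "spp (ch a' b')"
  let ?L = "side c d" and ?R = "side d (c + N)"
  have cd: "c < d" "d < c + N" using o by auto
  have h: "thin_hom Qv ?I ?J" by (rule thin_hom_forward[OF o t])
  have tt: "t \<in> spp (ch i j)" if "a \<le> i" "i \<le> a'" "b \<le> j" "j \<le> b'" for i j
    using supp_crossed[of i c j d t] t o that by auto
  \<comment> \<open>The side \<open>?L\<close> sees only the end \<open>a\<close> or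
    \<open>a'\<close> of a corner, and \<open>?R\<close> sees only the end \<open>b\<close> or
    \<open>b'\<close>.\<close>
  have Lm: "x \<in> spp (ch a' b) \<longleftrightarrow> x \<in> ?J" "x \<in> spp (ch a b') \<longleftrightarrow> x \<in> ?I" if "x \<in> ?L" for x
    using supp_side[OF that, of a' b b'] supp_side[OF that, of a b b'] o by auto
  have Rm: "x \<in> spp (ch a' b) \<longleftrightarrow> x \<in> ?I" "x \<in> spp (ch a b') \<longleftrightarrow> x \<in> ?J" if "x \<in> ?R" for x
    using supp_side[OF that, of b "a + N" "a' + N"] supp_side[OF that, of b' "a + N" "a' + N"] o
    unfolding chord_rot by linarith+
  have sides: "x \<in> ?L \<or> x \<in> ?R" if "x \<in> {1..n}" "x \<noteq> t" for x
    using side_cases[OF t cd that] .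
  have t': "\<tau> t = ch d (c + N)" "d < c + N" "c + N < d + N" using t cd chord_rot[of n d c] by simp_all
  have one: "(\<forall>x\<in>S. x \<in> ?L) \<or> (\<forall>x\<in>S. x \<in> ?R)"
    if S: "S = {x \<in> {1..n}. pos x < pos t} \<or> S = {x \<in> {1..n}. pos t < pos x}" for S
  proof (rule ccontr)
    assume "\<not> ?thesis"
    then obtain x y where xy: "x \<in> S" "x \<notin> ?L" "y \<in> S" "y \<notin> ?R" by blast
    have ne: "x \<noteq> t" "y \<noteq> t" "x \<in> {1..n}" "y \<in> {1..n}" using S xy by auto
    have "x \<in> ?R" using sides ne xy by blast
    then have "y \<in> ?R" using side_positions[OF t(1) t', of x y] S xy ne by auto
    then show False using xy by simp
  qed
  have split: "x \<in> {1..n} \<Longrightarrow> x = t \<or> pos x < pos t \<or> pos t < pos x" for x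
    using pos_inj[of x t] t(1) by linarith
  have sub: "spp \<gamma> \<subseteq> {1..n}" for \<gamma> by (rule supp_subset)
  have mid: "t \<in> spp (ch a' b)" "t \<in> spp (ch a b')" "t \<in> ?I" "t \<in> ?J" using tt o by auto
  have char: "S = {x \<in> A. pos x < pos t} \<union> {t} \<union> {x \<in> B. pos t < pos x}"
    if s: "S \<subseteq> {1..n}" "A \<subseteq> {1..n}" "B \<subseteq> {1..n}" "t \<in> S"
      and A: "\<And>x. x \<in> {1..n} \<Longrightarrow> pos x < pos t \<Longrightarrow> x \<in> S \<longleftrightarrow> x \<in> A"
      and B: "\<And>x. x \<in> {1..n} \<Longrightarrow> pos t < pos x \<Longrightarrow> x \<in> S \<longleftrightarrow> x \<in> B" for S A B
  proof (rule set_eqI)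
    fix x
    show "x \<in> S \<longleftrightarrow> x \<in> {x \<in> A. pos x < pos t} \<union> {t} \<union> {x \<in> B. pos t < pos x}"
    proof (cases "x \<in> {1..n}")
      case True
      from split[OF True] consider "x = t" | "pos x < pos t" | "pos t < pos x" by blast
      then show ?thesis
        by cases (use s A[OF True] B[OF True] in auto)
    next
      case False
      then have "x \<notin> S" "x \<notin> A" "x \<notin> B" "x \<noteq> t" using s by blast+
      then show ?thesis by simp
    qed
  qed
  from one[of "{x \<in> {1..n}. pos x < pos t}"] one[of "{x \<in> {1..n}. pos t < pos x}"]
  consider (LL) "\<And>x. x \<in> {1..n} \<Longrightarrow> pos x < pos t \<Longrightarrow> x \<in> ?L" "\<And>x. x \<in> {1..n} \<Longrightarrow> pos t < pos x \<Longrightarrow> x \<in> ?L"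
    | (LR) "\<And>x. x \<in> {1..n} \<Longrightarrow> pos x < pos t \<Longrightarrow> x \<in> ?L" "\<And>x. x \<in> {1..n} \<Longrightarrow> pos t < pos x \<Longrightarrow> x \<in> ?R"
    | (RL) "\<And>x. x \<in> {1..n} \<Longrightarrow> pos x < pos t \<Longrightarrow> x \<in> ?R" "\<And>x. x \<in> {1..n} \<Longrightarrow> pos t < pos x \<Longrightarrow> x \<in> ?L"
    | (RR) "\<And>x. x \<in> {1..n} \<Longrightarrow> pos x < pos t \<Longrightarrow> x \<in> ?R" "\<And>x. x \<in> {1..n} \<Longrightarrow> pos t < pos x \<Longrightarrow> x \<in> ?R"
    by blast
  then show ?thesis
  proof cases
    case LL
    have "x \<in> spp (ch a' b) \<longleftrightarrow> x \<in> ?J" for x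
      using split[of x] LL Lm(1)[of x] mid sub by blast
    then have "spp (ch a' b) = ?J" by blast
    then show ?thesis using n1 J by simp
  next
    case RR
    have "x \<in> spp (ch a' b) \<longleftrightarrow> x \<in> ?I" for x
      using split[of x] RR Rm(1)[of x] mid sub by blast
    then have "spp (ch a' b) = ?I" by blast
    then show ?thesis using n1 I by simp
  next
    case LR
    have e1: "spp (ch a' b) = {x \<in> ?J. pos x < pos t} \<union> {t} \<union> {x \<in> ?I. pos t < pos x}"
      by (rule char[OF sub sub sub mid(1)]) (use LR Lm Rm in auto)
    have e2: "spp (ch a b') = {x \<in> ?I. pos x < pos t} \<union> {t} \<union> {x \<in> ?J. pos t < pos x}"
      by (rule char[OF sub sub sub mid(2)]) (use LR Lm Rm in auto)
    show ?thesis
      by (rule mixed_intermediate_set[OF I J h mid(3,4)]) (use n1[unfolded e1] n2[unfolded e2] that in auto)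
  next
    case RL
    have e1: "spp (ch a' b) = {x \<in> ?I. pos x < pos t} \<union> {t} \<union> {x \<in> ?J. pos t < pos x}"
      by (rule char[OF sub sub sub mid(1)]) (use RL Lm Rm in auto)
    have e2: "spp (ch a b') = {x \<in> ?J. pos x < pos t} \<union> {t} \<union> {x \<in> ?I. pos t < pos x}"
      by (rule char[OF sub sub sub mid(2)]) (use RL Lm Rm in auto)
    show ?thesis
      by (rule mixed_intermediate_set[OF I J h mid(3,4)]) (use n1[unfolded e1] n2[unfolded e2] that in auto)
  qed
qed

end

section \<open>The mesh category of diagonals\<close>

section \<open>Paths of pivoting moves modulo the mesh relations\<close>

lemma fvs_span_closed:
  assumes "\<And>f. f \<in> B \<Longrightarrow> L f" "L 0" "\<And>f g. L f \<Longrightarrow> L g \<Longrightarrow> L (f + g)" "\<And>c f. L f \<Longrightarrow> L (fscale c f)"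
    and "f \<in> fvs.span B"
  shows "L f"
proof -
  have "fvs.subspace {f. L f}"
    unfolding fvs.subspace_def using assms(2-4) by simp
  then have "fvs.span B \<subseteq> {f. L f}" using assms(1) by (intro fvs.span_minimal) auto
  then show ?thesis using assms(5) by blast
qed

lemma basis_sum:
  assumes "finite S" "\<And>p. f p \<noteq> 0 \<Longrightarrow> p \<in> S"
  shows "f = (\<Sum>p\<in>S. fscale (f p) (basis_vec p))"
proof
  fix q
  have "(\<Sum>p\<in>S. fscale (f p) (basis_vec p)) q = (\<Sum>p\<in>S. if q = p then f p else 0)"
    unfolding fscale_def basis_vec_def by (induction S rule: infinite_finite_induct) auto
  also have "\<dots> = f q" using assms by (auto simp: sum.delta)
  finally show "f q = (\<Sum>p\<in>S. fscale (f p) (basis_vec p)) q" by simp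
qed

lemma is_path_append:
  assumes "is_path E x y p" "is_path E y z q"
  shows "is_path E x z (p @ tl q)"
proof (cases "tl q")
  case Nil
  then have "q = [y]" using assms(2) by (cases q) (auto simp: is_path_def)
  then have "y = z" using assms(2) by (simp add: is_path_def)
  then show ?thesis using assms(1) Nil by simp
next
  case (Cons r rs)
  then have q: "q = y # r # rs" using assms(2) by (cases q) (auto simp: is_path_def)
  show ?thesis using assms unfolding q is_path_def by (auto simp: successively_append_iff)
qed

lemma is_path_split:
  assumes "is_path E x y p" "i < length p"
  shows "is_path E x (p ! i) (take (Suc i) p)" "is_path E (p ! i) y (drop i p)"
    "p = take (Suc i) p @ tl (drop i p)"
proof -
  have p: "p \<noteq> []" "hd p = x" "last p = y" "successively (\<lambda>u v. (u, v) \<in> E) p"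
    using assms by (auto simp: is_path_def)
  have "successively (\<lambda>u v. (u, v) \<in> E) (take (Suc i) p @ drop (Suc i) p)" using p by simp
  then have s1: "successively (\<lambda>u v. (u, v) \<in> E) (take (Suc i) p)" unfolding successively_append_iff by blast
  have "successively (\<lambda>u v. (u, v) \<in> E) (take i p @ drop i p)" using p by simp
  then have s2: "successively (\<lambda>u v. (u, v) \<in> E) (drop i p)" unfolding successively_append_iff by blast
  show "is_path E x (p ! i) (take (Suc i) p)"
    unfolding is_path_def using p s1 assms(2) by (auto simp: take_Suc_conv_app_nth hd_append hd_conv_nth)
  show "is_path E (p ! i) y (drop i p)"
    unfolding is_path_def using p s2 assms(2) by (auto simp: hd_drop_conv_nth)
  show "p = take (Suc i) p @ tl (drop i p)" by (simp add: tl_drop flip: drop_Suc)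
qed

context labelled_tri
begin

definition csupp :: "diag list \<Rightarrow> nat set" where
  "csupp p = {x \<in> {1..n}. \<forall>d\<in>set p. x \<in> spp d}"

text \<open>The scalar by which \<open>f\<close> acts at the vertex \<open>x\<close>: a path acts as
  one if all its diagonals cross \<open>\<tau> x\<close>, and as zero otherwise. By
  \<open>phi_kernel\<close> these scalars are a complete invariant modulo the mesh
  relations.\<close>

definition phi :: "'k::field comb \<Rightarrow> nat \<Rightarrow> 'k" where
  "phi f x = (\<Sum>p | f p \<noteq> 0. if x \<in> csupp p then f p else 0)"

abbreviation mpath :: "diag \<Rightarrow> diag \<Rightarrow> diag list \<Rightarrow> bool" where
  "mpath \<equiv> is_path (moves n \<tau>)"

abbreviation rels :: "diag \<Rightarrow> diag \<Rightarrow> 'k::field comb set" where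
  "rels \<equiv> mesh_relators n \<tau>"

lemma phi_superset:
  assumes "finite S" "\<And>p. f p \<noteq> 0 \<Longrightarrow> p \<in> S"
  shows "phi f x = (\<Sum>p\<in>S. if x \<in> csupp p then f p else 0)"
  unfolding phi_def by (rule sum.mono_neutral_left) (use assms in auto)

lemma phi_zero [simp]: "phi 0 x = 0"
  by (simp add: phi_def)

lemma phi_add:
  assumes "finite {p. f p \<noteq> 0}" "finite {p. g p \<noteq> 0}"
  shows "phi (f + g) x = phi f x + phi g x"
proof -
  let ?S = "{p. f p \<noteq> 0} \<union> {p. g p \<noteq> 0}"
  have "phi (f + g) x = (\<Sum>p\<in>?S. if x \<in> csupp p then (f + g) p else 0)"
    by (rule phi_superset) (use assms in auto)
  also have "\<dots> = (\<Sum>p\<in>?S. if x \<in> csupp p then f p else 0) + (\<Sum>p\<in>?S. if x \<in> csupp p then g p else 0)"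
    unfolding sum.distrib[symmetric] by (rule sum.cong) auto
  also have "\<dots> = phi f x + phi g x"
    using phi_superset[of ?S f x] phi_superset[of ?S g x] assms by simp
  finally show ?thesis .
qed

lemma phi_scale: "phi (fscale c f) x = c * phi f x"
proof (cases "c = 0")
  case False
  then have "{p. fscale c f p \<noteq> 0} = {p. f p \<noteq> 0}" by (auto simp: fscale_def)
  then show ?thesis unfolding phi_def sum_distrib_left by (auto simp: fscale_def intro: sum.cong)
qed (simp add: phi_def fscale_def)

lemma finite_support_add:
  fixes f g :: "'a \<Rightarrow> 'k::field"
  assumes "finite {p. f p \<noteq> 0}" "finite {p. g p \<noteq> 0}"
  shows "finite {p. (f + g) p \<noteq> 0}"
  by (rule finite_subset[of _ "{p. f p \<noteq> 0} \<union> {p. g p \<noteq> 0}"]) (use assms in auto)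

lemma finite_support_scale:
  fixes f :: "'a \<Rightarrow> 'k::field"
  assumes "finite {p. f p \<noteq> 0}"
  shows "finite {p. fscale c f p \<noteq> 0}"
  by (rule finite_subset[OF _ assms]) (auto simp: fscale_def)

lemma phi_diff:
  assumes "finite {p. f p \<noteq> 0}" "finite {p. g p \<noteq> 0}"
  shows "phi (f - g) x = phi f x - phi g x"
proof -
  have "f - g = f + fscale (-1) g" by (simp add: fun_eq_iff fscale_def)
  then have "phi (f - g) x = phi (f + fscale (-1) g) x" by (simp only:)
  also have "\<dots> = phi f x + (-1) * phi g x"
    unfolding phi_add[OF assms(1) finite_support_scale[OF assms(2)]] phi_scale ..
  finally show ?thesis by simp
qed

lemma finite_basis: "finite {q. basis_vec p q \<noteq> (0 :: 'k::field)}"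
  by (rule finite_subset[of _ "{p}"]) (auto simp: basis_vec_def)

lemma phi_basis: "phi (basis_vec p :: 'k::field comb) x = (if x \<in> csupp p then 1 else 0)"
proof -
  have "phi (basis_vec p :: 'k comb) x = (\<Sum>q\<in>{p}. if x \<in> csupp q then basis_vec p q else 0)"
    by (rule phi_superset) (auto simp: basis_vec_def split: if_splits)
  then show ?thesis by (simp add: basis_vec_def)
qed

lemma csupp_concat:
  assumes "mpath \<gamma> \<delta> p" "mpath \<delta> \<epsilon> q"
  shows "csupp (p @ tl q) = csupp p \<inter> csupp q"
proof -
  have pq: "p \<noteq> []" "last p = hd q" "q \<noteq> []" using assms by (auto simp: is_path_def)
  have "last p \<in> set p" using pq(1) by (rule last_in_set)
  with pq(2,3) have "set (p @ tl q) = set p \<union> set q" by (cases q) auto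
  then show ?thesis by (auto simp: csupp_def)
qed

text \<open>A label crossing the first and the last diagonal of a mesh has its ends beyond both
  moves, so it crosses the two middle diagonals as well. Crossed diagonals are free, so neither term
  of the relation is replaced by zero.\<close>

lemma mesh_crossing:
  assumes "free {v1, v2}" "x \<in> spp {v1, v2}" "x \<in> spp {nxt n v1, nxt n v2}"
  shows "x \<in> spp {v1, nxt n v2}" "x \<in> spp {nxt n v1, v2}" "free {v1, nxt n v2}" "free {nxt n v1, v2}"
proof -
  have v: "v1 < n + 3" "v2 < n + 3" "v1 \<noteq> v2"
    using assms(1) unfolding free_diagonal_def diagonal_def by (auto simp: doubleton_eq_iff)
  obtain a b where ab: "a < b" "b < a + N" "pvert n a = v1" "pvert n b = v2"
    using chord_window[OF v] by metis
  have g: "{v1, v2} = ch a b" "{nxt n v1, nxt n v2} = ch (a + 1) (b + 1)"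
    "{v1, nxt n v2} = ch a (b + 1)" "{nxt n v1, v2} = ch (a + 1) b"
    using ab nxt_pvert unfolding chord_def by metis+
  have bd: "a + 2 \<le> b" "b \<le> a + int n + 1" using free_chord_bounds[of a b] assms(1) g ab by auto
  obtain c d where cd: "a < c" "c < b" "b < d" "d < a + N" "\<tau> x = ch c d" and x: "x \<in> {1..n}"
    using assms(2) supp_chord[of a b x] ab g by auto
  have "x \<in> spp (ch (a + 1) (b + 1))" using assms(3) g by simp
  then have o: "a + 1 < c" "b + 1 < d"
    using supp_window[of "a + 1" "b + 1" x c d] ab cd x by auto
  show "x \<in> spp {v1, nxt n v2}" "x \<in> spp {nxt n v1, v2}"
    unfolding g using supp_crossed[of a c "b + 1" d x] supp_crossed[of "a + 1" c b d x] o cd x by auto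
  show "free {v1, nxt n v2}" "free {nxt n v1, v2}"
    unfolding g using crossed_free[of x c d a "b + 1"] crossed_free[of x c d "a + 1" b] o cd x by auto
qed

lemma phi_path_via:
  "phi (path_via n \<tau> p \<beta> q :: 'k::field comb) x = (if free \<beta> \<and> x \<in> csupp (p @ \<beta> # q) then 1 else 0)"
  by (simp add: path_via_def phi_basis)

lemma finite_path_via: "finite {r. path_via n \<tau> p \<beta> q r \<noteq> (0 :: 'k::field)}"
  using finite_basis by (auto simp: path_via_def)

text \<open>If one of the two paths contributes at \<open>x\<close>, then \<open>\<tau> x\<close>
  crosses both outer corners of the mesh, and by \<open>mesh_crossing\<close> the other path
  contributes the same.\<close>

lemma relator_phi:
  assumes "r \<in> (rels \<gamma> \<delta> :: 'k::field comb set)"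
  shows "finite {p. r p \<noteq> 0} \<and> phi r x = 0"
proof -
  obtain p q v1 v2 where r: "r = path_via n \<tau> p {v1, nxt n v2} q - path_via n \<tau> p {nxt n v1, v2} q"
    and f: "free {v1, v2}" and pq: "mpath \<gamma> {v1, v2} p" "mpath {nxt n v1, nxt n v2} \<delta> q"
    using assms unfolding mesh_relators_def by blast
  have "{v1, v2} \<in> set p" "{nxt n v1, nxt n v2} \<in> set q"
    using pq unfolding is_path_def by (metis last_in_set, metis hd_in_set)
  then have "x \<in> spp {v1, v2} \<and> x \<in> spp {nxt n v1, nxt n v2}" if "x \<in> csupp p" "x \<in> csupp q"
    using that by (auto simp: csupp_def)
  then have *: "free {v1, nxt n v2} \<and> x \<in> csupp (p @ {v1, nxt n v2} # q) \<longleftrightarrow>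
      free {nxt n v1, v2} \<and> x \<in> csupp (p @ {nxt n v1, v2} # q)"
    using mesh_crossing[OF f, of x] by (auto simp: csupp_def)
  have "phi r x = 0"
    unfolding r phi_diff[OF finite_path_via finite_path_via] phi_path_via using * by simp
  moreover have "finite {s. r s \<noteq> 0}"
    by (rule finite_subset[of _ "{s. path_via n \<tau> p {v1, nxt n v2} q s \<noteq> (0 :: 'k)} \<union>
        {s. path_via n \<tau> p {nxt n v1, v2} q s \<noteq> (0 :: 'k)}"]) (auto simp: r finite_path_via)
  ultimately show ?thesis by simp
qed

lemma span_phi:
  assumes "f \<in> fvs.span (rels \<gamma> \<delta> :: 'k::field comb set)"
  shows "phi f x = 0"
proof -
  have "finite {p. f p \<noteq> 0} \<and> phi f x = 0"
  proof (rule fvs_span_closed[OF _ _ _ _ assms])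
    show "finite {p. f p \<noteq> 0} \<and> phi f x = 0" if "f \<in> rels \<gamma> \<delta>" for f :: "'k comb"
      using relator_phi[OF that] .
    show "finite {p. (0 :: 'k comb) p \<noteq> 0} \<and> phi (0 :: 'k comb) x = 0"
      unfolding phi_zero by simp
    show "finite {p. (f + g) p \<noteq> 0} \<and> phi (f + g) x = 0"
      if "finite {p. f p \<noteq> 0} \<and> phi f x = 0" "finite {p. g p \<noteq> 0} \<and> phi g x = 0" for f g :: "'k comb"
      using that phi_add[of f g x] finite_support_add[of f g] by (simp only: add_0_left)
    show "finite {p. fscale c f p \<noteq> 0} \<and> phi (fscale c f) x = 0"
      if "finite {p. f p \<noteq> 0} \<and> phi f x = 0" for f :: "'k comb" and c
      using that phi_scale[of c f x] finite_support_scale[of f c] by simp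
  qed
  then show ?thesis by simp
qed

text \<open>The letter \<open>True\<close> advances the first end and \<open>False\<close> the
  second. The cells need not be free: a word may run through boundary edges and members of
  \<open>T\<close>.\<close>

primrec dpath :: "int \<Rightarrow> int \<Rightarrow> bool list \<Rightarrow> diag list" where
  "dpath a b [] = [ch a b]"
| "dpath a b (s # w) = ch a b # (if s then dpath (a + 1) b w else dpath a (b + 1) w)"

abbreviation cT :: "bool list \<Rightarrow> int" where "cT w \<equiv> int (count_list w True)"
abbreviation cF :: "bool list \<Rightarrow> int" where "cF w \<equiv> int (count_list w False)"

lemma dpath_hd [simp]: "hd (dpath a b w) = ch a b" "dpath a b w \<noteq> []"
  by (cases w; simp)+

lemma dpath_last: "last (dpath a b w) = ch (a + cT w) (b + cF w)"
  by (induction w arbitrary: a b) (auto simp: algebra_simps)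

lemma dpath_length: "length (dpath a b w) = Suc (length w)"
  by (induction w arbitrary: a b) auto

lemma length_counts: "int (length w) = cT w + cF w"
  by (induction w) auto

lemma dpath_append: "dpath a b (u @ v) = dpath a b u @ tl (dpath (a + cT u) (b + cF u) v)"
proof (induction u arbitrary: a b)
  case Nil
  then show ?case by (cases v) auto
qed (auto simp: algebra_simps)

lemma dpath_append_Cons:
  "dpath a b (u @ s # v) = dpath a b u @ (if s then dpath (a + cT u + 1) (b + cF u) v else dpath (a + cT u) (b + cF u + 1) v)"
  by (simp add: dpath_append)

lemma dpath_cells:
  assumes "d \<in> set (dpath a b w)"
  obtains i j where "d = ch i j" "a \<le> i" "i \<le> a + cT w" "b \<le> j" "j \<le> b + cF w"
proof -
  have "\<exists>i j. d = ch i j \<and> a \<le> i \<and> i \<le> a + cT w \<and> b \<le> j \<and> j \<le> b + cF w"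
    using assms
  proof (induction w arbitrary: a b)
    case (Cons s w)
    show ?case
    proof (cases "d = ch a b")
      case False
      then have "d \<in> set (dpath (if s then a + 1 else a) (if s then b else b + 1) w)"
        using Cons.prems by (auto split: if_splits)
      from Cons.IH[OF this] show ?thesis by (cases s) fastforce+
    qed fastforce
  qed auto
  then show ?thesis using that by blast
qed

lemma moves_chord:
  assumes "(ch a b, e) \<in> moves n \<tau>"
  shows "e = ch (a + 1) b \<or> e = ch a (b + 1)"
proof -
  obtain v w where "ch a b = {v, w}" "e = {v, nxt n w}"
    using assms unfolding moves_def pivot_move_def by blast
  then have "e = {pvert n a, nxt n (pvert n b)} \<or> e = {pvert n b, nxt n (pvert n a)}"
    unfolding chord_def by (auto simp: doubleton_eq_iff)
  then show ?thesis unfolding nxt_pvert chord_def by (auto simp: insert_commute)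
qed

lemma moves_free: "(d, e) \<in> moves n \<tau> \<Longrightarrow> free d \<and> free e"
  unfolding moves_def pivot_move_def by blast

lemma mpath_free:
  assumes "mpath \<gamma> \<delta> p" "free \<gamma>" "d \<in> set p"
  shows "free d"
  using assms
proof (induction p arbitrary: \<gamma>)
  case (Cons c p)
  show ?case
  proof (cases p)
    case Nil
    then show ?thesis using Cons.prems by (auto simp: is_path_def)
  next
    case (Cons e q)
    then have "mpath e \<delta> p" "(\<gamma>, e) \<in> moves n \<tau>" "c = \<gamma>" using Cons.prems(1) by (auto simp: is_path_def)
    then show ?thesis using Cons.IH[of e] Cons.prems moves_free by auto
  qed
qed (simp add: is_path_def)

lemma path_word:
  assumes "mpath (ch a b) \<delta> p"
  obtains w where "p = dpath a b w" "\<delta> = ch (a + cT w) (b + cF w)"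
proof -
  have "\<exists>w. p = dpath a b w"
    using assms
  proof (induction p arbitrary: a b)
    case (Cons c p)
    have c: "c = ch a b" using Cons.prems by (simp add: is_path_def)
    show ?case
    proof (cases p)
      case Nil
      then show ?thesis using c by (intro exI[of _ "[]"]) simp
    next
      case (Cons e q)
      then have p: "mpath e \<delta> p" "(ch a b, e) \<in> moves n \<tau>" using Cons.prems(1) c by (auto simp: is_path_def)
      from moves_chord[OF p(2)] show ?thesis
      proof
        assume e: "e = ch (a + 1) b"
        obtain w where "p = dpath (a + 1) b w" using Cons.IH p(1) e by blast
        then show ?thesis using c by (intro exI[of _ "True # w"]) simp
      next
        assume e: "e = ch a (b + 1)"
        obtain w where "p = dpath a (b + 1) w" using Cons.IH p(1) e by blast
        then show ?thesis using c by (intro exI[of _ "False # w"]) simp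
      qed
    qed
  qed (simp add: is_path_def)
  then obtain w where w: "p = dpath a b w" by blast
  then have "\<delta> = ch (a + cT w) (b + cF w)" using assms dpath_last by (simp add: is_path_def)
  then show ?thesis using that w by blast
qed

lemma chord_move:
  assumes "free (ch a b)"
  shows "free (ch (a + 1) b) \<Longrightarrow> pivot_move n \<tau> (pvert n b) (ch a b) (ch (a + 1) b)"
    "free (ch a (b + 1)) \<Longrightarrow> pivot_move n \<tau> (pvert n a) (ch a b) (ch a (b + 1))"
  using assms nxt_pvert[of n a] nxt_pvert[of n b] unfolding pivot_move_def chord_def by (auto simp: insert_commute)

lemma word_path:
  assumes "\<forall>d\<in>set (dpath a b w). free d"
  shows "mpath (ch a b) (ch (a + cT w) (b + cF w)) (dpath a b w)"
  using assms
proof (induction w arbitrary: a b)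
  case (Cons s w)
  have f: "free (ch a b)" using Cons.prems by simp
  let ?a = "if s then a + 1 else a" and ?b = "if s then b else b + 1"
  have IH: "mpath (ch ?a ?b) (ch (a + cT (s # w)) (b + cF (s # w))) (dpath ?a ?b w)"
    using Cons.IH[of ?a ?b] Cons.prems by (cases s) (auto simp: algebra_simps)
  have "ch ?a ?b \<in> set (dpath ?a ?b w)" by (metis dpath_hd hd_in_set)
  then have "free (ch ?a ?b)" using Cons.prems by (cases s) auto
  then have "(ch a b, ch ?a ?b) \<in> moves n \<tau>"
    using chord_move[OF f] unfolding moves_def by (cases s) auto
  moreover have e: "dpath a b (s # w) = ch a b # dpath ?a ?b w" by simp
  ultimately show ?case
    using IH unfolding e is_path_def by (cases "dpath ?a ?b w") auto
qed (simp add: is_path_def)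

text \<open>Words that leave the free diagonals have value zero. This agrees with the convention in
  the mesh relations and makes the exchange of adjacent letters valid without exception.\<close>

definition wval :: "int \<Rightarrow> int \<Rightarrow> bool list \<Rightarrow> 'k::field comb" where
  "wval a b w = (if \<forall>d\<in>set (dpath a b w). free d then basis_vec (dpath a b w) else 0)"

text \<open>Exchanging two letters passes to the other middle term of one mesh. If a cell of the
  common part is not free, both values vanish.\<close>

lemma wval_swap:
  "wval a b (u @ True # False # v) - wval a b (u @ False # True # v) \<in>
     fvs.span (rels (ch a b) (ch (a + cT u + 1 + cT v) (b + cF u + 1 + cF v)) :: 'k::field comb set)"
proof -
  define i where "i = a + cT u"
  define j where "j = b + cF u"
  let ?p = "dpath a b u" and ?q = "dpath (i + 1) (j + 1) v"
  have d: "dpath a b (u @ True # False # v) = ?p @ ch (i + 1) j # ?q"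
    "dpath a b (u @ False # True # v) = ?p @ ch i (j + 1) # ?q"
    by (simp_all add: dpath_append_Cons i_def j_def add.assoc add.commute)
  show ?thesis
  proof (cases "(\<forall>d\<in>set ?p. free d) \<and> (\<forall>d\<in>set ?q. free d)")
    case True
    have v: "wval a b (u @ True # False # v) = (path_via n \<tau> ?p (ch (i + 1) j) ?q :: 'k comb)"
      "wval a b (u @ False # True # v) = (path_via n \<tau> ?p (ch i (j + 1)) ?q :: 'k comb)"
      unfolding wval_def d path_via_def using True by auto
    have last: "ch i j \<in> set ?p" using dpath_last[of a b u] last_in_set[of ?p] by (simp add: i_def j_def)
    have hd: "ch (i + 1) (j + 1) \<in> set ?q" by (metis dpath_hd hd_in_set)
    have c: "{pvert n j, nxt n (pvert n i)} = ch (i + 1) j" "{nxt n (pvert n j), pvert n i} = ch i (j + 1)"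
      "{pvert n j, pvert n i} = ch i j" "{nxt n (pvert n j), nxt n (pvert n i)} = ch (i + 1) (j + 1)"
      unfolding nxt_pvert chord_def by auto
    have p1: "mpath (ch a b) (ch i j) ?p" unfolding i_def j_def using True by (intro word_path) auto
    have p2: "mpath (ch (i + 1) (j + 1)) (ch (a + cT u + 1 + cT v) (b + cF u + 1 + cF v)) ?q"
      using word_path[of "i + 1" "j + 1" v] True by (simp add: i_def j_def)
    have "path_via n \<tau> ?p (ch (i + 1) j) ?q - path_via n \<tau> ?p (ch i (j + 1)) ?q
        \<in> (rels (ch a b) (ch (a + cT u + 1 + cT v) (b + cF u + 1 + cF v)) :: 'k comb set)"
      unfolding mesh_relators_def
      by (rule CollectI, intro exI[of _ ?p] exI[of _ ?q] exI[of _ "pvert n j"] exI[of _ "pvert n i"])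
        (use c p1 p2 True last hd in auto)
    then show ?thesis unfolding v by (rule fvs.span_base)
  next
    case False
    then have "wval a b (u @ True # False # v) = (0 :: 'k comb)" "wval a b (u @ False # True # v) = (0 :: 'k comb)"
      unfolding wval_def d by auto
    then show ?thesis using fvs.span_zero by simp
  qed
qed

text \<open>Adjacent exchanges generate all rearrangements. The prefix \<open>u\<close> is carried
  along so that the induction can work behind letters on which the words already agree.\<close>

lemma wval_permute:
  assumes "count_list w True = count_list w' True" "count_list w False = count_list w' False"
  shows "wval a b (u @ w) - wval a b (u @ w') \<in>
     fvs.span (rels (ch a b) (ch (a + cT u + cT w) (b + cF u + cF w)) :: 'k::field comb set)"
  using assms
proof (induction "length w" arbitrary: u w w')
  case 0
  then have "w = []" by simp
  moreover have "length w' = 0" using 0 length_counts[of w] length_counts[of w'] by simp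
  ultimately show ?case using fvs.span_zero by (simp only: length_0_conv diff_self)
next
  case (Suc k)
  have l: "length w = length w'" using length_counts[of w] length_counts[of w'] Suc.prems by simp
  obtain s v s' v' where w: "w = s # v" "w' = s' # v'" using Suc.hyps(2) l by (metis Suc_length_conv)
  let ?U = "fvs.span (rels (ch a b) (ch (a + cT u + cT w) (b + cF u + cF w)) :: 'k comb set)"
  have step: "wval a b (u @ t # x) - wval a b (u @ t # y) \<in> ?U"
    if "length x = k" "count_list (t # x) True = count_list w True" "count_list (t # x) False = count_list w False"
      "count_list y True = count_list x True" "count_list y False = count_list x False" for t x y
  proof -
    have e: "a + cT (u @ [t]) + cT x = a + cT u + cT w" "b + cF (u @ [t]) + cF x = b + cF u + cF w"
      unfolding that(2,3)[symmetric] by simp_all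
    have "wval a b ((u @ [t]) @ x) - wval a b ((u @ [t]) @ y) \<in> ?U"
      using Suc.hyps(1)[of x y "u @ [t]"] that unfolding e by simp
    then show ?thesis by simp
  qed
  have lv: "length v = k" "length v' = k" using w l Suc.hyps(2) by auto
  have trans: "x - z \<in> ?U" if "x - y \<in> ?U" "y - z \<in> ?U" for x y z :: "'k comb"
    using fvs.span_add[OF that] by simp
  have sym: "y - x \<in> ?U" if "x - y \<in> ?U" for x y :: "'k comb"
    using fvs.span_neg[OF that] by simp
  show ?case
  proof (cases "s = s'")
    case True
    then show ?thesis using step[of v s v'] lv w Suc.prems by (cases s) auto
  next
    case False
    text \<open>Bring the other letter to the second place of both words.\<close>
    define x where "x = remove1 s' v"
    define y where "y = remove1 s v'"
    have "count_list v s' > 0" "count_list v' s > 0"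
      using w Suc.prems False by (cases s; cases s'; auto)+
    then have cx: "\<And>t. count_list v t = count_list (s' # x) t" "\<And>t. count_list v' t = count_list (s # y) t"
      unfolding x_def y_def by (auto simp: count_list_remove1)
    have lx: "length (s' # x) = k" using lv cx length_counts[of v] length_counts[of "s' # x"] by simp
    have ly: "length (s # y) = k" using lv cx length_counts[of v'] length_counts[of "s # y"] by simp
    have cxy: "count_list x t = count_list y t" for t
      using cx[of t] Suc.prems w False by (cases t; cases s; cases s') auto
    have e: "length x = length y" using lx ly by simp
    have 1: "wval a b (u @ s # v) - wval a b (u @ s # s' # x) \<in> ?U"
      using step[of v s "s' # x"] lv w cx by auto
    have 2: "wval a b (u @ s' # s # y) - wval a b (u @ s' # v') \<in> ?U"
      using sym[OF step[of v' s' "s # y"]] lv w cx Suc.prems by auto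
    have 3: "wval a b (u @ s' # s # x) - wval a b (u @ s' # s # y) \<in> ?U"
      using step[of "s # x" s' "s # y"] lx cx cxy w Suc.prems False by (cases s; cases s') auto
    have ex: "a + cT u + 1 + cT x = a + cT u + cT w" "b + cF u + 1 + cF x = b + cF u + cF w"
      using cx w False by (cases s; cases s'; simp)+
    have 4: "wval a b (u @ s # s' # x) - wval a b (u @ s' # s # x) \<in> ?U"
      using wval_swap[of a b u x] sym[of "wval a b (u @ True # False # x)" "wval a b (u @ False # True # x)"] False
      unfolding ex by (cases s; cases s') auto
    show ?thesis unfolding w using trans[OF trans[OF 1 4] trans[OF 3 2]] w by simp
  qed
qed

end

context labelled_tri
begin

lemma free_not_edge: "free d \<Longrightarrow> \<not> edge d"
  by (auto simp: free_diagonal_def edge_def diagonal_def)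

definition rect_word :: "nat \<Rightarrow> nat \<Rightarrow> bool list" where
  "rect_word l r = replicate l True @ replicate r False"

lemma count_rect [simp]: "count_list (rect_word l r) True = l" "count_list (rect_word l r) False = r"
proof -
  have *: "count_list (replicate l s) t = (if s = t then l else 0)" for l and s t :: bool
    by (induction l) auto
  show "count_list (rect_word l r) True = l" "count_list (rect_word l r) False = r"
    by (simp_all add: rect_word_def *)
qed

lemma crossed_dpath:
  assumes "x \<in> {1..n}" "\<tau> x = ch c d" "a + cT w < c" "c < b" "b + cF w < d" "d < a + N" "e \<in> set (dpath a b w)"
  shows "x \<in> spp e" "free e"
proof -
  obtain i j where ij: "e = ch i j" "a \<le> i" "i \<le> a + cT w" "b \<le> j" "j \<le> b + cF w"
    using assms(7) by (rule dpath_cells)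
  then have o: "i < c" "c < j" "j < d" "d < i + N" using assms by auto
  show "x \<in> spp e" using supp_crossed[OF o assms(1,2)] ij by simp
  show "free e" using crossed_free[OF assms(1,2) o] ij by simp
qed

lemma crossed_word_path:
  assumes "x \<in> {1..n}" "\<tau> x = ch c d" "a + cT w < c" "c < b" "b + cF w < d" "d < a + N"
  shows "mpath (ch a b) (ch (a + cT w) (b + cF w)) (dpath a b w)" "x \<in> csupp (dpath a b w)"
proof -
  show "mpath (ch a b) (ch (a + cT w) (b + cF w)) (dpath a b w)"
    using crossed_dpath(2)[OF assms] by (intro word_path) blast
  show "x \<in> csupp (dpath a b w)"
    using crossed_dpath(1)[OF assms] assms(1) unfolding csupp_def by blast
qed

text \<open>Rearranging the word does not change the class, so one arrangement through a cell that
  is not free suffices. If there were none, the whole rectangle would be free, and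
  \<open>hex_edge\<close> would give a label crossing all of it, against the empty
  \<open>csupp\<close>.\<close>

lemma zero_path:
  assumes f: "free \<gamma>" and p: "mpath \<gamma> \<delta> p" and e: "csupp p = {}"
  shows "(basis_vec p :: 'k::field comb) \<in> fvs.span (rels \<gamma> \<delta>)"
proof -
  obtain a b where g: "\<gamma> = ch a b" "a + 2 \<le> b" "b \<le> a + int n + 1" by (rule free_chordE[OF f])
  obtain w where w: "p = dpath a b w" "\<delta> = ch (a + cT w) (b + cF w)" using path_word p g by blast
  have fr: "\<forall>d\<in>set (dpath a b w). free d" using mpath_free[OF p f] w by blast
  define a' where "a' = a + cT w"
  define b' where "b' = b + cF w"
  have "\<exists>w'. count_list w' True = count_list w True \<and> count_list w' False = count_list w False \<and>
      (\<exists>d\<in>set (dpath a b w'). \<not> free d)"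
  proof (rule ccontr)
    assume "\<not> ?thesis"
    then have all: "free d" if "count_list w' True = count_list w True" "count_list w' False = count_list w False"
      "d \<in> set (dpath a b w')" for w' d using that by blast
    have cell: "free (ch i j)" if ij: "a \<le> i" "i \<le> a'" "b \<le> j" "j \<le> b'" for i j
    proof -
      \<comment> \<open>\<open>u\<close> leads to the cell \<open>(i, j)\<close> and
        \<open>v\<close> from there to the far corner; together they rearrange
        \<open>w\<close>.\<close>
      define u where "u = rect_word (nat (i - a)) (nat (j - b))"
      define v where "v = rect_word (nat (a' - i)) (nat (b' - j))"
      have c: "a + cT u = i" "b + cF u = j" using ij by (auto simp: u_def)
      have "last (dpath a b u) = ch i j" using dpath_last[of a b u] c by simp
      then have "ch i j \<in> set (dpath a b u)" using last_in_set[of "dpath a b u"] by simp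
      then have "ch i j \<in> set (dpath a b (u @ v))" unfolding dpath_append by simp
      moreover have "count_list (u @ v) True = count_list w True" "count_list (u @ v) False = count_list w False"
        using ij by (auto simp: u_def v_def a'_def b'_def)
      ultimately show ?thesis using all by blast
    qed
    have ab: "a \<le> a'" "b \<le> b'" by (auto simp: a'_def b'_def)
    \<comment> \<open>Otherwise the rectangle contains the boundary edge from \<open>b - 1\<close>
      to \<open>b\<close>; \<open>o2\<close> treats the edge closing the polygon at \<open>a\<close>
      in the same way.\<close>
    have o1: "a' + 2 \<le> b"
    proof (rule ccontr)
      assume "\<not> a' + 2 \<le> b"
      then have "free (ch (b - 1) b)" using cell[of "b - 1" b] g ab by auto
      then show False using free_chord_bounds[of "b - 1" b] by auto
    qed
    have o2: "b' + 2 \<le> a + N"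
    proof (rule ccontr)
      assume "\<not> b' + 2 \<le> a + N"
      then have "free (ch a (a + int n + 2))" using cell[of a "a + int n + 2"] g ab by auto
      then show False using free_chord_bounds[of a "a + int n + 2"] by auto
    qed
    obtain c d where cd: "a' < c" "c < b" "b' < d" "d < a + N" "ch c d \<in> T"
      using hex_edge[OF ab(1) o1 ab(2) o2] cell free_not_edge by metis
    obtain x where x: "x \<in> {1..n}" "\<tau> x = ch c d" using cd(5) by (metis imageE)
    have "x \<in> csupp p"
      unfolding w(1) by (rule crossed_word_path(2)[OF x]) (use cd in \<open>auto simp: a'_def b'_def\<close>)
    then show False using e by simp
  qed
  then obtain w' where w': "count_list w' True = count_list w True" "count_list w' False = count_list w False"
    "\<exists>d\<in>set (dpath a b w'). \<not> free d" by blast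
  have "wval a b ([] @ w) - wval a b ([] @ w') \<in> fvs.span (rels (ch a b) (ch (a + cT [] + cT w) (b + cF [] + cF w)) :: 'k comb set)"
    by (rule wval_permute) (use w' in auto)
  moreover have "wval a b w' = (0 :: 'k comb)" unfolding wval_def using w'(3) by auto
  moreover have "wval a b w = (basis_vec p :: 'k comb)" unfolding wval_def w(1) using fr by simp
  ultimately show ?thesis using g w by (simp only: diff_zero append_Nil count_list.simps of_nat_0 add_0_right)
qed

text \<open>Every diagonal on the path crosses \<open>\<tau> x\<close>, so a moving end can never
  step onto or past the end of \<open>\<tau> x\<close> in front of it.\<close>

lemma csupp_bound:
  assumes "x \<in> csupp (dpath a b w)" "\<tau> x = ch c d" "a < c" "c < b" "b < d" "d < a + N"
  shows "a + cT w < c" "b + cF w < d"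
proof -
  have "a + cT w < c \<and> b + cF w < d"
    using assms
  proof (induction w arbitrary: a b)
    case (Cons s w)
    have x: "x \<in> {1..n}" using Cons.prems(1) by (simp add: csupp_def)
    show ?case
    proof (cases s)
      case True
      then have "x \<in> csupp (dpath (a + 1) b w)" using Cons.prems(1) by (auto simp: csupp_def)
      moreover from this have "x \<in> spp (ch (a + 1) b)"
        unfolding csupp_def using hd_in_set[of "dpath (a + 1) b w"] by simp
      then have "a + 1 < c" using supp_window[of "a + 1" b x c d] Cons.prems x by auto
      ultimately have "a + 1 + cT w < c \<and> b + cF w < d" using Cons.IH[of "a + 1" b] Cons.prems by auto
      then show ?thesis using True by simp
    next
      case False
      then have "x \<in> csupp (dpath a (b + 1) w)" using Cons.prems(1) by (auto simp: csupp_def)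
      moreover from this have "x \<in> spp (ch a (b + 1))"
        unfolding csupp_def using hd_in_set[of "dpath a (b + 1) w"] by simp
      then have "b + 1 < d" using supp_window[of a "b + 1" x c d] Cons.prems x by auto
      ultimately have "a + cT w < c \<and> b + 1 + cF w < d" using Cons.IH[of a "b + 1"] Cons.prems by auto
      then show ?thesis using False by simp
    qed
  qed auto
  then show "a + cT w < c" "b + cF w < d" by auto
qed

lemma nonzero_pathE:
  assumes f: "free (ch a b)" and ab: "a < b" "b < a + N" and p: "mpath (ch a b) \<delta> p" and e: "x \<in> csupp p"
  obtains w c d where "p = dpath a b w" "\<delta> = ch (a + cT w) (b + cF w)" "x \<in> {1..n}" "\<tau> x = ch c d"
    "a + cT w < c" "c < b" "b + cF w < d" "d < a + N"
proof -
  obtain w where w: "p = dpath a b w" "\<delta> = ch (a + cT w) (b + cF w)" using path_word p by blast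
  have "ch a b \<in> set p" using p unfolding is_path_def by (metis hd_in_set)
  then have x: "x \<in> {1..n}" "x \<in> spp (ch a b)" using e by (auto simp: csupp_def)
  obtain c d where cd: "a < c" "c < b" "b < d" "d < a + N" "\<tau> x = ch c d"
    using x(2) supp_chord[OF ab, of x] by blast
  show ?thesis
    using that[OF w x(1) cd(5) _ cd(2) _ cd(4)] csupp_bound[of x a b w c d] e cd w by auto
qed

text \<open>The labels crossing the paths bound how far the ends move, so the common target has the
  same lift for both words. Equal lifts mean equal letter counts, and \<open>wval_permute\<close>
  applies.\<close>

lemma equal_path:
  assumes f: "free \<gamma>" and p: "mpath \<gamma> \<delta> p" "csupp p \<noteq> {}" and q: "mpath \<gamma> \<delta> q" "csupp q \<noteq> {}"
  shows "(basis_vec p - basis_vec q :: 'k::field comb) \<in> fvs.span (rels \<gamma> \<delta>)"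
proof -
  obtain a b where g: "\<gamma> = ch a b" "a + 2 \<le> b" "b \<le> a + int n + 1" by (rule free_chordE[OF f])
  have ab: "a < b" "b < a + N" using g by auto
  obtain x where x: "x \<in> csupp p" using p by blast
  obtain y where y: "y \<in> csupp q" using q by blast
  from nonzero_pathE[OF f[unfolded g(1)] ab p(1)[unfolded g(1)] x]
  obtain w c d where w: "p = dpath a b w" "\<delta> = ch (a + cT w) (b + cF w)" "a + cT w < c" "c < b" "b + cF w < d" "d < a + N"
    by metis
  from nonzero_pathE[OF f[unfolded g(1)] ab q(1)[unfolded g(1)] y]
  obtain w' c' d' where w': "q = dpath a b w'" "\<delta> = ch (a + cT w') (b + cF w')" "a + cT w' < c'" "c' < b"
    "b + cF w' < d'" "d' < a + N" by metis
  have "ch (a + cT w) (b + cF w) = ch (a + cT w') (b + cF w')" using w w' by simp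
  then have c: "cT w = cT w'" "cF w = cF w'"
  proof -
    have e: "pvert n (a + cT w) \<in> ch (a + cT w') (b + cF w')" "pvert n (b + cF w) \<in> ch (a + cT w') (b + cF w')"
      using w w' by (auto simp: chord_def)
    have "a + cT w \<noteq> b + cF w'" "b + cF w \<noteq> a + cT w'" using w w' by auto
    then have "pvert n (a + cT w) \<noteq> pvert n (b + cF w')" "pvert n (b + cF w) \<noteq> pvert n (a + cT w')"
      using pvert_inj[of n "a + cT w" "b + cF w'"] pvert_inj[of n "b + cF w" "a + cT w'"] w w' by auto
    then have "pvert n (a + cT w) = pvert n (a + cT w')" "pvert n (b + cF w) = pvert n (b + cF w')"
      using e by (auto simp: chord_def)
    then show "cT w = cT w'" "cF w = cF w'"
      using pvert_inj[of n "a + cT w" "a + cT w'"] pvert_inj[of n "b + cF w" "b + cF w'"] w w' ab by auto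
  qed
  have fr: "\<forall>d\<in>set (dpath a b w). free d" "\<forall>d\<in>set (dpath a b w'). free d"
    using mpath_free[OF p(1) f] mpath_free[OF q(1) f] w w' by blast+
  have "wval a b ([] @ w) - wval a b ([] @ w') \<in> fvs.span (rels (ch a b) (ch (a + cT [] + cT w) (b + cF [] + cF w)) :: 'k comb set)"
    by (rule wval_permute) (use c in auto)
  moreover have "wval a b w' = (basis_vec q :: 'k comb)" unfolding wval_def w'(1) using fr by simp
  moreover have "wval a b w = (basis_vec p :: 'k comb)" unfolding wval_def w(1) using fr by simp
  ultimately show ?thesis using g w by (simp only: append_Nil count_list.simps of_nat_0 add_0_right)
qed

text \<open>A label crossing both ends of a nonzero path has one lift fitting both, by
  \<open>both_crossed\<close>, and then crosses the whole rectangle in which the path runs.\<close>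

lemma csupp_inter:
  assumes f: "free \<gamma>" and p: "mpath \<gamma> \<delta> p" "csupp p \<noteq> {}"
  shows "csupp p = spp \<gamma> \<inter> spp \<delta>"
proof -
  obtain a b where g: "\<gamma> = ch a b" "a + 2 \<le> b" "b \<le> a + int n + 1" by (rule free_chordE[OF f])
  have ab: "a < b" "b < a + N" using g by auto
  obtain z where z: "z \<in> csupp p" using p by blast
  from nonzero_pathE[OF f[unfolded g(1)] ab p(1)[unfolded g(1)] z]
  obtain w c d where w: "p = dpath a b w" "\<delta> = ch (a + cT w) (b + cF w)" "z \<in> {1..n}" "\<tau> z = ch c d"
    "a + cT w < c" "c < b" "b + cF w < d" "d < a + N" by metis
  have "x \<in> csupp p" if x: "x \<in> spp \<gamma>" "x \<in> spp \<delta>" for x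
  proof -
    have "a \<le> a + cT w" "b \<le> b + cF w" by auto
    then obtain e f where ef: "a + cT w < e" "e < b" "b + cF w < f" "f < a + N" "\<tau> x = ch e f"
      using both_crossed[of a "a + cT w" b "b + cF w" c d z x] w x g by metis
    have "x \<in> {1..n}" using x supp_subset by blast
    then show ?thesis using crossed_word_path(2)[of x e f a w b] ef w by simp
  qed
  moreover have "\<gamma> \<in> set p" "\<delta> \<in> set p" using p unfolding is_path_def by (metis hd_in_set, metis last_in_set)
  then have "csupp p \<subseteq> spp \<gamma> \<inter> spp \<delta>" by (auto simp: csupp_def)
  ultimately show ?thesis by blast
qed

text \<open>Both conditions amount to lifts whose ends move forward, with a label crossing the
  rectangle. In such a position any word filling the rectangle is a nonzero path.\<close>

lemma thin_hom_path:
  assumes "free \<gamma>" "free \<delta>"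
  shows "(\<exists>p. mpath \<gamma> \<delta> p \<and> csupp p \<noteq> {}) \<longleftrightarrow> thin_hom Qv (spp \<gamma>) (spp \<delta>)"
proof
  assume "\<exists>p. mpath \<gamma> \<delta> p \<and> csupp p \<noteq> {}"
  then obtain p z where p: "mpath \<gamma> \<delta> p" "z \<in> csupp p" by blast
  obtain a b where g: "\<gamma> = ch a b" "a + 2 \<le> b" "b \<le> a + int n + 1" by (rule free_chordE[OF assms(1)])
  have ab: "a < b" "b < a + N" using g by auto
  from nonzero_pathE[OF assms(1)[unfolded g(1)] ab p(1)[unfolded g(1)] p(2)]
  obtain w c d where w: "p = dpath a b w" "\<delta> = ch (a + cT w) (b + cF w)" "z \<in> {1..n}" "\<tau> z = ch c d"
    "a + cT w < c" "c < b" "b + cF w < d" "d < a + N" by metis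
  show "thin_hom Qv (spp \<gamma>) (spp \<delta>)"
    unfolding g(1) w(2) by (rule thin_hom_forward[of a _ b _ c d z]) (use w in auto)
next
  assume h: "thin_hom Qv (spp \<gamma>) (spp \<delta>)"
  from thin_homE[OF assms h] obtain a b a' b' c d z where
    o: "\<gamma> = ch a b" "\<delta> = ch a' b'" "a \<le> a'" "b \<le> b'" "a' < c" "c < b" "b' < d" "d < a + N"
    "z \<in> {1..n}" "\<tau> z = ch c d" by metis
  define w where "w = rect_word (nat (a' - a)) (nat (b' - b))"
  have e: "a + cT w = a'" "b + cF w = b'" using o by (auto simp: w_def)
  have "mpath \<gamma> \<delta> (dpath a b w) \<and> z \<in> csupp (dpath a b w)"
    using crossed_word_path[OF o(9,10), of a w b] o e by simp
  then show "\<exists>p. mpath \<gamma> \<delta> p \<and> csupp p \<noteq> {}" by blast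
qed

text \<open>Paths with empty \<open>csupp\<close> vanish and all others with the same ends agree, so
  the space of morphisms between two diagonals is at most one-dimensional.\<close>

lemma normal_form:
  fixes f :: "'k::field comb"
  assumes fr: "free \<gamma>" and f: "f \<in> path_comb n \<tau> \<gamma> \<delta>"
  shows "f \<in> fvs.span (rels \<gamma> \<delta>) \<or>
    (\<exists>p c. mpath \<gamma> \<delta> p \<and> csupp p \<noteq> {} \<and> f - fscale c (basis_vec p) \<in> fvs.span (rels \<gamma> \<delta>))"
proof -
  define S where "S = {p. f p \<noteq> 0}"
  have fin: "finite S" and pa: "\<And>p. p \<in> S \<Longrightarrow> mpath \<gamma> \<delta> p" using f by (auto simp: S_def path_comb_def)
  have fs: "f = (\<Sum>p\<in>S. fscale (f p) (basis_vec p))" by (rule basis_sum[OF fin]) (simp add: S_def)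
  let ?U = "fvs.span (rels \<gamma> \<delta>) :: 'k comb set"
  show ?thesis
  proof (cases "\<exists>p. mpath \<gamma> \<delta> p \<and> csupp p \<noteq> {}")
    case False
    then have "fscale (f p) (basis_vec p) \<in> ?U" if "p \<in> S" for p
      using zero_path[OF fr pa[OF that]] pa[OF that] by (blast intro: fvs.span_scale)
    then have "(\<Sum>p\<in>S. fscale (f p) (basis_vec p)) \<in> ?U" by (rule fvs.span_sum)
    then show ?thesis using fs by simp
  next
    case True
    then obtain p0 where p0: "mpath \<gamma> \<delta> p0" "csupp p0 \<noteq> {}" by blast
    define c where "c p = (if csupp p \<noteq> {} then f p else 0)" for p
    have "fscale (f p) (basis_vec p) - fscale (c p) (basis_vec p0) \<in> ?U" if "p \<in> S" for p
    proof (cases "csupp p = {}")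
      case True
      have "fscale (c p) (basis_vec p0) = (0 :: 'k comb)" using True by (simp add: c_def)
      then show ?thesis using fvs.span_scale[OF zero_path[OF fr pa[OF that] True]] by (simp only: diff_zero)
    next
      case False
      have "fscale (f p) (basis_vec p) - fscale (c p) (basis_vec p0) = fscale (f p) (basis_vec p - basis_vec p0 :: 'k comb)"
        using False by (simp add: c_def fvs.scale_right_diff_distrib)
      then show ?thesis using fvs.span_scale[OF equal_path[OF fr pa[OF that] False p0]] by (simp only:)
    qed
    then have "(\<Sum>p\<in>S. fscale (f p) (basis_vec p) - fscale (c p) (basis_vec p0)) \<in> ?U" by (rule fvs.span_sum)
    moreover have "(\<Sum>p\<in>S. fscale (f p) (basis_vec p) - fscale (c p) (basis_vec p0)) = f - fscale (\<Sum>p\<in>S. c p) (basis_vec p0)"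
      unfolding sum_subtractf fs[symmetric] fvs.scale_sum_left ..
    ultimately show ?thesis using p0 by metis
  qed
qed

lemma path_comb_finite: "f \<in> path_comb n \<tau> \<gamma> \<delta> \<Longrightarrow> finite {p. f p \<noteq> 0}"
  by (simp add: path_comb_def)

text \<open>By the normal form only a multiple of one nonzero path remains, and its coefficient is
  read off at any vertex of the \<open>csupp\<close> of that path.\<close>

lemma phi_kernel:
  fixes f :: "'k::field comb"
  assumes fr: "free \<gamma>" and f: "f \<in> path_comb n \<tau> \<gamma> \<delta>"
  shows "f \<in> fvs.span (rels \<gamma> \<delta>) \<longleftrightarrow> (\<forall>x. phi f x = 0)"
proof
  assume "f \<in> fvs.span (rels \<gamma> \<delta>)"
  then show "\<forall>x. phi f x = 0" using span_phi by blast
next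
  assume z: "\<forall>x. phi f x = 0"
  show "f \<in> fvs.span (rels \<gamma> \<delta>)"
  proof (rule ccontr)
    assume "f \<notin> fvs.span (rels \<gamma> \<delta>)"
    then obtain p c where p: "mpath \<gamma> \<delta> p" "csupp p \<noteq> {}" and s: "f - fscale c (basis_vec p) \<in> fvs.span (rels \<gamma> \<delta>)"
      using normal_form[OF assms] by blast
    obtain x where "x \<in> csupp p" using p by blast
    moreover have "phi (f - fscale c (basis_vec p)) x = 0" using span_phi[OF s] .
    ultimately have "c = 0"
      using z phi_diff[OF path_comb_finite[OF f] finite_support_scale[OF finite_basis]] by (simp add: phi_scale phi_basis)
    then have "fscale c (basis_vec p) = (0 :: 'k comb)" by simp
    then show False using s \<open>f \<notin> _\<close> by (simp only: diff_zero)
  qed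
qed

lemma basis_path_comb: "mpath \<gamma> \<delta> p \<Longrightarrow> basis_vec p \<in> path_comb n \<tau> \<gamma> \<delta>"
  unfolding path_comb_def using finite_basis by (auto simp: basis_vec_def split: if_splits)

lemma path_comb_zero: "(\<lambda>_. 0) \<in> path_comb n \<tau> \<gamma> \<delta>"
  by (simp add: path_comb_def)

lemma path_comb_add:
  "f \<in> path_comb n \<tau> \<gamma> \<delta> \<Longrightarrow> g \<in> path_comb n \<tau> \<gamma> \<delta> \<Longrightarrow> f + g \<in> path_comb n \<tau> \<gamma> \<delta>"
  unfolding path_comb_def using finite_support_add[of f g] by auto force

lemma path_comb_scale: "f \<in> path_comb n \<tau> \<gamma> \<delta> \<Longrightarrow> fscale c f \<in> path_comb n \<tau> \<gamma> \<delta>"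
  unfolding path_comb_def using finite_support_scale[of f c] by (auto simp: fscale_def)

lemma path_comb_diff:
  assumes "f \<in> path_comb n \<tau> \<gamma> \<delta>" "g \<in> path_comb n \<tau> \<gamma> \<delta>"
  shows "f - g \<in> path_comb n \<tau> \<gamma> \<delta>"
proof -
  have "f - g = f + fscale (-1) g" by (simp add: fun_eq_iff fscale_def)
  then show ?thesis using path_comb_add[OF assms(1) path_comb_scale[OF assms(2), of "-1"]] by (simp only:)
qed

text \<open>A concatenation is crossed throughout exactly when both factors are, and the double sum
  defining \<open>comb_concat\<close> then splits into a product.\<close>

lemma concat_path_comb:
  fixes f g :: "'k::field comb"
  assumes f: "f \<in> path_comb n \<tau> \<gamma> \<delta>" and g: "g \<in> path_comb n \<tau> \<delta> \<epsilon>"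
  shows "comb_concat f g \<in> path_comb n \<tau> \<gamma> \<epsilon>" "phi (comb_concat f g) x = phi f x * phi g x"
proof -
  define A where "A = {p. f p \<noteq> 0}"
  define B where "B = {p. g p \<noteq> 0}"
  have fin: "finite A" "finite B" and pA: "\<And>p. p \<in> A \<Longrightarrow> mpath \<gamma> \<delta> p" and pB: "\<And>p. p \<in> B \<Longrightarrow> mpath \<delta> \<epsilon> p"
    using f g by (auto simp: A_def B_def path_comb_def)
  define C where "C = (\<lambda>(p, q). p @ tl q) ` (A \<times> B)"
  have fC: "finite C" using fin by (simp add: C_def)
  have val: "comb_concat f g s = (\<Sum>p\<in>A. \<Sum>q\<in>B. if p @ tl q = s then f p * g q else 0)" for s
    by (simp add: comb_concat_def A_def B_def)
  have C: "s \<in> C" if "comb_concat f g s \<noteq> 0" for s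
  proof (rule ccontr)
    assume "s \<notin> C"
    then have "p @ tl q \<noteq> s" if "p \<in> A" "q \<in> B" for p q using that by (auto simp: C_def)
    then show False using that unfolding val by (simp cong: sum.cong)
  qed
  show "comb_concat f g \<in> path_comb n \<tau> \<gamma> \<epsilon>"
    unfolding path_comb_def
  proof (intro CollectI conjI allI impI)
    show "finite {s. comb_concat f g s \<noteq> 0}" by (rule finite_subset[OF _ fC]) (use C in auto)
    fix s assume "comb_concat f g s \<noteq> 0"
    then show "mpath \<gamma> \<epsilon> s" using C pA pB is_path_append unfolding C_def by fastforce
  qed
  have "phi (comb_concat f g) x = (\<Sum>s\<in>C. if x \<in> csupp s then comb_concat f g s else 0)"
    by (rule phi_superset[OF fC]) (rule C)
  also have "\<dots> = (\<Sum>s\<in>C. \<Sum>p\<in>A. \<Sum>q\<in>B. if p @ tl q = s then (if x \<in> csupp s then f p * g q else 0) else 0)"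
    unfolding val by (intro sum.cong refl) (auto intro!: sum.neutral sum.cong)
  also have "\<dots> = (\<Sum>p\<in>A. \<Sum>s\<in>C. \<Sum>q\<in>B. if p @ tl q = s then (if x \<in> csupp s then f p * g q else 0) else 0)"
    by (rule sum.swap)
  also have "\<dots> = (\<Sum>p\<in>A. \<Sum>q\<in>B. \<Sum>s\<in>C. if p @ tl q = s then (if x \<in> csupp s then f p * g q else 0) else 0)"
    by (intro sum.cong refl sum.swap)
  also have "\<dots> = (\<Sum>p\<in>A. \<Sum>q\<in>B. (if x \<in> csupp p then f p else 0) * (if x \<in> csupp q then g q else 0))"
  proof (intro sum.cong refl)
    fix p q assume pq: "p \<in> A" "q \<in> B"
    then have "p @ tl q \<in> C" by (auto simp: C_def)
    then have "(\<Sum>s\<in>C. if p @ tl q = s then (if x \<in> csupp s then f p * g q else 0) else 0) =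
        (if x \<in> csupp (p @ tl q) then f p * g q else 0)" by (simp add: sum.delta' fC)
    also have "\<dots> = (if x \<in> csupp p then f p else 0) * (if x \<in> csupp q then g q else 0)"
      using csupp_concat[OF pA pB] pq by simp
    finally show "(\<Sum>s\<in>C. if p @ tl q = s then (if x \<in> csupp s then f p * g q else 0) else 0) =
        (if x \<in> csupp p then f p else 0) * (if x \<in> csupp q then g q else 0)" .
  qed
  also have "\<dots> = phi f x * phi g x"
    unfolding phi_def A_def B_def sum_product ..
  finally show "phi (comb_concat f g) x = phi f x * phi g x" .
qed

end

context type_A
begin

abbreviation spd :: "diag \<Rightarrow> bool" where "spd \<equiv> sp_diagonal n \<tau> Qv F"

lemma replicate_pivot:
  assumes "\<forall>e\<in>set (dpath a b (replicate k s)). free e"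
  shows "successively (pivot_move n \<tau> (if s then pvert n b else pvert n a)) (dpath a b (replicate k s))"
  using assms
proof (induction k arbitrary: a b)
  case (Suc k)
  let ?a = "if s then a + 1 else a" and ?b = "if s then b else b + 1"
  have e: "dpath a b (replicate (Suc k) s) = ch a b # dpath ?a ?b (replicate k s)" by simp
  have "ch ?a ?b \<in> set (dpath ?a ?b (replicate k s))" by (metis dpath_hd hd_in_set)
  then have "free (ch a b)" "free (ch ?a ?b)" using Suc.prems unfolding e by auto
  then have m: "pivot_move n \<tau> (if s then pvert n b else pvert n a) (ch a b) (ch ?a ?b)"
    using chord_move by (cases s) auto
  have "successively (pivot_move n \<tau> (if s then pvert n ?b else pvert n ?a)) (dpath ?a ?b (replicate k s))"
    by (rule Suc.IH) (use Suc.prems e in auto)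
  moreover obtain ds where "dpath ?a ?b (replicate k s) = ch ?a ?b # ds"
    using dpath_hd[of ?a ?b "replicate k s"] by (metis list.collapse)
  ultimately show ?case unfolding e using m by (cases s) simp_all
qed simp

text \<open>In the case \<open>comp\<close> the factors may run through other diagonals than
  \<open>p\<close>: only the class matters, and a nonzero class is determined by its ends. The
  lengths are recorded so that the factorization can be iterated.\<close>

lemma sp_generation:
  assumes s: "spd \<gamma>" "spd \<delta>" and p: "mpath \<gamma> \<delta> p" "csupp p \<noteq> {}"
  obtains (triv) "p = [\<gamma>]" "\<gamma> = \<delta>"
    | (move) q where "sp_move n \<tau> Qv F \<gamma> \<delta> q" "mpath \<gamma> \<delta> q" "csupp q \<noteq> {}"
    | (comp) \<kappa> q r where "spd \<kappa>" "mpath \<gamma> \<kappa> q" "mpath \<kappa> \<delta> r" "csupp (q @ tl r) \<noteq> {}"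
        "length q < length p" "length r < length p"
proof -
  have fr: "free \<gamma>" "free \<delta>" and I: "spset (spp \<gamma>)" and J: "spset (spp \<delta>)" using s sp_iff by auto
  obtain a b where g: "\<gamma> = ch a b" "a + 2 \<le> b" "b \<le> a + int n + 1" by (rule free_chordE[OF fr(1)])
  have ab: "a < b" "b < a + N" using g by auto
  obtain z where z: "z \<in> csupp p" using p by blast
  from nonzero_pathE[OF fr(1)[unfolded g(1)] ab p(1)[unfolded g(1)] z]
  obtain w c d where w: "p = dpath a b w" "\<delta> = ch (a + cT w) (b + cF w)" "z \<in> {1..n}" "\<tau> z = ch c d"
    "a + cT w < c" "c < b" "b + cF w < d" "d < a + N" by metis
  have len: "length p = Suc (length w)" by (simp add: w(1) dpath_length)
  have pf: "\<forall>e\<in>set p. free e" using mpath_free[OF p(1) fr(1)] by blast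
  show ?thesis
  \<comment> \<open>A word in one letter keeps an end fixed, so it is trivial or an sp-move unless
    it meets an sp-diagonal on the way, where it can be split.\<close>
  proof (cases "cT w = 0 \<or> cF w = 0")
    case True
    then have "\<exists>k u. w = replicate k u"
    proof
      assume "cT w = 0"
      then have "True \<notin> set w" using count_list_0_iff by (metis of_nat_eq_0_iff)
      then have "\<forall>y\<in>set w. y = False" by auto
      then show ?thesis using replicate_eqI[of w "length w" False] by blast
    next
      assume "cF w = 0"
      then have "False \<notin> set w" using count_list_0_iff by (metis of_nat_eq_0_iff)
      then have "\<forall>y\<in>set w. y = True" by (metis (full_types))
      then show ?thesis using replicate_eqI[of w "length w" True] by blast
    qed
    then obtain k u where k: "w = replicate k u" by blast
    have piv: "\<exists>v. successively (pivot_move n \<tau> v) p"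
      using replicate_pivot[of a b k u] pf w(1) k by blast
    consider "length p = 1" | "2 \<le> length p" "\<forall>i. 0 < i \<and> Suc i < length p \<longrightarrow> \<not> spd (p ! i)"
      | i where "0 < i" "Suc i < length p" "spd (p ! i)"
    proof -
      have "length p = 1 \<or> 2 \<le> length p" using len by linarith
      then show thesis using that by blast
    qed
    then show ?thesis
    proof cases
      case 1
      then have "w = []" using len by simp
      then show ?thesis using triv w g by simp
    next
      case 2
      have "hd p = \<gamma>" "last p = \<delta>" using p by (auto simp: is_path_def)
      then have "sp_move n \<tau> Qv F \<gamma> \<delta> p" using 2 piv s unfolding sp_move_def by blast
      then show ?thesis using move p by blast
    next
      case 3
      then have "i < length p" by simp
      note sp = is_path_split[OF p(1) this]
      show ?thesis
        by (rule comp[OF 3(3) sp(1,2)]) (use sp(3) 3 p in auto)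
    qed
  next
    case False
    then have pos: "0 < cT w" "0 < cF w" by auto
    define a' where "a' = a + cT w"
    define b' where "b' = b + cF w"
    have o: "a < a'" "b < b'" "a' < c" "c < b" "b' < d" "d < a + N" using pos w by (auto simp: a'_def b'_def)
    have lw: "int (length p) = (a' - a) + (b' - b) + 1"
      using len length_counts[of w] by (simp add: a'_def b'_def)
    \<comment> \<open>Since \<open>z\<close> crosses the entire rectangle, any sp-diagonal in it
      other than the two given corners provides a factorization into nonzero paths.\<close>
    have inner: thesis if k: "spd \<kappa>" "\<kappa> = ch i j" "a \<le> i" "i \<le> a'" "b \<le> j" "j \<le> b'" "(i, j) \<noteq> (a, b)" "(i, j) \<noteq> (a', b')"
      for \<kappa> i j
    proof -
      define q where "q = rect_word (nat (i - a)) (nat (j - b))"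
      define r where "r = rect_word (nat (a' - i)) (nat (b' - j))"
      have q: "a + cT q = i" "b + cF q = j" and r: "i + cT r = a'" "j + cF r = b'"
        using k by (auto simp: q_def r_def)
      have pq: "mpath \<gamma> \<kappa> (dpath a b q)" "z \<in> csupp (dpath a b q)"
        using crossed_word_path[OF w(3,4), of a q b] q k o g by auto
      have pr: "mpath \<kappa> \<delta> (dpath i j r)" "z \<in> csupp (dpath i j r)"
        using crossed_word_path[OF w(3,4), of i r j] r k o w(2) by (auto simp: a'_def b'_def)
      have "int (length (dpath a b q)) = (i - a) + (j - b) + 1" "int (length (dpath i j r)) = (a' - i) + (b' - j) + 1"
        using q r length_counts[of q] length_counts[of r] by (auto simp: dpath_length)
      moreover have "a < i \<or> b < j" "i < a' \<or> j < b'" using k by auto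
      ultimately have "int (length (dpath a b q)) < int (length p)" "int (length (dpath i j r)) < int (length p)"
        using lw k by auto
      moreover have "csupp (dpath a b q @ tl (dpath i j r)) \<noteq> {}"
        using csupp_concat[OF pq(1) pr(1)] pq pr by blast
      ultimately show thesis using comp[OF k(1) pq(1) pr(1)] by simp
    qed
    have fc: "free (ch a' b)" "free (ch a b')"
      using crossed_free[OF w(3,4), of a' b] crossed_free[OF w(3,4), of a b'] o by auto
    consider "spset (spp (ch a' b))" | "spset (spp (ch a b'))" | "\<not> spset (spp (ch a' b))" "\<not> spset (spp (ch a b'))"
      by blast
    then show ?thesis
    proof cases
      case 1
      then have "spd (ch a' b)" using fc sp_iff by blast
      then show ?thesis by (rule inner) (use o in auto)
    next
      case 2
      then have "spd (ch a b')" using fc sp_iff by blast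
      then show ?thesis by (rule inner) (use o in auto)
    next
      case 3
      have aa: "a \<le> a'" "b \<le> b'" using o by auto
      have dl: "\<delta> = ch a' b'" using w by (simp add: a'_def b'_def)
      obtain K where K: "spset K" "thin_hom Qv (spp (ch a b)) K" "thin_hom Qv K (spp (ch a' b'))"
        "K \<noteq> spp (ch a b)" "K \<noteq> spp (ch a' b')" "spp (ch a b) \<subseteq> K"
        by (rule corner_intermediate[OF aa o(3-6) w(3,4) I[unfolded g(1)] J[unfolded dl] 3])
      obtain \<kappa> where k: "free \<kappa>" "spp \<kappa> = K" by (rule interval_supp[OF spset_interval[OF K(1)]])
      have sk: "spd \<kappa>" using sp_iff k K by simp
      have "z \<in> spp (ch a b)" using supp_crossed[of a c b d z] o w by auto
      then have zk: "z \<in> spp \<kappa>" using K k by blast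
      have cd: "c < d" "d < c + N" using o by auto
      obtain i j where ij: "\<kappa> = ch i j" "i < c" "c < j" "j < d" "d < i + N"
        by (rule common_lift[OF free_diagonalD[OF k(1)] zk w(4) cd])
      \<comment> \<open>The two thin morphisms place the intermediate diagonal inside the
        rectangle.\<close>
      have "a \<le> i" "b \<le> j"
        using thin_hom_order[OF K(2)[folded k(2), unfolded ij(1)], of c d z] o w ij by auto
      moreover have "i \<le> a'" "j \<le> b'"
        using thin_hom_order[OF K(3)[folded k(2), unfolded ij(1)], of c d z] o w ij by auto
      moreover have "(i, j) \<noteq> (a, b)" "(i, j) \<noteq> (a', b')" using K k ij by auto
      ultimately show ?thesis using inner[OF sk ij(1)] by blast
    qed
  qed
qed

end

section \<open>Categories, linear algebra and modules over a poset\<close>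

section \<open>Equivalences of categories\<close>

lemma category_ident: "category C \<Longrightarrow> a \<in> Ob C \<Longrightarrow> Ident C a \<in> Hom C a a"
  and category_comp: "category C \<Longrightarrow> a \<in> Ob C \<Longrightarrow> b \<in> Ob C \<Longrightarrow> c \<in> Ob C \<Longrightarrow>
    f \<in> Hom C a b \<Longrightarrow> g \<in> Hom C b c \<Longrightarrow> Comp C a b c g f \<in> Hom C a c"
  and category_right_id: "category C \<Longrightarrow> a \<in> Ob C \<Longrightarrow> b \<in> Ob C \<Longrightarrow> f \<in> Hom C a b \<Longrightarrow> Comp C a a b f (Ident C a) = f"
  and category_left_id: "category C \<Longrightarrow> a \<in> Ob C \<Longrightarrow> b \<in> Ob C \<Longrightarrow> f \<in> Hom C a b \<Longrightarrow> Comp C a b b (Ident C b) f = f"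
  and category_assoc: "category C \<Longrightarrow> a \<in> Ob C \<Longrightarrow> b \<in> Ob C \<Longrightarrow> c \<in> Ob C \<Longrightarrow> d \<in> Ob C \<Longrightarrow>
    f \<in> Hom C a b \<Longrightarrow> g \<in> Hom C b c \<Longrightarrow> h \<in> Hom C c d \<Longrightarrow>
    Comp C a b d (Comp C b c d h g) f = Comp C a c d h (Comp C a b c g f)"
  unfolding category_def by simp_all

lemma category_full_subcat: "category C \<Longrightarrow> category (full_subcat C S)"
  unfolding category_def full_subcat_def by simp

text \<open>The criterion that full, faithful and dense functors are equivalences. Objects of the
  inverse are chosen preimages, and every equation in \<open>C\<close> is checked after applying
  \<open>Fm\<close>, which is injective on each set of morphisms.\<close>

locale equivalence_data =
  fixes C :: "('o, 'm, 'k) lcat" and D :: "('p, 'l, 'k) lcat" and Fo Fm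
  assumes F: "is_functor C D Fo Fm"
    and full: "\<And>a b g. a \<in> Ob C \<Longrightarrow> b \<in> Ob C \<Longrightarrow> g \<in> Hom D (Fo a) (Fo b) \<Longrightarrow> \<exists>f\<in>Hom C a b. Fm a b f = g"
    and faithful: "\<And>a b f f'. a \<in> Ob C \<Longrightarrow> b \<in> Ob C \<Longrightarrow> f \<in> Hom C a b \<Longrightarrow> f' \<in> Hom C a b \<Longrightarrow>
      Fm a b f = Fm a b f' \<Longrightarrow> f = f'"
    and dense: "\<And>d. d \<in> Ob D \<Longrightarrow> \<exists>a\<in>Ob C. \<exists>e. is_iso D (Fo a) d e"
begin

lemma catC: "category C" and catD: "category D"
  and Fo_Ob: "a \<in> Ob C \<Longrightarrow> Fo a \<in> Ob D"
  and Fm_Hom: "a \<in> Ob C \<Longrightarrow> b \<in> Ob C \<Longrightarrow> f \<in> Hom C a b \<Longrightarrow> Fm a b f \<in> Hom D (Fo a) (Fo b)"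
  and Fm_id: "a \<in> Ob C \<Longrightarrow> Fm a a (Ident C a) = Ident D (Fo a)"
  and Fm_comp: "a \<in> Ob C \<Longrightarrow> b \<in> Ob C \<Longrightarrow> c \<in> Ob C \<Longrightarrow> f \<in> Hom C a b \<Longrightarrow> g \<in> Hom C b c \<Longrightarrow>
    Fm a c (Comp C a b c g f) = Comp D (Fo a) (Fo b) (Fo c) (Fm b c g) (Fm a b f)"
  using F unfolding is_functor_def by simp_all

lemmas cC = category_comp[OF catC] and cD = category_comp[OF catD]
lemmas aC = category_assoc[OF catC] and aD = category_assoc[OF catD]
lemmas iC = category_ident[OF catC] and iD = category_ident[OF catD]
lemmas rC = category_right_id[OF catC] and rD = category_right_id[OF catD]
lemmas lC = category_left_id[OF catC] and lD = category_left_id[OF catD]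

definition Go where "Go d = (SOME a. a \<in> Ob C \<and> (\<exists>e. is_iso D (Fo a) d e))"
definition eps where "eps d = (SOME e. is_iso D (Fo (Go d)) d e)"
definition eps' where "eps' d = (SOME g. g \<in> Hom D d (Fo (Go d)) \<and>
  Comp D (Fo (Go d)) d (Fo (Go d)) g (eps d) = Ident D (Fo (Go d)) \<and>
  Comp D d (Fo (Go d)) d (eps d) g = Ident D d)"
definition lift where "lift a b g = (SOME f. f \<in> Hom C a b \<and> Fm a b f = g)"

lemma Go_Ob: "d \<in> Ob D \<Longrightarrow> Go d \<in> Ob C"
  and eps_iso: "d \<in> Ob D \<Longrightarrow> is_iso D (Fo (Go d)) d (eps d)"
proof -
  assume d: "d \<in> Ob D"
  then have ex: "\<exists>a. a \<in> Ob C \<and> (\<exists>e. is_iso D (Fo a) d e)" using dense by blast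
  from someI_ex[OF this] have g: "Go d \<in> Ob C \<and> (\<exists>e. is_iso D (Fo (Go d)) d e)" unfolding Go_def .
  then show "Go d \<in> Ob C" by blast
  show "is_iso D (Fo (Go d)) d (eps d)" unfolding eps_def using g someI_ex by metis
qed

lemma eps_Hom: "d \<in> Ob D \<Longrightarrow> eps d \<in> Hom D (Fo (Go d)) d"
  using eps_iso by (auto simp: is_iso_def)

lemma eps': "d \<in> Ob D \<Longrightarrow> eps' d \<in> Hom D d (Fo (Go d))"
  "d \<in> Ob D \<Longrightarrow> Comp D (Fo (Go d)) d (Fo (Go d)) (eps' d) (eps d) = Ident D (Fo (Go d))"
  "d \<in> Ob D \<Longrightarrow> Comp D d (Fo (Go d)) d (eps d) (eps' d) = Ident D d"
proof -
  have "eps' d \<in> Hom D d (Fo (Go d)) \<and>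
    Comp D (Fo (Go d)) d (Fo (Go d)) (eps' d) (eps d) = Ident D (Fo (Go d)) \<and>
    Comp D d (Fo (Go d)) d (eps d) (eps' d) = Ident D d" if "d \<in> Ob D"
  proof -
    have "\<exists>g. g \<in> Hom D d (Fo (Go d)) \<and>
      Comp D (Fo (Go d)) d (Fo (Go d)) g (eps d) = Ident D (Fo (Go d)) \<and>
      Comp D d (Fo (Go d)) d (eps d) g = Ident D d"
      using eps_iso[OF that] unfolding is_iso_def by blast
    from someI_ex[OF this] show ?thesis unfolding eps'_def .
  qed
  then show "d \<in> Ob D \<Longrightarrow> eps' d \<in> Hom D d (Fo (Go d))"
    "d \<in> Ob D \<Longrightarrow> Comp D (Fo (Go d)) d (Fo (Go d)) (eps' d) (eps d) = Ident D (Fo (Go d))"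
    "d \<in> Ob D \<Longrightarrow> Comp D d (Fo (Go d)) d (eps d) (eps' d) = Ident D d" by blast+
qed

lemma lift:
  assumes "a \<in> Ob C" "b \<in> Ob C" "g \<in> Hom D (Fo a) (Fo b)"
  shows "lift a b g \<in> Hom C a b" "Fm a b (lift a b g) = g"
proof -
  have "\<exists>f. f \<in> Hom C a b \<and> Fm a b f = g" using full[OF assms] by blast
  from someI_ex[OF this] show "lift a b g \<in> Hom C a b" "Fm a b (lift a b g) = g"
    unfolding lift_def by blast+
qed

text \<open>Conjugation of \<open>h\<close> by the chosen isomorphisms \<open>eps\<close>. Its
  preimage under \<open>Fm\<close> is the inverse functor on morphisms, and \<open>eps_conj\<close>
  is the naturality of \<open>eps\<close>.\<close>

definition conj where
  "conj d e h = Comp D (Fo (Go d)) e (Fo (Go e)) (eps' e) (Comp D (Fo (Go d)) d e h (eps d))"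

lemma conj_Hom:
  assumes "d \<in> Ob D" "e \<in> Ob D" "h \<in> Hom D d e"
  shows "conj d e h \<in> Hom D (Fo (Go d)) (Fo (Go e))"
  unfolding conj_def using assms by (intro cD eps' eps_Hom Fo_Ob Go_Ob)

lemma eps_conj:
  assumes "d \<in> Ob D" "e \<in> Ob D" "h \<in> Hom D d e"
  shows "Comp D (Fo (Go d)) (Fo (Go e)) e (eps e) (conj d e h) = Comp D (Fo (Go d)) d e h (eps d)"
proof -
  note o = Fo_Ob[OF Go_Ob[OF assms(1)]] Fo_Ob[OF Go_Ob[OF assms(2)]]
  have h: "Comp D (Fo (Go d)) d e h (eps d) \<in> Hom D (Fo (Go d)) e"
    using assms o by (intro cD eps_Hom)
  show ?thesis
    unfolding conj_def
    using aD[OF o(1) assms(2) o(2) assms(2) h eps'(1)[OF assms(2)] eps_Hom[OF assms(2)], symmetric]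
      eps'(3)[OF assms(2)] lD[OF o(1) assms(2) h] by simp
qed

lemma conj_unique:
  assumes "d \<in> Ob D" "e \<in> Ob D" "x \<in> Ob D" "p \<in> Hom D x (Fo (Go e))" "q \<in> Hom D x (Fo (Go e))"
    "Comp D x (Fo (Go e)) e (eps e) p = Comp D x (Fo (Go e)) e (eps e) q"
  shows "p = q"
proof -
  note o = Fo_Ob[OF Go_Ob[OF assms(2)]]
  have "r = Comp D x e (Fo (Go e)) (eps' e) (Comp D x (Fo (Go e)) e (eps e) r)" if r: "r \<in> Hom D x (Fo (Go e))" for r
    using aD[OF assms(3) o assms(2) o r eps_Hom[OF assms(2)] eps'(1)[OF assms(2)]] eps'(2)[OF assms(2)] lD[OF assms(3) o r] by simp
  from this[OF assms(4)] this[OF assms(5)] show ?thesis using assms(6) by simp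
qed

definition Gm where "Gm d e h = lift (Go d) (Go e) (conj d e h)"

lemma Gm:
  assumes "d \<in> Ob D" "e \<in> Ob D" "h \<in> Hom D d e"
  shows "Gm d e h \<in> Hom C (Go d) (Go e)" "Fm (Go d) (Go e) (Gm d e h) = conj d e h"
  using lift[OF Go_Ob[OF assms(1)] Go_Ob[OF assms(2)] conj_Hom[OF assms]] unfolding Gm_def by blast+

lemma functor_G: "is_functor D C Go Gm"
  unfolding is_functor_def
proof (intro conjI ballI)
  fix a assume a: "a \<in> Ob D"
  note o = Fo_Ob[OF Go_Ob[OF a]]
  have "conj a a (Ident D a) = Ident D (Fo (Go a))"
    unfolding conj_def using lD[OF o a eps_Hom[OF a]] eps'(2)[OF a] by simp
  then have "Fm (Go a) (Go a) (Gm a a (Ident D a)) = Fm (Go a) (Go a) (Ident C (Go a))"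
    using Gm(2)[OF a a iD[OF a]] Fm_id[OF Go_Ob[OF a]] by simp
  then show "Gm a a (Ident D a) = Ident C (Go a)"
    by (rule faithful[rotated -1]) (use Go_Ob[OF a] Gm(1)[OF a a iD[OF a]] iC in auto)
next
  fix a b c f g assume o: "a \<in> Ob D" "b \<in> Ob D" "c \<in> Ob D" and f: "f \<in> Hom D a b" and g: "g \<in> Hom D b c"
  note oo = Go_Ob[OF o(1)] Go_Ob[OF o(2)] Go_Ob[OF o(3)]
  note ooo = Fo_Ob[OF oo(1)] Fo_Ob[OF oo(2)] Fo_Ob[OF oo(3)]
  note gf = cD[OF o f g]
  note cf = conj_Hom[OF o(1,2) f] and cg = conj_Hom[OF o(2,3) g] and cgf = conj_Hom[OF o(1,3) gf]
  have "Comp D (Fo (Go a)) (Fo (Go c)) c (eps c) (Comp D (Fo (Go a)) (Fo (Go b)) (Fo (Go c)) (conj b c g) (conj a b f))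
      = Comp D (Fo (Go a)) (Fo (Go b)) c (Comp D (Fo (Go b)) (Fo (Go c)) c (eps c) (conj b c g)) (conj a b f)"
    using aD[OF ooo(1,2,3) o(3) cf cg eps_Hom[OF o(3)]] by simp
  also have "\<dots> = Comp D (Fo (Go a)) (Fo (Go b)) c (Comp D (Fo (Go b)) b c g (eps b)) (conj a b f)"
    unfolding eps_conj[OF o(2,3) g] ..
  also have "\<dots> = Comp D (Fo (Go a)) b c g (Comp D (Fo (Go a)) (Fo (Go b)) b (eps b) (conj a b f))"
    by (rule aD[OF ooo(1,2) o(2,3) cf eps_Hom[OF o(2)] g])
  also have "\<dots> = Comp D (Fo (Go a)) b c g (Comp D (Fo (Go a)) a b f (eps a))"
    unfolding eps_conj[OF o(1,2) f] ..
  also have "\<dots> = Comp D (Fo (Go a)) a c (Comp D a b c g f) (eps a)"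
    by (rule aD[OF ooo(1) o(1,2,3) eps_Hom[OF o(1)] f g, symmetric])
  also have "\<dots> = Comp D (Fo (Go a)) (Fo (Go c)) c (eps c) (conj a c (Comp D a b c g f))"
    unfolding eps_conj[OF o(1,3) gf] ..
  finally have "Comp D (Fo (Go a)) (Fo (Go b)) (Fo (Go c)) (conj b c g) (conj a b f) = conj a c (Comp D a b c g f)"
    by (rule conj_unique[OF o(1,3) ooo(1) cD[OF ooo cf cg] cgf])
  then have "Fm (Go a) (Go c) (Comp C (Go a) (Go b) (Go c) (Gm b c g) (Gm a b f)) = Fm (Go a) (Go c) (Gm a c (Comp D a b c g f))"
    using Fm_comp[OF oo Gm(1)[OF o(1,2) f] Gm(1)[OF o(2,3) g]] Gm(2) o f g gf by simp
  then show "Gm a c (Comp D a b c g f) = Comp C (Go a) (Go b) (Go c) (Gm b c g) (Gm a b f)"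
    by (rule faithful[OF oo(1,3) cC[OF oo Gm(1)[OF o(1,2) f] Gm(1)[OF o(2,3) g]] Gm(1)[OF o(1,3) gf], symmetric])
qed (use catC catD Go_Ob Gm in auto)

definition eta where "eta a = lift (Go (Fo a)) a (eps (Fo a))"

lemma eta:
  assumes "a \<in> Ob C"
  shows "eta a \<in> Hom C (Go (Fo a)) a" "Fm (Go (Fo a)) a (eta a) = eps (Fo a)"
  using lift[OF Go_Ob[OF Fo_Ob[OF assms]] assms eps_Hom[OF Fo_Ob[OF assms]]] unfolding eta_def by blast+

lemma eta_iso:
  assumes a: "a \<in> Ob C"
  shows "is_iso C (Go (Fo a)) a (eta a)"
proof -
  let ?g = "lift a (Go (Fo a)) (eps' (Fo a))"
  note fa = Fo_Ob[OF a]
  note o = Go_Ob[OF fa]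
  have g: "?g \<in> Hom C a (Go (Fo a))" "Fm a (Go (Fo a)) ?g = eps' (Fo a)"
    using lift[OF a o eps'(1)[OF fa]] by auto
  have "Comp C (Go (Fo a)) a (Go (Fo a)) ?g (eta a) = Ident C (Go (Fo a))"
    by (rule faithful[OF o o cC[OF o a o eta(1)[OF a] g(1)] iC[OF o]])
      (simp add: Fm_comp[OF o a o eta(1)[OF a] g(1)] eta(2)[OF a] g(2) eps'(2)[OF fa] Fm_id[OF o])
  moreover have "Comp C a (Go (Fo a)) a (eta a) ?g = Ident C a"
    by (rule faithful[OF a a cC[OF a o a g(1) eta(1)[OF a]] iC[OF a]])
      (simp add: Fm_comp[OF a o a g(1) eta(1)[OF a]] eta(2)[OF a] g(2) eps'(3)[OF fa] Fm_id[OF a])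
  ultimately show ?thesis unfolding is_iso_def using g eta[OF a] by blast
qed

theorem equivalence: "is_equivalence C D Fo Fm"
proof -
  have "naturally_isomorphic C C (\<lambda>a. Go (Fo a)) (\<lambda>a b f. Gm (Fo a) (Fo b) (Fm a b f)) (\<lambda>a. a) (\<lambda>a b f. f)"
    unfolding naturally_isomorphic_def
  proof (intro exI[of _ eta] conjI ballI)
    fix a b f assume a: "a \<in> Ob C" and b: "b \<in> Ob C" and f: "f \<in> Hom C a b"
    note o = Go_Ob[OF Fo_Ob[OF a]] Go_Ob[OF Fo_Ob[OF b]]
    note Ff = Fm_Hom[OF a b f]
    note G = Gm[OF Fo_Ob[OF a] Fo_Ob[OF b] Ff]
    show "Comp C (Go (Fo a)) a b f (eta a) =
        Comp C (Go (Fo a)) (Go (Fo b)) b (eta b) (Gm (Fo a) (Fo b) (Fm a b f))"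
      by (rule faithful[OF o(1) b cC[OF o(1) a b eta(1)[OF a] f] cC[OF o b G(1) eta(1)[OF b]]])
        (simp add: Fm_comp[OF o(1) a b eta(1)[OF a] f] Fm_comp[OF o b G(1) eta(1)[OF b]] eta(2) a b G(2)
          eps_conj[OF Fo_Ob[OF a] Fo_Ob[OF b] Ff])
  qed (rule eta_iso)
  moreover have "naturally_isomorphic D D (\<lambda>a. Fo (Go a)) (\<lambda>a b f. Fm (Go a) (Go b) (Gm a b f)) (\<lambda>a. a) (\<lambda>a b f. f)"
    unfolding naturally_isomorphic_def
    by (intro exI[of _ eps] conjI ballI) (simp_all add: eps_iso Gm eps_conj)
  ultimately show ?thesis unfolding is_equivalence_def using F functor_G by blast
qed

end

section \<open>Linear maps between subspaces\<close>

lemma subspace_zero: "fvs.subspace A \<Longrightarrow> 0 \<in> A"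
  and subspace_add: "fvs.subspace A \<Longrightarrow> u \<in> A \<Longrightarrow> v \<in> A \<Longrightarrow> u + v \<in> A"
  and subspace_scale: "fvs.subspace A \<Longrightarrow> v \<in> A \<Longrightarrow> fscale c v \<in> A"
  unfolding fvs.subspace_def by blast+

lemma lin_map_in: "lin_map_on A B f \<Longrightarrow> v \<in> A \<Longrightarrow> f v \<in> B"
  and lin_map_add: "lin_map_on A B f \<Longrightarrow> u \<in> A \<Longrightarrow> v \<in> A \<Longrightarrow> f (u + v) = f u + f v"
  and lin_map_scale: "lin_map_on A B f \<Longrightarrow> v \<in> A \<Longrightarrow> f (fscale c v) = fscale c (f v)"
  unfolding lin_map_on_def by blast+

lemma lin_map_zero:
  assumes "lin_map_on A B f" "fvs.subspace A"
  shows "f 0 = 0"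
  using lin_map_scale[OF assms(1) subspace_zero[OF assms(2)], of 0] by simp

lemma lin_map_sum:
  assumes "lin_map_on A B f" "fvs.subspace A" "\<And>i. i \<in> I \<Longrightarrow> v i \<in> A"
  shows "f (\<Sum>i\<in>I. fscale (c i) (v i)) = (\<Sum>i\<in>I. fscale (c i) (f (v i)))"
  using assms(3)
proof (induction I rule: infinite_finite_induct)
  case (insert i I)
  have "fscale (c i) (v i) \<in> A" "(\<Sum>i\<in>I. fscale (c i) (v i)) \<in> A"
    using insert.prems assms(2) by (auto intro!: subspace_scale fvs.subspace_sum)
  then have "f (fscale (c i) (v i) + (\<Sum>i\<in>I. fscale (c i) (v i))) =
      fscale (c i) (f (v i)) + f (\<Sum>i\<in>I. fscale (c i) (v i))"
    using insert.prems lin_map_add[OF assms(1)] lin_map_scale[OF assms(1)] by simp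
  moreover have "f (\<Sum>i\<in>I. fscale (c i) (v i)) = (\<Sum>i\<in>I. fscale (c i) (f (v i)))"
    using insert.IH insert.prems by blast
  ultimately show ?case by (simp only: sum.insert[OF insert.hyps(1,2)])
next
  case (infinite I)
  then show ?case using lin_map_zero[OF assms(1,2)] by (simp only: sum.infinite[OF infinite.hyps])
next
  case empty
  then show ?case using lin_map_zero[OF assms(1,2)] by (simp only: sum.empty)
qed

lemma fin_dim_subset:
  assumes "fin_dim_subspace A" "fvs.subspace K" "K \<subseteq> A"
  shows "fin_dim_subspace K"
proof -
  obtain S where S: "finite S" "A = fvs.span S" using assms(1) unfolding fin_dim_subspace_def by blast
  obtain B where B: "B \<subseteq> K" "\<not> fvs.dependent B" "K \<subseteq> fvs.span B"
    using fvs.maximal_independent_subset[of K] by metis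
  have "finite B" using fvs.independent_span_bound[OF S(1) B(2)] B S assms by blast
  moreover have "K = fvs.span B" using B assms(2) fvs.span_minimal by blast
  ultimately show ?thesis unfolding fin_dim_subspace_def using assms by blast
qed

text \<open>Extend \<open>v\<close> to a basis of the whole space and take the coefficient of
  \<open>v\<close>.\<close>

lemma coordinate_functional:
  fixes v :: "'b \<Rightarrow> 'k::field"
  assumes "v \<noteq> 0"
  obtains g :: "('b \<Rightarrow> 'k) \<Rightarrow> 'k" where "g v = 1" "\<And>u w. g (u + w) = g u + g w" "\<And>c u. g (fscale c u) = c * g u"
proof -
  define B where "B = fvs.extend_basis {v}"
  have i: "\<not> fvs.dependent {v}" using assms by simp
  have B: "\<not> fvs.dependent B" "v \<in> B" "\<And>u. u \<in> fvs.span B"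
    unfolding B_def using fvs.independent_extend_basis[OF i] fvs.extend_basis_superset[OF i] fvs.span_extend_basis[OF i] by auto
  define g where "g u = fvs.representation B u v" for u
  have "g v = 1" unfolding g_def using fvs.representation_basis[OF B(1,2)] by simp
  moreover have "g (u + w) = g u + g w" for u w
    unfolding g_def using fvs.representation_add[OF B(1,3,3)] by simp
  moreover have "g (fscale c u) = c * g u" for c u
    unfolding g_def using fvs.representation_scale[OF B(1,3)] by simp
  ultimately show ?thesis using that by blast
qed

text \<open>Preimages are chosen on a basis of \<open>P\<close> only; both sides are linear, so the
  equation extends to the span.\<close>

lemma linear_lift:
  fixes A B P :: "'k::field vec set"
  assumes g: "lin_map_on A B g" "g ` A = B" and sA: "fvs.subspace A" and P: "fvs.subspace P" and f: "lin_map_on P B f"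
  obtains h where "lin_map_on P A h" "\<And>v. v \<in> P \<Longrightarrow> g (h v) = f v"
proof -
  interpret vp: vector_space_pair "fscale :: 'k \<Rightarrow> 'k vec \<Rightarrow> 'k vec" "fscale :: 'k \<Rightarrow> 'k vec \<Rightarrow> 'k vec"
    by unfold_locales
  obtain S where S: "S \<subseteq> P" "\<not> fvs.dependent S" "P \<subseteq> fvs.span S"
    using fvs.maximal_independent_subset[of P] by metis
  have PS: "P = fvs.span S" using S P fvs.span_minimal by blast
  define a where "a b = (SOME x. x \<in> A \<and> g x = f b)" for b
  have a: "a b \<in> A \<and> g (a b) = f b" if "b \<in> S" for b
  proof -
    have "f b \<in> g ` A" using lin_map_in[OF f] S that g by blast
    then have "\<exists>x. x \<in> A \<and> g x = f b" by (metis imageE)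
    then show ?thesis unfolding a_def by (rule someI_ex)
  qed
  obtain h where h: "Vector_Spaces.linear fscale fscale h" "\<forall>b\<in>S. h b = a b" using vp.linear_independent_extend[OF S(2)] by blast
  have hl: "h (u + v) = h u + h v" "h (fscale c v) = fscale c (h v)" for u v c
    using vp.linear_add[OF h(1)] vp.linear_scale[OF h(1)] by blast+
  have key: "v \<in> P \<and> h v \<in> A \<and> g (h v) = f v" if "v \<in> fvs.span S" for v
    using that
  proof (induction rule: fvs.span_induct_alt)
    case base
    show ?case
      using subspace_zero[OF P] hl(2)[of 0 0] subspace_zero[OF sA] lin_map_zero[OF g(1) sA] lin_map_zero[OF f P]
      by (simp only: fvs.scale_zero_left)
  next
    case (step c b y)
    have b: "b \<in> P" "a b \<in> A" "g (a b) = f b" "h b = a b" using a[OF step.hyps(1)] h(2) S(1) step.hyps(1) by auto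
    have cb: "fscale c b \<in> P" "fscale c (a b) \<in> A" using subspace_scale[OF P b(1)] subspace_scale[OF sA b(2)] .
    have e: "h (fscale c b + y) = fscale c (a b) + h y" unfolding hl b(4) ..
    have "g (fscale c (a b) + h y) = f (fscale c b + y)"
      using lin_map_add[OF g(1) cb(2)] lin_map_add[OF f cb(1)] lin_map_scale[OF g(1) b(2)] lin_map_scale[OF f b(1)] b step.IH
      by simp
    then show ?case unfolding e using subspace_add[OF P cb(1)] subspace_add[OF sA cb(2)] step.IH by blast
  qed
  show ?thesis
  proof (rule that)
    show "lin_map_on P A h" unfolding lin_map_on_def using key hl PS by blast
    show "g (h v) = f v" if "v \<in> P" for v using key that PS by blast
  qed
qed

section \<open>Modules over the incidence algebra of a finite poset\<close>

locale finite_poset =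
  fixes r :: "nat rel"
  assumes refl: "x \<in> Field r \<Longrightarrow> (x, x) \<in> r"
    and trans: "(x, y) \<in> r \<Longrightarrow> (y, z) \<in> r \<Longrightarrow> (x, z) \<in> r"
    and antisym: "(x, y) \<in> r \<Longrightarrow> (y, x) \<in> r \<Longrightarrow> x = y"
    and fin: "finite (Field r)"
begin

lemma Field1: "(x, y) \<in> r \<Longrightarrow> x \<in> Field r" and Field2: "(x, y) \<in> r \<Longrightarrow> y \<in> Field r"
  by (auto simp: Field_def)

lemma mod_space: "fg_module r M \<Longrightarrow> x \<in> Field r \<Longrightarrow> fin_dim_subspace (spc M x)"
  and mod_str: "fg_module r M \<Longrightarrow> (x, y) \<in> r \<Longrightarrow> lin_map_on (spc M x) (spc M y) (str M y x)"
  and mod_str_id: "fg_module r M \<Longrightarrow> x \<in> Field r \<Longrightarrow> v \<in> spc M x \<Longrightarrow> str M x x v = v"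
  and mod_str_comp: "fg_module r M \<Longrightarrow> (x, y) \<in> r \<Longrightarrow> (y, w) \<in> r \<Longrightarrow> v \<in> spc M x \<Longrightarrow>
    str M w y (str M y x v) = str M w x v"
  unfolding fg_module_def by blast+

lemma mod_subspace: "fg_module r M \<Longrightarrow> x \<in> Field r \<Longrightarrow> fvs.subspace (spc M x)"
  using mod_space unfolding fin_dim_subspace_def by blast

lemma hom_lin: "f \<in> mod_hom r M N \<Longrightarrow> x \<in> Field r \<Longrightarrow> lin_map_on (spc M x) (spc N x) (f x)"
  and hom_nat: "f \<in> mod_hom r M N \<Longrightarrow> (x, y) \<in> r \<Longrightarrow> v \<in> spc M x \<Longrightarrow> f y (str M y x v) = str N y x (f x v)"
  and hom_out: "f \<in> mod_hom r M N \<Longrightarrow> x \<notin> Field r \<or> v \<notin> spc M x \<Longrightarrow> f x v = 0"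
  unfolding mod_hom_def by blast+

lemma mod_homI:
  assumes "\<And>x. x \<in> Field r \<Longrightarrow> lin_map_on (spc M x) (spc N x) (f x)"
    "\<And>x y v. (x, y) \<in> r \<Longrightarrow> v \<in> spc M x \<Longrightarrow> f y (str M y x v) = str N y x (f x v)"
    "\<And>x v. x \<notin> Field r \<or> v \<notin> spc M x \<Longrightarrow> f x v = 0"
  shows "f \<in> mod_hom r M N"
  unfolding mod_hom_def using assms by blast

lemma category_mod_cat: "category (mod_cat r :: ('k::field psys, nat \<Rightarrow> 'k vec \<Rightarrow> 'k vec, 'k) lcat)"
proof -
  let ?id = "\<lambda>(M :: 'k psys) x v. if x \<in> Field r \<and> v \<in> spc M x then v else 0"
  have id: "?id M \<in> mod_hom r M M" if M: "fg_module r M" for M :: "'k psys"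
  proof (rule mod_homI)
    fix x assume x: "x \<in> Field r"
    show "lin_map_on (spc M x) (spc M x) (?id M x)"
      unfolding lin_map_on_def
      using x subspace_add[OF mod_subspace[OF M x]] subspace_scale[OF mod_subspace[OF M x]] by simp
  next
    fix x y and v :: "'k vec" assume "(x, y) \<in> r" "v \<in> spc M x"
    then show "?id M y (str M y x v) = str M y x (?id M x v)"
      using lin_map_in[OF mod_str[OF M]] Field1 Field2 by auto
  qed auto
  have comp: "(\<lambda>x v. g x (f x v)) \<in> mod_hom r L N"
    if M: "fg_module r M" and f: "f \<in> mod_hom r L M" and g: "g \<in> mod_hom r M N" for L M N :: "'k psys" and f g
  proof (rule mod_homI)
    fix x assume x: "x \<in> Field r"
    note lf = hom_lin[OF f x] and lg = hom_lin[OF g x]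
    show "lin_map_on (spc L x) (spc N x) (\<lambda>v. g x (f x v))"
      unfolding lin_map_on_def
      using lin_map_in[OF lf] lin_map_in[OF lg] lin_map_add[OF lf] lin_map_add[OF lg] lin_map_scale[OF lf] lin_map_scale[OF lg]
      by simp
  next
    fix x y v assume xy: "(x, y) \<in> r" "v \<in> spc L x"
    then show "g y (f y (str L y x v)) = str N y x (g x (f x v))"
      using hom_nat[OF f xy] hom_nat[OF g xy(1)] lin_map_in[OF hom_lin[OF f Field1[OF xy(1)]] xy(2)] by simp
  next
    fix x v assume o: "x \<notin> Field r \<or> v \<notin> spc L x"
    show "g x (f x v) = 0"
    proof (cases "x \<in> Field r")
      case True
      then show ?thesis using hom_out[OF f o] lin_map_zero[OF hom_lin[OF g True] mod_subspace[OF M True]] by simp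
    next
      case False
      then show ?thesis using hom_out[OF g] by blast
    qed
  qed
  have ids: "(\<lambda>x v. f x (?id M x v)) = f" "(\<lambda>x v. ?id N x (f x v)) = f"
    if M: "fg_module r M" and f: "f \<in> mod_hom r M N" for M N :: "'k psys" and f
  proof -
    have z: "f x 0 = 0" for x
    proof (cases "x \<in> Field r")
      case True
      then show ?thesis using lin_map_zero[OF hom_lin[OF f True] mod_subspace[OF M True]] by simp
    qed (use hom_out[OF f] in blast)
    show "(\<lambda>x v. f x (?id M x v)) = f"
    proof (intro ext)
      fix x v i
      show "f x (?id M x v) i = f x v i" using z[of x] hom_out[OF f, of x v] by (cases "x \<in> Field r \<and> v \<in> spc M x") auto
    qed
    show "(\<lambda>x v. ?id N x (f x v)) = f"
    proof (intro ext)
      fix x v i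
      show "?id N x (f x v) i = f x v i"
        using hom_out[OF f, of x v] lin_map_in[OF hom_lin[OF f], of x v] by (cases "x \<in> Field r \<and> v \<in> spc M x") auto
    qed
  qed
  show ?thesis
    unfolding category_def
    by (auto simp: mod_cat_def id comp ids simp del: zero_fun_apply)
qed

lemma category_mod_sp: "category (mod_sp r :: ('k::field psys, nat \<Rightarrow> 'k vec \<Rightarrow> 'k vec, 'k) lcat)"
  unfolding mod_sp_def by (rule category_full_subcat[OF category_mod_cat])

lemma mod_iso:
  fixes M N :: "'k::field psys"
  assumes M: "fg_module r M" and N: "fg_module r N" and f: "f \<in> mod_hom r M N"
    and b: "\<And>x. x \<in> Field r \<Longrightarrow> bij_betw (f x) (spc M x) (spc N x)"
  shows "is_iso (mod_cat r) M N f"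
proof -
  define g where "g x v = (if x \<in> Field r \<and> v \<in> spc N x then the_inv_into (spc M x) (f x) v else 0)" for x v
  have gf: "g x (f x v) = v" if "x \<in> Field r" "v \<in> spc M x" for x v
    using that b[OF that(1)] lin_map_in[OF hom_lin[OF f that(1)] that(2)] unfolding g_def
    by (simp add: bij_betw_def the_inv_into_f_f)
  have gin: "g x v \<in> spc M x" "f x (g x v) = v" if "x \<in> Field r" "v \<in> spc N x" for x v
  proof -
    have "v \<in> f x ` spc M x" using b[OF that(1)] that by (simp add: bij_betw_def)
    then obtain u where "u \<in> spc M x" "v = f x u" by blast
    then show "g x v \<in> spc M x" "f x (g x v) = v" using gf[OF that(1)] by auto
  qed
  have g: "g \<in> mod_hom r N M"
  proof (rule mod_homI)
    fix x assume x: "x \<in> Field r"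
    note lf = hom_lin[OF f x] and sM = mod_subspace[OF M x] and sN = mod_subspace[OF N x]
    have "g x (u + v) = g x u + g x v" if "u \<in> spc N x" "v \<in> spc N x" for u v
    proof -
      have "f x (g x u + g x v) = u + v" using lin_map_add[OF lf] gin[OF x] that by simp
      then show ?thesis using gf[OF x subspace_add[OF sM]] gin(1)[OF x] that by metis
    qed
    moreover have "g x (fscale c v) = fscale c (g x v)" if "v \<in> spc N x" for c v
    proof -
      have "f x (fscale c (g x v)) = fscale c v" using lin_map_scale[OF lf] gin[OF x] that by simp
      then show ?thesis using gf[OF x subspace_scale[OF sM]] gin(1)[OF x] that by metis
    qed
    ultimately show "lin_map_on (spc N x) (spc M x) (g x)"
      unfolding lin_map_on_def using gin(1)[OF x] by blast
  next
    fix x y v assume xy: "(x, y) \<in> r" "v \<in> spc N x"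
    note x = Field1[OF xy(1)] and y = Field2[OF xy(1)]
    have m: "str M y x (g x v) \<in> spc M y" using lin_map_in[OF mod_str[OF M xy(1)] gin(1)[OF x xy(2)]] .
    have "f y (str M y x (g x v)) = str N y x v"
      using hom_nat[OF f xy(1) gin(1)[OF x xy(2)]] gin(2)[OF x xy(2)] by simp
    then show "g y (str N y x v) = str M y x (g x v)" using gf[OF y m] by simp
  qed (auto simp: g_def)
  have "(\<lambda>x v. g x (f x v)) = (\<lambda>x v. if x \<in> Field r \<and> v \<in> spc M x then v else 0)"
  proof (intro ext)
    fix x v i
    show "g x (f x v) i = (if x \<in> Field r \<and> v \<in> spc M x then v else 0) i"
    proof (cases "x \<in> Field r \<and> v \<in> spc M x")
      case False
      then have "f x v = 0" using hom_out[OF f] by blast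
      moreover have "g x 0 = 0"
      proof (cases "x \<in> Field r")
        case True
        then show ?thesis using lin_map_zero[OF hom_lin[OF g True] mod_subspace[OF N True]] by simp
      qed (simp add: g_def)
      ultimately show ?thesis using False by auto
    qed (simp add: gf)
  qed
  moreover have "(\<lambda>x v. f x (g x v)) = (\<lambda>x v. if x \<in> Field r \<and> v \<in> spc N x then v else 0)"
  proof (intro ext)
    fix x v i
    show "f x (g x v) i = (if x \<in> Field r \<and> v \<in> spc N x then v else 0) i"
    proof (cases "x \<in> Field r \<and> v \<in> spc N x")
      case False
      then have "g x v = 0" by (auto simp: g_def)
      moreover have "f x 0 = 0"
      proof (cases "x \<in> Field r")
        case True
        then show ?thesis using lin_map_zero[OF hom_lin[OF f True] mod_subspace[OF M True]] by simp
      qed (use hom_out[OF f] in blast)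
      ultimately show ?thesis using False by auto
    qed (simp add: gin)
  qed
  ultimately show ?thesis unfolding is_iso_def mod_cat_def using f g by auto
qed

text \<open>The condition that the kernels of the maps to maximal elements intersect in zero, stated
  for single vectors. At a maximal element it holds with \<open>z = x\<close>.\<close>

definition detected :: "'k::field psys \<Rightarrow> bool" where
  "detected M \<longleftrightarrow> (\<forall>x\<in>Field r. \<forall>v\<in>spc M x. v \<noteq> 0 \<longrightarrow>
     (\<exists>z. (x, z) \<in> r \<and> (\<forall>y. (z, y) \<in> r \<longrightarrow> y = z) \<and> str M z x v \<noteq> 0))"

definition soc :: "'k::field psys \<Rightarrow> nat \<Rightarrow> 'k vec set" where
  "soc M x = {v \<in> spc M x. \<forall>y. (x, y) \<in> r \<longrightarrow> y \<noteq> x \<longrightarrow> str M y x v = 0}"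

lemma soc_subspace:
  assumes M: "fg_module r M" and x: "x \<in> Field r"
  shows "fvs.subspace (soc M x)"
  unfolding fvs.subspace_def
proof (intro conjI ballI allI)
  note s = mod_subspace[OF M x]
  note l = mod_str[OF M]
  show "0 \<in> soc M x" unfolding soc_def using subspace_zero[OF s] lin_map_zero[OF l s] by blast
  show "u + v \<in> soc M x" if "u \<in> soc M x" "v \<in> soc M x" for u v
    using that subspace_add[OF s] lin_map_add[OF l, of x] unfolding soc_def by simp
  show "fscale c v \<in> soc M x" if "v \<in> soc M x" for c v
    using that subspace_scale[OF s] lin_map_scale[OF l, of x] unfolding soc_def by simp
qed

text \<open>A simple submodule lives at one vertex: clearing it at a minimal vertex of its support
  leaves a smaller submodule, which must vanish. Hence its vectors are killed by all proper
  structure maps. Conversely, a nonzero vector killed by these maps spans a simple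
  submodule.\<close>

lemma socle_spc:
  fixes M :: "'k::field psys"
  assumes M: "fg_module r M" and x: "x \<in> Field r"
  shows "spc (socle r M) x = soc M x"
proof -
  have simple_sub: "S x \<subseteq> soc M x" if S: "simple_submodule r S M" for S
  proof -
    have sub: "submodule r S M" and ne: "\<exists>x\<in>Field r. S x \<noteq> {0}"
      and min: "\<And>N. submodule r N M \<Longrightarrow> \<forall>x\<in>Field r. N x \<subseteq> S x \<Longrightarrow>
        (\<forall>x\<in>Field r. N x = {0}) \<or> (\<forall>x\<in>Field r. N x = S x)"
      using S unfolding simple_submodule_def by blast+
    have sS: "fvs.subspace (S w) \<and> S w \<subseteq> spc M w" if "w \<in> Field r" for w
      using sub that unfolding submodule_def by blast
    have im: "str M w u v \<in> S w" if "(u, w) \<in> r" "v \<in> S u" for u w v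
      using sub that unfolding submodule_def by blast
    have wf: "wf {(u, w). (u, w) \<in> r \<and> u \<noteq> w}"
    proof (rule finite_acyclic_wf)
      show "finite {(u, w). (u, w) \<in> r \<and> u \<noteq> w}"
        by (rule finite_subset[of _ "Field r \<times> Field r"]) (auto simp: fin Field1 Field2)
      have "(u, w) \<in> r \<and> u \<noteq> w" if "(u, w) \<in> {(u, w). (u, w) \<in> r \<and> u \<noteq> w}\<^sup>+" for u w
        using that
      proof (induction rule: trancl_induct)
        case (step w w')
        then have "(u, w) \<in> r" "u \<noteq> w" "(w, w') \<in> r" by auto
        then show ?case using trans antisym by blast
      qed auto
      then show "acyclic {(u, w). (u, w) \<in> r \<and> u \<noteq> w}" unfolding acyclic_def by blast
    qed
    obtain m where m: "m \<in> Field r" "S m \<noteq> {0}" "\<And>u. (u, m) \<in> r \<Longrightarrow> u \<noteq> m \<Longrightarrow> S u = {0}"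
    proof -
      define Z where "Z = {w \<in> Field r. S w \<noteq> {0}}"
      obtain w where "w \<in> Z" using ne by (auto simp: Z_def)
      then have "\<exists>m\<in>Z. \<forall>u. (u, m) \<in> {(u, w). (u, w) \<in> r \<and> u \<noteq> w} \<longrightarrow> u \<notin> Z"
        by (rule wfE_min[OF wf]) blast
      then obtain m where m: "m \<in> Z" and min: "\<And>u. (u, m) \<in> {(u, w). (u, w) \<in> r \<and> u \<noteq> w} \<Longrightarrow> u \<notin> Z"
        by blast
      have "S u = {0}" if "(u, m) \<in> r" "u \<noteq> m" for u
        using min[of u] that Field1[OF that(1)] by (simp add: Z_def)
      moreover have "m \<in> Field r" "S m \<noteq> {0}" using m by (auto simp: Z_def)
      ultimately show ?thesis using that by blast
    qed
    \<comment> \<open>Clearing \<open>S\<close> at \<open>m\<close> respects the structure maps,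
      because \<open>S\<close> vanishes at all vertices strictly below \<open>m\<close>.\<close>
    define N where "N w = (if w = m then {0} else S w)" for w
    have "submodule r N M"
      unfolding submodule_def
    proof (intro conjI ballI)
      fix w assume w: "w \<in> Field r"
      show "fvs.subspace (N w)" "N w \<subseteq> spc M w"
        using sS[OF w] subspace_zero by (auto simp: N_def fvs.subspace_single_0)
    next
      fix e assume "e \<in> r"
      then obtain u w where e: "e = (u, w)" "(u, w) \<in> r" by (cases e) auto
      note l = lin_map_zero[OF mod_str[OF M e(2)] mod_subspace[OF M Field1[OF e(2)]]]
      have "str M w u v \<in> N w" if v: "v \<in> N u" for v
      proof (cases "u = m")
        case True
        then have "str M w u v = 0" using v l by (simp add: N_def)
        then show ?thesis using subspace_zero[OF conjunct1[OF sS[OF Field2[OF e(2)]]]] by (simp add: N_def)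
      next
        case False
        then have vS: "v \<in> S u" using v by (simp add: N_def)
        show ?thesis
        proof (cases "w = m")
          case True
          then have "v = 0" using m(3) e False vS by auto
          then show ?thesis using l True by (simp add: N_def)
        next
          case False
          then show ?thesis using im[OF e(2) vS] by (simp add: N_def)
        qed
      qed
      then show "case e of (x, y) \<Rightarrow> str M y x ` N x \<subseteq> N y" using e by auto
    qed
    moreover have "\<forall>w\<in>Field r. N w \<subseteq> S w" using sS subspace_zero by (auto simp: N_def)
    ultimately have alt: "(\<forall>w\<in>Field r. N w = {0}) \<or> (\<forall>w\<in>Field r. N w = S w)" by (rule min)
    have "N m \<noteq> S m" using m(2) by (simp add: N_def)
    then have Nz: "\<forall>w\<in>Field r. N w = {0}" using alt m(1) by blast
    have z: "S w = {0}" if "w \<in> Field r" "w \<noteq> m" for w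
    proof -
      have "S w = N w" using that(2) by (simp add: N_def)
      then show ?thesis using Nz that(1) by simp
    qed
    show ?thesis
    proof
      fix v assume v: "v \<in> S x"
      have "str M y x v = 0" if y: "(x, y) \<in> r" "y \<noteq> x" for y
      proof (cases "x = m")
        case True
        then show ?thesis using im[OF y(1) v] z[OF Field2[OF y(1)]] y by simp
      next
        case False
        then have "v = 0" using v z[OF x] by simp
        then show ?thesis using lin_map_zero[OF mod_str[OF M y(1)] mod_subspace[OF M x]] by simp
      qed
      then show "v \<in> soc M x" unfolding soc_def using v sS[OF x] by blast
    qed
  qed
  have "v \<in> (\<Union>S\<in>{S. simple_submodule r S M}. S x) \<or> v = 0" if v: "v \<in> soc M x" for v
  proof (cases "v = 0")
    case False
    define S where "S w = (if w = x then fvs.span {v} else {0 :: 'k vec})" for w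
    have sc: "\<exists>c. u = fscale c v" if "u \<in> fvs.span {v}" for u
      using that unfolding fvs.span_singleton by blast
    have vs: "fvs.span {v} \<subseteq> soc M x" by (rule fvs.span_minimal[OF _ soc_subspace[OF M x]]) (use v in auto)
    have "submodule r S M"
      unfolding submodule_def
    proof (intro conjI ballI)
      fix w assume w: "w \<in> Field r"
      show "fvs.subspace (S w)" by (simp add: S_def fvs.subspace_span fvs.subspace_single_0)
      show "S w \<subseteq> spc M w" using vs subspace_zero[OF mod_subspace[OF M w]] by (auto simp: S_def soc_def)
    next
      fix e assume "e \<in> r"
      then obtain u w where e: "e = (u, w)" "(u, w) \<in> r" by (cases e) auto
      have "str M w u a \<in> S w" if a: "a \<in> S u" for a
      proof (cases "u = x")
        case True
        then have a': "a \<in> soc M x" "a \<in> fvs.span {v}" using a vs by (auto simp: S_def)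
        show ?thesis
        proof (cases "w = x")
          case True
          then show ?thesis using mod_str_id[OF M x] a' \<open>u = x\<close> by (auto simp: S_def soc_def)
        next
          case False
          then have "str M w u a = 0" using a'(1) e \<open>u = x\<close> by (auto simp: soc_def)
          then show ?thesis using False by (simp add: S_def)
        qed
      next
        case False
        then have "a = 0" using a by (simp add: S_def)
        then have "str M w u a = 0" using lin_map_zero[OF mod_str[OF M e(2)] mod_subspace[OF M Field1[OF e(2)]]] by simp
        then show ?thesis by (simp add: S_def fvs.span_zero)
      qed
      then show "case e of (x, y) \<Rightarrow> str M y x ` S x \<subseteq> S y" using e by auto
    qed
    moreover have vS: "v \<in> S x" by (simp add: S_def fvs.span_base)
    then have "\<exists>w\<in>Field r. S w \<noteq> {0}" using x False by (intro bexI[of _ x]) auto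
    moreover have "(\<forall>w\<in>Field r. N w = {0}) \<or> (\<forall>w\<in>Field r. N w = S w)"
      if N: "submodule r N M" "\<forall>w\<in>Field r. N w \<subseteq> S w" for N
    proof -
      have sN: "fvs.subspace (N w)" if "w \<in> Field r" for w using N(1) that unfolding submodule_def by blast
      have o: "N w = {0}" if "w \<in> Field r" "w \<noteq> x" for w
      proof -
        have "N w \<subseteq> S w" using N(2) that(1) by blast
        then show ?thesis using that(2) subspace_zero[OF sN[OF that(1)]] by (auto simp: S_def)
      qed
      show ?thesis
      proof (cases "N x = {0}")
        case True
        then show ?thesis using o by blast
      next
        case False
        then obtain u where u: "u \<in> N x" "u \<noteq> 0" using subspace_zero[OF sN[OF x]] by blast
        have "N x \<subseteq> S x" using N(2) x by blast
        then have Nx: "N x \<subseteq> fvs.span {v}" by (simp add: S_def)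
        then have "u \<in> fvs.span {v}" using u(1) by blast
        then obtain c where c: "u = fscale c v" using sc by blast
        then have "c \<noteq> 0" using u(2) by auto
        then have "fscale (inverse c) u = v" unfolding c by simp
        then have "v \<in> N x" using subspace_scale[OF sN[OF x] u(1)] by metis
        then have "fvs.span {v} \<subseteq> N x" by (intro fvs.span_minimal[OF _ sN[OF x]]) auto
        then have "N x = S x" using Nx by (simp add: S_def)
        moreover have "N w = S w" if "w \<in> Field r" "w \<noteq> x" for w using o[OF that] that by (simp add: S_def)
        ultimately show ?thesis by blast
      qed
    qed
    ultimately have "simple_submodule r S M" unfolding simple_submodule_def by blast
    then show ?thesis using vS by blast
  qed simp
  then have "soc M x \<subseteq> fvs.span (\<Union>S\<in>{S. simple_submodule r S M}. S x)"
    using fvs.span_base fvs.span_zero by (metis subsetI)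
  moreover have "fvs.span (\<Union>S\<in>{S. simple_submodule r S M}. S x) \<subseteq> soc M x"
    by (rule fvs.span_minimal[OF _ soc_subspace[OF M x]]) (use simple_sub in auto)
  ultimately show ?thesis by (simp add: socle_def)
qed

lemma socle_str: "str (socle r M) = str M"
  by (simp add: socle_def)

lemma socle_module:
  fixes M :: "'k::field psys"
  assumes M: "fg_module r M"
  shows "fg_module r (socle r M)"
proof -
  have sub: "spc (socle r M) x \<subseteq> spc M x" if "x \<in> Field r" for x
    using socle_spc[OF M that] by (auto simp: soc_def)
  have lin: "lin_map_on (spc (socle r M) x) (spc (socle r M) y) (str M y x)" if xy: "(x, y) \<in> r" for x y
  proof -
    note x = Field1[OF xy] and y = Field2[OF xy]
    have "str M y x v \<in> soc M y" if v: "v \<in> soc M x" for v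
    proof (cases "y = x")
      case True
      then show ?thesis using mod_str_id[OF M x] v by (auto simp: soc_def)
    next
      case False
      then have "str M y x v = 0" using v xy by (auto simp: soc_def)
      then show ?thesis using subspace_zero[OF soc_subspace[OF M y]] by simp
    qed
    then show ?thesis
      using mod_str[OF M xy] sub[OF x] unfolding lin_map_on_def socle_spc[OF M x] socle_spc[OF M y] by blast
  qed
  have "fin_dim_subspace (spc (socle r M) x)" if x: "x \<in> Field r" for x
    using fin_dim_subset[OF mod_space[OF M x] soc_subspace[OF M x]] sub[OF x] unfolding socle_spc[OF M x] by blast
  then show ?thesis
    unfolding fg_module_def socle_str
    using lin mod_str_id[OF M] mod_str_comp[OF M] sub Field1 by blast
qed

text \<open>Follow \<open>v\<close> to a vertex \<open>z\<close> that is maximal among those where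
  its image is nonzero. There the image lies in the socle, so \<open>z\<close> is a maximal element
  of the poset.\<close>

lemma detected_soc:
  assumes M: "fg_module r M"
  shows "detected M \<longleftrightarrow> (\<forall>x\<in>Field r. (\<exists>y. (x, y) \<in> r \<and> y \<noteq> x) \<longrightarrow> soc M x = {0})"
proof
  assume d: "detected M"
  show "\<forall>x\<in>Field r. (\<exists>y. (x, y) \<in> r \<and> y \<noteq> x) \<longrightarrow> soc M x = {0}"
  proof (intro ballI impI)
    fix x assume x: "x \<in> Field r" and y: "\<exists>y. (x, y) \<in> r \<and> y \<noteq> x"
    have "v = 0" if v: "v \<in> soc M x" for v
    proof (rule ccontr)
      assume "v \<noteq> 0"
      then obtain z where z: "(x, z) \<in> r" "\<forall>y. (z, y) \<in> r \<longrightarrow> y = z" "str M z x v \<noteq> 0"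
        using d x v unfolding detected_def soc_def by blast
      then have "z \<noteq> x" using y by blast
      then show False using v z by (auto simp: soc_def)
    qed
    then show "soc M x = {0}" using subspace_zero[OF soc_subspace[OF M x]] by blast
  qed
next
  assume s: "\<forall>x\<in>Field r. (\<exists>y. (x, y) \<in> r \<and> y \<noteq> x) \<longrightarrow> soc M x = {0}"
  show "detected M"
    unfolding detected_def
  proof (intro ballI impI)
    fix x v assume x: "x \<in> Field r" and v: "v \<in> spc M x" "v \<noteq> 0"
    define A where "A = {y. (x, y) \<in> r \<and> str M y x v \<noteq> 0}"
    have fA: "finite A" by (rule finite_subset[OF _ fin]) (auto simp: A_def Field2)
    have "x \<in> A" using refl[OF x] mod_str_id[OF M x] v by (auto simp: A_def)
    then obtain z where z: "z \<in> A" "\<And>y. y \<in> A \<Longrightarrow> (z, y) \<in> r \<Longrightarrow> y = z"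
    proof -
      \<comment> \<open>A maximal element of \<open>A\<close> is found by minimizing the number of
        elements of \<open>A\<close> above it.\<close>
      define up where "up y = card {w \<in> A. (y, w) \<in> r}" for y
      obtain z where z: "z \<in> A" "\<And>y. y \<in> A \<Longrightarrow> up z \<le> up y"
        using ex_has_least_nat[of "\<lambda>y. y \<in> A" x up] \<open>x \<in> A\<close> by blast
      have "y = z" if y: "y \<in> A" "(z, y) \<in> r" for y
      proof (rule ccontr)
        assume "y \<noteq> z"
        have "{w \<in> A. (y, w) \<in> r} \<subset> {w \<in> A. (z, w) \<in> r}"
        proof
          show "{w \<in> A. (y, w) \<in> r} \<subseteq> {w \<in> A. (z, w) \<in> r}" using trans[OF y(2)] by blast
          have "z \<in> {w \<in> A. (z, w) \<in> r}" using z(1) refl Field1[OF y(2)] by blast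
          moreover have "z \<notin> {w \<in> A. (y, w) \<in> r}" using antisym[OF y(2)] \<open>y \<noteq> z\<close> by blast
          ultimately show "{w \<in> A. (y, w) \<in> r} \<noteq> {w \<in> A. (z, w) \<in> r}" by blast
        qed
        then have "up y < up z" unfolding up_def by (intro psubset_card_mono) (auto simp: fA)
        then show False using z(2)[OF y(1)] by simp
      qed
      then show ?thesis using that z by blast
    qed
    have xz: "(x, z) \<in> r" "str M z x v \<noteq> 0" using z(1) by (auto simp: A_def)
    note zF = Field2[OF xz(1)]
    have "str M y z (str M z x v) = 0" if y: "(z, y) \<in> r" "y \<noteq> z" for y
    proof -
      have "y \<notin> A" using z(2) y by blast
      then have "str M y x v = 0" using trans[OF xz(1) y(1)] by (auto simp: A_def)
      then show ?thesis using mod_str_comp[OF M xz(1) y(1) v(1)] by simp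
    qed
    then have "str M z x v \<in> soc M z" unfolding soc_def using lin_map_in[OF mod_str[OF M xz(1)] v(1)] by blast
    then have "\<forall>y. (z, y) \<in> r \<longrightarrow> y = z" using s zF xz(2) by blast
    then show "\<exists>z. (x, z) \<in> r \<and> (\<forall>y. (z, y) \<in> r \<longrightarrow> y = z) \<and> str M z x v \<noteq> 0" using xz by blast
  qed
qed

text \<open>The socle lives at the maximal elements, so all its structure maps between different
  vertices start from zero. Linear lifts chosen vertex by vertex are then automatically
  compatible.\<close>

lemma detected_projective:
  fixes M :: "'k::field psys"
  assumes M: "fg_module r M" and d: "detected M"
  shows "socle_projective r M"
  unfolding socle_projective_def projective_def
proof (intro conjI allI impI)
  let ?P = "socle r M"
  show "fg_module r ?P" by (rule socle_module[OF M])
  note P = this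
  fix A B :: "'k psys" and g f
  assume a: "fg_module r A \<and> fg_module r B \<and> g \<in> mod_hom r A B \<and> (\<forall>x\<in>Field r. g x ` spc A x = spc B x) \<and> f \<in> mod_hom r ?P B"
  then have A: "fg_module r A" and g: "g \<in> mod_hom r A B" and gs: "\<And>x. x \<in> Field r \<Longrightarrow> g x ` spc A x = spc B x"
    and f: "f \<in> mod_hom r ?P B" by blast+
  have zero: "v = 0" if "x \<in> Field r" "v \<in> spc ?P x" "(x, y) \<in> r" "y \<noteq> x" for x y v
    using d that unfolding detected_soc[OF M] socle_spc[OF M that(1)] by blast
  have ex: "\<exists>h. lin_map_on (spc ?P x) (spc A x) h \<and> (\<forall>v\<in>spc ?P x. g x (h v) = f x v)" if x: "x \<in> Field r" for x
    using linear_lift[OF hom_lin[OF g x] gs[OF x] mod_subspace[OF A x] mod_subspace[OF P x] hom_lin[OF f x]] by metis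
  define h where "h x v = (if x \<in> Field r \<and> v \<in> spc ?P x
    then (SOME h. lin_map_on (spc ?P x) (spc A x) h \<and> (\<forall>v\<in>spc ?P x. g x (h v) = f x v)) v else 0)" for x v
  have h: "lin_map_on (spc ?P x) (spc A x) (h x) \<and> (\<forall>v\<in>spc ?P x. g x (h x v) = f x v)" if x: "x \<in> Field r" for x
  proof -
    define k where "k = (SOME h. lin_map_on (spc ?P x) (spc A x) h \<and> (\<forall>v\<in>spc ?P x. g x (h v) = f x v))"
    have k: "lin_map_on (spc ?P x) (spc A x) k" "\<forall>v\<in>spc ?P x. g x (k v) = f x v"
      using someI_ex[OF ex[OF x]] unfolding k_def by blast+
    have e: "h x v = k v" if "v \<in> spc ?P x" for v using that x by (simp add: h_def k_def)
    note s = mod_subspace[OF P x]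
    show ?thesis
      using k e subspace_add[OF s] subspace_scale[OF s] unfolding lin_map_on_def by simp
  qed
  have "h \<in> mod_hom r ?P A"
  proof (rule mod_homI)
    show "lin_map_on (spc ?P x) (spc A x) (h x)" if "x \<in> Field r" for x using h[OF that] by blast
  next
    fix x y v assume xy: "(x, y) \<in> r" "v \<in> spc ?P x"
    note x = Field1[OF xy(1)] and y = Field2[OF xy(1)]
    show "h y (str ?P y x v) = str A y x (h x v)"
    proof (cases "y = x")
      case True
      have "h x v \<in> spc A x" using h[OF x] lin_map_in xy by blast
      then show ?thesis using True mod_str_id[OF P x xy(2)] mod_str_id[OF A x] by simp
    next
      case False
      then have "v = 0" using zero[OF x xy(2,1)] by blast
      have hx: "lin_map_on (spc ?P x) (spc A x) (h x)" and hy: "lin_map_on (spc ?P y) (spc A y) (h y)"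
        using h x y by blast+
      show ?thesis
        unfolding \<open>v = 0\<close> lin_map_zero[OF mod_str[OF P xy(1)] mod_subspace[OF P x]]
          lin_map_zero[OF hx mod_subspace[OF P x]] lin_map_zero[OF hy mod_subspace[OF P y]]
          lin_map_zero[OF mod_str[OF A xy(1)] mod_subspace[OF A x]] ..
    qed
  qed (auto simp: h_def)
  then show "\<exists>h\<in>mod_hom r ?P A. \<forall>x\<in>Field r. \<forall>v\<in>spc ?P x. g x (h x v) = f x v" using h by blast
qed

text \<open>Otherwise some \<open>v \<noteq> 0\<close> in the socle at a non-maximal \<open>x\<close> is mapped to a generator of the simple
  module at \<open>x\<close>, and this map does not lift to the projective module that is constant above \<open>x\<close>.\<close>

lemma projective_detected:
  fixes M :: "'k::field psys"
  assumes M: "fg_module r M" and p: "socle_projective r M"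
  shows "detected M"
  unfolding detected_soc[OF M]
proof (intro ballI impI)
  fix x assume x: "x \<in> Field r" and "\<exists>y. (x, y) \<in> r \<and> y \<noteq> x"
  then obtain y where y: "(x, y) \<in> r" "y \<noteq> x" by blast
  let ?P = "socle r M"
  note P = socle_module[OF M]
  have "v = 0" if v: "v \<in> soc M x" for v
  proof (rule ccontr)
    assume v0: "v \<noteq> 0"
    have "\<exists>e :: 'k vec \<Rightarrow> 'k. e v = 1 \<and> (\<forall>u w. e (u + w) = e u + e w) \<and> (\<forall>c u. e (fscale c u) = c * e u)"
      by (rule coordinate_functional[OF v0]) blast
    then obtain e :: "'k vec \<Rightarrow> 'k" where e: "e v = 1" "\<And>u w. e (u + w) = e u + e w" "\<And>c u. e (fscale c u) = c * e u"
      by blast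
    \<comment> \<open>The line spanned by \<open>b\<close> plays the role of \<open>k\<close> inside
      \<open>nat \<Rightarrow> 'k\<close>.\<close>
    define b :: "'k vec" where "b = basis_vec 0"
    define L where "L = fvs.span {b}"
    have bb: "b \<noteq> 0" by (auto simp: b_def basis_vec_def fun_eq_iff intro: exI[of _ 0])
    have sL: "fin_dim_subspace L" unfolding fin_dim_subspace_def L_def using fvs.subspace_span by blast
    have sZ: "fin_dim_subspace {0 :: 'k vec}" unfolding fin_dim_subspace_def
      using fvs.subspace_single_0 fvs.span_empty by (metis finite.emptyI)
    have subL: "fvs.subspace L" by (simp add: L_def fvs.subspace_span)
    have L0: "0 \<in> L" by (rule subspace_zero[OF subL])
    have bL: "b \<in> L" by (simp add: L_def fvs.span_base)
    define A :: "'k psys" where "A = \<lparr>spc = (\<lambda>w. if (x, w) \<in> r then L else {0}), str = (\<lambda>w u a. if (x, u) \<in> r then a else 0)\<rparr>"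
    define B :: "'k psys" where "B = \<lparr>spc = (\<lambda>w. if w = x then L else {0}), str = (\<lambda>w u a. if w = x \<and> u = x then a else 0)\<rparr>"
    have A: "fg_module r A"
      unfolding fg_module_def
    proof (intro conjI ballI allI impI)
      show "fin_dim_subspace (spc A w)" if "w \<in> Field r" for w using sL sZ by (simp add: A_def)
      fix q assume "q \<in> r"
      then obtain u w where q: "q = (u, w)" "(u, w) \<in> r" by (cases q) auto
      show "case q of (x, y) \<Rightarrow> lin_map_on (spc A x) (spc A y) (str A y x)"
        unfolding q(1) case_prod_conv lin_map_on_def using trans[of x u w] q(2) L0 by (auto simp: A_def simp del: zero_fun_apply)
    qed (auto simp: A_def split: if_splits dest: trans)
    have B: "fg_module r B"
      unfolding fg_module_def
    proof (intro conjI ballI allI impI)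
      show "fin_dim_subspace (spc B w)" if "w \<in> Field r" for w using sL sZ by (simp add: B_def)
      fix q assume "q \<in> r"
      then obtain u w where q: "q = (u, w)" "(u, w) \<in> r" by (cases q) auto
      show "case q of (x, y) \<Rightarrow> lin_map_on (spc B x) (spc B y) (str B y x)"
        unfolding q(1) case_prod_conv lin_map_on_def using L0 by (auto simp: B_def simp del: zero_fun_apply)
    next
      fix u w t a assume "(u, w) \<in> r" "(w, t) \<in> r" "a \<in> spc B u"
      then show "str B t w (str B w u a) = str B t u a" using antisym[of x w] by (auto simp: B_def)
    qed (auto simp: B_def split: if_splits)
    define g :: "nat \<Rightarrow> 'k vec \<Rightarrow> 'k vec" where "g w a = (if w = x \<and> a \<in> L then a else 0)" for w a
    have g: "g \<in> mod_hom r A B"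
    proof (rule mod_homI)
      fix w assume w: "w \<in> Field r"
      show "lin_map_on (spc A w) (spc B w) (g w)"
        unfolding lin_map_on_def using refl[OF x] subspace_add[OF subL] subspace_scale[OF subL] by (auto simp: A_def B_def g_def)
    next
      fix u w a assume uw: "(u, w) \<in> r" "a \<in> spc A u"
      show "g w (str A w u a) = str B w u (g u a)"
      proof (cases "w = x")
        case True
        then show ?thesis using uw antisym[of x u] refl[OF x] by (auto simp: A_def B_def g_def split: if_splits)
      next
        case False
        then show ?thesis by (simp add: B_def g_def)
      qed
    next
      fix w a assume "w \<notin> Field r \<or> a \<notin> spc A w"
      then show "g w a = 0" using refl[OF x] x by (auto simp: g_def A_def split: if_splits)
    qed
    have gs: "\<forall>w\<in>Field r. g w ` spc A w = spc B w"
    proof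
      fix w assume "w \<in> Field r"
      show "g w ` spc A w = spc B w"
        using refl[OF x] L0 by (cases "w = x") (auto simp: A_def B_def g_def image_iff)
    qed
    define f :: "nat \<Rightarrow> 'k vec \<Rightarrow> 'k vec" where "f w a = (if w = x \<and> a \<in> soc M x then fscale (e a) b else 0)" for w a
    have f: "f \<in> mod_hom r ?P B"
    proof (rule mod_homI)
      fix w assume w: "w \<in> Field r"
      note s = soc_subspace[OF M x]
      show "lin_map_on (spc ?P w) (spc B w) (f w)"
        unfolding lin_map_on_def using subspace_add[OF s] subspace_scale[OF s] subspace_scale[OF subL bL] socle_spc[OF M x]
        by (auto simp: B_def f_def e fvs.scale_left_distrib simp del: plus_fun_apply zero_fun_apply)
    next
      fix u w a assume uw: "(u, w) \<in> r" "a \<in> spc ?P u"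
      have a: "a \<in> soc M u" using uw socle_spc[OF M Field1[OF uw(1)]] by simp
      show "f w (str ?P w u a) = str B w u (f u a)"
      proof (cases "w = u")
        case True
        then have "str M w u a = a" using mod_str_id[OF M Field1[OF uw(1)]] a by (auto simp: soc_def)
        then show ?thesis unfolding socle_str using True by (simp add: B_def f_def)
      next
        case False
        then have "str M w u a = 0" using a uw(1) by (auto simp: soc_def)
        moreover have "e 0 = 0" using e(3)[of 0 0] by (simp only: fvs.scale_zero_left mult_zero_left)
        ultimately show ?thesis unfolding socle_str using False by (auto simp: B_def f_def simp del: zero_fun_apply)
      qed
    next
      fix w a assume "w \<notin> Field r \<or> a \<notin> spc ?P w"
      then show "f w a = 0" using x socle_spc[OF M x] by (auto simp: f_def)
    qed
    have "projective r ?P" using p by (simp add: socle_projective_def)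
    then obtain h where h: "h \<in> mod_hom r ?P A" "\<forall>w\<in>Field r. \<forall>u\<in>spc ?P w. g w (h w u) = f w u"
      using A B g gs f unfolding projective_def by blast
    have vP: "v \<in> spc ?P x" using v socle_spc[OF M x] by simp
    have "g x (h x v) = b" using h(2) x vP v e(1) by (auto simp: f_def)
    then have hv: "h x v = b" using bb by (auto simp: g_def split: if_splits)
    \<comment> \<open>At \<open>y\<close> the vector \<open>v\<close> has already become zero, while
      its lift \<open>b\<close> survives in the module that is constant above
      \<open>x\<close>.\<close>
    have "h y (str ?P y x v) = str A y x (h x v)" by (rule hom_nat[OF h(1) y(1) vP])
    moreover have "str ?P y x v = 0" using v y unfolding socle_str by (auto simp: soc_def)
    moreover have "h y 0 = 0"
      using lin_map_zero[OF hom_lin[OF h(1) Field2[OF y(1)]] mod_subspace[OF P Field2[OF y(1)]]] .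
    ultimately show False using hv bb refl[OF x] by (simp add: A_def)
  qed
  then show "soc M x = {0}" using subspace_zero[OF soc_subspace[OF M x]] by blast
qed

lemma socle_projective_iff: "fg_module r M \<Longrightarrow> socle_projective r M \<longleftrightarrow> detected M"
  using detected_projective projective_detected by blast

end

section \<open>Decomposition of representations of a line into intervals\<close>

section \<open>Matching bases of a representation of a quiver of type A\<close>

lemma lin_map_span_image:
  assumes f: "lin_map_on A B f" and A: "fvs.subspace A" and S: "S \<subseteq> A"
  shows "f ` fvs.span S = fvs.span (f ` S)"
proof
  have sp: "fvs.span S \<subseteq> A" by (rule fvs.span_minimal[OF S A])
  show "f ` fvs.span S \<subseteq> fvs.span (f ` S)"
  proof (rule image_subsetI)
    fix v assume "v \<in> fvs.span S"
    then have "f v \<in> fvs.span (f ` S) \<and> v \<in> A"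
    proof (induction rule: fvs.span_induct_alt)
      case base
      show ?case unfolding lin_map_zero[OF f A] using fvs.span_zero subspace_zero[OF A] by blast
    next
      case (step c x y)
      have xA: "x \<in> A" and "y \<in> A" using step S by auto
      then have "f (fscale c x + y) = fscale c (f x) + f y"
        using lin_map_add[OF f subspace_scale[OF A xA]] lin_map_scale[OF f xA] by simp
      moreover have "fscale c (f x) + f y \<in> fvs.span (f ` S)"
        using step fvs.span_base[of "f x" "f ` S"] by (intro fvs.span_add fvs.span_scale) auto
      moreover have "fscale c x + y \<in> A" using subspace_add[OF A subspace_scale[OF A xA] \<open>y \<in> A\<close>] .
      ultimately show ?case by (simp only:)
    qed
    then show "f v \<in> fvs.span (f ` S)" ..
  qed
  have "v \<in> f ` fvs.span S" if "v \<in> fvs.span (f ` S)" for v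
    using that
  proof (induction rule: fvs.span_induct_alt)
    case base
    then show ?case using lin_map_zero[OF f A] fvs.span_zero by (metis image_eqI)
  next
    case (step c x y)
    then obtain u w where u: "u \<in> S" "x = f u" and w: "w \<in> fvs.span S" "y = f w" by blast
    have uA: "u \<in> A" and wA: "w \<in> A" using u w S sp by auto
    have "f (fscale c u + w) = fscale c x + y"
      using lin_map_add[OF f subspace_scale[OF A uA] wA] lin_map_scale[OF f uA] u w by simp
    moreover have "fscale c u + w \<in> fvs.span S"
      using fvs.span_base[OF u(1)] w by (intro fvs.span_add fvs.span_scale)
    ultimately show ?case by (metis image_eqI)
  qed
  then show "fvs.span (f ` S) \<subseteq> f ` fvs.span S" by blast
qed

lemma lin_map_diff:
  assumes f: "lin_map_on A B f" and A: "fvs.subspace A" and uv: "u \<in> A" "v \<in> A"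
  shows "f (u - v) = f u - f v"
proof -
  have "f (u - v + v) = f (u - v) + f v"
    by (rule lin_map_add[OF f fvs.subspace_diff[OF A uv] uv(2)])
  then show ?thesis by simp
qed

lemma kernel_subspace:
  assumes f: "lin_map_on A B f" and A: "fvs.subspace A" and W: "fvs.subspace W"
  shows "fvs.subspace {v \<in> A. f v \<in> W}"
  unfolding fvs.subspace_def
proof (intro conjI ballI allI)
  show "0 \<in> {v \<in> A. f v \<in> W}"
    using lin_map_zero[OF f A] subspace_zero[OF A] subspace_zero[OF W] by (simp only: mem_Collect_eq)
  show "u + v \<in> {v \<in> A. f v \<in> W}" if "u \<in> {v \<in> A. f v \<in> W}" "v \<in> {v \<in> A. f v \<in> W}" for u v
    using that lin_map_add[OF f] subspace_add[OF A] subspace_add[OF W] by simp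
  show "fscale c v \<in> {v \<in> A. f v \<in> W}" if "v \<in> {v \<in> A. f v \<in> W}" for c v
    using that lin_map_scale[OF f] subspace_scale[OF A] subspace_scale[OF W] by simp
qed

lemma image_subspace:
  assumes f: "lin_map_on A B f" and A: "fvs.subspace A" and W: "fvs.subspace W" "W \<subseteq> A"
  shows "fvs.subspace (f ` W)"
proof -
  have "fvs.span W = W" using W(1) by simp
  then show ?thesis using lin_map_span_image[OF f A W(2)] fvs.subspace_span by metis
qed

text \<open>Indexing by all naturals with an eventually constant value lets flags of different
  lengths be treated uniformly.\<close>

definition flag :: "('b \<Rightarrow> 'k::field) set \<Rightarrow> (nat \<Rightarrow> ('b \<Rightarrow> 'k) set) \<Rightarrow> bool" where
  "flag V W \<longleftrightarrow> (\<forall>j. fvs.subspace (W j)) \<and> (\<forall>j. W j \<subseteq> W (Suc j)) \<and> (\<exists>m. \<forall>j\<ge>m. W j = V)"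

text \<open>Compatibility of a basis with all steps at once. It allows a basis to be carried through
  a linear map once kernels, images and preimages have been built into the flag.\<close>

definition adapted :: "(nat \<Rightarrow> ('b \<Rightarrow> 'k::field) set) \<Rightarrow> ('b \<Rightarrow> 'k) set \<Rightarrow> bool" where
  "adapted W B \<longleftrightarrow> \<not> fvs.dependent B \<and> (\<forall>j. W j \<subseteq> fvs.span (B \<inter> W j))"

text \<open>The matrix of \<open>f\<close> in these bases has entries 0 and 1, with at most one 1 in
  each row and each column.\<close>

definition matches :: "(('b \<Rightarrow> 'k::field) \<Rightarrow> 'c \<Rightarrow> 'k) \<Rightarrow> ('b \<Rightarrow> 'k) set \<Rightarrow> ('c \<Rightarrow> 'k) set \<Rightarrow> bool" where
  "matches f A B \<longleftrightarrow> f ` A \<subseteq> insert 0 B \<and> inj_on f {a \<in> A. f a \<noteq> 0}"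

lemma flag_mono: "flag V W \<Longrightarrow> i \<le> j \<Longrightarrow> W i \<subseteq> W j"
  unfolding flag_def by (meson lift_Suc_mono_le)

lemma flag_sub: "flag V W \<Longrightarrow> W j \<subseteq> V"
proof -
  assume f: "flag V W"
  then obtain m where m: "\<forall>j\<ge>m. W j = V" unfolding flag_def by blast
  have "W j \<subseteq> W (max j m)" by (rule flag_mono[OF f]) simp
  then show ?thesis using m by simp
qed

lemma adapted_span:
  assumes "flag V W" "adapted W B" "B \<subseteq> V"
  shows "fvs.span B = V"
proof -
  obtain m where m: "W m = V" and s: "fvs.subspace (W m)" using assms(1) unfolding flag_def by blast
  have "V \<subseteq> fvs.span (B \<inter> V)" using assms(2) m unfolding adapted_def by metis
  then have "V \<subseteq> fvs.span B" using assms(3) by (simp add: Int_absorb2)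
  moreover have "fvs.span B \<subseteq> V" using fvs.span_minimal[OF assms(3)] s m by simp
  ultimately show ?thesis by blast
qed

lemma independent_notin_span:
  assumes "\<not> fvs.dependent B" "b \<in> B" "b \<in> fvs.span S" "S \<subseteq> B"
  shows "b \<in> S"
proof (rule ccontr)
  assume "b \<notin> S"
  then have "fvs.span S \<subseteq> fvs.span (B - {b})" using assms by (intro fvs.span_mono) auto
  then show False using assms unfolding fvs.dependent_def by blast
qed

text \<open>The condition ranges over subsets \<open>S\<close> of \<open>D\<close> because the
  elements of \<open>D\<close> join the independent set one at a time.\<close>

lemma independent_union:
  assumes "\<not> fvs.dependent B" "finite D"
    and "\<And>c S. c \<in> D \<Longrightarrow> S \<subseteq> D \<Longrightarrow> c \<in> fvs.span (B \<union> S) \<Longrightarrow> c \<in> S"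
  shows "\<not> fvs.dependent (B \<union> D)"
  using assms(2,3)
proof (induction D rule: finite_induct)
  case (insert c D)
  have ind: "\<not> fvs.dependent (B \<union> D)" using insert.IH insert.prems by blast
  have "c \<notin> fvs.span (B \<union> D)" using insert.prems[of c D] insert.hyps by blast
  then show ?case using fvs.independent_insertI ind by (metis Un_insert_right)
qed (use assms(1) in simp)

lemma independent_finite:
  assumes "fin_dim_subspace V" "\<not> fvs.dependent B" "B \<subseteq> V"
  shows "finite B"
  using assms fvs.independent_span_bound[of _ B] unfolding fin_dim_subspace_def by metis

text \<open>The hypothesis on \<open>C\<close> says that \<open>C\<close> is adapted to the flag
  induced on its own span. Going up the flag, the vectors of \<open>C\<close> that are new at a
  level therefore stay independent of the basis found below it.\<close>

lemma adapted_extension: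
  assumes V: "fin_dim_subspace V" and W: "flag V W" and C: "\<not> fvs.dependent C" "C \<subseteq> V"
    and CW: "\<And>j. fvs.span C \<inter> W j \<subseteq> fvs.span (C \<inter> W j)"
  obtains B where "adapted W B" "C \<subseteq> B" "B \<subseteq> V"
proof -
  have sW: "fvs.subspace (W j)" for j using W unfolding flag_def by blast
  have "\<exists>B. \<not> fvs.dependent B \<and> B \<subseteq> W j \<and> C \<inter> W j \<subseteq> B \<and> (\<forall>i\<le>j. W i \<subseteq> fvs.span (B \<inter> W i))" for j
  proof (induction j)
    case 0
    have "\<not> fvs.dependent (C \<inter> W 0)" using C(1) fvs.independent_mono by blast
    then obtain B where "C \<inter> W 0 \<subseteq> B" "B \<subseteq> W 0" "\<not> fvs.dependent B" "W 0 \<subseteq> fvs.span B"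
      using fvs.maximal_independent_subset_extend[of "C \<inter> W 0" "W 0"] by blast
    then show ?case by (intro exI[of _ B]) (auto simp: Int_absorb2)
  next
    case (Suc j)
    then obtain B where B: "\<not> fvs.dependent B" "B \<subseteq> W j" "C \<inter> W j \<subseteq> B" "\<And>i. i \<le> j \<Longrightarrow> W i \<subseteq> fvs.span (B \<inter> W i)" by blast
    have BW: "fvs.span B \<subseteq> W j" by (rule fvs.span_minimal[OF B(2) sW])
    define D where "D = C \<inter> W (Suc j) - W j"
    have fD: "finite D" by (rule finite_subset[OF _ independent_finite[OF V C]]) (auto simp: D_def)
    have "\<not> fvs.dependent (B \<union> D)"
    proof (rule independent_union[OF B(1) fD])
      fix c S assume c: "c \<in> D" and S: "S \<subseteq> D" and sp: "c \<in> fvs.span (B \<union> S)"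
      then obtain w u where wu: "c = w + u" "w \<in> fvs.span B" "u \<in> fvs.span S" unfolding fvs.span_Un by blast
      have SC: "S \<subseteq> C" "c \<in> C" using S c by (auto simp: D_def)
      have "u \<in> fvs.span C" "c \<in> fvs.span C" using wu(3) fvs.span_mono[OF SC(1)] fvs.span_base[OF SC(2)] by auto
      then have "c - u \<in> fvs.span C" by (intro fvs.span_diff)
      moreover have "c - u = w" using wu by simp
      ultimately have "w \<in> fvs.span (C \<inter> W j)" using CW[of j] wu(2) BW by blast
      then have "c \<in> fvs.span (C \<inter> W j \<union> S)" unfolding fvs.span_Un using wu by blast
      then have "c \<in> C \<inter> W j \<union> S"
        by (rule independent_notin_span[OF C(1) SC(2)]) (use SC in auto)
      then show "c \<in> S" using c by (auto simp: D_def)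
    qed
    moreover have "B \<union> D \<subseteq> W (Suc j)" using B(2) flag_mono[OF W, of j "Suc j"] by (auto simp: D_def)
    ultimately obtain B' where B': "B \<union> D \<subseteq> B'" "B' \<subseteq> W (Suc j)" "\<not> fvs.dependent B'" "W (Suc j) \<subseteq> fvs.span B'"
      using fvs.maximal_independent_subset_extend[of "B \<union> D" "W (Suc j)"] by blast
    have "W i \<subseteq> fvs.span (B' \<inter> W i)" if "i \<le> Suc j" for i
    proof (cases "i = Suc j")
      case True
      then show ?thesis using B' by (simp add: Int_absorb2)
    next
      case False
      then have "W i \<subseteq> fvs.span (B \<inter> W i)" using B(4) that by auto
      also have "\<dots> \<subseteq> fvs.span (B' \<inter> W i)" using B' by (intro fvs.span_mono) auto
      finally show ?thesis .
    qed
    moreover have "C \<inter> W (Suc j) \<subseteq> B'" using B' B(3) by (auto simp: D_def)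
    ultimately show ?case using B' by blast
  qed
  note ex = this
  obtain m where m: "\<And>j. j \<ge> m \<Longrightarrow> W j = V" using W unfolding flag_def by blast
  obtain B where B: "\<not> fvs.dependent B" "B \<subseteq> W m" "C \<inter> W m \<subseteq> B" "\<And>i. i \<le> m \<Longrightarrow> W i \<subseteq> fvs.span (B \<inter> W i)"
    using ex[of m] by blast
  have "W j \<subseteq> fvs.span (B \<inter> W j)" for j
    using B(4)[of j] B(4)[of m] m[of j] m[of m] by (cases "j \<le> m") auto
  moreover have "C \<subseteq> B" "B \<subseteq> V" using B(2,3) m[of m] C(2) by auto
  ultimately show ?thesis using that[of B] B(1) by (simp add: adapted_def)
qed

lemma adapted_exists:
  assumes "fin_dim_subspace V" "flag V W"
  obtains B where "adapted W B" "B \<subseteq> V"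
proof -
  have sW: "fvs.subspace (W j)" for j using assms(2) unfolding flag_def by blast
  obtain B where "adapted W B" "{} \<subseteq> B" "B \<subseteq> V"
  proof (rule adapted_extension[OF assms fvs.independent_empty])
    show "fvs.span {} \<inter> W j \<subseteq> fvs.span ({} \<inter> W j)" for j by simp
  qed auto
  then show ?thesis using that by blast
qed

text \<open>The flag goes forward and the basis comes back. The new flag consists of the images of
  the steps of \<open>W\<close>, so a basis adapted to it can be lifted level by level and completed
  by an adapted basis of the kernel.\<close>

lemma step_right:
  assumes V: "fin_dim_subspace V" and V': "fin_dim_subspace V'" and f: "lin_map_on V V' f" and W: "flag V W"
  shows "\<exists>W'. flag V' W' \<and> (\<forall>B'. adapted W' B' \<and> B' \<subseteq> V' \<longrightarrow> (\<exists>B. adapted W B \<and> B \<subseteq> V \<and> matches f B B'))"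
proof -
  have sV: "fvs.subspace V" and sV': "fvs.subspace V'" using V V' unfolding fin_dim_subspace_def by blast+
  have sW: "fvs.subspace (W j)" for j using W unfolding flag_def by blast
  obtain m where m: "\<And>j. j \<ge> m \<Longrightarrow> W j = V" using W unfolding flag_def by blast
  \<comment> \<open>The images need not exhaust \<open>V'\<close>, so the flag jumps to
    \<open>V'\<close> after the level \<open>m\<close> at which \<open>W\<close> is
    complete.\<close>
  define W' where "W' j = (if j \<le> m then f ` W j else V')" for j
  have fV: "f ` V \<subseteq> V'" using lin_map_in[OF f] by blast
  have "flag V' W'"
    unfolding flag_def
  proof (intro conjI allI)
    show "fvs.subspace (W' j)" for j
      unfolding W'_def using image_subspace[OF f sV sW flag_sub[OF W]] sV' by simp
    show "W' j \<subseteq> W' (Suc j)" for j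
      unfolding W'_def using flag_mono[OF W, of j "Suc j"] flag_sub[OF W, of j] fV by auto
    show "\<exists>m. \<forall>j\<ge>m. W' j = V'" by (rule exI[of _ "Suc m"]) (simp add: W'_def)
  qed
  moreover have "\<exists>B. adapted W B \<and> B \<subseteq> V \<and> matches f B B'" if B': "adapted W' B'" "B' \<subseteq> V'" for B'
  proof -
    have iB': "\<not> fvs.dependent B'" and aB': "\<And>j. W' j \<subseteq> fvs.span (B' \<inter> W' j)" using B'(1) unfolding adapted_def by blast+
    define K where "K = {v \<in> V. f v \<in> {0}}"
    have sK: "fvs.subspace K" unfolding K_def by (rule kernel_subspace[OF f sV fvs.subspace_single_0])
    have K: "fin_dim_subspace K" by (rule fin_dim_subset[OF V sK]) (auto simp: K_def)
    have fK: "flag K (\<lambda>j. W j \<inter> K)"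
      unfolding flag_def
    proof (intro conjI allI)
      show "fvs.subspace (W j \<inter> K)" for j using sW sK by (rule fvs.subspace_inter)
      show "W j \<inter> K \<subseteq> W (Suc j) \<inter> K" for j using flag_mono[OF W, of j "Suc j"] by auto
      show "\<exists>m. \<forall>j\<ge>m. W j \<inter> K = K" by (rule exI[of _ m]) (auto simp: m K_def)
    qed
    obtain C where C: "adapted (\<lambda>j. W j \<inter> K) C" "C \<subseteq> K" by (rule adapted_exists[OF K fK])
    define D where "D = B' \<inter> f ` V"
    \<comment> \<open>Each vector is lifted at the lowest possible level, so the lift lies in every
      step of \<open>W\<close> whose image contains the vector.\<close>
    define lev where "lev d = (LEAST j. d \<in> f ` W j)" for d
    define l where "l d = (SOME x. x \<in> W (lev d) \<and> f x = d)" for d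
    have l: "l d \<in> W j \<and> f (l d) = d" if "d \<in> D" "d \<in> f ` W j" for d j
    proof -
      have "d \<in> f ` W (lev d)" unfolding lev_def by (rule LeastI[of "\<lambda>j. d \<in> f ` W j", OF that(2)])
      then have "\<exists>x. x \<in> W (lev d) \<and> f x = d" by blast
      then have "l d \<in> W (lev d) \<and> f (l d) = d" unfolding l_def by (rule someI_ex)
      moreover have "lev d \<le> j" unfolding lev_def by (rule Least_le[of "\<lambda>j. d \<in> f ` W j", OF that(2)])
      ultimately show ?thesis using flag_mono[OF W] by blast
    qed
    have lV: "l d \<in> V" "f (l d) = d" if "d \<in> D" for d
      using l[OF that, of m] that m[of m] by (auto simp: D_def)
    have iC: "\<not> fvs.dependent C" and aC: "\<And>j. W j \<inter> K \<subseteq> fvs.span (C \<inter> (W j \<inter> K))" using C(1) unfolding adapted_def by blast+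
    have CK: "C \<subseteq> V" "\<And>c. c \<in> C \<Longrightarrow> f c = 0" using C(2) by (auto simp: K_def)
    define B where "B = C \<union> l ` D"
    have BV: "B \<subseteq> V" using CK lV by (auto simp: B_def)
    have fD: "finite D" by (rule finite_subset[OF _ independent_finite[OF V' iB' B'(2)]]) (auto simp: D_def)
    have "\<not> fvs.dependent B"
      unfolding B_def
    proof (rule independent_union[OF iC])
      show "finite (l ` D)" using fD by simp
      fix c S assume c: "c \<in> l ` D" and S: "S \<subseteq> l ` D" and sp: "c \<in> fvs.span (C \<union> S)"
      obtain d where d: "d \<in> D" "c = l d" using c by blast
      have "C \<union> S \<subseteq> V" using CK S lV by auto
      then have "f c \<in> fvs.span (f ` (C \<union> S))" using lin_map_span_image[OF f sV] sp by blast
      moreover have sub: "f ` (C \<union> S) \<subseteq> insert 0 (f ` S)" using CK by auto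
      ultimately have "f c \<in> fvs.span (insert 0 (f ` S))" using subsetD[OF fvs.span_mono[OF sub]] by blast
      then have "d \<in> fvs.span (insert 0 (f ` S))" using lV(2)[OF d(1)] d(2) by simp
      then have "d \<in> fvs.span (f ` S)" by (metis fvs.span_insert_0)
      moreover have "f ` S \<subseteq> D" using S lV by auto
      moreover have "d \<in> B'" "D \<subseteq> B'" using d by (auto simp: D_def)
      ultimately have "d \<in> f ` S" using independent_notin_span[OF iB', of d "f ` S"] by blast
      then show "c \<in> S" using S lV(2) d by fastforce
    qed
    moreover have "W j \<subseteq> fvs.span (B \<inter> W j)" for j
    proof -
      have main: "W j \<subseteq> fvs.span (B \<inter> W j)" if j: "j \<le> m" for j
      proof
        fix w assume w: "w \<in> W j"
        define E where "E = B' \<inter> W' j"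
        have ED: "E \<subseteq> D" "E \<subseteq> f ` W j" using j flag_sub[OF W, of j] by (auto simp: E_def D_def W'_def)
        have lE: "l ` E \<subseteq> V" "l ` E \<subseteq> W j" using ED l lV by blast+
        have "f ` (l ` E) = E" using ED lV(2) by force
        moreover have "f w \<in> fvs.span E" using aB'[of j] w j by (auto simp: E_def W'_def)
        ultimately have "f w \<in> f ` fvs.span (l ` E)" using lin_map_span_image[OF f sV lE(1)] by simp
        then obtain u where u: "u \<in> fvs.span (l ` E)" "f w = f u" by blast
        have uW: "u \<in> W j" using u fvs.span_minimal[OF lE(2) sW] by blast
        have "f (w - u) = f w - f u" using lin_map_diff[OF f sV] w uW flag_sub[OF W] by blast
        then have "w - u \<in> W j \<inter> K"
          using u fvs.subspace_diff[OF sW w uW] flag_sub[OF W, of j] by (auto simp: K_def)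
        then have "w - u \<in> fvs.span (C \<inter> (W j \<inter> K))" using aC by blast
        moreover have "fvs.span (C \<inter> (W j \<inter> K)) \<subseteq> fvs.span (B \<inter> W j)" by (rule fvs.span_mono) (auto simp: B_def)
        moreover have "fvs.span (l ` E) \<subseteq> fvs.span (B \<inter> W j)" by (rule fvs.span_mono) (use lE ED in \<open>auto simp: B_def\<close>)
        ultimately have "(w - u) + u \<in> fvs.span (B \<inter> W j)" using u by (intro fvs.span_add) auto
        then show "w \<in> fvs.span (B \<inter> W j)" by simp
      qed
      show ?thesis using main[of j] main[of m] m[of j] m[of m] by (cases "j \<le> m") auto
    qed
    moreover have "matches f B B'"
    proof -
      have "b = l (f b)" "f b \<in> B'" if "b \<in> B" "f b \<noteq> 0" for b
        using that CK lV by (auto simp: B_def D_def)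
      note nz = this
      have "inj_on f {b \<in> B. f b \<noteq> 0}" by (rule inj_on_inverseI[of _ l]) (use nz(1) in auto)
      then show ?thesis unfolding matches_def using nz(2) by blast
    qed
    ultimately show ?thesis using BV unfolding adapted_def by blast
  qed
  ultimately show ?thesis by blast
qed

text \<open>The new flag is the kernel followed by the preimages of the steps of \<open>W\<close>.
  Adapted basis vectors outside the kernel have independent images, which are adapted to the flag on
  their span, so \<open>adapted_extension\<close> completes them.\<close>

lemma step_left:
  assumes V: "fin_dim_subspace V" and V': "fin_dim_subspace V'" and g: "lin_map_on V' V g" and W: "flag V W"
  shows "\<exists>W'. flag V' W' \<and> (\<forall>B'. adapted W' B' \<and> B' \<subseteq> V' \<longrightarrow> (\<exists>B. adapted W B \<and> B \<subseteq> V \<and> matches g B' B))"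
proof -
  have sV: "fvs.subspace V" and sV': "fvs.subspace V'" using V V' unfolding fin_dim_subspace_def by blast+
  have sW: "fvs.subspace (W j)" for j using W unfolding flag_def by blast
  obtain m where m: "\<And>j. j \<ge> m \<Longrightarrow> W j = V" using W unfolding flag_def by blast
  define W' where "W' j = (case j of 0 \<Rightarrow> {v \<in> V'. g v \<in> {0}} | Suc i \<Rightarrow> {v \<in> V'. g v \<in> W i})" for j
  have W'0: "W' 0 = {v \<in> V'. g v \<in> {0}}" and W'S: "W' (Suc i) = {v \<in> V'. g v \<in> W i}" for i
    by (simp_all add: W'_def)
  have "flag V' W'"
    unfolding flag_def
  proof (intro conjI allI)
    show "fvs.subspace (W' j)" for j
      using kernel_subspace[OF g sV' fvs.subspace_single_0] kernel_subspace[OF g sV' sW]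
      by (cases j) (simp_all only: W'0 W'S)
    show "W' j \<subseteq> W' (Suc j)" for j
    proof (cases j)
      case 0
      then show ?thesis using subspace_zero[OF sW] by (auto simp: W'0 W'S)
    next
      case (Suc i)
      then show ?thesis using flag_mono[OF W, of i "Suc i"] by (auto simp: W'S)
    qed
    have "W' j = V'" if j: "j \<ge> Suc m" for j
    proof -
      obtain i where i: "j = Suc i" "m \<le> i" using j by (cases j) auto
      show ?thesis unfolding i W'S using m[OF i(2)] lin_map_in[OF g] by blast
    qed
    then show "\<exists>m. \<forall>j\<ge>m. W' j = V'" by blast
  qed
  moreover have "\<exists>B. adapted W B \<and> B \<subseteq> V \<and> matches g B' B" if B': "adapted W' B'" "B' \<subseteq> V'" for B'
  proof -
    have iB': "\<not> fvs.dependent B'" and aB': "\<And>j. W' j \<subseteq> fvs.span (B' \<inter> W' j)" using B'(1) unfolding adapted_def by blast+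
    define E where "E = B' - W' 0"
    have EV: "E \<subseteq> V'" "E \<subseteq> B'" using B'(2) by (auto simp: E_def)
    have spE: "fvs.span E \<subseteq> V'" by (rule fvs.span_minimal[OF EV(1) sV'])
    have key: "b \<in> S" if b: "b \<in> E" and S: "S \<subseteq> E" and gb: "g b \<in> fvs.span (g ` S)" for b S
    proof -
      have SV: "S \<subseteq> V'" using S EV by blast
      then obtain u where u: "u \<in> fvs.span S" "g b = g u" using gb lin_map_span_image[OF g sV' SV] by blast
      have uV: "u \<in> V'" and bV: "b \<in> V'" using u(1) S spE fvs.span_mono[OF S] b EV by blast+
      have "g (b - u) = 0" using lin_map_diff[OF g sV' bV uV] u by simp
      then have "b - u \<in> W' 0" using fvs.subspace_diff[OF sV' bV uV] by (simp add: W'0)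
      then have "b - u \<in> fvs.span (B' \<inter> W' 0)" using aB' by blast
      moreover have "b = (b - u) + u" by simp
      ultimately have "b \<in> fvs.span (B' \<inter> W' 0 \<union> S)" unfolding fvs.span_Un using u(1) by blast
      moreover have "b \<in> B'" "B' \<inter> W' 0 \<union> S \<subseteq> B'" using b S EV by auto
      ultimately have "b \<in> B' \<inter> W' 0 \<union> S" using independent_notin_span[OF iB'] by blast
      then show ?thesis using b by (auto simp: E_def)
    qed
    have inj: "inj_on g E"
    proof (rule inj_onI)
      fix b c assume "b \<in> E" "c \<in> E" "g b = g c"
      then show "b = c" using key[of b "{c}"] fvs.span_base[of "g c" "g ` {c}"] by auto
    qed
    have fE: "finite E" by (rule finite_subset[OF EV(2) independent_finite[OF V' iB' B'(2)]])
    have "\<not> fvs.dependent ({} \<union> g ` E)"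
    proof (rule independent_union[OF fvs.independent_empty])
      show "finite (g ` E)" using fE by simp
      fix c S assume c: "c \<in> g ` E" and S: "S \<subseteq> g ` E" and sp: "c \<in> fvs.span ({} \<union> S)"
      obtain b where b: "b \<in> E" "c = g b" using c by blast
      obtain S' where S': "S' \<subseteq> E" "S = g ` S'" using S by (meson subset_imageE)
      show "c \<in> S" using key[OF b(1) S'(1)] sp b S' by auto
    qed
    then have iD: "\<not> fvs.dependent (g ` E)" by simp
    have DV: "g ` E \<subseteq> V" using EV lin_map_in[OF g] by blast
    have "fvs.span (g ` E) \<inter> W j \<subseteq> fvs.span (g ` E \<inter> W j)" for j
    proof
      fix v assume v: "v \<in> fvs.span (g ` E) \<inter> W j"
      then obtain u where u: "u \<in> fvs.span E" "v = g u" using lin_map_span_image[OF g sV' EV(1)] by blast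
      have "u \<in> W' (Suc j)" using u v spE by (auto simp: W'S)
      then have "u \<in> fvs.span (B' \<inter> W' (Suc j))" using aB' by blast
      then have "v \<in> fvs.span (g ` (B' \<inter> W' (Suc j)))"
        using lin_map_span_image[OF g sV', of "B' \<inter> W' (Suc j)"] B'(2) u(2) by blast
      moreover have sub: "g ` (B' \<inter> W' (Suc j)) \<subseteq> insert 0 (g ` E \<inter> W j)"
        using B'(2) by (auto simp: W'S E_def W'0)
      ultimately have "v \<in> fvs.span (insert 0 (g ` E \<inter> W j))" using subsetD[OF fvs.span_mono[OF sub]] by blast
      then show "v \<in> fvs.span (g ` E \<inter> W j)" by (metis fvs.span_insert_0)
    qed
    then obtain B where B: "adapted W B" "g ` E \<subseteq> B" "B \<subseteq> V" by (rule adapted_extension[OF V W iD DV])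
    have nz: "b \<in> E" if "b \<in> B'" "g b \<noteq> 0" for b using that by (auto simp: E_def W'0)
    have "matches g B' B"
      unfolding matches_def
    proof
      show "g ` B' \<subseteq> insert 0 B" using nz B(2) by blast
      show "inj_on g {a \<in> B'. g a \<noteq> 0}" by (rule inj_on_subset[OF inj]) (use nz in auto)
    qed
    then show ?thesis using B by blast
  qed
  ultimately show ?thesis by blast
qed

locale line_rep =
  fixes V :: "nat \<Rightarrow> ('b \<Rightarrow> 'k::field) set" and rt :: "nat \<Rightarrow> bool" and h :: "nat \<Rightarrow> ('b \<Rightarrow> 'k) \<Rightarrow> ('b \<Rightarrow> 'k)" and k :: nat
  assumes V: "\<And>i. i \<le> k \<Longrightarrow> fin_dim_subspace (V i)"
    and h_right: "\<And>i. i < k \<Longrightarrow> rt i \<Longrightarrow> lin_map_on (V i) (V (Suc i)) (h i)"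
    and h_left: "\<And>i. i < k \<Longrightarrow> \<not> rt i \<Longrightarrow> lin_map_on (V (Suc i)) (V i) (h i)"
begin

definition matched :: "(nat \<Rightarrow> ('b \<Rightarrow> 'k) set) \<Rightarrow> nat \<Rightarrow> bool" where
  "matched B i \<longleftrightarrow> (if rt i then matches (h i) (B i) (B (Suc i)) else matches (h i) (B (Suc i)) (B i))"

text \<open>The flag at \<open>j\<close> collects the constraints from all maps between positions up
  to \<open>j\<close>: whichever adapted basis is chosen there later, bases to its left can be
  matched to it.\<close>

lemma matching_flag:
  "j \<le> k \<Longrightarrow> \<exists>W. flag (V j) W \<and> (\<forall>B. adapted W B \<and> B \<subseteq> V j \<longrightarrow>
     (\<exists>Bs. Bs j = B \<and> (\<forall>i\<le>j. \<not> fvs.dependent (Bs i) \<and> fvs.span (Bs i) = V i) \<and> (\<forall>i<j. matched Bs i)))"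
proof (induction j)
  case 0
  have fl: "flag (V 0) (\<lambda>_. V 0)" using V[of 0] by (simp add: flag_def fin_dim_subspace_def)
  have "\<exists>Bs. Bs 0 = B \<and> (\<forall>i\<le>0. \<not> fvs.dependent (Bs i) \<and> fvs.span (Bs i) = V i) \<and> (\<forall>i<0. matched Bs i)"
    if "adapted (\<lambda>_. V 0) B \<and> B \<subseteq> V 0" for B
  proof -
    have "\<not> fvs.dependent B" "fvs.span B = V 0" using adapted_span[OF fl] that by (auto simp: adapted_def)
    then show ?thesis by (intro exI[of _ "\<lambda>_. B"]) auto
  qed
  then show ?case using fl by blast
next
  case (Suc j)
  obtain W where W: "flag (V j) W" and
    ext: "\<And>B. adapted W B \<Longrightarrow> B \<subseteq> V j \<Longrightarrow>
     \<exists>Bs. Bs j = B \<and> (\<forall>i\<le>j. \<not> fvs.dependent (Bs i) \<and> fvs.span (Bs i) = V i) \<and> (\<forall>i<j. matched Bs i)"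
  proof -
    have "j \<le> k" using Suc.prems by simp
    from Suc.IH[OF this] show ?thesis using that by (elim exE conjE) simp
  qed
  have fd: "fin_dim_subspace (V j)" "fin_dim_subspace (V (Suc j))" using V Suc.prems by auto
  have "\<exists>W'. flag (V (Suc j)) W' \<and> (\<forall>B'. adapted W' B' \<and> B' \<subseteq> V (Suc j) \<longrightarrow> (\<exists>B. adapted W B \<and> B \<subseteq> V j \<and>
      (if rt j then matches (h j) B B' else matches (h j) B' B)))"
  proof (cases "rt j")
    case True
    then show ?thesis using step_right[OF fd h_right W] Suc.prems by simp
  next
    case False
    then show ?thesis using step_left[OF fd h_left W] Suc.prems by simp
  qed
  then obtain W' where W': "flag (V (Suc j)) W'" and st: "\<And>B'. adapted W' B' \<Longrightarrow> B' \<subseteq> V (Suc j) \<Longrightarrow>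
    \<exists>B. adapted W B \<and> B \<subseteq> V j \<and> (if rt j then matches (h j) B B' else matches (h j) B' B)" by blast
  have "\<exists>Bs. Bs (Suc j) = B' \<and> (\<forall>i\<le>Suc j. \<not> fvs.dependent (Bs i) \<and> fvs.span (Bs i) = V i) \<and>
        (\<forall>i<Suc j. matched Bs i)" if B': "adapted W' B' \<and> B' \<subseteq> V (Suc j)" for B'
  proof -
    obtain B where B: "adapted W B" "B \<subseteq> V j" "if rt j then matches (h j) B B' else matches (h j) B' B"
      using st[of B'] B' by blast
    obtain Bs where Bs: "Bs j = B" "\<And>i. i \<le> j \<Longrightarrow> \<not> fvs.dependent (Bs i) \<and> fvs.span (Bs i) = V i" "\<And>i. i < j \<Longrightarrow> matched Bs i"
      using ext[OF B(1,2)] by blast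
    have "\<not> fvs.dependent B'" "fvs.span B' = V (Suc j)" using adapted_span[OF W'] B' by (auto simp: adapted_def)
    then show ?thesis
      using Bs B(3) by (intro exI[of _ "Bs(Suc j := B')"]) (auto simp: matched_def le_Suc_eq less_Suc_eq)
  qed
  then show ?case using W' by blast
qed

lemma matching_bases:
  obtains Bs where "\<And>i. i \<le> k \<Longrightarrow> \<not> fvs.dependent (Bs i)" "\<And>i. i \<le> k \<Longrightarrow> fvs.span (Bs i) = V i" "\<And>i. i < k \<Longrightarrow> matched Bs i"
proof -
  obtain W where W: "flag (V k) W" and ext: "\<forall>B. adapted W B \<and> B \<subseteq> V k \<longrightarrow>
     (\<exists>Bs. Bs k = B \<and> (\<forall>i\<le>k. \<not> fvs.dependent (Bs i) \<and> fvs.span (Bs i) = V i) \<and> (\<forall>i<k. matched Bs i))"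
    using matching_flag[OF order_refl] by (elim exE conjE)
  have "\<exists>B. adapted W B \<and> B \<subseteq> V k" by (rule adapted_exists[OF V[OF order_refl] W]) blast
  then obtain Bs where "(\<forall>i\<le>k. \<not> fvs.dependent (Bs i) \<and> fvs.span (Bs i) = V i) \<and> (\<forall>i<k. matched Bs i)"
    using ext by meson
  then show ?thesis using that[of Bs] by simp
qed

end

section \<open>Interval decomposition\<close>

locale matched_rep = line_rep V rt h k
  for V :: "nat \<Rightarrow> ('b \<Rightarrow> 'k::field) set" and rt h k +
  fixes Bs :: "nat \<Rightarrow> ('b \<Rightarrow> 'k) set"
  assumes indep: "\<And>i. i \<le> k \<Longrightarrow> \<not> fvs.dependent (Bs i)"
    and span: "\<And>i. i \<le> k \<Longrightarrow> fvs.span (Bs i) = V i"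
    and match: "\<And>i. i < k \<Longrightarrow> matched Bs i"
begin

text \<open>Partners are basis vectors at neighbouring positions identified by the map between them,
  whichever way it points. Chains of partners are the interval summands.\<close>

definition partner :: "nat \<Rightarrow> ('b \<Rightarrow> 'k) \<Rightarrow> ('b \<Rightarrow> 'k) \<Rightarrow> bool" where
  "partner i b b' \<longleftrightarrow> b \<in> Bs i \<and> b' \<in> Bs (Suc i) \<and> (if rt i then h i b = b' else h i b' = b)"

lemma nonzero: "i \<le> k \<Longrightarrow> b \<in> Bs i \<Longrightarrow> b \<noteq> 0"
  using indep fvs.dependent_zero by metis

lemma partner_left:
  assumes "i < k" "partner i b b'" "partner i c b'"
  shows "b = c"
proof (cases "rt i")
  case True
  then have inj: "inj_on (h i) {a \<in> Bs i. h i a \<noteq> 0}" using match[OF assms(1)] by (simp add: matched_def matches_def)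
  have "b' \<noteq> 0" using nonzero[of "Suc i" b'] assms by (simp add: partner_def)
  then show ?thesis using inj_onD[OF inj, of b c] assms True by (auto simp: partner_def)
next
  case False
  then show ?thesis using assms by (simp add: partner_def)
qed

lemma partner_right:
  assumes "i < k" "partner i b b'" "partner i b c'"
  shows "b' = c'"
proof (cases "rt i")
  case False
  then have inj: "inj_on (h i) {a \<in> Bs (Suc i). h i a \<noteq> 0}" using match[OF assms(1)] by (simp add: matched_def matches_def)
  have "b \<noteq> 0" using nonzero[of i b] assms by (simp add: partner_def)
  then show ?thesis using inj_onD[OF inj, of b' c'] assms False by (auto simp: partner_def)
next
  case True
  then show ?thesis using assms by (simp add: partner_def)
qed

text \<open>The label of a basis vector is the leftmost vector of its chain of partners.\<close>

primrec lbl :: "nat \<Rightarrow> ('b \<Rightarrow> 'k) \<Rightarrow> nat \<times> ('b \<Rightarrow> 'k)" where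
  "lbl 0 b = (0, b)"
| "lbl (Suc i) b' = (if \<exists>b. partner i b b' then lbl i (THE b. partner i b b') else (Suc i, b'))"

lemma lbl_partner:
  assumes "i < k" "partner i b b'"
  shows "lbl (Suc i) b' = lbl i b"
proof -
  have "(THE b. partner i b b') = b" using assms partner_left by blast
  then show ?thesis using assms by auto
qed

lemma lbl_le: "i \<le> k \<Longrightarrow> fst (lbl i b) \<le> i"
proof (induction i arbitrary: b)
  case (Suc i)
  show ?case
  proof (cases "\<exists>c. partner i c b")
    case True
    then obtain c where c: "partner i c b" by blast
    have "fst (lbl i c) \<le> i" using Suc by simp
    then show ?thesis using lbl_partner[OF _ c] Suc.prems by simp
  qed simp
qed simp

text \<open>Equal labels lead back either to the same left partner, which has at most one partner on
  its right, or to chains starting here, whose labels contain the vectors themselves.\<close>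

lemma lbl_inj:
  "i \<le> k \<Longrightarrow> b \<in> Bs i \<Longrightarrow> c \<in> Bs i \<Longrightarrow> lbl i b = lbl i c \<Longrightarrow> b = c"
proof (induction i arbitrary: b c)
  case (Suc i)
  have ik: "i < k" "i \<le> k" using Suc.prems(1) by auto
  consider b' c' where "partner i b' b" "partner i c' c" | b' where "partner i b' b" "\<nexists>c'. partner i c' c"
    | c' where "partner i c' c" "\<nexists>b'. partner i b' b" | "\<nexists>b'. partner i b' b" "\<nexists>c'. partner i c' c" by blast
  then show ?case
  proof cases
    case 1
    have "b' = c'" using Suc.IH[OF ik(2), of b' c'] Suc.prems(4) lbl_partner[OF ik(1)] 1 by (simp only:) (simp add: partner_def)
    then show ?thesis using partner_right[OF ik(1)] 1 by blast
  next
    case 2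
    then have "lbl i b' = (Suc i, c)" using Suc.prems(4) lbl_partner[OF ik(1) 2(1)] by simp
    then show ?thesis using lbl_le[OF ik(2), of b'] by simp
  next
    case 3
    then have "lbl i c' = (Suc i, b)" using Suc.prems(4) lbl_partner[OF ik(1) 3(1)] by simp
    then show ?thesis using lbl_le[OF ik(2), of c'] by simp
  next
    case 4
    then show ?thesis using Suc.prems(4) by simp
  qed
qed simp

definition alive :: "nat \<times> ('b \<Rightarrow> 'k) \<Rightarrow> nat \<Rightarrow> bool" where
  "alive c i \<longleftrightarrow> i \<le> k \<and> (\<exists>b\<in>Bs i. lbl i b = c)"

definition elt :: "nat \<times> ('b \<Rightarrow> 'k) \<Rightarrow> nat \<Rightarrow> 'b \<Rightarrow> 'k" where
  "elt c i = (THE b. b \<in> Bs i \<and> lbl i b = c)"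

definition labels :: "(nat \<times> ('b \<Rightarrow> 'k)) set" where
  "labels = {c. \<exists>i. alive c i}"

lemma elt_eq: "i \<le> k \<Longrightarrow> b \<in> Bs i \<Longrightarrow> elt (lbl i b) i = b"
  unfolding elt_def using lbl_inj by blast

lemma elt: "alive c i \<Longrightarrow> elt c i \<in> Bs i \<and> lbl i (elt c i) = c"
  unfolding alive_def using elt_eq by metis

lemma alive_le: "alive c i \<Longrightarrow> fst c \<le> i \<and> i \<le> k"
  unfolding alive_def using lbl_le by blast

text \<open>A chain begins only at the position recorded in its label, so every later member has a
  partner on its left. This makes the positions of a chain an interval.\<close>

lemma alive_pred:
  assumes "alive c (Suc i)" "fst c \<le> i"
  shows "alive c i \<and> partner i (elt c i) (elt c (Suc i))"
proof -
  let ?b' = "elt c (Suc i)"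
  have b': "?b' \<in> Bs (Suc i)" "lbl (Suc i) ?b' = c" using elt[OF assms(1)] by auto
  have ik: "i < k" using alive_le[OF assms(1)] by simp
  have "\<exists>b. partner i b ?b'"
  proof (rule ccontr)
    assume "\<not> ?thesis"
    then have "c = (Suc i, ?b')" using b'(2) by simp
    then have "fst c = Suc i" by (metis fst_conv)
    then show False using assms(2) by simp
  qed
  then obtain b where b: "partner i b ?b'" by blast
  then have l: "lbl i b = c" using lbl_partner[OF ik] b'(2) by simp
  have "b \<in> Bs i" using b by (simp add: partner_def)
  then have "alive c i" "elt c i = b" using l ik elt_eq[of i b] by (auto simp: alive_def)
  then show ?thesis using b by simp
qed

lemma alive_down: "alive c (j + d) \<Longrightarrow> fst c \<le> j \<Longrightarrow> alive c j"
  by (induction d) (auto dest: alive_pred)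

lemma alive_interval:
  assumes "c \<in> labels"
  obtains l r where "l \<le> r" "r \<le> k" "\<And>i. alive c i \<longleftrightarrow> l \<le> i \<and> i \<le> r"
proof -
  define A where "A = {i. alive c i}"
  have A: "finite A" "A \<noteq> {}" using assms by (auto simp: A_def labels_def alive_def)
  define r where "r = Max A"
  have r: "alive c r" using Max_in[OF A] by (simp add: r_def A_def)
  have "alive c i \<longleftrightarrow> fst c \<le> i \<and> i \<le> r" for i
  proof
    assume "alive c i"
    then show "fst c \<le> i \<and> i \<le> r" using alive_le Max_ge[OF A(1), of i] by (auto simp: r_def A_def)
  next
    assume i: "fst c \<le> i \<and> i \<le> r"
    then show "alive c i" using alive_down[of c i "r - i"] r by simp
  qed
  then show ?thesis using that[of "fst c" r] alive_le[OF r] by blast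
qed

lemma elt_inj: "inj_on (\<lambda>c. elt c i) {c. alive c i}"
  by (rule inj_on_inverseI[of _ "lbl i"]) (use elt in auto)

lemma elt_image:
  assumes "i \<le> k"
  shows "(\<lambda>c. elt c i) ` {c. alive c i} = Bs i"
proof
  show "(\<lambda>c. elt c i) ` {c. alive c i} \<subseteq> Bs i" using elt by auto
  show "Bs i \<subseteq> (\<lambda>c. elt c i) ` {c. alive c i}"
  proof
    fix b assume b: "b \<in> Bs i"
    then have "alive (lbl i b) i" "elt (lbl i b) i = b" using assms elt_eq by (auto simp: alive_def)
    then show "b \<in> (\<lambda>c. elt c i) ` {c. alive c i}" by (metis image_eqI mem_Collect_eq)
  qed
qed

lemma finite_bases: "i \<le> k \<Longrightarrow> finite (Bs i)"
  using independent_finite[OF V indep] span fvs.span_superset by metis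

lemma finite_labels: "finite labels"
proof -
  have "labels \<subseteq> (\<Union>i\<le>k. lbl i ` Bs i)"
  proof
    fix c assume "c \<in> labels"
    then obtain i b where "i \<le> k" "b \<in> Bs i" "c = lbl i b" unfolding labels_def alive_def by blast
    then show "c \<in> (\<Union>i\<le>k. lbl i ` Bs i)" by blast
  qed
  moreover have "finite (\<Union>i\<le>k. lbl i ` Bs i)" using finite_bases by auto
  ultimately show ?thesis by (rule finite_subset)
qed

lemma elt_step_right:
  assumes "i < k" "rt i" "alive c i"
  shows "h i (elt c i) = (if alive c (Suc i) then elt c (Suc i) else 0)"
proof -
  have e: "elt c i \<in> Bs i" "lbl i (elt c i) = c" using elt[OF assms(3)] by auto
  show ?thesis
  proof (cases "h i (elt c i) = 0")
    case True
    have "\<not> alive c (Suc i)"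
    proof
      assume a: "alive c (Suc i)"
      have "partner i (elt c i) (elt c (Suc i))" using alive_pred[OF a] alive_le[OF assms(3)] by simp
      then have "elt c (Suc i) = 0" using True assms by (simp add: partner_def)
      then show False using nonzero[of "Suc i"] elt[OF a] assms by auto
    qed
    then show ?thesis using True by simp
  next
    case False
    have "h i ` Bs i \<subseteq> insert 0 (Bs (Suc i))" using match[OF assms(1)] assms(2) by (simp add: matched_def matches_def)
    then have "h i (elt c i) \<in> Bs (Suc i)" using False e by auto
    then have p: "partner i (elt c i) (h i (elt c i))" using e assms by (simp add: partner_def)
    have l: "lbl (Suc i) (h i (elt c i)) = c" using lbl_partner[OF assms(1) p] e by simp
    have m: "h i (elt c i) \<in> Bs (Suc i)" using p by (simp add: partner_def)
    have "alive c (Suc i)" unfolding alive_def using l m assms(1) by (metis Suc_leI)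
    moreover have "elt c (Suc i) = h i (elt c i)" using elt_eq[of "Suc i", OF _ m] l assms(1) by (metis Suc_leI)
    ultimately show ?thesis by simp
  qed
qed

lemma elt_step_left:
  assumes "i < k" "\<not> rt i" "alive c (Suc i)"
  shows "h i (elt c (Suc i)) = (if alive c i then elt c i else 0)"
proof (cases "alive c i")
  case True
  then have "partner i (elt c i) (elt c (Suc i))" using alive_pred[OF assms(3)] alive_le by blast
  then show ?thesis using True assms by (simp add: partner_def)
next
  case False
  have e: "elt c (Suc i) \<in> Bs (Suc i)" "lbl (Suc i) (elt c (Suc i)) = c" using elt[OF assms(3)] by auto
  have "h i (elt c (Suc i)) = 0"
  proof (rule ccontr)
    assume n: "h i (elt c (Suc i)) \<noteq> 0"
    have "h i ` Bs (Suc i) \<subseteq> insert 0 (Bs i)" using match[OF assms(1)] assms(2) by (simp add: matched_def matches_def)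
    then have "h i (elt c (Suc i)) \<in> Bs i" using n e by auto
    then have p: "partner i (h i (elt c (Suc i))) (elt c (Suc i))" using e assms by (simp add: partner_def)
    then have "lbl i (h i (elt c (Suc i))) = c" using lbl_partner[OF assms(1)] e by simp
    then show False using False p assms by (auto simp: alive_def partner_def)
  qed
  then show ?thesis using False by simp
qed

end

section \<open>Construction and uniqueness of the functor\<close>

section \<open>The category of diagonals\<close>

context labelled_tri
begin

abbreviation CM :: "diag list \<Rightarrow> diag list \<Rightarrow> 'k::field cmat set" where "CM \<equiv> comb_mat n \<tau>"
abbreviation ME :: "diag list \<Rightarrow> diag list \<Rightarrow> 'k::field cmat rel" where "ME \<equiv> mesh_eq n \<tau>"
abbreviation obj :: "diag list \<Rightarrow> bool" where "obj as \<equiv> \<forall>\<gamma>\<in>set as. free \<gamma>"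
abbreviation hom :: "diag list \<Rightarrow> diag list \<Rightarrow> 'k::field cmat set set" where "hom as bs \<equiv> CM as bs // ME as bs"

definition Phi :: "'k::field cmat \<Rightarrow> nat \<Rightarrow> nat \<Rightarrow> nat \<Rightarrow> 'k" where
  "Phi f = (\<lambda>i j. phi (f i j))"

text \<open>The choice of a representative is harmless, since \<open>Phi\<close> is constant on mesh
  classes by \<open>mesh_eq_Phi\<close>.\<close>

definition PhiC :: "'k::field cmat set \<Rightarrow> nat \<Rightarrow> nat \<Rightarrow> nat \<Rightarrow> 'k" where
  "PhiC X = Phi (SOME f. f \<in> X)"

lemma CM_entry: "f \<in> CM as bs \<Longrightarrow> i < length as \<Longrightarrow> j < length bs \<Longrightarrow> f i j \<in> path_comb n \<tau> (as ! i) (bs ! j)"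
  and CM_out: "f \<in> CM as bs \<Longrightarrow> \<not> (i < length as \<and> j < length bs) \<Longrightarrow> f i j = 0"
  unfolding comb_mat_def by blast+

lemma CM_I:
  assumes "\<And>i j. i < length as \<Longrightarrow> j < length bs \<Longrightarrow> f i j \<in> path_comb n \<tau> (as ! i) (bs ! j)"
    "\<And>i j. \<not> (i < length as \<and> j < length bs) \<Longrightarrow> f i j = 0"
  shows "f \<in> CM as bs"
  unfolding comb_mat_def using assms by blast

lemma CM_finite:
  assumes "f \<in> CM as bs"
  shows "finite {p. f i j p \<noteq> 0}"
proof (cases "i < length as \<and> j < length bs")
  case True
  then show ?thesis using path_comb_finite[OF CM_entry[OF assms]] by blast
next
  case False
  then show ?thesis using CM_out[OF assms False] by simp
qed

text \<open>This is \<open>phi_kernel\<close> in every entry. It lets a morphism be replaced by a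
  matrix of functions on the vertices, for which equality is immediate to test.\<close>

lemma mesh_eq_Phi:
  fixes f g :: "'k::field cmat"
  assumes as: "obj as"
  shows "(f, g) \<in> ME as bs \<longleftrightarrow> f \<in> CM as bs \<and> g \<in> CM as bs \<and> Phi f = Phi g"
proof -
  have "(\<forall>i<length as. \<forall>j<length bs. f i j - g i j \<in> fvs.span (rels (as ! i) (bs ! j))) \<longleftrightarrow> Phi f = Phi g"
    if f: "f \<in> CM as bs" and g: "g \<in> CM as bs"
  proof -
    have e: "f i j - g i j \<in> fvs.span (rels (as ! i) (bs ! j)) \<longleftrightarrow> phi (f i j) = phi (g i j)"
      if ij: "i < length as" "j < length bs" for i j
    proof -
      have "free (as ! i)" using as ij by simp
      then have "f i j - g i j \<in> fvs.span (rels (as ! i) (bs ! j)) \<longleftrightarrow> (\<forall>x. phi (f i j - g i j) x = 0)"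
        by (rule phi_kernel[OF _ path_comb_diff[OF CM_entry[OF f ij] CM_entry[OF g ij]]])
      then show ?thesis unfolding phi_diff[OF CM_finite[OF f] CM_finite[OF g]] by (simp add: fun_eq_iff)
    qed
    have o: "f i j = g i j" if "\<not> (i < length as \<and> j < length bs)" for i j
      using CM_out[OF f that] CM_out[OF g that] by simp
    show ?thesis
    proof
      assume "\<forall>i<length as. \<forall>j<length bs. f i j - g i j \<in> fvs.span (rels (as ! i) (bs ! j))"
      then have "phi (f i j) = phi (g i j)" for i j using e o by (cases "i < length as \<and> j < length bs") auto
      then show "Phi f = Phi g" unfolding Phi_def by simp
    next
      assume "Phi f = Phi g"
      then have "phi (f i j) = phi (g i j)" for i j unfolding Phi_def by metis
      then show "\<forall>i<length as. \<forall>j<length bs. f i j - g i j \<in> fvs.span (rels (as ! i) (bs ! j))" using e by blast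
    qed
  qed
  then show ?thesis unfolding mesh_eq_def by blast
qed

lemma class_Phi: "obj as \<Longrightarrow> ME as bs `` {f} = (if f \<in> CM as bs then {g \<in> CM as bs. Phi g = Phi f} else {})"
  by (auto simp: mesh_eq_Phi)

text \<open>The operations of \<open>cat_T\<close> take the class of a set of representatives. If
  \<open>Phi\<close> is constant on that set, the result is a single class with that value.\<close>

lemma class_set:
  fixes S :: "'k::field cmat set"
  assumes as: "obj as" and S: "S \<noteq> {}" "\<And>f. f \<in> S \<Longrightarrow> f \<in> CM as bs \<and> Phi f = R"
  shows "ME as bs `` S \<in> hom as bs" "PhiC (ME as bs `` S) = R"
proof -
  obtain f where f: "f \<in> S" using S by blast
  have e: "ME as bs `` S = ME as bs `` {f}"
    using S(2) f by (auto simp: mesh_eq_Phi[OF as])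
  show "ME as bs `` S \<in> hom as bs" unfolding e using S(2)[OF f] by (auto intro: quotientI)
  have c: "ME as bs `` {f} = {g \<in> CM as bs. Phi g = R}" using class_Phi[OF as, of bs f] S(2)[OF f] by simp
  have "\<exists>g. g \<in> ME as bs `` {f}" using c S(2)[OF f] by blast
  then have "(SOME g. g \<in> ME as bs `` {f}) \<in> ME as bs `` {f}" by (rule someI_ex)
  then show "PhiC (ME as bs `` S) = R" unfolding e PhiC_def using c by blast
qed

lemma class_hom:
  assumes "obj as" "f \<in> CM as bs"
  shows "ME as bs `` {f} \<in> hom as bs" "PhiC (ME as bs `` {f}) = Phi f"
  using class_set[OF assms(1), of "{f}" bs "Phi f"] assms(2) by auto

lemma homE:
  assumes "obj as" "X \<in> hom as bs"
  obtains f where "f \<in> X" "f \<in> CM as bs" "X = ME as bs `` {f}" "PhiC X = Phi f"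
proof -
  obtain f where f: "f \<in> CM as bs" "X = ME as bs `` {f}" using assms(2) by (auto elim: quotientE)
  moreover have "f \<in> X" using f class_Phi[OF assms(1), of bs f] by auto
  ultimately show ?thesis using that class_hom[OF assms(1) f(1)] by blast
qed

lemma hom_member:
  assumes "obj as" "X \<in> hom as bs" "f \<in> X"
  shows "f \<in> CM as bs" "Phi f = PhiC X"
proof -
  obtain g where g: "g \<in> CM as bs" "X = ME as bs `` {g}" "PhiC X = Phi g" by (rule homE[OF assms(1,2)]) blast
  then have "f \<in> {h \<in> CM as bs. Phi h = Phi g}" using assms(3) class_Phi[OF assms(1), of bs g] by simp
  then show "f \<in> CM as bs" "Phi f = PhiC X" using g by auto
qed

lemma hom_eqI:
  assumes "obj as" "X \<in> hom as bs" "Y \<in> hom as bs" "PhiC X = PhiC Y"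
  shows "X = Y"
proof -
  obtain f where f: "f \<in> CM as bs" "X = ME as bs `` {f}" "PhiC X = Phi f" by (rule homE[OF assms(1,2)]) blast
  obtain g where g: "g \<in> CM as bs" "Y = ME as bs `` {g}" "PhiC Y = Phi g" by (rule homE[OF assms(1,3)]) blast
  have "ME as bs `` {f} = ME as bs `` {g}"
    unfolding class_Phi[OF assms(1)] using f(1,3) g(1,3) assms(4) by simp
  then show ?thesis unfolding f(2) g(2) .
qed

lemma phi_support:
  assumes "f \<in> path_comb n \<tau> \<gamma> \<delta>" "phi f x \<noteq> 0"
  shows "x \<in> spp \<gamma> \<inter> spp \<delta>"
proof -
  have "\<exists>p. f p \<noteq> 0 \<and> x \<in> csupp p"
  proof (rule ccontr)
    assume "\<not> ?thesis"
    then have "phi f x = 0" unfolding phi_def by (intro sum.neutral) auto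
    then show False using assms(2) by simp
  qed
  then obtain p where p: "f p \<noteq> 0" "x \<in> csupp p" by blast
  then have "mpath \<gamma> \<delta> p" using assms(1) by (auto simp: path_comb_def)
  then have "\<gamma> \<in> set p" "\<delta> \<in> set p" unfolding is_path_def by (metis hd_in_set, metis last_in_set)
  then show ?thesis using p by (auto simp: csupp_def)
qed

lemma PhiC_support:
  assumes "obj as" "X \<in> hom as bs" "PhiC X i j x \<noteq> 0"
  shows "i < length as" "j < length bs" "x \<in> spp (as ! i)" "x \<in> spp (bs ! j)"
proof -
  obtain f where f: "f \<in> CM as bs" "PhiC X = Phi f" by (rule homE[OF assms(1,2)]) blast
  then have nz: "phi (f i j) x \<noteq> 0" using assms(3) by (simp add: Phi_def)
  then have "i < length as \<and> j < length bs" using CM_out[OF f(1), of i j] by fastforce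
  then show "i < length as" "j < length bs" "x \<in> spp (as ! i)" "x \<in> spp (bs ! j)"
    using phi_support[OF CM_entry[OF f(1)] nz] by blast+
qed

lemma phi_sum:
  fixes f :: "'c \<Rightarrow> 'k::field comb"
  assumes "finite I" "\<And>i. i \<in> I \<Longrightarrow> f i \<in> path_comb n \<tau> \<gamma> \<delta>"
  shows "(\<Sum>i\<in>I. f i) \<in> path_comb n \<tau> \<gamma> \<delta> \<and> phi (\<Sum>i\<in>I. f i) x = (\<Sum>i\<in>I. phi (f i) x)"
  using assms
proof (induction I rule: finite_induct)
  case empty
  have "(0 :: 'k comb) \<in> path_comb n \<tau> \<gamma> \<delta>" using path_comb_zero by (simp only: zero_fun_def)
  then show ?case by (simp only: sum.empty phi_zero simp_thms)
next
  case (insert i I)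
  have i: "f i \<in> path_comb n \<tau> \<gamma> \<delta>" and s: "(\<Sum>i\<in>I. f i) \<in> path_comb n \<tau> \<gamma> \<delta>"
    "phi (\<Sum>i\<in>I. f i) x = (\<Sum>i\<in>I. phi (f i) x)" using insert by blast+
  show ?case
    unfolding sum.insert[OF insert.hyps] phi_add[OF path_comb_finite[OF i] path_comb_finite[OF s(1)]] s(2)
    by (rule conjI[OF path_comb_add[OF i s(1)] refl])
qed

lemma comb_concat_zero: "comb_concat 0 g = 0" "comb_concat f 0 = 0"
  by (simp_all add: comb_concat_def fun_eq_iff)

lemma comp_rep:
  fixes f g :: "'k::field cmat"
  assumes f: "f \<in> CM as bs" and g: "g \<in> CM bs cs"
  defines "m \<equiv> \<lambda>i l. \<Sum>j<length bs. comb_concat (f i j) (g j l)"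
  shows "m \<in> CM as cs" "Phi m = (\<lambda>i l x. \<Sum>j<length bs. Phi f i j x * Phi g j l x)"
proof -
  have e: "m i l \<in> path_comb n \<tau> (as ! i) (cs ! l) \<and> phi (m i l) x = (\<Sum>j<length bs. phi (f i j) x * phi (g j l) x)"
    if il: "i < length as" "l < length cs" for i l x
  proof -
    have c: "comb_concat (f i j) (g j l) \<in> path_comb n \<tau> (as ! i) (cs ! l)"
      "phi (comb_concat (f i j) (g j l)) x = phi (f i j) x * phi (g j l) x" if "j \<in> {..<length bs}" for j
      using concat_path_comb[OF CM_entry[OF f il(1), of j] CM_entry[OF g _ il(2), of j]] that by auto
    show ?thesis unfolding m_def using phi_sum[OF finite_lessThan c(1), of "length bs" "\<lambda>j. j" x] c(2) by simp
  qed
  have z: "m i l = 0" if "\<not> (i < length as \<and> l < length cs)" for i l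
  proof -
    have "comb_concat (f i j) (g j l) = 0" for j
      using that CM_out[OF f, of i j] CM_out[OF g, of j l] comb_concat_zero by (cases "i < length as") (simp_all only: simp_thms)
    then show ?thesis unfolding m_def by (simp only: sum.neutral_const)
  qed
  show "m \<in> CM as cs" using e z by (intro CM_I) blast+
  have "phi (m i l) x = (\<Sum>j<length bs. phi (f i j) x * phi (g j l) x)" for i l x
  proof (cases "i < length as \<and> l < length cs")
    case True
    then show ?thesis using e by blast
  next
    case False
    have "phi (f i j) x * phi (g j l) x = 0" for j
      using False CM_out[OF f, of i j] CM_out[OF g, of j l] phi_zero by (cases "i < length as") auto
    then show ?thesis unfolding z[OF False] phi_zero by (simp del: mult_eq_0_iff)
  qed
  then show "Phi m = (\<lambda>i l x. \<Sum>j<length bs. Phi f i j x * Phi g j l x)" unfolding Phi_def by blast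
qed

abbreviation cT_cat :: "(diag list, 'k::field cmat set, 'k) lcat" where "cT_cat \<equiv> cat_T n \<tau>"

lemma Comp_PhiC:
  fixes X Y :: "'k::field cmat set"
  assumes o: "obj as" "obj bs" and X: "X \<in> hom as bs" and Y: "Y \<in> hom bs cs"
  shows "Comp cT_cat as bs cs Y X \<in> hom as cs"
    "PhiC (Comp cT_cat as bs cs Y X) = (\<lambda>i l x. \<Sum>j<length bs. PhiC X i j x * PhiC Y j l x)"
proof -
  let ?S = "{(\<lambda>i l. \<Sum>j<length bs. comb_concat (f i j) (g j l)) | f g. f \<in> X \<and> g \<in> Y}"
  have e: "Comp cT_cat as bs cs Y X = ME as cs `` ?S" by (simp add: cat_T_def)
  obtain f where "f \<in> X" using homE[OF o(1) X] by blast
  moreover obtain g where "g \<in> Y" using homE[OF o(2) Y] by blast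
  ultimately have ne: "?S \<noteq> {}" by blast
  have S: "h \<in> CM as cs \<and> Phi h = (\<lambda>i l x. \<Sum>j<length bs. PhiC X i j x * PhiC Y j l x)" if h: "h \<in> ?S" for h
  proof -
    obtain f g where fg: "h = (\<lambda>i l. \<Sum>j<length bs. comb_concat (f i j) (g j l))" "f \<in> X" "g \<in> Y" using h by blast
    show ?thesis
      using comp_rep[OF hom_member(1)[OF o(1) X fg(2)] hom_member(1)[OF o(2) Y fg(3)]]
        hom_member(2)[OF o(1) X fg(2)] hom_member(2)[OF o(2) Y fg(3)] unfolding fg(1) by simp
  qed
  show "Comp cT_cat as bs cs Y X \<in> hom as cs" unfolding e by (rule class_set(1)[OF o(1) ne S])
  show "PhiC (Comp cT_cat as bs cs Y X) = (\<lambda>i l x. \<Sum>j<length bs. PhiC X i j x * PhiC Y j l x)"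
    unfolding e by (rule class_set(2)[OF o(1) ne S])
qed

lemma Add_PhiC:
  fixes X Y :: "'k::field cmat set"
  assumes o: "obj as" and X: "X \<in> hom as bs" and Y: "Y \<in> hom as bs"
  shows "PhiC (Add cT_cat as bs X Y) = (\<lambda>i j x. PhiC X i j x + PhiC Y i j x)"
proof -
  let ?S = "{f + g | f g. f \<in> X \<and> g \<in> Y}"
  have e: "Add cT_cat as bs X Y = ME as bs `` ?S" by (simp add: cat_T_def)
  obtain f where "f \<in> X" using homE[OF o X] by blast
  moreover obtain g where "g \<in> Y" using homE[OF o Y] by blast
  ultimately have ne: "?S \<noteq> {}" by blast
  have S: "h \<in> CM as bs \<and> Phi h = (\<lambda>i j x. PhiC X i j x + PhiC Y i j x)" if h: "h \<in> ?S" for h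
  proof -
    obtain f g where fg: "h = f + g" "f \<in> X" "g \<in> Y" using h by blast
    note f = hom_member[OF o X fg(2)] and g = hom_member[OF o Y fg(3)]
    have en: "(f + g) i j = f i j + g i j" for i j by simp
    have "f + g \<in> CM as bs"
    proof (rule CM_I)
      show "(f + g) i j \<in> path_comb n \<tau> (as ! i) (bs ! j)" if "i < length as" "j < length bs" for i j
        unfolding en by (rule path_comb_add[OF CM_entry[OF f(1) that] CM_entry[OF g(1) that]])
      show "(f + g) i j = 0" if "\<not> (i < length as \<and> j < length bs)" for i j
        unfolding en CM_out[OF f(1) that] CM_out[OF g(1) that] by (rule add_0_left)
    qed
    moreover have "Phi (f + g) = (\<lambda>i j x. Phi f i j x + Phi g i j x)"
      unfolding Phi_def en using phi_add[OF CM_finite[OF f(1)] CM_finite[OF g(1)]] by blast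
    ultimately show ?thesis unfolding fg(1) f(2)[symmetric] g(2)[symmetric] by simp
  qed
  show ?thesis unfolding e by (rule class_set(2)[OF o ne S])
qed

lemma Scale_PhiC:
  fixes X :: "'k::field cmat set"
  assumes o: "obj as" and X: "X \<in> hom as bs"
  shows "Scale cT_cat as bs c X \<in> hom as bs" "PhiC (Scale cT_cat as bs c X) = (\<lambda>i j x. c * PhiC X i j x)"
proof -
  let ?S = "{(\<lambda>i j. fscale c (f i j)) | f. f \<in> X}"
  have e: "Scale cT_cat as bs c X = ME as bs `` ?S" by (simp add: cat_T_def)
  obtain f where "f \<in> X" using homE[OF o X] by blast
  then have ne: "?S \<noteq> {}" by blast
  have S: "h \<in> CM as bs \<and> Phi h = (\<lambda>i j x. c * PhiC X i j x)" if h: "h \<in> ?S" for h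
  proof -
    obtain f where f': "h = (\<lambda>i j. fscale c (f i j))" "f \<in> X" using h by blast
    note f = hom_member[OF o X f'(2)]
    have "h \<in> CM as bs"
      unfolding f'(1)
    proof (rule CM_I)
      show "fscale c (f i j) \<in> path_comb n \<tau> (as ! i) (bs ! j)" if "i < length as" "j < length bs" for i j
        by (rule path_comb_scale[OF CM_entry[OF f(1) that]])
      show "fscale c (f i j) = 0" if "\<not> (i < length as \<and> j < length bs)" for i j
        unfolding CM_out[OF f(1) that] by (rule fvs.scale_zero_right)
    qed
    moreover have "Phi h = (\<lambda>i j x. c * Phi f i j x)"
      unfolding Phi_def f'(1) using phi_scale by blast
    ultimately show ?thesis unfolding f(2)[symmetric] by simp
  qed
  show "Scale cT_cat as bs c X \<in> hom as bs" unfolding e by (rule class_set(1)[OF o ne S])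
  show "PhiC (Scale cT_cat as bs c X) = (\<lambda>i j x. c * PhiC X i j x)"
    unfolding e by (rule class_set(2)[OF o ne S])
qed

lemma unit_mat_CM:
  fixes p :: "diag list"
  assumes "i < length as" "j < length bs" "mpath (as ! i) (bs ! j) p"
  shows "(unit_mat i j p :: 'k::field cmat) \<in> CM as bs"
proof (rule CM_I)
  fix i' j' assume "i' < length as" "j' < length bs"
  show "(unit_mat i j p :: 'k cmat) i' j' \<in> path_comb n \<tau> (as ! i') (bs ! j')"
  proof (cases "i' = i \<and> j' = j")
    case True
    then show ?thesis using basis_path_comb[OF assms(3)] by (simp add: unit_mat_def)
  next
    case False
    then have "(unit_mat i j p :: 'k cmat) i' j' = 0" by (simp only: unit_mat_def if_False)
    then show ?thesis using path_comb_zero by (simp only: zero_fun_def)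
  qed
next
  fix i' j' assume "\<not> (i' < length as \<and> j' < length bs)"
  then have "\<not> (i' = i \<and> j' = j)" using assms by blast
  then show "(unit_mat i j p :: 'k cmat) i' j' = 0" by (simp only: unit_mat_def if_False)
qed

lemma Phi_unit_mat:
  "Phi (unit_mat i j p :: 'k::field cmat) = (\<lambda>i' j' x. if i' = i \<and> j' = j \<and> x \<in> csupp p then 1 else 0)"
proof (intro ext)
  fix i' j' x
  show "Phi (unit_mat i j p :: 'k cmat) i' j' x = (if i' = i \<and> j' = j \<and> x \<in> csupp p then 1 else 0)"
  proof (cases "i' = i \<and> j' = j")
    case True
    then show ?thesis by (simp add: Phi_def unit_mat_def phi_basis)
  next
    case False
    then have "(unit_mat i j p :: 'k cmat) i' j' = 0" by (simp only: unit_mat_def if_False)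
    then show ?thesis using False unfolding Phi_def by (simp only: phi_zero) auto
  qed
qed

lemma csupp_single: "csupp [\<gamma>] = spp \<gamma>"
  using supp_subset[of \<gamma>] by (auto simp: csupp_def)

lemma Ident_PhiC:
  assumes o: "obj as"
  shows "Ident cT_cat as \<in> (hom as as :: 'k::field cmat set set)"
    "PhiC (Ident cT_cat as :: 'k cmat set) = (\<lambda>i j x. if i = j \<and> i < length as \<and> x \<in> spp (as ! i) then 1 else 0)"
proof -
  define u :: "'k cmat" where "u = (\<Sum>i<length as. unit_mat i i [as ! i])"
  have ap: "(\<Sum>i\<in>I. (unit_mat i i [as ! i] :: 'k cmat)) a b = (\<Sum>i\<in>I. (unit_mat i i [as ! i] :: 'k cmat) a b)" for I a b
    by (induction I rule: infinite_finite_induct) simp_all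
  have ent: "u a b = (if a = b \<and> a < length as then basis_vec [as ! a] else 0)" for a b
  proof -
    have "u a b = (\<Sum>i<length as. if i = a then (if a = b then basis_vec [as ! a] else 0) else 0)"
      unfolding u_def ap by (rule sum.cong) (auto simp: unit_mat_def)
    then show ?thesis by (simp only: sum.delta finite_lessThan) auto
  qed
  have "u \<in> CM as as"
  proof (rule CM_I)
    fix i j assume i: "i < length as" and j: "j < length as"
    have "mpath (as ! i) (as ! i) [as ! i]" by (simp add: is_path_def)
    then have "basis_vec [as ! i] \<in> path_comb n \<tau> (as ! i) (as ! i)" by (rule basis_path_comb)
    then show "u i j \<in> path_comb n \<tau> (as ! i) (as ! j)"
      unfolding ent using path_comb_zero unfolding zero_fun_def by (cases "i = j") (simp_all only: i j if_True if_False simp_thms)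
  next
    fix i j assume "\<not> (i < length as \<and> j < length as)"
    then have "\<not> (i = j \<and> i < length as)" by auto
    then show "u i j = 0" unfolding ent by (simp only: if_False)
  qed
  note cl = class_hom[OF o this]
  have e: "Ident cT_cat as = ME as as `` {u}" by (simp add: cat_T_def u_def)
  show "Ident cT_cat as \<in> (hom as as :: 'k cmat set set)" unfolding e by (rule cl(1))
  have "phi (u i j) x = (if i = j \<and> i < length as \<and> x \<in> spp (as ! i) then 1 else 0)" for i j x
  proof (cases "i = j \<and> i < length as")
    case True
    then show ?thesis unfolding ent using phi_basis[of "[as ! i]" x] csupp_single[of "as ! i"] by simp
  next
    case False
    then have "u i j = 0" unfolding ent by (simp only: if_False)
    then show ?thesis using False by (simp only: phi_zero) auto
  qed
  then show "PhiC (Ident cT_cat as :: 'k cmat set) = (\<lambda>i j x. if i = j \<and> i < length as \<and> x \<in> spp (as ! i) then 1 else 0)"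
    unfolding e cl(2) Phi_def by blast
qed

lemma Ob_T: "as \<in> Ob cT_cat \<longleftrightarrow> obj as" and Hom_T: "Hom cT_cat = hom"
  by (simp_all add: cat_T_def)

text \<open>As \<open>PhiC\<close> separates morphisms, the laws reduce to those of matrices at each
  vertex. The identity is one only on supports, and there all nonzero entries of morphisms
  live.\<close>

lemma category_T: "category (cT_cat :: (diag list, 'k::field cmat set, 'k) lcat)"
  unfolding category_def Ob_T Hom_T
proof (intro conjI ballI impI; unfold mem_Collect_eq Ob_T)
  fix as assume "obj as"
  then show "Ident cT_cat as \<in> (hom as as :: 'k cmat set set)" by (rule Ident_PhiC)
next
  fix as bs cs and f g :: "'k cmat set" assume "obj as" "obj bs" "f \<in> hom as bs" "g \<in> hom bs cs"
  then show "Comp cT_cat as bs cs g f \<in> hom as cs" by (rule Comp_PhiC)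
next
  fix as bs and f :: "'k cmat set" assume o: "obj as" "obj bs" and f: "f \<in> hom as bs"
  note ia = Ident_PhiC[OF o(1)] and ib = Ident_PhiC[OF o(2)]
  have "(\<Sum>j<length as. (if i = j \<and> i < length as \<and> x \<in> spp (as ! i) then 1 else 0) * PhiC f j l x) = PhiC f i l x" for i l x
  proof -
    have "(\<Sum>j<length as. (if i = j \<and> i < length as \<and> x \<in> spp (as ! i) then 1 else 0) * PhiC f j l x)
      = (\<Sum>j<length as. if i = j then (if x \<in> spp (as ! i) then PhiC f i l x else 0) else 0)"
      by (rule sum.cong) auto
    then show ?thesis using PhiC_support[OF o(1) f, of i l x] by (auto simp: sum.delta)
  qed
  then have "PhiC (Comp cT_cat as as bs f (Ident cT_cat as)) = PhiC f"
    unfolding Comp_PhiC(2)[OF o(1) o(1) ia(1) f] ia(2) by blast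
  then show "Comp cT_cat as as bs f (Ident cT_cat as) = f" by (rule hom_eqI[OF o(1) Comp_PhiC(1)[OF o(1) o(1) ia(1) f] f])
  have "(\<Sum>j<length bs. PhiC f i j x * (if j = l \<and> j < length bs \<and> x \<in> spp (bs ! j) then 1 else 0)) = PhiC f i l x" for i l x
  proof -
    have "(\<Sum>j<length bs. PhiC f i j x * (if j = l \<and> j < length bs \<and> x \<in> spp (bs ! j) then 1 else 0))
      = (\<Sum>j<length bs. if j = l then (if x \<in> spp (bs ! l) then PhiC f i l x else 0) else 0)"
      by (rule sum.cong) auto
    then show ?thesis using PhiC_support[OF o(1) f, of i l x] by (auto simp: sum.delta)
  qed
  then have "PhiC (Comp cT_cat as bs bs (Ident cT_cat bs) f) = PhiC f"
    unfolding Comp_PhiC(2)[OF o f ib(1)] ib(2) by blast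
  then show "Comp cT_cat as bs bs (Ident cT_cat bs) f = f" by (rule hom_eqI[OF o(1) Comp_PhiC(1)[OF o f ib(1)] f])
next
  fix as bs cs ds and f g h :: "'k cmat set"
  assume o: "obj as" "obj bs" "obj cs" "obj ds" and f: "f \<in> hom as bs" and g: "g \<in> hom bs cs" and h: "h \<in> hom cs ds"
  note gf = Comp_PhiC[OF o(1,2) f g] and hg = Comp_PhiC[OF o(2,3) g h]
  have "(\<Sum>j<length bs. PhiC f i j x * (\<Sum>k<length cs. PhiC g j k x * PhiC h k l x)) =
      (\<Sum>k<length cs. (\<Sum>j<length bs. PhiC f i j x * PhiC g j k x) * PhiC h k l x)" for i l x
    unfolding sum_distrib_left sum_distrib_right mult.assoc by (rule sum.swap)
  then have "PhiC (Comp cT_cat as bs ds (Comp cT_cat bs cs ds h g) f) = PhiC (Comp cT_cat as cs ds h (Comp cT_cat as bs cs g f))"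
    unfolding Comp_PhiC(2)[OF o(1,2) f hg(1)] Comp_PhiC(2)[OF o(1,3) gf(1) h] hg(2) gf(2) by blast
  then show "Comp cT_cat as bs ds (Comp cT_cat bs cs ds h g) f = Comp cT_cat as cs ds h (Comp cT_cat as bs cs g f)"
    by (rule hom_eqI[OF o(1) Comp_PhiC(1)[OF o(1,2) f hg(1)] Comp_PhiC(1)[OF o(1,3) gf(1) h]])
qed

end

section \<open>The functor on morphisms\<close>

context type_A
begin

sublocale fp: finite_poset "poset_of n Qv F"
proof
  show "x \<in> Field P \<Longrightarrow> (x, x) \<in> P" for x using P_Field P_refl by blast
  show "(x, y) \<in> P \<Longrightarrow> (y, z) \<in> P \<Longrightarrow> (x, z) \<in> P" for x y z by (rule P_trans)
  show "(x, y) \<in> P \<Longrightarrow> (y, x) \<in> P \<Longrightarrow> x = y" for x y by (rule P_antisym)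
  show "finite (Field P)" using P_Field by simp
qed

abbreviation Oob :: "diag list \<Rightarrow> 'k::field psys" where "Oob \<equiv> Omega_ob n \<tau>"
abbreviation spo :: "diag list \<Rightarrow> bool" where "spo as \<equiv> \<forall>\<gamma>\<in>set as. spd \<gamma>"
abbreviation TF :: "(diag list, 'k::field cmat set, 'k) lcat" where "TF \<equiv> cat_TF n \<tau> Qv F"
abbreviation SP :: "('k::field psys, nat \<Rightarrow> 'k vec \<Rightarrow> 'k vec, 'k) lcat" where "SP \<equiv> mod_sp P"

lemma spo_obj: "spo as \<Longrightarrow> obj as"
  using sp_iff by blast

lemma Ob_TF: "as \<in> Ob TF \<longleftrightarrow> spo as"
  using spo_obj by (auto simp: cat_TF_def full_subcat_def cat_T_def)

lemma TF_simps: "Hom TF = hom" "Ident TF = Ident cT_cat" "Comp TF = Comp cT_cat" "Add TF = Add cT_cat" "Scale TF = Scale cT_cat"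
  by (simp_all add: cat_TF_def full_subcat_def cat_T_def)

lemma category_TF: "category TF"
  unfolding cat_TF_def by (rule category_full_subcat[OF category_T])

lemma SP_simps: "Hom SP = mod_hom P"
    "Ident SP = (\<lambda>M x v. if x \<in> Field P \<and> v \<in> spc M x then v else 0)"
    "Comp SP = (\<lambda>L M N g f x v. g x (f x v))"
    "Add SP = (\<lambda>M N f g x v. f x v + g x v)" "Scale SP = (\<lambda>M N c f x v. fscale c (f x v))"
  and Ob_SP: "M \<in> Ob SP \<longleftrightarrow> fg_module P M \<and> socle_projective P M"
  by (simp_all add: mod_sp_def full_subcat_def mod_cat_def)

lemma Oob_spc: "v \<in> spc (Oob as) x \<longleftrightarrow> (\<forall>i. v i \<noteq> 0 \<longrightarrow> i < length as \<and> x \<in> spp (as ! i))"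
  by (simp add: Omega_ob_def)

lemma Oob_str: "str (Oob as) y x v = (\<lambda>i. if i < length as \<and> x \<in> spp (as ! i) \<and> y \<in> spp (as ! i) then v i else 0)"
  by (simp add: Omega_ob_def fun_eq_iff)

lemma Oob_subspace: "fvs.subspace (spc (Oob as :: 'k::field psys) x)"
  unfolding fvs.subspace_def
proof (intro conjI ballI allI)
  show "0 \<in> spc (Oob as :: 'k psys) x" unfolding Oob_spc by simp
  show "u + v \<in> spc (Oob as) x" if "u \<in> spc (Oob as) x" "v \<in> spc (Oob as) x" for u v :: "'k vec"
    using that unfolding Oob_spc by (metis add_0 plus_fun_apply)
  show "fscale c v \<in> spc (Oob as) x" if "v \<in> spc (Oob as) x" for c and v :: "'k vec"
    using that unfolding Oob_spc fscale_def by auto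
qed

lemma Oob_basis: "i < length as \<Longrightarrow> x \<in> spp (as ! i) \<Longrightarrow> (basis_vec i :: 'k::field vec) \<in> spc (Oob as) x"
  unfolding Oob_spc basis_vec_def by auto

lemma Oob_expand:
  fixes v :: "'k::field vec"
  assumes "v \<in> spc (Oob as) x"
  shows "v = (\<Sum>i | i < length as \<and> x \<in> spp (as ! i). fscale (v i) (basis_vec i))"
  by (rule basis_sum) (use assms in \<open>auto simp: Oob_spc\<close>)

lemma Oob_fin_dim: "fin_dim_subspace (spc (Oob as :: 'k::field psys) x)"
proof -
  let ?B = "(basis_vec :: nat \<Rightarrow> 'k vec) ` {i. i < length as \<and> x \<in> spp (as ! i)}"
  have "fvs.span ?B \<subseteq> spc (Oob as) x"
    by (rule fvs.span_minimal[OF _ Oob_subspace]) (use Oob_basis in auto)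
  moreover have "spc (Oob as) x \<subseteq> fvs.span ?B"
  proof
    fix v :: "'k vec" assume "v \<in> spc (Oob as) x"
    then have e: "v = (\<Sum>i | i < length as \<and> x \<in> spp (as ! i). fscale (v i) (basis_vec i))" by (rule Oob_expand)
    have "(\<Sum>i | i < length as \<and> x \<in> spp (as ! i). fscale (v i) (basis_vec i)) \<in> fvs.span ?B"
      by (intro fvs.span_sum fvs.span_scale fvs.span_base) auto
    then show "v \<in> fvs.span ?B" using e by simp
  qed
  ultimately have "spc (Oob as :: 'k psys) x = fvs.span ?B" by blast
  moreover have "finite ?B" by simp
  ultimately show ?thesis unfolding fin_dim_subspace_def using Oob_subspace by blast
qed

lemma sp_supp_convex: "spd \<gamma> \<Longrightarrow> x \<in> spp \<gamma> \<Longrightarrow> w \<in> spp \<gamma> \<Longrightarrow> (x, y) \<in> P \<Longrightarrow> (y, w) \<in> P \<Longrightarrow> y \<in> spp \<gamma>"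
  using spset_convex sp_iff by blast

text \<open>Composition of structure maps could fail for \<open>x \<preceq> y \<preceq> w\<close>
  with only \<open>y\<close> outside a support; convexity of sp-supports in the poset excludes
  this.\<close>

lemma Oob_module:
  assumes "spo as"
  shows "fg_module P (Oob as :: 'k::field psys)"
proof -
  have "lin_map_on (spc (Oob as :: 'k psys) x) (spc (Oob as) y) (str (Oob as) y x)" for x y
    unfolding lin_map_on_def Oob_spc Oob_str by (auto simp: fun_eq_iff fscale_def)
  moreover have "str (Oob as) x x v = v" if "v \<in> spc (Oob as) x" for x and v :: "'k vec"
    using that unfolding Oob_spc Oob_str by (auto simp: fun_eq_iff)
  moreover have "str (Oob as) w y (str (Oob as) y x v) = str (Oob as) w x v"
    if "(x, y) \<in> P" "(y, w) \<in> P" for x y w and v :: "'k vec"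
  proof -
    have "y \<in> spp (as ! i)" if "i < length as" "x \<in> spp (as ! i)" "w \<in> spp (as ! i)" for i
      using sp_supp_convex[OF _ that(2,3) \<open>(x, y) \<in> P\<close> \<open>(y, w) \<in> P\<close>] assms that(1) by simp
    then show ?thesis unfolding Oob_str by (auto simp: fun_eq_iff)
  qed
  ultimately show ?thesis unfolding fg_module_def using Oob_fin_dim by blast
qed

text \<open>A nonzero coordinate belongs to one summand and survives to a sink of its support, which
  is a maximal element of the poset.\<close>

lemma Oob_sp:
  assumes "spo as"
  shows "(Oob as :: 'k::field psys) \<in> Ob SP"
proof -
  have "fp.detected (Oob as :: 'k psys)"
    unfolding fp.detected_def
  proof (intro ballI impI)
    fix x and v :: "'k vec" assume v: "v \<in> spc (Oob as) x" "v \<noteq> 0"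
    then obtain i where i: "v i \<noteq> 0" by (auto simp: fun_eq_iff)
    then have ix: "i < length as" "x \<in> spp (as ! i)" using v by (auto simp: Oob_spc)
    then have "spset (spp (as ! i))" using assms sp_iff by simp
    then obtain z where z: "z \<in> spp (as ! i)" "is_sink n Qv z" "(x, z) \<in> Qv\<^sup>*" using spset_sink ix by blast
    have "x \<in> {1..n}" using ix supp_subset by blast
    then have "(x, z) \<in> P" using z reach_P by blast
    moreover have "str (Oob as) z x v \<noteq> 0" using i ix z by (auto simp: Oob_str fun_eq_iff)
    ultimately show "\<exists>z. (x, z) \<in> P \<and> (\<forall>y. (z, y) \<in> P \<longrightarrow> y = z) \<and> str (Oob as) z x v \<noteq> 0"
      using sink_maximal[OF z(2)] by blast
  qed
  then show ?thesis using Ob_SP fp.socle_projective_iff[OF Oob_module[OF assms]] Oob_module[OF assms] by blast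
qed

text \<open>Reads off the normal form: a nonzero path has the whole intersection of the supports as
  its \<open>csupp\<close>, and it exists only if there is a thin morphism.\<close>

lemma phi_constant:
  fixes f :: "'k::field comb"
  assumes "free \<gamma>" "free \<delta>" "f \<in> path_comb n \<tau> \<gamma> \<delta>"
  obtains c where "c \<noteq> 0 \<Longrightarrow> thin_hom Qv (spp \<gamma>) (spp \<delta>)" "\<And>x. phi f x = (if x \<in> spp \<gamma> \<inter> spp \<delta> then c else 0)"
proof (cases "f \<in> fvs.span (rels \<gamma> \<delta>)")
  case True
  then show ?thesis using that[of 0] span_phi by auto
next
  case False
  then obtain p c where p: "mpath \<gamma> \<delta> p" "csupp p \<noteq> {}" and s: "f - fscale c (basis_vec p) \<in> fvs.span (rels \<gamma> \<delta>)"
    using normal_form[OF assms(1,3)] by blast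
  have "thin_hom Qv (spp \<gamma>) (spp \<delta>)" using thin_hom_path[OF assms(1,2)] p by blast
  moreover have "phi f x = (if x \<in> spp \<gamma> \<inter> spp \<delta> then c else 0)" for x
  proof -
    have "phi (f - fscale c (basis_vec p)) x = 0" by (rule span_phi[OF s])
    then have "phi f x = phi (fscale c (basis_vec p)) x"
      unfolding phi_diff[OF path_comb_finite[OF assms(3)] finite_support_scale[OF finite_basis]] by simp
    then show ?thesis unfolding phi_scale phi_basis csupp_inter[OF assms(1) p] by simp
  qed
  ultimately show ?thesis using that by blast
qed

text \<open>Thin morphisms refer to arrows of \<open>Q\<close> only; \<open>thin_hom_P\<close>
  extends the commutation to all relations of the poset, alien arrows included.\<close>

lemma phi_natural:
  fixes f :: "'k::field comb"
  assumes g: "spd \<gamma>" "spd \<delta>" and f: "f \<in> path_comb n \<tau> \<gamma> \<delta>" and xy: "(x, y) \<in> P" "x \<in> spp \<gamma>"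
  shows "(if y \<in> spp \<gamma> then phi f y else 0) = (if x \<in> spp \<delta> \<and> y \<in> spp \<delta> then phi f x else 0)"
proof -
  have fr: "free \<gamma>" "free \<delta>" and sp: "spset (spp \<gamma>)" "spset (spp \<delta>)" using g sp_iff by auto
  obtain c where c: "c \<noteq> 0 \<Longrightarrow> thin_hom Qv (spp \<gamma>) (spp \<delta>)" "\<And>x. phi f x = (if x \<in> spp \<gamma> \<inter> spp \<delta> then c else 0)"
    by (rule phi_constant[OF fr f]) blast
  show ?thesis
  proof (cases "c = 0 \<or> y \<notin> spp \<delta>")
    case True
    then show ?thesis using c(2) by auto
  next
    case False
    then have "x \<in> spp \<delta> \<longleftrightarrow> y \<in> spp \<gamma>" using thin_hom_P[OF sp c(1) xy] by blast
    then show ?thesis using c(2) xy False by auto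
  qed
qed

text \<open>The explicit candidate for the functor: the \<open>(i, j)\<close> entry of a morphism
  acts at \<open>x\<close> by its scalar there. Outside the module the value is zero, as
  \<open>mod_hom\<close> requires.\<close>

definition Om0 :: "diag list \<Rightarrow> diag list \<Rightarrow> 'k::field cmat set \<Rightarrow> nat \<Rightarrow> 'k vec \<Rightarrow> 'k vec" where
  "Om0 as bs X x v = (\<lambda>j. if v \<in> spc (Oob as) x then \<Sum>i<length as. PhiC X i j x * v i else 0)"

lemma Om0_apply: "v \<in> spc (Oob as) x \<Longrightarrow> Om0 as bs X x v j = (\<Sum>i<length as. PhiC X i j x * v i)"
  and Om0_out: "v \<notin> spc (Oob as) x \<Longrightarrow> Om0 as bs X x v = 0"
  by (simp_all add: Om0_def fun_eq_iff)

lemma Oob_zero_outside: "x \<notin> {1..n} \<Longrightarrow> v \<in> spc (Oob as) x \<Longrightarrow> v = 0"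
proof -
  assume x: "x \<notin> {1..n}" and v: "v \<in> spc (Oob as) x"
  have "x \<notin> spp \<gamma>" for \<gamma> using x supp_subset[of \<gamma>] by blast
  then show "v = 0" using v by (auto simp: fun_eq_iff Oob_spc)
qed

lemma Om0_in:
  assumes as: "obj as" and X: "X \<in> hom as bs"
  shows "Om0 as bs X x v \<in> spc (Oob bs) x"
proof (cases "v \<in> spc (Oob as) x")
  case True
  have "j < length bs \<and> x \<in> spp (bs ! j)" if nz: "(\<Sum>i<length as. PhiC X i j x * v i) \<noteq> 0" for j
  proof -
    obtain i where "PhiC X i j x \<noteq> 0" using nz by (metis (no_types, lifting) mult_zero_left sum.neutral)
    then show ?thesis using PhiC_support[OF as X] by blast
  qed
  then show ?thesis using True unfolding Oob_spc[of _ bs] by (simp add: Om0_apply)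
next
  case False
  then show ?thesis using Om0_out subspace_zero[OF Oob_subspace] by metis
qed

lemma Om0_hom:
  fixes X :: "'k::field cmat set"
  assumes as: "spo as" and bs: "spo bs" and X: "X \<in> hom as bs"
  shows "Om0 as bs X \<in> mod_hom P (Oob as) (Oob bs)"
proof (rule fp.mod_homI)
  note o = spo_obj[OF as]
  fix x
  show "lin_map_on (spc (Oob as :: 'k psys) x) (spc (Oob bs) x) (Om0 as bs X x)"
    unfolding lin_map_on_def
  proof (intro conjI ballI allI)
    show "Om0 as bs X x v \<in> spc (Oob bs) x" for v :: "'k vec" by (rule Om0_in[OF o X])
    show "Om0 as bs X x (u + v) = Om0 as bs X x u + Om0 as bs X x v"
      if "u \<in> spc (Oob as) x" "v \<in> spc (Oob as) x" for u v :: "'k vec"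
      using that subspace_add[OF Oob_subspace that] by (simp add: fun_eq_iff Om0_apply distrib_left sum.distrib)
    show "Om0 as bs X x (fscale c v) = fscale c (Om0 as bs X x v)" if "v \<in> spc (Oob as) x" for c and v :: "'k vec"
      using that subspace_scale[OF Oob_subspace that]
      by (simp add: fun_eq_iff Om0_apply fscale_def sum_distrib_left mult.left_commute)
  qed
next
  note o = spo_obj[OF as]
  fix x y and v :: "'k vec" assume xy: "(x, y) \<in> P" and v: "v \<in> spc (Oob as) x"
  have sv: "str (Oob as) y x v \<in> spc (Oob as) y" unfolding Oob_spc Oob_str by simp
  obtain f where f: "f \<in> CM as bs" "PhiC X = Phi f" by (rule homE[OF o X]) blast
  show "Om0 as bs X y (str (Oob as) y x v) = str (Oob bs) y x (Om0 as bs X x v)"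
  proof
    fix j
    have t: "PhiC X i j y * str (Oob as) y x v i =
        (if j < length bs \<and> x \<in> spp (bs ! j) \<and> y \<in> spp (bs ! j) then PhiC X i j x * v i else 0)"
      if i: "i < length as" for i
    proof (cases "v i = 0 \<or> \<not> j < length bs")
      case True
      then show ?thesis using PhiC_support(2)[OF o X, of i j y] by (auto simp: Oob_str)
    next
      case False
      then have xi: "x \<in> spp (as ! i)" and j: "j < length bs" using v by (auto simp: Oob_spc)
      have "spd (as ! i)" "spd (bs ! j)" using as bs i j by auto
      then have "(if y \<in> spp (as ! i) then phi (f i j) y else 0) = (if x \<in> spp (bs ! j) \<and> y \<in> spp (bs ! j) then phi (f i j) x else 0)"
        by (rule phi_natural[OF _ _ CM_entry[OF f(1) i j] xy xi])
      then show ?thesis using xi i j unfolding f(2) Phi_def by (auto simp: Oob_str split: if_splits)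
    qed
    have "Om0 as bs X y (str (Oob as) y x v) j = (\<Sum>i<length as.
        (if j < length bs \<and> x \<in> spp (bs ! j) \<and> y \<in> spp (bs ! j) then PhiC X i j x * v i else 0))"
      unfolding Om0_apply[OF sv] by (rule sum.cong[OF refl]) (use t in auto)
    also have "\<dots> = str (Oob bs) y x (Om0 as bs X x v) j"
      by (cases "j < length bs \<and> x \<in> spp (bs ! j) \<and> y \<in> spp (bs ! j)") (auto simp: Oob_str Om0_apply[OF v])
    finally show "Om0 as bs X y (str (Oob as) y x v) j = str (Oob bs) y x (Om0 as bs X x v) j" .
  qed
next
  fix x and v :: "'k vec" assume a: "x \<notin> Field P \<or> v \<notin> spc (Oob as) x"
  show "Om0 as bs X x v = 0"
  proof (cases "v \<in> spc (Oob as) x")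
    case True
    then have "v = 0" using a P_Field Oob_zero_outside by blast
    then show ?thesis using True by (simp add: fun_eq_iff Om0_apply)
  qed (rule Om0_out)
qed

lemma Om0_ident:
  assumes as: "spo as"
  shows "Om0 as as (Ident cT_cat as) = (Ident SP (Oob as) :: nat \<Rightarrow> 'k::field vec \<Rightarrow> 'k vec)"
proof (intro ext)
  note id = Ident_PhiC[OF spo_obj[OF as]]
  fix x j and v :: "'k vec"
  show "Om0 as as (Ident cT_cat as) x v j = (Ident SP (Oob as) :: nat \<Rightarrow> 'k vec \<Rightarrow> 'k vec) x v j"
  proof (cases "v \<in> spc (Oob as) x")
    case True
    have "Om0 as as (Ident cT_cat as) x v j = (\<Sum>i<length as. if i = j then (if x \<in> spp (as ! j) then v j else 0) else 0)"
      unfolding Om0_apply[OF True] id(2) by (rule sum.cong) auto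
    also have "\<dots> = v j" using True by (auto simp: sum.delta Oob_spc)
    finally show ?thesis using True Oob_zero_outside[OF _ True] P_Field by (auto simp: SP_simps)
  next
    case False
    then show ?thesis by (simp add: SP_simps Om0_out)
  qed
qed

lemma Om0_comp:
  fixes X Y :: "'k::field cmat set"
  assumes o: "spo as" "spo bs" and X: "X \<in> hom as bs" and Y: "Y \<in> hom bs cs"
  shows "Om0 as cs (Comp cT_cat as bs cs Y X) x v = Om0 bs cs Y x (Om0 as bs X x v)"
proof (cases "v \<in> spc (Oob as) x")
  case True
  note oo = spo_obj[OF o(1)] spo_obj[OF o(2)]
  show ?thesis
  proof
    fix l
    have "Om0 as cs (Comp cT_cat as bs cs Y X) x v l = (\<Sum>i<length as. \<Sum>j<length bs. PhiC X i j x * PhiC Y j l x * v i)"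
      unfolding Om0_apply[OF True] Comp_PhiC(2)[OF oo X Y] sum_distrib_right ..
    also have "\<dots> = (\<Sum>j<length bs. \<Sum>i<length as. PhiC X i j x * PhiC Y j l x * v i)" by (rule sum.swap)
    also have "\<dots> = (\<Sum>j<length bs. PhiC Y j l x * (\<Sum>i<length as. PhiC X i j x * v i))"
      by (simp add: sum_distrib_left mult_ac)
    also have "\<dots> = Om0 bs cs Y x (Om0 as bs X x v) l"
      unfolding Om0_apply[OF Om0_in[OF oo(1) X]] Om0_apply[OF True] ..
    finally show "Om0 as cs (Comp cT_cat as bs cs Y X) x v l = Om0 bs cs Y x (Om0 as bs X x v) l" .
  qed
next
  case False
  have "Om0 bs cs Y x 0 = 0"
    by (rule ext) (simp only: Om0_apply[OF subspace_zero[OF Oob_subspace]] zero_fun_apply mult_zero_right sum.neutral_const)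
  then show ?thesis using False by (simp add: Om0_out)
qed

lemma Om0_functor: "is_linear_functor (TF :: (diag list, 'k::field cmat set, 'k) lcat) SP Oob Om0"
  unfolding is_linear_functor_def is_functor_def TF_simps
proof (intro conjI allI ballI; (unfold Ob_TF)?)
  show "category (TF :: (diag list, 'k cmat set, 'k) lcat)" by (rule category_TF)
  show "category (SP :: ('k psys, nat \<Rightarrow> 'k vec \<Rightarrow> 'k vec, 'k) lcat)" by (rule fp.category_mod_sp)
next
  fix as bs and X Y :: "'k cmat set" assume o: "spo as" and X: "X \<in> hom as bs" and Y: "Y \<in> hom as bs"
  show "Om0 as bs (Add cT_cat as bs X Y) = Add SP (Oob as) (Oob bs) (Om0 as bs X) (Om0 as bs Y)"
  proof (intro ext)
    fix x j and v :: "'k vec"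
    show "Om0 as bs (Add cT_cat as bs X Y) x v j = Add SP (Oob as) (Oob bs) (Om0 as bs X) (Om0 as bs Y) x v j"
      unfolding Om0_def Add_PhiC[OF spo_obj[OF o] X Y] SP_simps by (simp add: distrib_right sum.distrib)
  qed
next
  fix as bs c and X :: "'k cmat set" assume o: "spo as" and X: "X \<in> hom as bs"
  show "Om0 as bs (Scale cT_cat as bs c X) = Scale SP (Oob as) (Oob bs) c (Om0 as bs X)"
  proof (intro ext)
    fix x j and v :: "'k vec"
    show "Om0 as bs (Scale cT_cat as bs c X) x v j = Scale SP (Oob as) (Oob bs) c (Om0 as bs X) x v j"
      unfolding Om0_def Scale_PhiC(2)[OF spo_obj[OF o] X] SP_simps by (simp add: fscale_def sum_distrib_left mult.assoc)
  qed
next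
  fix as bs cs and X Y :: "'k cmat set"
  assume o: "spo as" "spo bs" and X: "X \<in> hom as bs" and Y: "Y \<in> hom bs cs"
  show "Om0 as cs (Comp cT_cat as bs cs Y X) = Comp SP (Oob as) (Oob bs) (Oob cs) (Om0 bs cs Y) (Om0 as bs X)"
    unfolding SP_simps using Om0_comp[OF o X Y] by blast
next
  fix as bs and X :: "'k cmat set" assume o: "spo as" "spo bs" and X: "X \<in> hom as bs"
  show "Om0 as bs X \<in> Hom SP (Oob as) (Oob bs)" unfolding SP_simps by (rule Om0_hom[OF o X])
qed (use Oob_sp Om0_ident in auto)

text \<open>The moving end cannot arrive at the pivot, because the diagonal would degenerate to a
  point. So it stays in the window and only the letter \<open>False\<close> occurs.\<close>

lemma pivot_word:
  assumes "successively (pivot_move n \<tau> (pvert n a)) p" "p \<noteq> []" "hd p = ch a b" "a < b" "b < a + N"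
  shows "\<exists>k. p = dpath a b (replicate k False) \<and> b + int k < a + N"
  using assms
proof (induction p arbitrary: b)
  case (Cons d p)
  show ?case
  proof (cases p)
    case Nil
    then show ?thesis using Cons.prems by (intro exI[of _ 0]) simp
  next
    case (Cons e q)
    then have m: "pivot_move n \<tau> (pvert n a) (ch a b) e" and s: "successively (pivot_move n \<tau> (pvert n a)) p"
      using Cons.prems by auto
    then obtain w where w: "ch a b = {pvert n a, w}" "e = {pvert n a, nxt n w}" "free e" unfolding pivot_move_def by blast
    have "pvert n a \<noteq> pvert n b" using pvert_inj[of n a b] Cons.prems by auto
    then have "w = pvert n b" using w(1) unfolding chord_def by (auto simp: doubleton_eq_iff)
    then have e: "e = ch a (b + 1)" using w(2) nxt_pvert unfolding chord_def by simp
    have "b + 1 < a + N"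
    proof (rule ccontr)
      assume "\<not> b + 1 < a + N"
      then have "b + 1 = a + N" using Cons.prems by linarith
      then have "pvert n (b + 1) = pvert n a" using pvert_shift(1)[of n a] by (simp only:)
      then have "e = {pvert n a}" using e unfolding chord_def by simp
      then show False using w(3) unfolding free_diagonal_def diagonal_def by (metis doubleton_eq_iff insert_absorb2)
    qed
    then obtain k where "p = dpath a (b + 1) (replicate k False)" "b + 1 + int k < a + N"
    proof -
      have "p \<noteq> []" "hd p = ch a (b + 1)" "a < b + 1" using Cons e Cons.prems(4) by auto
      from Cons.IH[OF s this \<open>b + 1 < a + N\<close>] show ?thesis using that by blast
    qed
    then show ?thesis using Cons.prems by (intro exI[of _ "Suc k"]) auto
  qed
qed simp

text \<open>In contrast to \<open>csupp_inter\<close>, disjoint supports are covered too. With a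
  fixed pivot only one end moves, so a label crossing the first and the last diagonal crosses all of
  them, and disjoint supports give the prescribed zero map.\<close>

lemma sp_move_path:
  assumes m: "sp_move n \<tau> Qv F \<gamma> \<gamma>' p"
  shows "mpath \<gamma> \<gamma>' p" "csupp p = spp \<gamma> \<inter> spp \<gamma>'"
proof -
  have p: "2 \<le> length p" "hd p = \<gamma>" "last p = \<gamma>'" and sp: "spd \<gamma>" using m unfolding sp_move_def by blast+
  obtain v where v: "successively (pivot_move n \<tau> v) p" using m unfolding sp_move_def by blast
  have ne: "p \<noteq> []" using p by auto
  have "successively (\<lambda>u w. (u, w) \<in> moves n \<tau>) p"
    by (rule successively_mono[OF v]) (auto simp: moves_def)
  then show mp: "mpath \<gamma> \<gamma>' p" unfolding is_path_def using p ne by blast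
  obtain d q where dq: "p = \<gamma> # d # q" using p by (cases p rule: remdups_adj.cases) auto
  then obtain w where w: "\<gamma> = {v, w}" "free \<gamma>" using v unfolding pivot_move_def by auto
  have vw: "v < n + 3" "w < n + 3" "v \<noteq> w" using w unfolding free_diagonal_def diagonal_def by (auto simp: doubleton_eq_iff)
  obtain a b where ab: "\<gamma> = ch a b" "a < b" "b < a + N" "pvert n a = v"
    using chord_window[OF vw] w by metis
  obtain k where k: "p = dpath a b (replicate k False)" "b + int k < a + N"
    using pivot_word[OF v[folded ab(4)] ne _ ab(2,3)] p ab by blast
  have cw: "cT (replicate k False) = 0" "cF (replicate k False) = int k" by (induction k) auto
  have last: "\<gamma>' = ch a (b + int k)" using p(3) dpath_last[of a b "replicate k False"] k cw by simp
  have "x \<in> csupp p" if x: "x \<in> spp \<gamma>" "x \<in> spp \<gamma>'" for x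
  proof -
    obtain c d where cd: "a < c" "c < b" "b < d" "d < a + N" "\<tau> x = ch c d" and x1: "x \<in> {1..n}"
      using x(1) supp_chord[OF ab(2,3), of x] ab(1) by auto
    have "b + int k < d"
      using supp_window[of a "b + int k" x c d] x(2) last cd x1 ab k by auto
    then show ?thesis
      unfolding k(1) using crossed_word_path(2)[OF x1 cd(5), of a "replicate k False" b] cd cw by simp
  qed
  moreover have "csupp p \<subseteq> spp \<gamma> \<inter> spp \<gamma>'"
    using hd_in_set[OF ne] last_in_set[OF ne] p by (auto simp: csupp_def)
  ultimately show "csupp p = spp \<gamma> \<inter> spp \<gamma>'" by blast
qed

lemma Om0_unit:
  assumes as: "obj as" and ij: "i < length as" "j < length bs" and p: "mpath (as ! i) (bs ! j) p"
    and v: "(v :: 'k::field vec) \<in> spc (Oob as) x"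
  shows "Om0 as bs (ME as bs `` {unit_mat i j p}) x v = (\<lambda>l. if l = j \<and> x \<in> csupp p then v i else 0)"
proof
  fix l
  have "Om0 as bs (ME as bs `` {unit_mat i j p}) x v l = (\<Sum>i'<length as. if i' = i then (if l = j \<and> x \<in> csupp p then v i else 0) else 0)"
    unfolding Om0_apply[OF v] class_hom(2)[OF as unit_mat_CM[OF ij p]] Phi_unit_mat by (rule sum.cong) auto
  then show "Om0 as bs (ME as bs `` {unit_mat i j p}) x v l = (if l = j \<and> x \<in> csupp p then v i else 0)"
    using ij by (simp add: sum.delta)
qed

lemma Om0_is_Omega: "is_Omega n \<tau> Qv F (Om0 :: diag list \<Rightarrow> diag list \<Rightarrow> 'k::field cmat set \<Rightarrow> nat \<Rightarrow> 'k vec \<Rightarrow> 'k vec)"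
  unfolding is_Omega_def
proof (intro conjI allI impI Om0_functor ballI; (unfold Ob_TF)?)
  fix as i assume as: "spo as" and i: "i < length as"
  note o = spo_obj[OF as]
  have oi: "obj [as ! i]" using o i by simp
  have p: "mpath (as ! i) (as ! i) [as ! i]" by (simp add: is_path_def)
  show "Om0 [as ! i] as (ME [as ! i] as `` {unit_mat 0 i [as ! i]}) =
      (\<lambda>x v. if v \<in> spc (Oob [as ! i]) x then (\<lambda>l. if l = i then v 0 else 0) else (0 :: 'k vec))"
  proof (intro ext)
    fix x l and v :: "'k vec"
    show "Om0 [as ! i] as (ME [as ! i] as `` {unit_mat 0 i [as ! i]}) x v l =
      (if v \<in> spc (Oob [as ! i]) x then (\<lambda>l. if l = i then v 0 else 0) else (0 :: 'k vec)) l"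
    proof (cases "v \<in> spc (Oob [as ! i]) x")
      case True
      then show ?thesis using Om0_unit[OF oi _ i _ True, of 0 "[as ! i]"] p csupp_single by (auto simp: Oob_spc)
    qed (simp add: Om0_out)
  qed
  show "Om0 as [as ! i] (ME as [as ! i] `` {unit_mat i 0 [as ! i]}) =
      (\<lambda>x v. if v \<in> spc (Oob as) x then (\<lambda>l. if l = 0 then v i else 0) else (0 :: 'k vec))"
  proof (intro ext)
    fix x l and v :: "'k vec"
    show "Om0 as [as ! i] (ME as [as ! i] `` {unit_mat i 0 [as ! i]}) x v l =
      (if v \<in> spc (Oob as) x then (\<lambda>l. if l = 0 then v i else 0) else (0 :: 'k vec)) l"
    proof (cases "v \<in> spc (Oob as) x")
      case True
      then show ?thesis using Om0_unit[OF o i _ _ True, of 0 "[as ! i]" "[as ! i]"] p csupp_single by (auto simp: Oob_spc)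
    qed (simp add: Om0_out)
  qed
next
  fix \<gamma> \<gamma>' p assume m: "sp_move n \<tau> Qv F \<gamma> \<gamma>' p"
  have o: "obj [\<gamma>]" using m sp_iff unfolding sp_move_def by simp
  show "Om0 [\<gamma>] [\<gamma>'] (ME [\<gamma>] [\<gamma>'] `` {unit_mat 0 0 p}) =
      (\<lambda>x v. if v \<in> spc (Oob [\<gamma>]) x \<and> x \<in> spp \<gamma> \<inter> spp \<gamma>' then v else (0 :: 'k vec))"
  proof (intro ext)
    fix x l and v :: "'k vec"
    show "Om0 [\<gamma>] [\<gamma>'] (ME [\<gamma>] [\<gamma>'] `` {unit_mat 0 0 p}) x v l =
      (if v \<in> spc (Oob [\<gamma>]) x \<and> x \<in> spp \<gamma> \<inter> spp \<gamma>' then v else (0 :: 'k vec)) l"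
    proof (cases "v \<in> spc (Oob [\<gamma>]) x")
      case True
      then have "v l = 0" if "l \<noteq> 0" using that by (auto simp: Oob_spc)
      then show ?thesis using Om0_unit[OF o _ _ _ True, of 0 0 "[\<gamma>']" p] sp_move_path[OF m] True by auto
    qed (simp add: Om0_out)
  qed
qed

end

section \<open>Fullness and faithfulness\<close>

lemma sum_fun_apply: "(\<Sum>i\<in>I. F i) j = (\<Sum>i\<in>I. F i j)"
  by (induction I rule: infinite_finite_induct) simp_all

text \<open>Two intervals of a line meet in an interval, so equality across single arrows propagates
  through the intersection.\<close>

lemma (in line_quiver) interval_constant:
  assumes I: "interval I" and J: "interval J" and xy: "x \<in> I \<inter> J" "y \<in> I \<inter> J"
    and c: "\<And>u v. (u, v) \<in> Q \<Longrightarrow> u \<in> I \<inter> J \<Longrightarrow> v \<in> I \<inter> J \<Longrightarrow> m u = m v"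
  shows "m x = m y"
proof -
  obtain l r where I': "r < n" "I = iv l r" using I by (rule intervalE)
  obtain l' r' where J': "J = iv l' r'" using J by (rule intervalE)
  have key: "m u = m v" if "u \<in> I \<inter> J" "v \<in> I \<inter> J" "pos v = pos u + d" for u v d
    using that
  proof (induction d arbitrary: v)
    case 0
    then have "u \<in> {1..n}" "v \<in> {1..n}" "pos u = pos v" using interval_subset[OF I] by auto
    then have "u = v" by (rule pos_inj)
    then show ?case by simp
  next
    case (Suc d)
    have "pos u + d < n" using Suc.prems I' by (auto simp: iv_def)
    then obtain w where w: "w \<in> {1..n}" "pos w = pos u + d" by (rule pos_surj)
    then have wI: "w \<in> I \<inter> J" using Suc.prems I' J' by (auto simp: iv_def)
    have "v \<in> {1..n}" using Suc.prems interval_subset[OF I] by blast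
    then have "(w, v) \<in> Q \<or> (v, w) \<in> Q" using w Suc.prems arrow_iff[of w v] arrow_iff[of v w] by auto
    then have "m w = m v" using c[of w v] c[of v w] wI Suc.prems by auto
    then show ?case using Suc.IH[OF Suc.prems(1) wI w(2)] by simp
  qed
  show ?thesis
    using key[OF xy, of "pos y - pos x"] key[OF xy(2,1), of "pos x - pos y"] by (cases "pos x \<le> pos y") auto
qed

context type_A
begin

lemma Omega_functor: "is_Omega n \<tau> Qv F Om \<Longrightarrow> is_functor TF SP Oob Om"
  and Omega_comp: "is_Omega n \<tau> Qv F Om \<Longrightarrow> spo as \<Longrightarrow> spo bs \<Longrightarrow> spo cs \<Longrightarrow> X \<in> hom as bs \<Longrightarrow> Y \<in> hom bs cs \<Longrightarrow>
    Om as cs (Comp cT_cat as bs cs Y X) = (\<lambda>x v. Om bs cs Y x (Om as bs X x v))"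
  and Omega_ident: "is_Omega n \<tau> Qv F Om \<Longrightarrow> spo as \<Longrightarrow> Om as as (Ident cT_cat as) = Ident SP (Oob as)"
  and Omega_hom: "is_Omega n \<tau> Qv F Om \<Longrightarrow> spo as \<Longrightarrow> spo bs \<Longrightarrow> X \<in> hom as bs \<Longrightarrow> Om as bs X \<in> mod_hom P (Oob as) (Oob bs)"
  and Omega_scale: "is_Omega n \<tau> Qv F Om \<Longrightarrow> spo as \<Longrightarrow> spo bs \<Longrightarrow> X \<in> hom as bs \<Longrightarrow>
    Om as bs (Scale cT_cat as bs c X) = (\<lambda>x v. fscale c (Om as bs X x v))"
  and Omega_move: "is_Omega n \<tau> Qv F Om \<Longrightarrow> sp_move n \<tau> Qv F \<gamma> \<gamma>' p \<Longrightarrow> Om [\<gamma>] [\<gamma>'] (ME [\<gamma>] [\<gamma>'] `` {unit_mat 0 0 p}) =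
      (\<lambda>x v. if v \<in> spc (Oob [\<gamma>]) x \<and> x \<in> spp \<gamma> \<inter> spp \<gamma>' then v else 0)"
  and Omega_incl: "is_Omega n \<tau> Qv F Om \<Longrightarrow> spo as \<Longrightarrow> i < length as \<Longrightarrow>
    Om [as ! i] as (ME [as ! i] as `` {unit_mat 0 i [as ! i]}) =
      (\<lambda>x v. if v \<in> spc (Oob [as ! i]) x then (\<lambda>l. if l = i then v 0 else 0) else 0)"
  and Omega_proj: "is_Omega n \<tau> Qv F Om \<Longrightarrow> spo as \<Longrightarrow> i < length as \<Longrightarrow>
    Om as [as ! i] (ME as [as ! i] `` {unit_mat i 0 [as ! i]}) =
      (\<lambda>x v. if v \<in> spc (Oob as) x then (\<lambda>l. if l = 0 then v i else 0) else 0)"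
  for Om :: "diag list \<Rightarrow> diag list \<Rightarrow> 'k::field cmat set \<Rightarrow> nat \<Rightarrow> 'k vec \<Rightarrow> 'k vec"
proof -
  assume O: "is_Omega n \<tau> Qv F Om"
  note c = O[unfolded is_Omega_def]
  note L = c[THEN conjunct1] and ip = c[THEN conjunct2, THEN conjunct1] and mv = c[THEN conjunct2, THEN conjunct2]
  show Fu: "is_functor TF SP Oob Om" using L unfolding is_linear_functor_def by (elim conjE)
  show "sp_move n \<tau> Qv F \<gamma> \<gamma>' p \<Longrightarrow> Om [\<gamma>] [\<gamma>'] (ME [\<gamma>] [\<gamma>'] `` {unit_mat 0 0 p}) =
      (\<lambda>x v. if v \<in> spc (Oob [\<gamma>]) x \<and> x \<in> spp \<gamma> \<inter> spp \<gamma>' then v else 0)" using mv by simp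
  show "spo as \<Longrightarrow> i < length as \<Longrightarrow> Om [as ! i] as (ME [as ! i] as `` {unit_mat 0 i [as ! i]}) =
      (\<lambda>x v. if v \<in> spc (Oob [as ! i]) x then (\<lambda>l. if l = i then v 0 else 0) else 0)"
    "spo as \<Longrightarrow> i < length as \<Longrightarrow> Om as [as ! i] (ME as [as ! i] `` {unit_mat i 0 [as ! i]}) =
      (\<lambda>x v. if v \<in> spc (Oob as) x then (\<lambda>l. if l = 0 then v i else 0) else 0)"
    using ip[rule_format, unfolded Ob_TF, of as i] by blast+
  show "spo as \<Longrightarrow> Om as as (Ident cT_cat as) = Ident SP (Oob as)"
    using Fu unfolding is_functor_def TF_simps by (simp add: Ob_TF)
  show "spo as \<Longrightarrow> spo bs \<Longrightarrow> X \<in> hom as bs \<Longrightarrow> Om as bs X \<in> mod_hom P (Oob as) (Oob bs)"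
    using Fu unfolding is_functor_def TF_simps SP_simps by (simp add: Ob_TF)
  show "spo as \<Longrightarrow> spo bs \<Longrightarrow> spo cs \<Longrightarrow> X \<in> hom as bs \<Longrightarrow> Y \<in> hom bs cs \<Longrightarrow>
    Om as cs (Comp cT_cat as bs cs Y X) = (\<lambda>x v. Om bs cs Y x (Om as bs X x v))"
    using Fu unfolding is_functor_def TF_simps SP_simps by (simp add: Ob_TF)
  show "spo as \<Longrightarrow> spo bs \<Longrightarrow> X \<in> hom as bs \<Longrightarrow> Om as bs (Scale cT_cat as bs c X) = (\<lambda>x v. fscale c (Om as bs X x v))"
    using L unfolding is_linear_functor_def TF_simps SP_simps by (simp add: Ob_TF)
qed

abbreviation Uc :: "diag \<Rightarrow> diag \<Rightarrow> diag list \<Rightarrow> 'k::field cmat set" where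
  "Uc \<gamma> \<delta> p \<equiv> ME [\<gamma>] [\<delta>] `` {unit_mat 0 0 p}"

lemma Uc:
  assumes "free \<gamma>" "mpath \<gamma> \<delta> p"
  shows "(Uc \<gamma> \<delta> p :: 'k::field cmat set) \<in> hom [\<gamma>] [\<delta>]"
    "PhiC (Uc \<gamma> \<delta> p :: 'k cmat set) = (\<lambda>i j x. if i = 0 \<and> j = 0 \<and> x \<in> csupp p then 1 else 0)"
proof -
  have c: "(unit_mat 0 0 p :: 'k cmat) \<in> CM [\<gamma>] [\<delta>]" by (rule unit_mat_CM) (use assms in auto)
  have o: "obj [\<gamma>]" using assms by simp
  show "(Uc \<gamma> \<delta> p :: 'k cmat set) \<in> hom [\<gamma>] [\<delta>]"
    "PhiC (Uc \<gamma> \<delta> p :: 'k cmat set) = (\<lambda>i j x. if i = 0 \<and> j = 0 \<and> x \<in> csupp p then 1 else 0)"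
    using class_hom[OF o c] unfolding Phi_unit_mat by auto
qed

text \<open>Identities and sp-moves have fixed values, and \<open>sp_generation\<close> reaches
  every nonzero path from them by induction on the length. Replacing a path by another one is
  allowed because nonzero paths with the same ends have the same class.\<close>

lemma Omega_path:
  fixes Om :: "diag list \<Rightarrow> diag list \<Rightarrow> 'k::field cmat set \<Rightarrow> nat \<Rightarrow> 'k vec \<Rightarrow> 'k vec"
  assumes O: "is_Omega n \<tau> Qv F Om"
  shows "spd \<gamma> \<Longrightarrow> spd \<delta> \<Longrightarrow> mpath \<gamma> \<delta> p \<Longrightarrow> csupp p \<noteq> {} \<Longrightarrow> Om [\<gamma>] [\<delta>] (Uc \<gamma> \<delta> p) = Om0 [\<gamma>] [\<delta>] (Uc \<gamma> \<delta> p)"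
proof (induction "length p" arbitrary: \<gamma> \<delta> p rule: less_induct)
  case less
  have fr: "free \<gamma>" "free \<delta>" using less.prems sp_iff by auto
  have o: "obj [\<gamma>]" "spo [\<gamma>]" "spo [\<delta>]" using fr less.prems by auto
  note U = Uc[OF fr(1) less.prems(3)]
  from less.prems show ?case
  proof (cases rule: sp_generation)
    case triv
    have e: "(\<Sum>i<length [\<gamma>]. unit_mat i i [[\<gamma>] ! i]) = (unit_mat 0 0 [\<gamma>] :: 'k cmat)" by simp
    have "Uc \<gamma> \<gamma> [\<gamma>] = (Ident cT_cat [\<gamma>] :: 'k cmat set)"
      unfolding cat_T_def using e by simp
    then show ?thesis
      unfolding triv(1) triv(2)[symmetric] by (simp add: Omega_ident[OF O o(2)] Omega_ident[OF Om0_is_Omega o(2)])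
  next
    case (move q)
    note Uq = Uc[OF fr(1) move(2)]
    have "csupp q = csupp p"
      using csupp_inter[OF fr(1) less.prems(3,4)] csupp_inter[OF fr(1) move(2,3)] by simp
    then have e: "Uc \<gamma> \<delta> p = (Uc \<gamma> \<delta> q :: 'k cmat set)"
      by (intro hom_eqI[OF o(1) U(1) Uq(1)]) (simp only: U(2) Uq(2))
    show ?thesis unfolding e Omega_move[OF O move(1)] Omega_move[OF Om0_is_Omega move(1)] by (rule refl)
  next
    case (comp \<kappa> q r)
    have fk: "free \<kappa>" and ok: "obj [\<kappa>]" "spo [\<kappa>]" using comp(1) sp_iff by auto
    note Uq = Uc[OF fr(1) comp(2)] and Ur = Uc[OF fk comp(3)]
    have cs: "csupp (q @ tl r) = csupp q \<inter> csupp r" by (rule csupp_concat[OF comp(2,3)])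
    have ne: "csupp q \<noteq> {}" "csupp r \<noteq> {}" using comp(4) cs by auto
    have "mpath \<gamma> \<delta> (q @ tl r)" by (rule is_path_append[OF comp(2,3)])
    then have "csupp (q @ tl r) = csupp p"
      using csupp_inter[OF fr(1) less.prems(3,4)] csupp_inter[OF fr(1) _ comp(4)] by simp
    then have c: "x \<in> csupp p \<longleftrightarrow> x \<in> csupp q \<and> x \<in> csupp r" for x using cs by blast
    note C = Comp_PhiC[OF o(1) ok(1) Uq(1) Ur(1)]
    have "PhiC (Uc \<gamma> \<delta> p :: 'k cmat set) = PhiC (Comp cT_cat [\<gamma>] [\<kappa>] [\<delta>] (Uc \<kappa> \<delta> r) (Uc \<gamma> \<kappa> q))"
      unfolding C(2) U(2) Uq(2) Ur(2) by (auto simp: fun_eq_iff c)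
    then have e: "Uc \<gamma> \<delta> p = (Comp cT_cat [\<gamma>] [\<kappa>] [\<delta>] (Uc \<kappa> \<delta> r) (Uc \<gamma> \<kappa> q) :: 'k cmat set)"
      by (rule hom_eqI[OF o(1) U(1) C(1)])
    have "Om [\<gamma>] [\<kappa>] (Uc \<gamma> \<kappa> q) = Om0 [\<gamma>] [\<kappa>] (Uc \<gamma> \<kappa> q)"
      by (rule less.hyps[OF comp(5) less.prems(1) comp(1,2) ne(1)])
    moreover have "Om [\<kappa>] [\<delta>] (Uc \<kappa> \<delta> r) = Om0 [\<kappa>] [\<delta>] (Uc \<kappa> \<delta> r)"
      by (rule less.hyps[OF comp(6) comp(1) less.prems(2) comp(3) ne(2)])
    ultimately show ?thesis
      unfolding e Omega_comp[OF O o(2) ok(2) o(3) Uq(1) Ur(1)] Omega_comp[OF Om0_is_Omega o(2) ok(2) o(3) Uq(1) Ur(1)] by simp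
  qed
qed

text \<open>By the normal form, a morphism between two diagonals is zero or a multiple of a nonzero
  path, where \<open>Omega_path\<close> applies.\<close>

lemma Omega_single:
  fixes Om :: "diag list \<Rightarrow> diag list \<Rightarrow> 'k::field cmat set \<Rightarrow> nat \<Rightarrow> 'k vec \<Rightarrow> 'k vec"
  assumes O: "is_Omega n \<tau> Qv F Om" and sp: "spd \<gamma>" "spd \<delta>" and X: "X \<in> hom [\<gamma>] [\<delta>]"
  shows "Om [\<gamma>] [\<delta>] X = Om0 [\<gamma>] [\<delta>] X"
proof -
  have fr: "free \<gamma>" "free \<delta>" using sp sp_iff by auto
  have o: "obj [\<gamma>]" "spo [\<gamma>]" "spo [\<delta>]" using fr sp by auto
  obtain f where f: "f \<in> CM [\<gamma>] [\<delta>]" "PhiC X = Phi f" by (rule homE[OF o(1) X]) blast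
  have f0: "f 0 0 \<in> path_comb n \<tau> \<gamma> \<delta>" using CM_entry[OF f(1), of 0 0] by simp
  have z: "PhiC X i j x = 0" if "\<not> (i = 0 \<and> j = 0)" for i j x
    using PhiC_support(1,2)[OF o(1) X, of i j x] that by auto
  \<comment> \<open>The zero morphism is written as \<open>0\<close> times \<open>X\<close>, so that
    both cases use only compatibility with scalars.\<close>
  have "\<exists>c Y. X = Scale cT_cat [\<gamma>] [\<delta>] c Y \<and> Y \<in> hom [\<gamma>] [\<delta>] \<and> (c = 0 \<or> Om [\<gamma>] [\<delta>] Y = Om0 [\<gamma>] [\<delta>] Y)"
  proof (cases "f 0 0 \<in> fvs.span (rels \<gamma> \<delta>)")
    case True
    then have "PhiC X 0 0 x = 0" for x using span_phi f(2) by (simp add: Phi_def)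
    then have "PhiC X i j x = 0" for i j x using z by (cases "i = 0 \<and> j = 0") auto
    then have "PhiC X = PhiC (Scale cT_cat [\<gamma>] [\<delta>] 0 X)" unfolding Scale_PhiC(2)[OF o(1) X] by (simp add: fun_eq_iff)
    then have "X = Scale cT_cat [\<gamma>] [\<delta>] 0 X" by (rule hom_eqI[OF o(1) X Scale_PhiC(1)[OF o(1) X]])
    then show ?thesis using X by blast
  next
    case False
    then obtain p c where p: "mpath \<gamma> \<delta> p" "csupp p \<noteq> {}" and s: "f 0 0 - fscale c (basis_vec p) \<in> fvs.span (rels \<gamma> \<delta>)"
      using normal_form[OF fr(1) f0] by blast
    note U = Uc[OF fr(1) p(1), where ?'k = 'k]
    have "PhiC X 0 0 x = c * (if x \<in> csupp p then 1 else 0)" for x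
    proof -
      have "phi (f 0 0 - fscale c (basis_vec p)) x = 0" by (rule span_phi[OF s])
      then show ?thesis
        unfolding phi_diff[OF path_comb_finite[OF f0] finite_support_scale[OF finite_basis]] phi_scale phi_basis f(2) Phi_def by simp
    qed
    then have "PhiC X i j x = c * (if i = 0 \<and> j = 0 \<and> x \<in> csupp p then 1 else 0)" for i j x
      using z by (cases "i = 0 \<and> j = 0") auto
    then have "PhiC X = PhiC (Scale cT_cat [\<gamma>] [\<delta>] c (Uc \<gamma> \<delta> p))"
      unfolding Scale_PhiC(2)[OF o(1) U(1)] U(2) by blast
    then have "X = Scale cT_cat [\<gamma>] [\<delta>] c (Uc \<gamma> \<delta> p)" by (rule hom_eqI[OF o(1) X Scale_PhiC(1)[OF o(1) U(1)]])
    then show ?thesis using U(1) Omega_path[OF O sp p] by blast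
  qed
  then obtain c Y where Y: "X = Scale cT_cat [\<gamma>] [\<delta>] c Y" "Y \<in> hom [\<gamma>] [\<delta>]" "c = 0 \<or> Om [\<gamma>] [\<delta>] Y = Om0 [\<gamma>] [\<delta>] Y" by blast
  have "fscale c (Om [\<gamma>] [\<delta>] Y x v) = fscale c (Om0 [\<gamma>] [\<delta>] Y x v)" for x v
    using Y(3) by (auto simp: fscale_def)
  then show ?thesis unfolding Y(1) Omega_scale[OF O o(2,3) Y(2)] Omega_scale[OF Om0_is_Omega o(2,3) Y(2)] by blast
qed

lemma incl_hom: "spo as \<Longrightarrow> i < length as \<Longrightarrow> (ME [as ! i] as `` {unit_mat 0 i [as ! i]} :: 'k::field cmat set) \<in> hom [as ! i] as"
  and proj_hom: "spo as \<Longrightarrow> i < length as \<Longrightarrow> (ME as [as ! i] `` {unit_mat i 0 [as ! i]} :: 'k::field cmat set) \<in> hom as [as ! i]"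
proof -
  assume as: "spo as" and i: "i < length as"
  have p: "mpath (as ! i) (as ! i) [as ! i]" by (simp add: is_path_def)
  have o: "obj as" "obj [as ! i]" using spo_obj[OF as] i by auto
  show "(ME [as ! i] as `` {unit_mat 0 i [as ! i]} :: 'k cmat set) \<in> hom [as ! i] as"
    by (rule class_hom(1)[OF o(2) unit_mat_CM]) (use i p in auto)
  show "(ME as [as ! i] `` {unit_mat i 0 [as ! i]} :: 'k cmat set) \<in> hom as [as ! i]"
    by (rule class_hom(1)[OF o(1) unit_mat_CM]) (use i p in auto)
qed

text \<open>Canonical inclusions and projections have prescribed images, so functoriality recovers
  each entry from a morphism between single summands, evaluated at the generator
  \<open>basis_vec 0\<close>.\<close>

lemma Omega_entry:
  fixes Om :: "diag list \<Rightarrow> diag list \<Rightarrow> 'k::field cmat set \<Rightarrow> nat \<Rightarrow> 'k vec \<Rightarrow> 'k vec"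
  assumes O: "is_Omega n \<tau> Qv F Om" and as: "spo as" and bs: "spo bs" and X: "X \<in> hom as bs"
    and v: "v \<in> spc (Oob as) x" and j: "j < length bs"
  shows "Om as bs X x v j = (\<Sum>i | i < length as \<and> x \<in> spp (as ! i). v i *
    Om [as ! i] [bs ! j] (Comp cT_cat [as ! i] bs [bs ! j] (ME bs [bs ! j] `` {unit_mat j 0 [bs ! j]})
      (Comp cT_cat [as ! i] as bs X (ME [as ! i] as `` {unit_mat 0 i [as ! i]}))) x (basis_vec 0) 0)"
proof (cases "x \<in> {1..n}")
  case False
  then have e: "v = 0" using Oob_zero_outside v by blast
  have no: "x \<notin> spp \<gamma>" for \<gamma> using False supp_subset[of \<gamma>] by blast
  have "Om as bs X x v = 0" using fp.hom_out[OF Omega_hom[OF O as bs X]] False P_Field by blast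
  then show ?thesis using no by simp
next
  case True
  then have xF: "x \<in> Field P" using P_Field by simp
  let ?S = "{i. i < length as \<and> x \<in> spp (as ! i)}"
  note lin = fp.hom_lin[OF Omega_hom[OF O as bs X] xF]
  have ve: "v = (\<Sum>i\<in>?S. fscale (v i) (basis_vec i))" by (rule Oob_expand[OF v])
  have "Om as bs X x v = (\<Sum>i\<in>?S. fscale (v i) (Om as bs X x (basis_vec i)))"
    by (subst ve, rule lin_map_sum[OF lin Oob_subspace]) (use Oob_basis in auto)
  then have "Om as bs X x v j = (\<Sum>i\<in>?S. fscale (v i) (Om as bs X x (basis_vec i))) j" by simp
  also have "\<dots> = (\<Sum>i\<in>?S. v i * Om as bs X x (basis_vec i) j)"
    by (simp add: fscale_def sum_fun_apply)
  also have "\<dots> = (\<Sum>i\<in>?S. v i *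
    Om [as ! i] [bs ! j] (Comp cT_cat [as ! i] bs [bs ! j] (ME bs [bs ! j] `` {unit_mat j 0 [bs ! j]})
      (Comp cT_cat [as ! i] as bs X (ME [as ! i] as `` {unit_mat 0 i [as ! i]}))) x (basis_vec 0) 0)"
  proof (intro sum.cong refl arg_cong[where f = "\<lambda>c. v _ * c"])
    fix i assume "i \<in> ?S"
    then have i: "i < length as" "x \<in> spp (as ! i)" by auto
    have sp: "spo [as ! i]" "spo [bs ! j]" using as bs i j by auto
    have ob: "obj [as ! i]" using sp spo_obj by blast
    note inc = incl_hom[OF as i(1), where ?'k = 'k] and prj = proj_hom[OF bs j, where ?'k = 'k]
    note Xi = Comp_PhiC(1)[OF ob spo_obj[OF as] inc X]
    have b0: "(basis_vec 0 :: 'k vec) \<in> spc (Oob [as ! i]) x" using Oob_basis[of 0 "[as ! i]" x] i by simp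
    have bi: "(\<lambda>l. if l = i then (basis_vec 0 :: 'k vec) 0 else 0) = basis_vec i" by (simp add: basis_vec_def fun_eq_iff)
    have im: "Om as bs X x (basis_vec i) \<in> spc (Oob bs) x" by (rule lin_map_in[OF lin Oob_basis[OF i]])
    show "Om as bs X x (basis_vec i) j = Om [as ! i] [bs ! j] (Comp cT_cat [as ! i] bs [bs ! j] (ME bs [bs ! j] `` {unit_mat j 0 [bs ! j]})
      (Comp cT_cat [as ! i] as bs X (ME [as ! i] as `` {unit_mat 0 i [as ! i]}))) x (basis_vec 0) 0"
      unfolding Omega_comp[OF O sp(1) bs sp(2) Xi prj] Omega_comp[OF O sp(1) as bs inc X]
        Omega_incl[OF O as i(1)] Omega_proj[OF O bs j] using b0 im bi by simp
  qed
  finally show ?thesis .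
qed

lemma Omega_unique:
  fixes Om :: "diag list \<Rightarrow> diag list \<Rightarrow> 'k::field cmat set \<Rightarrow> nat \<Rightarrow> 'k vec \<Rightarrow> 'k vec"
  assumes O: "is_Omega n \<tau> Qv F Om" and as: "spo as" and bs: "spo bs" and X: "X \<in> hom as bs"
  shows "Om as bs X = Om0 as bs X"
proof (intro ext)
  fix x v j
  note h = Omega_hom[OF O as bs X] and h0 = Om0_hom[OF as bs X]
  show "Om as bs X x v j = Om0 as bs X x v j"
  proof (cases "x \<in> Field P \<and> v \<in> spc (Oob as) x")
    case False
    then show ?thesis using fp.hom_out[OF h] fp.hom_out[OF h0] by metis
  next
    case True
    then have v: "v \<in> spc (Oob as) x" and xF: "x \<in> Field P" by blast+
    show ?thesis
    proof (cases "j < length bs")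
      case False
      have "Om as bs X x v \<in> spc (Oob bs) x" "Om0 as bs X x v \<in> spc (Oob bs) x"
        using lin_map_in[OF fp.hom_lin[OF h xF] v] lin_map_in[OF fp.hom_lin[OF h0 xF] v] by auto
      then show ?thesis using False unfolding Oob_spc by metis
    next
      case j: True
      show ?thesis
        unfolding Omega_entry[OF O as bs X v j] Omega_entry[OF Om0_is_Omega as bs X v j]
      proof (intro sum.cong refl)
        fix i assume "i \<in> {i. i < length as \<and> x \<in> spp (as ! i)}"
        then have i: "i < length as" by simp
        have sp: "spd (as ! i)" "spd (bs ! j)" using as bs i j by auto
        have ob: "obj [as ! i]" using sp sp_iff by simp
        note inc = incl_hom[OF as i, where ?'k = 'k] and prj = proj_hom[OF bs j, where ?'k = 'k]
        note Xi = Comp_PhiC(1)[OF ob spo_obj[OF bs] Comp_PhiC(1)[OF ob spo_obj[OF as] inc X] prj]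
        show "v i * Om [as ! i] [bs ! j] (Comp cT_cat [as ! i] bs [bs ! j] (ME bs [bs ! j] `` {unit_mat j 0 [bs ! j]})
            (Comp cT_cat [as ! i] as bs X (ME [as ! i] as `` {unit_mat 0 i [as ! i]}))) x (basis_vec 0) 0 =
          v i * Om0 [as ! i] [bs ! j] (Comp cT_cat [as ! i] bs [bs ! j] (ME bs [bs ! j] `` {unit_mat j 0 [bs ! j]})
            (Comp cT_cat [as ! i] as bs X (ME [as ! i] as `` {unit_mat 0 i [as ! i]}))) x (basis_vec 0) 0"
          unfolding Omega_single[OF O sp Xi] ..
      qed
    qed
  qed
qed

lemma Om0_basis:
  assumes "i < length as" "x \<in> spp (as ! i)"
  shows "Om0 as bs X x (basis_vec i :: 'k::field vec) j = PhiC X i j x"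
proof -
  have "Om0 as bs X x (basis_vec i) j = (\<Sum>i'<length as. if i' = i then PhiC X i j x else 0)"
    unfolding Om0_apply[OF Oob_basis[OF assms]] by (rule sum.cong) (auto simp: basis_vec_def)
  then show ?thesis using assms(1) by (simp add: sum.delta)
qed

text \<open>Evaluating at basis vectors returns the entries on the supports, and off the supports
  all entries vanish.\<close>

lemma Om0_faithful:
  fixes X Y :: "'k::field cmat set"
  assumes as: "obj as" and X: "X \<in> hom as bs" and Y: "Y \<in> hom as bs" and e: "Om0 as bs X = Om0 as bs Y"
  shows "X = Y"
proof (rule hom_eqI[OF as X Y], intro ext)
  fix i j x
  show "PhiC X i j x = PhiC Y i j x"
  proof (cases "i < length as \<and> x \<in> spp (as ! i)")
    case True
    then show ?thesis using Om0_basis[of i as x bs X j] Om0_basis[of i as x bs Y j] e by simp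
  next
    case False
    then show ?thesis using PhiC_support(1,3)[OF as X, of i j x] PhiC_support(1,3)[OF as Y, of i j x] by metis
  qed
qed

text \<open>Fullness for one pair of diagonals. Commuting with arrows forces the scalars to be
  constant on the intersection of the supports. If the constant is nonzero, the same equations say
  that \<open>thin_hom\<close> holds, which supplies a path.\<close>

lemma thin_scalars:
  fixes m :: "nat \<Rightarrow> 'k::field"
  assumes g: "spd \<gamma>" "spd \<delta>" and out: "\<And>x. x \<in> spp \<gamma> \<Longrightarrow> x \<notin> spp \<delta> \<Longrightarrow> m x = 0"
    and nat: "\<And>u v. (u, v) \<in> Qv \<Longrightarrow> u \<in> spp \<gamma> \<Longrightarrow>
      (if v \<in> spp \<gamma> then m v else 0) = (if u \<in> spp \<delta> \<and> v \<in> spp \<delta> then m u else 0)"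
  obtains f where "f \<in> path_comb n \<tau> \<gamma> \<delta>" "\<And>x. x \<in> spp \<gamma> \<Longrightarrow> phi f x = m x"
proof (cases "\<exists>x\<in>spp \<gamma>. m x \<noteq> 0")
  case False
  then show ?thesis using that[OF path_comb_zero] phi_zero unfolding zero_fun_def by fastforce
next
  case True
  have fr: "free \<gamma>" "free \<delta>" and I: "interval (spp \<gamma>)" "interval (spp \<delta>)" using g sp_iff spset_interval by auto
  obtain x0 where x0: "x0 \<in> spp \<gamma> \<inter> spp \<delta>" "m x0 \<noteq> 0" using True out by blast
  have c: "m x = m x0" if "x \<in> spp \<gamma> \<inter> spp \<delta>" for x
  proof (rule interval_constant[OF I that x0(1)])
    fix u v assume "(u, v) \<in> Qv" "u \<in> spp \<gamma> \<inter> spp \<delta>" "v \<in> spp \<gamma> \<inter> spp \<delta>"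
    then show "m u = m v" using nat[of u v] by auto
  qed
  have "thin_hom Qv (spp \<gamma>) (spp \<delta>)"
    unfolding thin_hom_def
  proof (intro conjI ballI)
    show "spp \<gamma> \<inter> spp \<delta> \<noteq> {}" using x0 by blast
    fix e assume "e \<in> Qv"
    then obtain u v where uv: "e = (u, v)" "(u, v) \<in> Qv" by (cases e) auto
    have "v \<in> spp \<gamma>" if "u \<in> spp \<gamma> \<inter> spp \<delta>" "v \<in> spp \<delta>"
      using nat[OF uv(2)] that c[OF that(1)] x0 by (auto split: if_splits)
    moreover have "u \<in> spp \<delta>" if "u \<in> spp \<gamma>" "v \<in> spp \<gamma> \<inter> spp \<delta>"
      using nat[OF uv(2) that(1)] that c[OF that(2)] x0 by (auto split: if_splits)
    ultimately show "case e of (u, v) \<Rightarrow> (u \<in> spp \<gamma> \<inter> spp \<delta> \<and> v \<in> spp \<delta> \<longrightarrow> v \<in> spp \<gamma>) \<and>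
        (u \<in> spp \<gamma> \<and> v \<in> spp \<gamma> \<inter> spp \<delta> \<longrightarrow> u \<in> spp \<delta>)" unfolding uv(1) by simp
  qed
  then obtain p where p: "mpath \<gamma> \<delta> p" "csupp p \<noteq> {}" using thin_hom_path[OF fr] by blast
  show ?thesis
  proof (rule that)
    show "fscale (m x0) (basis_vec p) \<in> path_comb n \<tau> \<gamma> \<delta>" by (rule path_comb_scale[OF basis_path_comb[OF p(1)]])
    show "phi (fscale (m x0) (basis_vec p)) x = m x" if "x \<in> spp \<gamma>" for x
      unfolding phi_scale phi_basis csupp_inter[OF fr(1) p] using c[of x] out[of x] that by auto
  qed
qed

lemma Om0_full:
  fixes h :: "nat \<Rightarrow> 'k::field vec \<Rightarrow> 'k vec"
  assumes as: "spo as" and bs: "spo bs" and h: "h \<in> mod_hom P (Oob as) (Oob bs)"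
  shows "\<exists>X\<in>hom as bs. Om0 as bs X = h"
proof -
  have xF: "x \<in> Field P" if "x \<in> spp \<gamma>" for x \<gamma> using that supp_subset[of \<gamma>] P_Field by blast
  have "\<exists>f. f \<in> path_comb n \<tau> (as ! i) (bs ! j) \<and> (\<forall>x\<in>spp (as ! i). phi f x = h x (basis_vec i) j)"
    if ij: "i < length as" "j < length bs" for i j
  proof -
    have sp: "spd (as ! i)" "spd (bs ! j)" using as bs ij by auto
    have im: "h x (basis_vec i) \<in> spc (Oob bs) x" if "x \<in> spp (as ! i)" for x
      by (rule lin_map_in[OF fp.hom_lin[OF h xF[OF that]] Oob_basis[OF ij(1) that]])
    obtain f where "f \<in> path_comb n \<tau> (as ! i) (bs ! j)" "\<And>x. x \<in> spp (as ! i) \<Longrightarrow> phi f x = h x (basis_vec i) j"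
    proof (rule thin_scalars[OF sp, of "\<lambda>x. h x (basis_vec i) j"])
      show "h x (basis_vec i) j = 0" if "x \<in> spp (as ! i)" "x \<notin> spp (bs ! j)" for x
        using im[OF that(1)] that(2) unfolding Oob_spc by blast
    next
      fix u v assume uv: "(u, v) \<in> Qv" "u \<in> spp (as ! i)"
      let ?s = "str (Oob as) v u (basis_vec i) :: 'k vec"
      have "h v ?s = str (Oob bs) v u (h u (basis_vec i))"
        by (rule fp.hom_nat[OF h Q_P[OF uv(1)] Oob_basis[OF ij(1) uv(2)]])
      then have e: "h v ?s j = (if u \<in> spp (bs ! j) \<and> v \<in> spp (bs ! j) then h u (basis_vec i) j else 0)"
        using ij by (simp add: Oob_str)
      have s: "?s = (if v \<in> spp (as ! i) then basis_vec i else 0)"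
        using ij uv by (auto simp: Oob_str basis_vec_def fun_eq_iff)
      have "h v 0 = 0"
        using lin_map_zero[OF fp.hom_lin[OF h] Oob_subspace, of v] quiver_ranges[OF uv(1)] P_Field by blast
      then have "h v ?s j = (if v \<in> spp (as ! i) then h v (basis_vec i) j else 0)"
        unfolding s by (cases "v \<in> spp (as ! i)") (simp_all only: if_True if_False zero_fun_apply)
      then show "(if v \<in> spp (as ! i) then h v (basis_vec i) j else 0) =
          (if u \<in> spp (bs ! j) \<and> v \<in> spp (bs ! j) then h u (basis_vec i) j else 0)"
        using e by simp
    qed blast
    then show ?thesis by blast
  qed
  then obtain g where g: "\<And>i j. i < length as \<Longrightarrow> j < length bs \<Longrightarrow>
      g i j \<in> path_comb n \<tau> (as ! i) (bs ! j) \<and> (\<forall>x\<in>spp (as ! i). phi (g i j) x = h x (basis_vec i) j)" by metis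
  define f where "f i j = (if i < length as \<and> j < length bs then g i j else 0)" for i j
  have f: "f \<in> CM as bs"
  proof (rule CM_I)
    show "f i j \<in> path_comb n \<tau> (as ! i) (bs ! j)" if "i < length as" "j < length bs" for i j
      using g that by (simp add: f_def)
    show "f i j = 0" if "\<not> (i < length as \<and> j < length bs)" for i j
      unfolding f_def using that by (simp only: if_False)
  qed
  define X where "X = ME as bs `` {f}"
  have X: "X \<in> hom as bs" "PhiC X = Phi f" unfolding X_def by (rule class_hom[OF spo_obj[OF as] f])+
  have "Om0 as bs X x v = h x v" for x v
  proof (cases "x \<in> Field P \<and> v \<in> spc (Oob as) x")
    case False
    then show ?thesis using fp.hom_out[OF h] fp.hom_out[OF Om0_hom[OF as bs X(1)]] by metis
  next
    case True
    then have v: "v \<in> spc (Oob as) x" and x: "x \<in> Field P" by blast+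
    let ?S = "{i. i < length as \<and> x \<in> spp (as ! i)}"
    have ve: "v = (\<Sum>i\<in>?S. fscale (v i) (basis_vec i))" by (rule Oob_expand[OF v])
    have bas: "\<And>i. i \<in> ?S \<Longrightarrow> (basis_vec i :: 'k vec) \<in> spc (Oob as) x" using Oob_basis by auto
    have "Om0 as bs X x (basis_vec i) = h x (basis_vec i)" if i: "i \<in> ?S" for i
    proof
      fix j
      have i': "i < length as" "x \<in> spp (as ! i)" using i by auto
      show "Om0 as bs X x (basis_vec i) j = h x (basis_vec i) j"
      proof (cases "j < length bs")
        case True
        then show ?thesis unfolding Om0_basis[OF i'] X(2) Phi_def f_def using g i' by simp
      next
        case False
        have "h x (basis_vec i) \<in> spc (Oob bs) x" by (rule lin_map_in[OF fp.hom_lin[OF h x] bas[OF i]])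
        then have "h x (basis_vec i) j = 0" using False unfolding Oob_spc by blast
        moreover have "PhiC X i j x = 0" using PhiC_support(2)[OF spo_obj[OF as] X(1), of i j x] False by blast
        ultimately show ?thesis unfolding Om0_basis[OF i'] by simp
      qed
    qed
    then have "(\<Sum>i\<in>?S. fscale (v i) (Om0 as bs X x (basis_vec i))) = (\<Sum>i\<in>?S. fscale (v i) (h x (basis_vec i)))"
      by (intro sum.cong refl) simp
    moreover have "Om0 as bs X x v = (\<Sum>i\<in>?S. fscale (v i) (Om0 as bs X x (basis_vec i)))"
      by (subst ve, rule lin_map_sum[OF fp.hom_lin[OF Om0_hom[OF as bs X(1)] x] Oob_subspace bas])
    moreover have "h x v = (\<Sum>i\<in>?S. fscale (v i) (h x (basis_vec i)))"
      by (subst ve, rule lin_map_sum[OF fp.hom_lin[OF h x] Oob_subspace bas])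
    ultimately show ?thesis by simp
  qed
  then show ?thesis using X(1) by blast
qed

end

section \<open>Density\<close>

lemma independent_family_coeff:
  assumes "finite J" "inj_on e J" "\<not> fvs.dependent (e ` J)" and z: "(\<Sum>i\<in>J. fscale (c i) (e i)) = 0" and "j \<in> J"
  shows "c j = 0"
proof -
  let ?g = "\<lambda>b. c (the_inv_into J e b)"
  have "(\<Sum>b\<in>e ` J. fscale (?g b) b) = (\<Sum>i\<in>J. fscale (?g (e i)) (e i))" by (rule sum.reindex_cong[OF assms(2) refl refl])
  also have "\<dots> = (\<Sum>i\<in>J. fscale (c i) (e i))" by (rule sum.cong[OF refl]) (simp add: the_inv_into_f_f[OF assms(2)])
  finally have "(\<Sum>b\<in>e ` J. fscale (?g b) b) = 0" using z by simp
  then have "?g (e j) = 0"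
    using fvs.independentD[OF assms(3), of "e ` J" ?g "e j"] assms(1,5) by simp
  then show ?thesis using the_inv_into_f_f[OF assms(2,5)] by simp
qed

lemma span_family:
  assumes "finite J" "inj_on e J" "w \<in> fvs.span (e ` J)"
  obtains c where "w = (\<Sum>i\<in>J. fscale (c i) (e i))"
proof -
  have "w \<in> range (\<lambda>u. \<Sum>b\<in>e ` J. fscale (u b) b)" using assms(3) fvs.span_finite[of "e ` J"] assms(1) by simp
  then obtain u where u: "w = (\<Sum>b\<in>e ` J. fscale (u b) b)" by blast
  have "(\<Sum>b\<in>e ` J. fscale (u b) b) = (\<Sum>i\<in>J. fscale (u (e i)) (e i))" by (rule sum.reindex_cong[OF assms(2) refl refl])
  then show ?thesis using that[of "\<lambda>i. u (e i)"] u by simp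
qed

context type_A
begin

text \<open>Arrows of \<open>Q\<close> respect the matched bases by construction. That the summands
  are sp-intervals and that alien arrows respect the bases is tested at sinks, where all relations
  come from paths of \<open>Q\<close>.\<close>

lemma interval_decomposition:
  fixes M :: "'k::field psys"
  assumes M: "fg_module P M" and d: "fp.detected M"
  obtains L :: "(nat \<times> 'k vec) set" and I E where "finite L" "\<And>c. c \<in> L \<Longrightarrow> spset (I c)"
    "\<And>x. x \<in> {1..n} \<Longrightarrow> inj_on (\<lambda>c. E c x) {c \<in> L. x \<in> I c}"
    "\<And>x. x \<in> {1..n} \<Longrightarrow> \<not> fvs.dependent ((\<lambda>c. E c x) ` {c \<in> L. x \<in> I c})"
    "\<And>x. x \<in> {1..n} \<Longrightarrow> fvs.span ((\<lambda>c. E c x) ` {c \<in> L. x \<in> I c}) = spc M x"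
    "\<And>c x y. c \<in> L \<Longrightarrow> (x, y) \<in> P \<Longrightarrow> x \<in> I c \<Longrightarrow> str M y x (E c x) = (if y \<in> I c then E c y else 0)"
proof -
  define k where "k = n - 1"
  have k: "Suc k = n" using n2 by (simp add: k_def)
  define lab where "lab = the_inv_into {1..n} pos"
  have lab: "lab (pos x) = x" if "x \<in> {1..n}" for x
    using the_inv_into_f_f[OF _ that, of pos] bij that by (simp add: lab_def bij_betw_def)
  define h where "h i = (if rt i then str M (lab (Suc i)) (lab i) else str M (lab i) (lab (Suc i)))" for i
  have arrow: "rt i \<Longrightarrow> (lab i, lab (Suc i)) \<in> Qv" "\<not> rt i \<Longrightarrow> (lab (Suc i), lab i) \<in> Qv" if i: "i < k" for i
  proof -
    obtain x where x: "x \<in> {1..n}" "pos x = i" by (rule pos_surj[of i]) (use i k in auto)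
    obtain y where y: "y \<in> {1..n}" "pos y = Suc i" by (rule pos_surj[of "Suc i"]) (use i k in auto)
    have "lab i = x" "lab (Suc i) = y" using lab x y by metis+
    then show "rt i \<Longrightarrow> (lab i, lab (Suc i)) \<in> Qv" "\<not> rt i \<Longrightarrow> (lab (Suc i), lab i) \<in> Qv"
      using arrow_iff x y by auto
  qed
  have rep: "line_rep (\<lambda>i. spc M (lab i)) rt h (k)"
  proof
    fix i
    show "fin_dim_subspace (spc M (lab i))" if i: "i \<le> k"
    proof -
      obtain x where "x \<in> {1..n}" "pos x = i" by (rule pos_surj[of i]) (use i k in auto)
      then show ?thesis using fp.mod_space[OF M] lab P_Field by metis
    qed
    show "lin_map_on (spc M (lab i)) (spc M (lab (Suc i))) (h i)" if "i < k" "rt i"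
      using fp.mod_str[OF M Q_P[OF arrow(1)[OF that]]] that by (simp add: h_def)
    show "lin_map_on (spc M (lab (Suc i))) (spc M (lab i)) (h i)" if "i < k" "\<not> rt i"
      using fp.mod_str[OF M Q_P[OF arrow(2)[OF that]]] that by (simp add: h_def)
  qed
  obtain Bs where Bs: "\<And>i. i \<le> k \<Longrightarrow> \<not> fvs.dependent (Bs i)" "\<And>i. i \<le> k \<Longrightarrow> fvs.span (Bs i) = spc M (lab i)"
    "\<And>i. i < k \<Longrightarrow> line_rep.matched rt h Bs i"
    by (rule line_rep.matching_bases[OF rep]) blast
  interpret mr: matched_rep "\<lambda>i. spc M (lab i)" rt h "k" Bs
    by (intro matched_rep.intro rep matched_rep_axioms.intro Bs)
  define L where "L = mr.labels"
  define I where "I c = {x \<in> {1..n}. mr.alive c (pos x)}" for c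
  define E where "E c x = mr.elt c (pos x)" for c x
  have Ix: "x \<in> {1..n}" "mr.alive c (pos x)" "c \<in> L" if "x \<in> I c" for c x
    using that by (auto simp: I_def L_def mr.labels_def)
  have pn: "pos x \<le> k" if "x \<in> {1..n}" for x using pos_less[OF that] k by simp
  have alive_set: "{c \<in> L. x \<in> I c} = {c. mr.alive c (pos x)}" if "x \<in> {1..n}" for x
    using that by (auto simp: I_def L_def mr.labels_def)
  have basis: "(\<lambda>c. E c x) ` {c \<in> L. x \<in> I c} = Bs (pos x)" if "x \<in> {1..n}" for x
    unfolding alive_set[OF that] E_def by (rule mr.elt_image[OF pn[OF that]])
  have inj: "inj_on (\<lambda>c. E c x) {c \<in> L. x \<in> I c}" if "x \<in> {1..n}" for x
    unfolding alive_set[OF that] E_def by (rule mr.elt_inj)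
  have indep: "\<not> fvs.dependent (Bs (pos x))" if "x \<in> {1..n}" for x using Bs(1) pn[OF that] by blast
  have sp: "fvs.span (Bs (pos x)) = spc M x" if "x \<in> {1..n}" for x using Bs(2)[OF pn[OF that]] lab[OF that] by simp
  have EB: "E c x \<in> Bs (pos x)" if "x \<in> I c" for c x using mr.elt[OF Ix(2)[OF that]] by (simp add: E_def)
  have Espc: "E c x \<in> spc M x" if "x \<in> I c" for c x
    using fvs.span_base[OF EB[OF that]] sp[OF Ix(1)[OF that]] by simp
  have Enz: "E c x \<noteq> 0" if "x \<in> I c" for c x by (rule mr.nonzero[OF pn[OF Ix(1)[OF that]] EB[OF that]])
  have Q_arrow: "str M y x (E c x) = (if y \<in> I c then E c y else 0)" if xy: "(x, y) \<in> Qv" and x: "x \<in> I c" for c x y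
  proof -
    have rg: "x \<in> {1..n}" "y \<in> {1..n}" using xy arrow_iff by auto
    note al = Ix(2)[OF x] and l = lab[OF rg(1)] lab[OF rg(2)]
    have yI: "y \<in> I c \<longleftrightarrow> mr.alive c (pos y)" using rg by (simp add: I_def)
    consider "pos y = Suc (pos x)" "rt (pos x)" | "pos x = Suc (pos y)" "\<not> rt (pos y)" using xy arrow_iff by blast
    then show ?thesis
    proof cases
      case 1
      have "pos x < k" using pos_less[OF rg(2)] 1 k by simp
      from mr.elt_step_right[OF this 1(2) al] show ?thesis
        unfolding E_def yI h_def 1(1)[symmetric] l using 1(2) by simp
    next
      case 2
      have i: "pos y < k" using pos_less[OF rg(1)] 2 k by simp
      have "mr.alive c (Suc (pos y))" using al 2 by simp
      from mr.elt_step_left[OF i 2(2) this] show ?thesis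
        unfolding E_def yI h_def 2(1)[symmetric] l using 2(2) by simp
    qed
  qed
  have intv: "interval (I c)" if c: "c \<in> L" for c
  proof -
    have "c \<in> mr.labels" using c by (simp add: L_def)
    then obtain l r where lr: "l \<le> r" "r \<le> k" "\<And>i. mr.alive c i \<longleftrightarrow> l \<le> i \<and> i \<le> r" by (rule mr.alive_interval) blast
    have "I c = iv l r" unfolding I_def iv_def lr(3) by blast
    moreover have "r < n" using lr k by simp
    ultimately show ?thesis using lr(1) unfolding interval_def by blast
  qed
  have zero: "str M y x 0 = 0" if "(x, y) \<in> P" for x y
    using lin_map_zero[OF fp.mod_str[OF M that]] fp.mod_subspace[OF M] P_range[OF that] P_Field by simp
  have Q_path: "str M y x (E c x) = (if y \<in> I c then E c y else 0)" if xy: "(x, y) \<in> Qv\<^sup>*" and x: "x \<in> I c" for c x y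
    using xy
  proof (induction rule: rtrancl_induct)
    case base
    show ?case using fp.mod_str_id[OF M _ Espc[OF x]] P_Field Ix(1)[OF x] x by simp
  next
    case (step y w)
    have xP: "(x, y) \<in> P" using reach_P[OF Ix(1)[OF x] step.hyps(1)] .
    note yw = Q_P[OF step.hyps(2)]
    have comp: "str M w x (E c x) = str M w y (str M y x (E c x))"
      using fp.mod_str_comp[OF M xP yw Espc[OF x]] by simp
    show ?case
    proof (cases "y \<in> I c")
      case True
      then show ?thesis using comp step.IH Q_arrow[OF step.hyps(2)] by simp
    next
      case False
      then have "w \<notin> I c" using interval_convex[OF intv[OF Ix(3)[OF x]] x _ step.hyps(1)] step.hyps(2) by blast
      then show ?thesis unfolding comp step.IH using False by (simp only: if_False zero[OF yw])
    qed
  qed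
  \<comment> \<open>Maximal elements of the poset are sinks, and below a sink the order comes from
    \<open>Q\<close>, so detection needs only paths of \<open>Q\<close>.\<close>
  have detect: "\<exists>z. is_sink n Qv z \<and> (x, z) \<in> Qv\<^sup>* \<and> str M z x v \<noteq> 0"
    if x: "x \<in> {1..n}" and v: "v \<in> spc M x" "v \<noteq> 0" for x v
  proof -
    obtain z where z: "(x, z) \<in> P" "\<And>y. (z, y) \<in> P \<Longrightarrow> y = z" "str M z x v \<noteq> 0"
      using d x v P_Field unfolding fp.detected_def by blast
    have s: "is_sink n Qv z" using maximal_sink z(2) P_range[OF z(1)] by blast
    have "(x, z) \<in> Qv\<^sup>*" using sink_below[OF s] z(1) P_iff by blast
    then show ?thesis using s z(3) by blast
  qed
  \<comment> \<open>The vector \<open>E c z\<close> is also obtained through \<open>t\<close>, so it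
    lies in the span of the basis vectors at \<open>z\<close> whose chains pass through
    \<open>t\<close>. By independence it is one of them, hence the chain of \<open>c\<close> passes
    through \<open>t\<close>.\<close>
  have F_closed: "t \<in> I c"
    if st: "(s, t) \<in> F" and z: "is_sink n Qv z" "(s, z) \<in> Qv\<^sup>*" "(t, z) \<in> Qv\<^sup>*" and c: "s \<in> I c" "z \<in> I c" for c s t z
  proof -
    have rg: "s \<in> {1..n}" "t \<in> {1..n}" "z \<in> {1..n}" using P_range[OF F_P[OF st]] Ix c by auto
    define w where "w = str M t s (E c s)"
    have w: "w \<in> spc M t" unfolding w_def by (rule lin_map_in[OF fp.mod_str[OF M F_P[OF st]] Espc[OF c(1)]])
    have tz: "(t, z) \<in> P" by (rule reach_P[OF rg(2) z(3)])
    define S where "S = (\<lambda>c. E c z) ` {c \<in> L. z \<in> I c \<and> t \<in> I c}"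
    have "str M z t w = E c z"
      using fp.mod_str_comp[OF M F_P[OF st] tz Espc[OF c(1)]] Q_path[OF z(2) c(1)] c(2) by (simp add: w_def)
    moreover have "str M z t w \<in> fvs.span (str M z t ` Bs (pos t))"
      using lin_map_span_image[OF fp.mod_str[OF M tz] fp.mod_subspace[OF M], of "Bs (pos t)"] w sp[OF rg(2)]
        fvs.span_superset[of "Bs (pos t)"] P_Field rg by auto
    moreover have "str M z t ` Bs (pos t) \<subseteq> insert 0 S"
      using Q_path[OF z(3)] unfolding S_def basis[OF rg(2), symmetric] by auto
    ultimately have "E c z \<in> fvs.span (insert 0 S)" by (metis fvs.span_mono subsetD)
    then have "E c z \<in> fvs.span S" by (metis fvs.span_insert_0)
    moreover have "S \<subseteq> Bs (pos z)" using EB unfolding S_def by blast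
    ultimately have "E c z \<in> S" using independent_notin_span[OF indep[OF rg(3)] EB[OF c(2)]] by blast
    then obtain c' where c': "c' \<in> L" "z \<in> I c'" "t \<in> I c'" "E c z = E c' z" unfolding S_def by blast
    have "c = c'" using inj_onD[OF inj[OF rg(3)] c'(4)] c' c(2) Ix(3) by simp
    then show ?thesis using c'(3) by simp
  qed
  have spI: "spset (I c)" if "c \<in> L" for c
    unfolding spset_def
  proof (intro conjI ballI)
    show "interval (I c)" by (rule intv[OF that])
    fix x assume x: "x \<in> I c"
    obtain z where "is_sink n Qv z" "(x, z) \<in> Qv\<^sup>*" "str M z x (E c x) \<noteq> 0" using detect[OF Ix(1)[OF x] Espc[OF x] Enz[OF x]] by blast
    then show "\<exists>z\<in>I c. is_sink n Qv z \<and> (x, z) \<in> Qv\<^sup>*" using Q_path[OF _ x, of z] by (auto split: if_splits)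
  next
    fix e assume "e \<in> F"
    then show "case e of (s, t) \<Rightarrow> \<forall>z. is_sink n Qv z \<and> (s, z) \<in> Qv\<^sup>* \<and> (t, z) \<in> Qv\<^sup>* \<and> s \<in> I c \<and> z \<in> I c \<longrightarrow> t \<in> I c"
      using F_closed by (cases e) blast
  qed
  \<comment> \<open>The image of \<open>E c s\<close> and its expected value have the same image at
    the sink above \<open>t\<close>. There is only one such sink, so detection makes the two vectors
    equal.\<close>
  have F_arrow: "str M t s (E c s) = (if t \<in> I c then E c t else 0)" if st: "(s, t) \<in> F" and s: "s \<in> I c" for c s t
  proof -
    obtain z where z: "is_sink n Qv z" "(s, z) \<in> Qv\<^sup>*" "(t, z) \<in> Qv\<^sup>*" using F_sink[OF st] by blast
    have rg: "s \<in> {1..n}" "t \<in> {1..n}" using P_range[OF F_P[OF st]] by auto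
    have tz: "(t, z) \<in> P" by (rule reach_P[OF rg(2) z(3)])
    note sub = fp.mod_subspace[OF M, of t, unfolded P_Field, OF rg(2)]
    define u where "u = str M t s (E c s)"
    define v where "v = (if t \<in> I c then E c t else 0)"
    have u: "u \<in> spc M t" unfolding u_def by (rule lin_map_in[OF fp.mod_str[OF M F_P[OF st]] Espc[OF s]])
    have v: "v \<in> spc M t" unfolding v_def using Espc subspace_zero[OF sub] by simp
    have "str M z t u = (if z \<in> I c then E c z else 0)"
      using fp.mod_str_comp[OF M F_P[OF st] tz Espc[OF s]] Q_path[OF z(2) s] by (simp add: u_def)
    moreover have "str M z t v = (if z \<in> I c then E c z else 0)"
      using Q_path[OF z(3), of c] zero[OF tz] F_closed[OF st z s] by (simp add: v_def)
    ultimately have "str M z t (u - v) = 0" using lin_map_diff[OF fp.mod_str[OF M tz] sub u v] by simp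
    moreover have "str M z' t (u - v) = 0" if z': "is_sink n Qv z'" "(t, z') \<in> Qv\<^sup>*" for z'
      using F_one_sink[OF st z(1) z'(1) z(3) z'(2)] \<open>str M z t (u - v) = 0\<close> by simp
    ultimately have "u - v = 0" using detect[OF rg(2) fvs.subspace_diff[OF sub u v]] by blast
    then show ?thesis by (simp add: u_def v_def)
  qed
  have P_path: "str M y x (E c x) = (if y \<in> I c then E c y else 0)" if xy: "(x, y) \<in> P" and x: "x \<in> I c" for c x y
  proof -
    have "(x, y) \<in> (Qv \<union> F)\<^sup>*" using xy P_iff by blast
    then show ?thesis
    proof (induction rule: rtrancl_induct)
      case base
      show ?case using fp.mod_str_id[OF M _ Espc[OF x]] P_Field Ix(1)[OF x] x by simp
    next
      case (step y w)
      have xP: "(x, y) \<in> P" using P_iff Ix(1)[OF x] step.hyps(1) by blast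
      have yw: "(y, w) \<in> P" using Q_P F_P step.hyps(2) by blast
      have comp: "str M w x (E c x) = str M w y (str M y x (E c x))"
        using fp.mod_str_comp[OF M xP yw Espc[OF x]] by simp
      show ?case
      proof (cases "y \<in> I c")
        case True
        then show ?thesis using comp step.IH Q_arrow[of y w c] F_arrow[of y w c] step.hyps(2) by auto
      next
        case False
        then have "w \<notin> I c" using spset_convex[OF spI[OF Ix(3)[OF x]] x _ xP yw] by blast
        then show ?thesis unfolding comp step.IH using False by (simp only: if_False zero[OF yw])
      qed
    qed
  qed
  show ?thesis
  proof (rule that[of L I E])
    show "finite L" unfolding L_def by (rule mr.finite_labels)
    show "\<not> fvs.dependent ((\<lambda>c. E c x) ` {c \<in> L. x \<in> I c})" if "x \<in> {1..n}" for x
      unfolding basis[OF that] by (rule indep[OF that])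
    show "fvs.span ((\<lambda>c. E c x) ` {c \<in> L. x \<in> I c}) = spc M x" if "x \<in> {1..n}" for x
      unfolding basis[OF that] by (rule sp[OF that])
  qed (use spI inj P_path in auto)
qed

text \<open>Each interval summand is the support of an sp-diagonal by \<open>interval_supp\<close>.
  Listing the summands gives the object, and sending \<open>basis_vec i\<close> to the vectors of
  the corresponding chain gives the isomorphism.\<close>

lemma Omega_dense:
  fixes M :: "'k::field psys"
  assumes "M \<in> Ob SP"
  shows "\<exists>as. spo as \<and> (\<exists>f. is_iso SP (Oob as) M f)"
proof -
  have M: "fg_module P M" and d: "fp.detected M" using assms Ob_SP fp.socle_projective_iff by auto
  obtain L :: "(nat \<times> 'k vec) set" and I E where L: "finite L" "\<And>c. c \<in> L \<Longrightarrow> spset (I c)"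
    and inj: "\<And>x. x \<in> {1..n} \<Longrightarrow> inj_on (\<lambda>c. E c x) {c \<in> L. x \<in> I c}"
    and ind: "\<And>x. x \<in> {1..n} \<Longrightarrow> \<not> fvs.dependent ((\<lambda>c. E c x) ` {c \<in> L. x \<in> I c})"
    and spn: "\<And>x. x \<in> {1..n} \<Longrightarrow> fvs.span ((\<lambda>c. E c x) ` {c \<in> L. x \<in> I c}) = spc M x"
    and st: "\<And>c x y. c \<in> L \<Longrightarrow> (x, y) \<in> P \<Longrightarrow> x \<in> I c \<Longrightarrow> str M y x (E c x) = (if y \<in> I c then E c y else 0)"
    by (rule interval_decomposition[OF M d]) blast
  have "\<exists>\<gamma>. spd \<gamma> \<and> spp \<gamma> = I c" if "c \<in> L" for c
  proof -
    have sp: "spset (I c)" by (rule L(2)[OF that])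
    then have "interval (I c)" by (simp add: spset_def)
    then obtain \<gamma> where "free \<gamma>" "spp \<gamma> = I c" by (rule interval_supp)
    then show ?thesis using sp_iff sp by auto
  qed
  then obtain \<gamma> where g: "\<And>c. c \<in> L \<Longrightarrow> spd (\<gamma> c)" "\<And>c. c \<in> L \<Longrightarrow> spp (\<gamma> c) = I c" by metis
  obtain cs where cs: "set cs = L" "distinct cs" using finite_distinct_list[OF L(1)] by blast
  define as where "as = map \<gamma> cs"
  have as: "spo as" using g(1) cs by (auto simp: as_def)
  define J where "J x = {i. i < length cs \<and> x \<in> I (cs ! i)}" for x
  define e where "e x i = E (cs ! i) x" for x i
  have csL: "cs ! i \<in> L" if "i < length cs" for i using cs that by auto
  have J: "i \<in> J x \<longleftrightarrow> i < length as \<and> x \<in> spp (as ! i)" for i x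
    using g(2)[OF csL] by (auto simp: J_def as_def)
  have fJ: "finite (J x)" for x by (simp add: J_def)
  have img: "(!) cs ` J x = {c \<in> L. x \<in> I c}" for x
    unfolding J_def cs(1)[symmetric] set_conv_nth by auto
  have e_img: "e x ` J x = (\<lambda>c. E c x) ` {c \<in> L. x \<in> I c}" for x
    unfolding img[symmetric] e_def by (simp add: image_image)
  have e_inj: "inj_on (e x) (J x)" if "x \<in> {1..n}" for x
  proof -
    have "inj_on ((!) cs) (J x)" using cs(2) by (auto intro!: inj_onI simp: J_def nth_eq_iff_index_eq)
    then have "inj_on ((\<lambda>c. E c x) \<circ> (!) cs) (J x)" by (rule comp_inj_on) (use inj[OF that] img in simp)
    then show ?thesis by (simp add: e_def[abs_def] comp_def)
  qed
  have e_ind: "\<not> fvs.dependent (e x ` J x)" and e_spn: "fvs.span (e x ` J x) = spc M x" if "x \<in> {1..n}" for x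
    unfolding e_img using ind[OF that] spn[OF that] by auto
  have e_spc: "e x i \<in> spc M x" if "x \<in> {1..n}" "i \<in> J x" for x i
    using fvs.span_base[of "e x i" "e x ` J x"] e_spn that by auto
  have e_str: "str M y x (e x i) = (if i \<in> J y then e y i else 0)" if "(x, y) \<in> P" "i \<in> J x" for x y i
    using st[OF csL that(1)] that(2) by (auto simp: J_def e_def)
  have sub: "fvs.subspace (spc M x)" if "x \<in> {1..n}" for x using fp.mod_subspace[OF M] P_Field that by simp
  define f where "f x v = (if x \<in> {1..n} \<and> v \<in> spc (Oob as) x then \<Sum>i\<in>J x. fscale (v i) (e x i) else 0)" for x v
  have f: "f x v = (\<Sum>i\<in>J x. fscale (v i) (e x i))" if "x \<in> {1..n}" "v \<in> spc (Oob as) x" for x v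
    using that by (simp add: f_def)
  note osub = Oob_subspace[of as]
  have lin: "lin_map_on (spc (Oob as) x) (spc M x) (f x)" if x: "x \<in> {1..n}" for x
    unfolding lin_map_on_def
  proof (intro conjI ballI allI)
    fix v :: "'k vec" assume v: "v \<in> spc (Oob as) x"
    show "f x v \<in> spc M x"
      unfolding f[OF x v] by (rule fvs.subspace_sum[OF sub[OF x]]) (rule subspace_scale[OF sub[OF x] e_spc[OF x]])
    show "f x (fscale c v) = fscale c (f x v)" for c
    proof -
      have "f x (fscale c v) = (\<Sum>i\<in>J x. fscale (c * v i) (e x i))"
        unfolding f[OF x subspace_scale[OF osub v]] by (simp add: fscale_def)
      also have "\<dots> = fscale c (f x v)" unfolding f[OF x v] fvs.scale_sum_right fvs.scale_scale ..
      finally show ?thesis .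
    qed
    fix u :: "'k vec" assume u: "u \<in> spc (Oob as) x"
    have "f x (u + v) = (\<Sum>i\<in>J x. fscale (u i + v i) (e x i))"
      unfolding f[OF x subspace_add[OF osub u v]] by simp
    also have "\<dots> = f x u + f x v" unfolding f[OF x u] f[OF x v] fvs.scale_left_distrib sum.distrib ..
    finally show "f x (u + v) = f x u + f x v" .
  qed
  have hom: "f \<in> mod_hom P (Oob as) M"
  proof (rule fp.mod_homI)
    show "lin_map_on (spc (Oob as) x) (spc M x) (f x)" if "x \<in> Field P" for x using lin that P_Field by simp
    show "f x v = 0" if "x \<notin> Field P \<or> v \<notin> spc (Oob as) x" for x v using that unfolding f_def P_Field by (simp only: de_Morgan_conj[symmetric] if_False)
    fix x y and v :: "'k vec" assume xy: "(x, y) \<in> P" and v: "v \<in> spc (Oob as) x"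
    have rg: "x \<in> {1..n}" "y \<in> {1..n}" using P_range[OF xy] by auto
    have sv: "str (Oob as) y x v \<in> spc (Oob as) y" unfolding Oob_spc Oob_str by simp
    have o: "str (Oob as) y x v i = (if i \<in> J x \<and> i \<in> J y then v i else 0)" for i unfolding Oob_str J by auto
    have "f y (str (Oob as) y x v) = (\<Sum>i\<in>J y. fscale (if i \<in> J x \<and> i \<in> J y then v i else 0) (e y i))"
      unfolding f[OF rg(2) sv] o ..
    also have "\<dots> = (\<Sum>i\<in>J x \<inter> J y. fscale (v i) (e y i))"
      by (rule sum.mono_neutral_cong_right[OF fJ]) auto
    also have "\<dots> = (\<Sum>i\<in>J x. fscale (v i) (str M y x (e x i)))"
      by (rule sum.mono_neutral_cong_left[OF fJ]) (auto simp: e_str[OF xy])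
    also have "\<dots> = str M y x (f x v)"
      unfolding f[OF rg(1) v] by (rule lin_map_sum[OF fp.mod_str[OF M xy] sub[OF rg(1)] e_spc[OF rg(1)], symmetric])
    finally show "f y (str (Oob as) y x v) = str M y x (f x v)" .
  qed
  have bij: "bij_betw (f x) (spc (Oob as) x) (spc M x)" if "x \<in> Field P" for x
    unfolding bij_betw_def
  proof
    have x: "x \<in> {1..n}" using that P_Field by simp
    show "inj_on (f x) (spc (Oob as) x)"
    proof (rule inj_onI)
      fix u v :: "'k vec" assume u: "u \<in> spc (Oob as) x" and v: "v \<in> spc (Oob as) x" and eq: "f x u = f x v"
      have "(\<Sum>i\<in>J x. fscale (u i - v i) (e x i)) = 0"
        using eq unfolding f[OF x u] f[OF x v] fvs.scale_left_diff_distrib sum_subtractf by simp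
      then have "u i - v i = 0" if "i \<in> J x" for i
        using independent_family_coeff[OF fJ e_inj[OF x] e_ind[OF x], of "\<lambda>i. u i - v i"] that by blast
      moreover have "u i = 0 \<and> v i = 0" if "i \<notin> J x" for i using that u v unfolding Oob_spc J by blast
      ultimately have "u i = v i" for i by (cases "i \<in> J x") auto
      then show "u = v" by (rule ext)
    qed
    show "f x ` spc (Oob as) x = spc M x"
    proof
      show "f x ` spc (Oob as) x \<subseteq> spc M x" using lin_map_in[OF lin[OF x]] by blast
      show "spc M x \<subseteq> f x ` spc (Oob as) x"
      proof
        fix w assume "w \<in> spc M x"
        then have "w \<in> fvs.span (e x ` J x)" using e_spn[OF x] by simp
        then obtain c where c: "w = (\<Sum>i\<in>J x. fscale (c i) (e x i))" by (rule span_family[OF fJ e_inj[OF x]])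
        define v where "v i = (if i \<in> J x then c i else 0)" for i
        have v: "v \<in> spc (Oob as) x" unfolding Oob_spc v_def J by auto
        have "f x v = w" unfolding f[OF x v] c by (rule sum.cong) (simp_all add: v_def)
        then show "w \<in> f x ` spc (Oob as) x" using v by blast
      qed
    qed
  qed
  have "is_iso (mod_cat P) (Oob as) M f" by (rule fp.mod_iso[OF Oob_module[OF as] M hom bij])
  then have "is_iso SP (Oob as) M f" unfolding is_iso_def mod_sp_def full_subcat_def by simp
  then show ?thesis using as by blast
qed

text \<open>By uniqueness, fullness and faithfulness of the explicit functor \<open>Om0\<close>
  carry over to any functor with the prescribed values.\<close>

lemma Omega_equivalence:
  fixes Om :: "diag list \<Rightarrow> diag list \<Rightarrow> 'k::field cmat set \<Rightarrow> nat \<Rightarrow> 'k vec \<Rightarrow> 'k vec"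
  assumes O: "is_Omega n \<tau> Qv F Om"
  shows "is_equivalence TF SP Oob Om"
proof -
  interpret equivalence_data TF SP Oob Om
  proof
    show "is_functor TF SP Oob Om" by (rule Omega_functor[OF O])
    fix as bs :: "diag list" assume "as \<in> Ob (TF :: (diag list, 'k cmat set, 'k) lcat)" "bs \<in> Ob (TF :: (diag list, 'k cmat set, 'k) lcat)"
    then have o: "spo as" "spo bs" using Ob_TF by auto
    show "\<exists>f\<in>Hom TF as bs. Om as bs f = g" if "g \<in> Hom SP (Oob as) (Oob bs)" for g
      using Om0_full[OF o that[unfolded SP_simps]] Omega_unique[OF O o] unfolding TF_simps by metis
    show "f = f'" if "f \<in> Hom TF as bs" "f' \<in> Hom TF as bs" "Om as bs f = Om as bs f'" for f f'
      using that Omega_unique[OF O o] Om0_faithful[OF spo_obj[OF o(1)]] unfolding TF_simps by metis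
  next
    show "\<exists>a\<in>Ob TF. \<exists>e. is_iso SP (Oob a) d e" if d: "d \<in> Ob SP" for d :: "'k psys"
      using Omega_dense[OF d] Ob_TF by blast
  qed
  show ?thesis by (rule equivalence)
qed

end

theorem theorem4p4:
  fixes n :: nat and Q F :: "(nat \<times> nat) set" and \<tau> :: "nat \<Rightarrow> diag"
  assumes "n \<ge> 2"
    and "dynkin_A n Q"
    and "alien_set n Q F"
    and "labelled_triangulation n \<tau>"
    and "quiver_of n \<tau> = Q"
  shows "(\<exists>Om :: diag list \<Rightarrow> diag list \<Rightarrow> 'k::field cmat set \<Rightarrow> nat \<Rightarrow> 'k vec \<Rightarrow> 'k vec.
            is_Omega n \<tau> Q F Om) \<and>
         (\<forall>Om :: diag list \<Rightarrow> diag list \<Rightarrow> 'k cmat set \<Rightarrow> nat \<Rightarrow> 'k vec \<Rightarrow> 'k vec.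
            is_Omega n \<tau> Q F Om \<longrightarrow>
            is_equivalence (cat_TF n \<tau> Q F) (mod_sp (poset_of n Q F)) (Omega_ob n \<tau>) Om)"
proof -
  obtain pos rt where l: "line_quiver n Q pos rt" using dynkin_line[OF assms(2)] by blast
  interpret type_A n \<tau> pos rt F
    by (intro type_A.intro labelled_tri.intro alien_line.intro alien_line_axioms.intro type_A_axioms.intro)
      (use assms l in simp_all)
  show ?thesis using Om0_is_Omega Omega_equivalence unfolding assms(5)[symmetric] by blast
qed

end
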